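(* If $0\le m,n\le p-1$ and $q\ge0$, then $$\operatorname{Ext}^q(S_m,W_n)=\begin{cases}k&\text{if }(m=n\text{ and }q=0)\text{ or }q=2p-m-n-3\text{ or }q=2p-m-n-2,\\0&\text{otherwise.}\end{cases}$$
   Context: $k$ is a field of characteristic $p>0$; $\mathcal{P}_e$ is the abelian category of homogeneous strict polynomial functors of degree $e$ over $k$ (Friedlander–Suslin; functors from finite-dimensional $k$-vector spaces to finite-dimensional $k$-vector spaces). For a partition (Young diagram) $\lambda=(\lambda_1,\dots,\lambda_n)$ of $e$ with conjugate $\widetilde\lambda$, put $\Lambda^\lambda=\Lambda^{\lambda_1}\otimes\dots\otimes\Lambda^{\lambda_n}$, $S^\lambda=S^{\lambda_1}\otimes\dots\otimes S^{\lambda_n}$ (tensor products of exterior, resp. symmetric, powers). The Schur functor $S_\lambda$ is the image of the composite $\Lambda^\lambda\hookrightarrow I^{\otimes e}\to I^{\otimes e}\twoheadrightarrow S^{\widetilde\lambda}$ of the natural monomorphism, the permutation of tensor factors that passes from the row reading to the column reading of the boxes of $\lambda$, and the natural epimorphism. The Kuhn dual is $G^\#(V)=G(V^* )^*$; the Weyl functor is $W_\lambda=(S_\lambda)^\#$. For $0\le i\le p-1$ put $S_i=S_{(i+1,1^{p-i-1})}$, $W_i=W_{(i+1,1^{p-i-1})}$ in $\mathcal{P}_p$. $\operatorname{Ext}$-groups are computed in $\mathcal{P}_p$ (equivalently in its block $\mathcal{P}_p^\varnothing$ corresponding to hooks). *)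

theory Defs
  imports
    Complex_Main
    "HOL-Library.Multiset"
    "HOL-Library.Poly_Mapping"
    "HOL-Library.Function_Algebras"
    "HOL-Combinatorics.Permutations"
begin

section \<open>Vector spaces\<close>

text \<open>
  All finite-dimensional vector spaces below are subspaces of a space of functions
  \<open>'b \<Rightarrow> 'k\<close> with pointwise operations.
\<close>

definition fscale :: "'k::field \<Rightarrow> ('b \<Rightarrow> 'k) \<Rightarrow> 'b \<Rightarrow> 'k"
  where "fscale c f = (\<lambda>x. c * f x)"

global_interpretation fun_vs: vector_space "fscale :: 'k::field \<Rightarrow> ('b \<Rightarrow> 'k) \<Rightarrow> 'b \<Rightarrow> 'k"
  by unfold_locales (simp_all add: fscale_def fun_eq_iff algebra_simps)

definition fd_subspace :: "('b \<Rightarrow> 'k::field) set \<Rightarrow> bool"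
  where "fd_subspace U \<longleftrightarrow> (\<exists>B. finite B \<and> U = fun_vs.span B)"

definition linear_map ::
    "('b \<Rightarrow> 'k::field) set \<Rightarrow> ('c \<Rightarrow> 'k) set \<Rightarrow> (('b \<Rightarrow> 'k) \<Rightarrow> ('c \<Rightarrow> 'k)) \<Rightarrow> bool"
  where "linear_map U V f \<longleftrightarrow>
    (\<forall>x\<in>U. f x \<in> V) \<and>
    (\<forall>x\<in>U. \<forall>y\<in>U. f (x + y) = f x + f y) \<and>
    (\<forall>c. \<forall>x\<in>U. f (fscale c x) = fscale c (f x))"

text \<open>Vector spaces over \<open>'k\<close> that arise as quotients, and their isomorphism.\<close>

record ('k, 'x) vspace =
  elems :: "'x set"
  vadd :: "'x \<Rightarrow> 'x \<Rightarrow> 'x"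
  vscale :: "'k \<Rightarrow> 'x \<Rightarrow> 'x"

definition vspace_iso :: "('k, 'x) vspace \<Rightarrow> ('k, 'y) vspace \<Rightarrow> bool"  (infix "\<cong>\<^sub>k" 50)
  where "V \<cong>\<^sub>k W \<longleftrightarrow> (\<exists>f. bij_betw f (elems V) (elems W) \<and>
    (\<forall>x\<in>elems V. \<forall>y\<in>elems V. f (vadd V x y) = vadd W (f x) (f y)) \<and>
    (\<forall>c. \<forall>x\<in>elems V. f (vscale V c x) = vscale W c (f x)))"

definition base_field :: "('k::field, 'k) vspace"
  where "base_field = \<lparr>elems = UNIV, vadd = (+), vscale = (*)\<rparr>"

definition zero_space :: "('k::field, 'k) vspace"
  where "zero_space = \<lparr>elems = {0}, vadd = (+), vscale = (*)\<rparr>"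


section \<open>Homogeneous strict polynomial functors\<close>

text \<open>
  The source category is replaced by its skeleton \<open>k\<^sup>n\<close>, \<open>n \<in> \<nat>\<close>, a morphism
  \<open>k\<^sup>m \<rightarrow> k\<^sup>n\<close> being an \<open>n \<times> m\<close> matrix, with generic entries \<open>X\<^sub>i\<^sub>j\<close> for \<open>i < n\<close>, \<open>j < m\<close>.
  Following Friedlander and Suslin, a functor \<open>T\<close> that is homogeneous of degree \<open>e\<close> has as its
  action on morphisms an element of
  \<open>S\<^sup>e(Hom(k\<^sup>m, k\<^sup>n)\<^sup>*) \<otimes> Hom(T(k\<^sup>m), T(k\<^sup>n))\<close>, that is, a formal sum
  \<open>\<Sum>\<mu>. X\<^sup>\<mu> \<otimes> T\<^sub>\<mu>\<close> over the monomials of degree \<open>e\<close>. A monomial is encoded as the multiset of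
  the index pairs of its factors, \<open>val T n\<close> is \<open>T(k\<^sup>n)\<close> and \<open>coef T m n \<mu>\<close> is \<open>T\<^sub>\<mu>\<close>. The values
  of \<open>coef T m n \<mu>\<close> outside \<open>val T m\<close> are irrelevant.
\<close>

record ('b, 'k) spf =
  val :: "nat \<Rightarrow> ('b \<Rightarrow> 'k) set"
  coef :: "nat \<Rightarrow> nat \<Rightarrow> (nat \<times> nat) multiset \<Rightarrow> ('b \<Rightarrow> 'k) \<Rightarrow> ('b \<Rightarrow> 'k)"

definition monomials :: "nat \<Rightarrow> nat \<Rightarrow> nat \<Rightarrow> (nat \<times> nat) multiset set"
  where "monomials e m n = {\<mu>. size \<mu> = e \<and> set_mset \<mu> \<subseteq> {..<n} \<times> {..<m}}"

definition spf_map ::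
    "nat \<Rightarrow> ('b, 'k::field) spf \<Rightarrow> nat \<Rightarrow> nat \<Rightarrow> (nat \<Rightarrow> nat \<Rightarrow> 'k) \<Rightarrow> ('b \<Rightarrow> 'k) \<Rightarrow> ('b \<Rightarrow> 'k)"
  where "spf_map e T m n A v =
    (\<Sum>\<mu>\<in>monomials e m n. fscale (\<Prod>(i, j)\<in>#\<mu>. A i j) (coef T m n \<mu> v))"

text \<open>
  The polynomial \<open>(XY)\<^sup>\<rho>\<close>, where \<open>X\<close> has \<open>m\<close> columns and \<open>Y\<close> has \<open>m\<close> rows, in the polynomial
  ring on the variables \<open>X\<^sub>i\<^sub>j = Inl (i, j)\<close> and \<open>Y\<^sub>j\<^sub>l = Inr (j, l)\<close>. Polynomials are elements
  of the monoid algebra over the free commutative monoid of multisets of variables.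
\<close>

definition matmul_monomial ::
    "nat \<Rightarrow> (nat \<times> nat) multiset \<Rightarrow> (nat \<times> nat + nat \<times> nat) multiset \<Rightarrow>\<^sub>0 'k::field"
  where "matmul_monomial m \<rho> =
    (\<Prod>(i, l)\<in>#\<rho>. \<Sum>j<m. Poly_Mapping.single {#Inl (i, j)#} 1 * Poly_Mapping.single {#Inr (j, l)#} 1)"

text \<open>
  The last conjunct is the identity \<open>T(X) \<circ> T(Y) = T(XY)\<close> between polynomials, compared at
  \<open>X\<^sup>\<mu> Y\<^sup>\<nu>\<close>. It is required formally and not only for matrices over \<open>k\<close>, since \<open>k\<close> may be finite.
\<close>

definition is_spf :: "nat \<Rightarrow> ('b, 'k::field) spf \<Rightarrow> bool"
  where "is_spf e T \<longleftrightarrow>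
    (\<forall>n. fd_subspace (val T n)) \<and>
    (\<forall>m n \<mu>. linear_map (val T m) (val T n) (coef T m n \<mu>)) \<and>
    (\<forall>m n \<mu>. \<mu> \<notin> monomials e m n \<longrightarrow> (\<forall>v\<in>val T m. coef T m n \<mu> v = 0)) \<and>
    (\<forall>n. \<forall>v\<in>val T n. spf_map e T n n (\<lambda>i j. if i = j then 1 else 0) v = v) \<and>
    (\<forall>l m n \<mu> \<nu>. \<forall>v\<in>val T l.
       coef T m n \<mu> (coef T l m \<nu> v) =
       (\<Sum>\<rho>\<in>monomials e l n.
          fscale (Poly_Mapping.lookup (matmul_monomial m \<rho>) (image_mset Inl \<mu> + image_mset Inr \<nu>))
            (coef T l n \<rho> v)))"

text \<open>
  Natural transformations are compatible with the formal action. They are normalised to vanish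
  off the values of the source, so that equality of functions is equality of transformations.
\<close>

definition nat_trans ::
    "('b, 'k::field) spf \<Rightarrow> ('c, 'k) spf \<Rightarrow> (nat \<Rightarrow> ('b \<Rightarrow> 'k) \<Rightarrow> ('c \<Rightarrow> 'k)) set"
  where "nat_trans F G = {\<alpha>.
    (\<forall>n. linear_map (val F n) (val G n) (\<alpha> n)) \<and>
    (\<forall>n v. v \<notin> val F n \<longrightarrow> \<alpha> n v = 0) \<and>
    (\<forall>m n \<mu>. \<forall>v\<in>val F m. \<alpha> n (coef F m n \<mu> v) = coef G m n \<mu> (\<alpha> m v))}"

definition nt_comp :: "(nat \<Rightarrow> 'b \<Rightarrow> 'c) \<Rightarrow> (nat \<Rightarrow> 'a \<Rightarrow> 'b) \<Rightarrow> nat \<Rightarrow> 'a \<Rightarrow> 'c"  (infixl "\<circ>\<^sub>N" 55)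
  where "\<beta> \<circ>\<^sub>N \<alpha> = (\<lambda>n. \<beta> n \<circ> \<alpha> n)"

definition nt_scale ::
    "'k::field \<Rightarrow> (nat \<Rightarrow> ('b \<Rightarrow> 'k) \<Rightarrow> ('c \<Rightarrow> 'k)) \<Rightarrow> nat \<Rightarrow> ('b \<Rightarrow> 'k) \<Rightarrow> ('c \<Rightarrow> 'k)"
  where "nt_scale c \<alpha> = (\<lambda>n v. fscale c (\<alpha> n v))"

text \<open>Kernels, images and cokernels in the category are formed objectwise.\<close>

definition nt_epi ::
    "('b, 'k::field) spf \<Rightarrow> ('c, 'k) spf \<Rightarrow> (nat \<Rightarrow> ('b \<Rightarrow> 'k) \<Rightarrow> ('c \<Rightarrow> 'k)) \<Rightarrow> bool"
  where "nt_epi F G \<alpha> \<longleftrightarrow> \<alpha> \<in> nat_trans F G \<and> (\<forall>n. \<alpha> n ` val F n = val G n)"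

definition spf_image ::
    "('b, 'k::field) spf \<Rightarrow> ('c, 'k) spf \<Rightarrow> (nat \<Rightarrow> ('b \<Rightarrow> 'k) \<Rightarrow> ('c \<Rightarrow> 'k)) \<Rightarrow> ('c, 'k) spf"
  where "spf_image F G \<alpha> = \<lparr>val = (\<lambda>n. \<alpha> n ` val F n), coef = coef G\<rparr>"

text \<open>
  Kuhn dual \<open>G(V\<^sup>*)\<^sup>*\<close>, with \<open>(k\<^sup>n)\<^sup>*\<close> identified with \<open>k\<^sup>n\<close> through the dual basis; the dual of the
  map given by \<open>X\<close> is then given by the transpose of \<open>X\<close>. Functionals on \<open>G(k\<^sup>n)\<close> are extended
  by zero.
\<close>

definition kuhn_dual :: "('b, 'k::field) spf \<Rightarrow> ('b \<Rightarrow> 'k, 'k) spf"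
  where "kuhn_dual G = \<lparr>
    val = (\<lambda>n. {\<phi>.
      (\<forall>x\<in>val G n. \<forall>y\<in>val G n. \<phi> (x + y) = \<phi> x + \<phi> y) \<and>
      (\<forall>c. \<forall>x\<in>val G n. \<phi> (fscale c x) = c * \<phi> x) \<and>
      (\<forall>x. x \<notin> val G n \<longrightarrow> \<phi> x = 0)}),
    coef = (\<lambda>m n \<mu> \<phi> x. if x \<in> val G n then \<phi> (coef G n m (image_mset prod.swap \<mu>) x) else 0)\<rparr>"


section \<open>Ext groups\<close>

text \<open>
  Every finite-dimensional space embeds in \<open>nat list \<Rightarrow> 'k\<close>, so the functors with values in this
  space form a category equivalent to the category of all homogeneous strict polynomial functors
  of degree \<open>e\<close>. Projectivity is tested, and resolutions are formed, there; the arguments of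
  \<open>Ext\<close> may have their values in other function spaces.
\<close>

type_synonym 'k pfun = "(nat list, 'k) spf"

definition projective :: "nat \<Rightarrow> 'k::field pfun \<Rightarrow> bool"
  where "projective e P \<longleftrightarrow> is_spf e P \<and>
    (\<forall>(E :: 'k pfun) (F :: 'k pfun) \<beta> \<gamma>.
       is_spf e E \<and> is_spf e F \<and> nt_epi E F \<beta> \<and> \<gamma> \<in> nat_trans P F \<longrightarrow>
       (\<exists>\<delta>\<in>nat_trans P E. \<beta> \<circ>\<^sub>N \<delta> = \<gamma>))"

text \<open>\<open>\<cdots> \<rightarrow> P 2 \<rightarrow> P 1 \<rightarrow> P 0 \<rightarrow> F \<rightarrow> 0\<close> with differentials \<open>d i : P (i + 1) \<rightarrow> P i\<close> and
  augmentation \<open>\<epsilon>\<close>.\<close>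

definition proj_resolution ::
    "nat \<Rightarrow> ('b, 'k::field) spf \<Rightarrow> (nat \<Rightarrow> 'k pfun) \<Rightarrow>
     (nat \<Rightarrow> nat \<Rightarrow> (nat list \<Rightarrow> 'k) \<Rightarrow> (nat list \<Rightarrow> 'k)) \<Rightarrow>
     (nat \<Rightarrow> (nat list \<Rightarrow> 'k) \<Rightarrow> ('b \<Rightarrow> 'k)) \<Rightarrow> bool"
  where "proj_resolution e F P d \<epsilon> \<longleftrightarrow>
    (\<forall>i. projective e (P i)) \<and>
    (\<forall>i. d i \<in> nat_trans (P (Suc i)) (P i)) \<and>
    nt_epi (P 0) F \<epsilon> \<and>
    (\<forall>n. d 0 n ` val (P 1) n = {v \<in> val (P 0) n. \<epsilon> n v = 0}) \<and>
    (\<forall>i n. d (Suc i) n ` val (P (Suc (Suc i))) n = {v \<in> val (P (Suc i)) n. d i n v = 0})"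

fun coboundaries ::
    "(nat \<Rightarrow> 'k::field pfun) \<Rightarrow> (nat \<Rightarrow> nat \<Rightarrow> (nat list \<Rightarrow> 'k) \<Rightarrow> (nat list \<Rightarrow> 'k)) \<Rightarrow>
     ('c, 'k) spf \<Rightarrow> nat \<Rightarrow> (nat \<Rightarrow> (nat list \<Rightarrow> 'k) \<Rightarrow> ('c \<Rightarrow> 'k)) set"
  where
    "coboundaries P d G 0 = {0}"
  | "coboundaries P d G (Suc q) = (\<lambda>\<beta>. \<beta> \<circ>\<^sub>N d q) ` nat_trans (P q) G"

definition cocycles ::
    "(nat \<Rightarrow> 'k::field pfun) \<Rightarrow> (nat \<Rightarrow> nat \<Rightarrow> (nat list \<Rightarrow> 'k) \<Rightarrow> (nat list \<Rightarrow> 'k)) \<Rightarrow>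
     ('c, 'k) spf \<Rightarrow> nat \<Rightarrow> (nat \<Rightarrow> (nat list \<Rightarrow> 'k) \<Rightarrow> ('c \<Rightarrow> 'k)) set"
  where "cocycles P d G q = {\<alpha> \<in> nat_trans (P q) G. \<alpha> \<circ>\<^sub>N d q = 0}"

text \<open>The \<open>q\<close>-th cohomology of \<open>Hom(P, G)\<close>: cosets of cocycles modulo coboundaries.\<close>

definition Hom_cohomology ::
    "(nat \<Rightarrow> 'k::field pfun) \<Rightarrow> (nat \<Rightarrow> nat \<Rightarrow> (nat list \<Rightarrow> 'k) \<Rightarrow> (nat list \<Rightarrow> 'k)) \<Rightarrow>
     ('c, 'k) spf \<Rightarrow> nat \<Rightarrow> ('k, (nat \<Rightarrow> (nat list \<Rightarrow> 'k) \<Rightarrow> ('c \<Rightarrow> 'k)) set) vspace"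
  where "Hom_cohomology P d G q = \<lparr>
    elems = (\<lambda>\<alpha>. {\<alpha> + b | b. b \<in> coboundaries P d G q}) ` cocycles P d G q,
    vadd = (\<lambda>A B. {a + b | a b. a \<in> A \<and> b \<in> B}),
    vscale = (\<lambda>c A. {nt_scale c a + b | a b. a \<in> A \<and> b \<in> coboundaries P d G q})\<rparr>"

text \<open>Up to isomorphism, \<open>Ext\<close> does not depend on the chosen projective resolution of \<open>F\<close>.\<close>

definition Ext ::
    "nat \<Rightarrow> nat \<Rightarrow> ('b, 'k::field) spf \<Rightarrow> ('c, 'k) spf \<Rightarrow>
     ('k, (nat \<Rightarrow> (nat list \<Rightarrow> 'k) \<Rightarrow> ('c \<Rightarrow> 'k)) set) vspace"
  where "Ext e q F G =
    (let (P, d, \<epsilon>) = (SOME (P, d, \<epsilon>). proj_resolution e F P d \<epsilon>) in Hom_cohomology P d G q)"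


section \<open>Tensor, symmetric and exterior powers\<close>

definition words :: "nat \<Rightarrow> nat \<Rightarrow> nat list set"
  where "words e n = {w. length w = e \<and> set w \<subseteq> {..<n}}"

text \<open>\<open>coords A\<close> is the vector space with basis \<open>A\<close> (given by its coordinate functions), and
  \<open>basis_map A g\<close> sends the basis vector \<open>w \<in> A\<close> to the basis vector \<open>g w\<close>.\<close>

definition coords :: "'b set \<Rightarrow> ('b \<Rightarrow> 'k::field) set"
  where "coords A = {f. \<forall>w. w \<notin> A \<longrightarrow> f w = 0}"

definition basis_map :: "'b set \<Rightarrow> ('b \<Rightarrow> 'c) \<Rightarrow> ('b \<Rightarrow> 'k::field) \<Rightarrow> ('c \<Rightarrow> 'k)"
  where "basis_map A g f = (\<lambda>u. \<Sum>w | w \<in> A \<and> g w = u. f w)"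

text \<open>
  \<open>I\<^sup>\<otimes>\<^sup>e\<close>: the word \<open>w\<close> stands for \<open>e\<^bsub>w!0\<^esub> \<otimes> \<cdots> \<otimes> e\<^bsub>w!(e-1)\<^esub>\<close>, and \<open>X\<close> sends \<open>w\<close> to
  \<open>\<Sum>u. (\<Prod>i. X\<^bsub>u!i, w!i\<^esub>) u\<close>.
\<close>

definition tensor_power :: "nat \<Rightarrow> 'k::field pfun"
  where "tensor_power e = \<lparr>
    val = (\<lambda>n. coords (words e n)),
    coef = (\<lambda>m n \<mu> f u. if u \<in> words e n
      then (\<Sum>w | w \<in> words e m \<and> mset (zip u w) = \<mu>. f w) else 0)\<rparr>"

text \<open>\<open>blocks \<kappa> w\<close> cuts a word of length \<open>sum_list \<kappa>\<close> into consecutive blocks of lengths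
  \<open>\<kappa>\<^sub>1, \<kappa>\<^sub>2, \<dots>\<close>.\<close>

fun blocks :: "nat list \<Rightarrow> 'a list \<Rightarrow> 'a list list"
  where
    "blocks [] w = []"
  | "blocks (d # ds) w = take d w # blocks ds (drop d w)"

definition sort_blocks :: "nat list \<Rightarrow> nat list \<Rightarrow> nat list"
  where "sort_blocks \<kappa> w = concat (map sort (blocks \<kappa> w))"

text \<open>
  \<open>S\<^sup>\<kappa> = S\<^bsup>\<kappa>\<^sub>1\<^esup> \<otimes> S\<^bsup>\<kappa>\<^sub>2\<^esup> \<otimes> \<cdots>\<close>: a word \<open>w\<close> with weakly increasing blocks stands for the tensor
  product of the monomials given by its blocks. The natural epimorphism \<open>\<pi>\<close> from the tensor power
  multiplies out each block, and the action is induced through it: \<open>X\<close> sends \<open>\<pi> w\<close> to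
  \<open>\<pi>(X w)\<close>, where \<open>w\<close> serves as its own representative in the tensor power.
\<close>

definition sym_epi :: "nat list \<Rightarrow> nat \<Rightarrow> (nat list \<Rightarrow> 'k::field) \<Rightarrow> (nat list \<Rightarrow> 'k)"
  where "sym_epi \<kappa> n = basis_map (words (sum_list \<kappa>) n) (sort_blocks \<kappa>)"

definition sym_power :: "nat list \<Rightarrow> 'k::field pfun"
  where "sym_power \<kappa> = \<lparr>
    val = (\<lambda>n. coords {w \<in> words (sum_list \<kappa>) n. \<forall>b\<in>set (blocks \<kappa> w). sorted b}),
    coef = (\<lambda>m n \<mu> f. sym_epi \<kappa> n (coef (tensor_power (sum_list \<kappa>)) m n \<mu> f))\<rparr>"

text \<open>
  \<open>\<Lambda>\<^sup>\<kappa> = \<Lambda>\<^bsup>\<kappa>\<^sub>1\<^esup> \<otimes> \<Lambda>\<^bsup>\<kappa>\<^sub>2\<^esup> \<otimes> \<cdots>\<close>: a word with strictly increasing blocks stands for the tensor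
  product of the wedge products of its blocks. The natural monomorphism is
  \<open>v\<^sub>1 \<and> \<cdots> \<and> v\<^sub>d \<mapsto> \<Sum>\<sigma>. sign \<sigma> v\<^bsub>\<sigma>1\<^esub> \<otimes> \<cdots> \<otimes> v\<^bsub>\<sigma>d\<^esub>\<close> on each block. The coordinate of its
  value at a word with strictly increasing blocks is the coordinate at that word of the wedge
  product, which is how the action (whose matrix entries are products of minors of \<open>X\<close>) is read
  off from that on the tensor power.
\<close>

definition row_boxes :: "nat list \<Rightarrow> (nat \<times> nat) list"
  where "row_boxes \<kappa> = [(r, c). r \<leftarrow> [0..<length \<kappa>], c \<leftarrow> [0..<\<kappa> ! r]]"

definition young_subgroup :: "nat list \<Rightarrow> (nat \<Rightarrow> nat) set"
  where "young_subgroup \<kappa> = {\<sigma>. \<sigma> permutes {..<sum_list \<kappa>} \<and>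
    (\<forall>i<sum_list \<kappa>. fst (row_boxes \<kappa> ! \<sigma> i) = fst (row_boxes \<kappa> ! i))}"

definition ext_words :: "nat list \<Rightarrow> nat \<Rightarrow> nat list set"
  where "ext_words \<kappa> n = {w \<in> words (sum_list \<kappa>) n. \<forall>b\<in>set (blocks \<kappa> w). sorted_wrt (<) b}"

definition ext_mono :: "nat list \<Rightarrow> nat \<Rightarrow> (nat list \<Rightarrow> 'k::field) \<Rightarrow> (nat list \<Rightarrow> 'k)"
  where "ext_mono \<kappa> n f =
    (\<Sum>\<sigma>\<in>young_subgroup \<kappa>. fscale (of_int (sign \<sigma>)) (basis_map (ext_words \<kappa> n) (permute_list \<sigma>) f))"

definition ext_power :: "nat list \<Rightarrow> 'k::field pfun"
  where "ext_power \<kappa> = \<lparr>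
    val = (\<lambda>n. coords (ext_words \<kappa> n)),
    coef = (\<lambda>m n \<mu> f u. if u \<in> ext_words \<kappa> n
      then coef (tensor_power (sum_list \<kappa>)) m n \<mu> (ext_mono \<kappa> m f) u else 0)\<rparr>"


section \<open>Schur and Weyl functors\<close>

text \<open>A partition is a weakly decreasing list; boxes are pairs (row, column), counted from 0.\<close>

definition conjugate_partition :: "nat list \<Rightarrow> nat list"
  where "conjugate_partition \<kappa> =
    map (\<lambda>c. length (filter (\<lambda>r. c < r) \<kappa>)) [0..<foldr max \<kappa> 0]"

definition col_boxes :: "nat list \<Rightarrow> (nat \<times> nat) list"
  where "col_boxes \<kappa> = [(r, c). c \<leftarrow> [0..<foldr max \<kappa> 0], r \<leftarrow> [0..<length \<kappa>], c < \<kappa> ! r]"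

text \<open>A word read along the rows fills the boxes of \<open>\<kappa>\<close>; the filling is read along the columns.\<close>

definition row_to_col_word :: "nat list \<Rightarrow> nat list \<Rightarrow> nat list"
  where "row_to_col_word \<kappa> w = map (\<lambda>b. the (map_of (zip (row_boxes \<kappa>) w) b)) (col_boxes \<kappa>)"

definition row_to_col :: "nat list \<Rightarrow> nat \<Rightarrow> (nat list \<Rightarrow> 'k::field) \<Rightarrow> (nat list \<Rightarrow> 'k)"
  where "row_to_col \<kappa> n = basis_map (words (sum_list \<kappa>) n) (row_to_col_word \<kappa>)"

definition schur_functor :: "nat list \<Rightarrow> 'k::field pfun"
  where "schur_functor \<kappa> =
    spf_image (ext_power \<kappa>) (sym_power (conjugate_partition \<kappa>))
      (sym_epi (conjugate_partition \<kappa>) \<circ>\<^sub>N row_to_col \<kappa> \<circ>\<^sub>N ext_mono \<kappa>)"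

definition weyl_functor :: "nat list \<Rightarrow> (nat list \<Rightarrow> 'k, 'k::field) spf"
  where "weyl_functor \<kappa> = kuhn_dual (schur_functor \<kappa>)"

definition hook :: "nat \<Rightarrow> nat \<Rightarrow> nat list"
  where "hook p i = (i + 1) # replicate (p - i - 1) 1"

end

theory Submission
  imports Defs "HOL-Combinatorics.Multiset_Permutations"
begin

text \<open>
  Write \<open>P\<^sub>j = \<Lambda>\<^sup>j \<otimes> \<Gamma>\<^bsup>p-j\<^esup>\<close>, realised as the tensors of degree \<open>p\<close> that alternate in the first \<open>j\<close> positions
  and are symmetric in the others. For \<open>j < p\<close> it is projective because \<open>j!\<close> is invertible. The two
  Koszul differentials \<open>\<kappa> : P\<^sub>j \<rightarrow> P\<^bsub>j+1\<^esub>\<close> and \<open>\<delta> : P\<^bsub>j+1\<^esub> \<rightarrow> P\<^sub>j\<close> satisfy \<open>\<delta>\<kappa> + \<kappa>\<delta> = p = 0\<close>, and weighting them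
  by the multiplicity of a letter turns each into a contracting homotopy for the other. Hence
  \<open>0 \<rightarrow> P\<^sub>0 \<rightarrow> \<cdots> \<rightarrow> P\<^bsub>p-1\<^esub> \<rightarrow> P\<^bsub>p-1\<^esub> \<rightarrow> P\<^bsub>p-2\<^esub> \<rightarrow> \<cdots> \<rightarrow> P\<^bsub>m+1\<^esub> \<rightarrow> S\<^sub>m \<rightarrow> 0\<close>, with first \<open>\<kappa>\<close>, then \<open>\<kappa>\<close> through \<open>\<Lambda>\<^sup>p\<close>, then \<open>\<delta>\<close> as
  differentials, is a projective resolution; for \<open>m = p - 1\<close> it begins with the second copy of
  \<open>P\<^bsub>p-1\<^esub>\<close>, mapping onto \<open>S\<^bsub>p-1\<^esub> = \<Lambda>\<^sup>p\<close>.

  The Weyl functor embeds into \<open>ker \<kappa> \<subseteq> P\<^bsub>n+1\<^esub>\<close>, and \<open>\<kappa> : P\<^sub>n \<rightarrow> P\<^bsub>n+1\<^esub>\<close> factors through it by some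
  \<open>\<psi> : P\<^sub>n \<rightarrow> W\<^sub>n\<close>. A homomorphism from \<open>P\<^sub>j\<close> is determined by the image of a generator, a tensor whose
  content and sign behaviour are prescribed, and inspection of such tensors gives
  \<open>Hom(P\<^sub>n, W\<^sub>n) = k\<psi>\<close>, \<open>Hom(P\<^bsub>n+1\<^esub>, W\<^sub>n) = k\<psi>\<delta>\<close> for \<open>n + 1 < p\<close>, and \<open>Hom(P\<^sub>j, W\<^sub>n) = 0\<close> otherwise. In the
  complex \<open>Hom(P, W\<^sub>n)\<close> the only non-zero differential sends \<open>\<psi>\<close> to \<open>\<psi>\<delta>\<close>, and counting degrees yields
  the claim.
\<close>

text \<open>Degree \<open>q\<close> is position \<open>a = m + 1 + q\<close> of a sequence with
  \<open>P_a\<close> at \<open>a < p\<close> and \<open>P_(2p-1-a)\<close> at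
  \<open>p \<le> a < 2p\<close>. So \<open>P_n\<close> stands at \<open>n\<close> and
  \<open>2p-1-n\<close>, and \<open>P_(n+1)\<close> at \<open>n+1\<close> and \<open>2p-2-n\<close>.
  In the first half \<psi> and \<psi>\<delta> cancel; for \<open>n + 1 < p\<close>, starting the
  sequence at \<open>m = n\<close> leaves \<psi>\<delta> alone, which is the class in degree 0. In
  the second half the differential is \<kappa>, and \<psi>\<delta>\<kappa> = 0 because \<psi> is
  given by \<kappa> and \<kappa>\<delta>\<kappa> = 0; there both classes survive, in degrees
  \<open>2p-m-n-3\<close> and \<open>2p-m-n-2\<close>. The homotopies break down exactly on constant
  words, where the weights add up to 0. Alternation in two positions kills these words, so only
  \<open>P_0\<close> and \<open>P_1\<close> need separate arguments. As \<open>k\<close> may be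
  finite, weight spaces and letter symmetries cannot in general be read off from matrices over
  \<open>k\<close>; the components \<open>coef\<close> of the formal action at suitable monomials
  take their place. \<open>Ext\<close> refers to an unspecified resolution, so the comparison
  theorem comes before any particular one.\<close>

section \<open>Linear maps\<close>

lemma fscale_apply: "fscale c f x = c * f x"
  by (simp add: fscale_def)

lemma sum_fun_apply: "(\<Sum>i\<in>A. f i) x = (\<Sum>i\<in>A. f i x)"
  by (induction A rule: infinite_finite_induct) auto

lemma linear_mapD:
  assumes "linear_map U V f"
  shows linear_map_mem: "x \<in> U \<Longrightarrow> f x \<in> V"
    and linear_map_add: "x \<in> U \<Longrightarrow> y \<in> U \<Longrightarrow> f (x + y) = f x + f y"
    and linear_map_scale: "x \<in> U \<Longrightarrow> f (fscale c x) = fscale c (f x)"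
  using assms by (auto simp: linear_map_def)

lemma linear_map_zero:
  assumes "linear_map U V f" "fun_vs.subspace U"
  shows "f 0 = 0"
  using linear_map_scale[OF assms(1), of 0 0] fun_vs.subspace_0[OF assms(2)]
  by (simp add: fscale_def zero_fun_def)

lemma linear_map_diff:
  assumes "linear_map U V f" "fun_vs.subspace U" "x \<in> U" "y \<in> U"
  shows "f (x - y) = f x - f y"
  using linear_map_add[OF assms(1), of "x - y" y] assms(3,4)
    fun_vs.subspace_diff[OF assms(2,3,4)]
  by (simp add: algebra_simps)

lemma linear_map_sum:
  assumes "linear_map U V f" "fun_vs.subspace U" "\<And>i. i \<in> A \<Longrightarrow> x i \<in> U"
  shows "f (\<Sum>i\<in>A. fscale (c i) (x i)) = (\<Sum>i\<in>A. fscale (c i) (f (x i)))"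
  using assms(3)
proof (induction A rule: infinite_finite_induct)
  case (insert i A)
  have "(\<Sum>i\<in>A. fscale (c i) (x i)) \<in> U"
    using insert.prems by (intro fun_vs.subspace_sum[OF assms(2)] fun_vs.subspace_scale[OF assms(2)]) auto
  moreover have "fscale (c i) (x i) \<in> U"
    using insert.prems by (intro fun_vs.subspace_scale[OF assms(2)]) auto
  ultimately have "f (fscale (c i) (x i) + (\<Sum>i\<in>A. fscale (c i) (x i)))
      = f (fscale (c i) (x i)) + f (\<Sum>i\<in>A. fscale (c i) (x i))"
    by (rule linear_map_add[OF assms(1), rotated])
  also have "f (fscale (c i) (x i)) = fscale (c i) (f (x i))"
    using insert.prems by (intro linear_map_scale[OF assms(1)]) auto
  also have "f (\<Sum>i\<in>A. fscale (c i) (x i)) = (\<Sum>i\<in>A. fscale (c i) (f (x i)))"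
    using insert.prems by (intro insert.IH) auto
  finally show ?case
    by (simp only: sum.insert[OF insert.hyps(1,2)])
next
  case (infinite A)
  show ?case
    unfolding sum.infinite[OF infinite.hyps] by (rule linear_map_zero[OF assms(1,2)])
next
  case empty
  show ?case
    unfolding sum.empty by (rule linear_map_zero[OF assms(1,2)])
qed

lemma linear_map_image_subspace:
  assumes "linear_map U V f" "fun_vs.subspace U"
  shows "fun_vs.subspace (f ` U)"
  unfolding fun_vs.subspace_def
proof (intro conjI ballI allI)
  show "0 \<in> f ` U"
    using linear_map_zero[OF assms] fun_vs.subspace_0[OF assms(2)] by (metis image_eqI)
next
  fix x y assume "x \<in> f ` U" "y \<in> f ` U"
  then obtain a b where ab: "a \<in> U" "b \<in> U" "x = f a" "y = f b" by blast
  then have "x + y = f (a + b)"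
    using linear_map_add[OF assms(1)] by simp
  then show "x + y \<in> f ` U"
    using fun_vs.subspace_add[OF assms(2) ab(1,2)] by blast
next
  fix c x assume "x \<in> f ` U"
  then obtain a where a: "a \<in> U" "x = f a" by blast
  then have "fscale c x = f (fscale c a)"
    using linear_map_scale[OF assms(1)] by simp
  then show "fscale c x \<in> f ` U"
    using fun_vs.subspace_scale[OF assms(2) a(1)] by blast
qed

lemma fd_subspace_subspace: "fd_subspace U \<Longrightarrow> fun_vs.subspace U"
  by (auto simp: fd_subspace_def)

lemma fd_subspace_image:
  assumes "linear_map U V f" "fd_subspace U"
  shows "fd_subspace (f ` U)"
proof -
  obtain B where B: "finite B" "U = fun_vs.span B"
    using assms(2) by (auto simp: fd_subspace_def)
  have sub: "fun_vs.subspace U"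
    using B by auto
  have "f ` U = fun_vs.span (f ` B)"
  proof
    show "fun_vs.span (f ` B) \<subseteq> f ` U"
      using B fun_vs.span_superset[of B]
      by (intro fun_vs.span_minimal linear_map_image_subspace[OF assms(1) sub]) auto
    have "f x \<in> fun_vs.span (f ` B) \<and> x \<in> U" if "x \<in> fun_vs.span B" for x
      using that
    proof (induction rule: fun_vs.span_induct_alt)
      case base
      show ?case
        by (simp only: linear_map_zero[OF assms(1) sub] fun_vs.span_zero fun_vs.subspace_0[OF sub])
    next
      case (step c x y)
      have x: "x \<in> U"
        using step.hyps B(2) by (blast intro: fun_vs.span_base)
      have cx: "fscale c x \<in> U"
        by (rule fun_vs.subspace_scale[OF sub x])
      have y: "f y \<in> fun_vs.span (f ` B)" "y \<in> U"
        using step.IH by blast+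
      have "f x \<in> fun_vs.span (f ` B)"
        using step.hyps by (blast intro: fun_vs.span_base)
      then show ?case
        unfolding linear_map_add[OF assms(1) cx y(2)] linear_map_scale[OF assms(1) x]
        by (intro conjI fun_vs.span_add fun_vs.span_scale y fun_vs.subspace_add[OF sub cx])
    qed
    then show "f ` U \<subseteq> fun_vs.span (f ` B)"
      using B by auto
  qed
  then show ?thesis
    using B by (auto simp: fd_subspace_def)
qed

lemma fd_subspace_mono:
  assumes "fun_vs.subspace U" "U \<subseteq> V" "fd_subspace V"
  shows "fd_subspace U"
proof -
  obtain B where B: "finite B" "V = fun_vs.span B"
    using assms(3) by (auto simp: fd_subspace_def)
  obtain C where C: "C \<subseteq> U" "fun_vs.independent C" "U \<subseteq> fun_vs.span C"
    using fun_vs.maximal_independent_subset[of U] by metis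
  have "finite C"
    using fun_vs.independent_span_bound[OF B(1) C(2)] C(1) assms(2) B(2) by auto
  moreover have "U = fun_vs.span C"
    using C fun_vs.span_minimal[OF C(1) assms(1)] by auto
  ultimately show ?thesis
    by (auto simp: fd_subspace_def)
qed

section \<open>Spaces of coordinate functions\<close>

definition unit_vec :: "'b \<Rightarrow> 'b \<Rightarrow> 'k::field"
  where "unit_vec w = (\<lambda>u. if u = w then 1 else 0)"

lemma coords_expand:
  assumes "finite A" "f \<in> coords A"
  shows "f = (\<Sum>w\<in>A. fscale (f w) (unit_vec w))"
  using assms by (auto simp: fun_eq_iff sum_fun_apply fscale_apply unit_vec_def coords_def if_distrib cong: if_cong)

lemma coords_subspace: "fun_vs.subspace (coords A)"
  by (auto simp: fun_vs.subspace_def coords_def fscale_apply)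

lemma fd_subspace_coords:
  assumes "finite A"
  shows "fd_subspace (coords A :: ('b \<Rightarrow> 'k::field) set)"
proof -
  have "coords A = fun_vs.span (unit_vec ` A :: ('b \<Rightarrow> 'k) set)"
  proof
    show "coords A \<subseteq> fun_vs.span (unit_vec ` A :: ('b \<Rightarrow> 'k) set)"
    proof
      fix f :: "'b \<Rightarrow> 'k" assume "f \<in> coords A"
      then have "f = (\<Sum>w\<in>A. fscale (f w) (unit_vec w))"
        using coords_expand[OF assms] by blast
      also have "\<dots> \<in> fun_vs.span (unit_vec ` A)"
        by (intro fun_vs.span_sum fun_vs.span_scale fun_vs.span_base) auto
      finally show "f \<in> fun_vs.span (unit_vec ` A)" .
    qed
    show "fun_vs.span (unit_vec ` A) \<subseteq> (coords A :: ('b \<Rightarrow> 'k) set)"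
      by (intro fun_vs.span_minimal coords_subspace) (auto simp: coords_def unit_vec_def)
  qed
  then show ?thesis
    using assms by (auto simp: fd_subspace_def)
qed


section \<open>Natural transformations\<close>

text \<open>A weaker property than \<open>is_spf\<close>. It is the one established for the Weyl
  functor, and it suffices for forming sums and multiples of transformations into it.\<close>

definition lin_functor :: "('b, 'k::field) spf \<Rightarrow> bool"
  where "lin_functor G \<longleftrightarrow> (\<forall>n. fun_vs.subspace (val G n)) \<and>
    (\<forall>m n \<mu>. linear_map (val G m) (val G n) (coef G m n \<mu>))"

lemma is_spf_lin_functor: "is_spf e T \<Longrightarrow> lin_functor T"
  by (auto simp: is_spf_def lin_functor_def fd_subspace_subspace)

lemma lin_functorD:
  assumes "lin_functor G"
  shows "fun_vs.subspace (val G n)" "linear_map (val G m) (val G n) (coef G m n \<mu>)"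
  using assms by (auto simp: lin_functor_def)

lemma nat_transD:
  assumes "\<alpha> \<in> nat_trans F G"
  shows "linear_map (val F n) (val G n) (\<alpha> n)"
    and "v \<notin> val F n \<Longrightarrow> \<alpha> n v = 0"
    and "v \<in> val F m \<Longrightarrow> \<alpha> n (coef F m n \<mu> v) = coef G m n \<mu> (\<alpha> m v)"
    and "v \<in> val F n \<Longrightarrow> \<alpha> n v \<in> val G n"
  using assms by (auto simp: nat_trans_def linear_map_def)

lemma nat_trans_zero_vec:
  assumes "\<alpha> \<in> nat_trans F G" "lin_functor F"
  shows "\<alpha> n 0 = 0"
  using linear_map_zero[OF nat_transD(1)[OF assms(1)] lin_functorD(1)[OF assms(2)]] .

text \<open>If 0 is a value of \<open>F\<close> this is linearity, otherwise it is the normalisation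
  off the values. Composites need it, since off the values of its source the inner transformation
  returns 0.\<close>

lemma nat_trans_zero_vec':
  assumes "\<alpha> \<in> nat_trans F G"
  shows "\<alpha> n 0 = 0"
proof (cases "0 \<in> val F n")
  case True
  then show ?thesis
    using linear_map_scale[OF nat_transD(1)[OF assms], of 0 n 0]
    by (simp add: fscale_def zero_fun_def)
qed (use nat_transD(2)[OF assms] in auto)

lemma nat_trans_add:
  assumes "lin_functor G" "\<alpha> \<in> nat_trans F G" "\<beta> \<in> nat_trans F G"
  shows "\<alpha> + \<beta> \<in> nat_trans F G"
  using nat_transD[OF assms(2)] nat_transD[OF assms(3)]
    fun_vs.subspace_add[OF lin_functorD(1)[OF assms(1)]] linear_mapD[OF lin_functorD(2)[OF assms(1)]]
  unfolding nat_trans_def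
  by (auto simp: linear_map_def algebra_simps fun_vs.scale_right_distrib)

lemma nat_trans_scale:
  assumes "lin_functor G" "\<alpha> \<in> nat_trans F G"
  shows "nt_scale c \<alpha> \<in> nat_trans F G"
  using nat_transD[OF assms(2)]
    fun_vs.subspace_scale[OF lin_functorD(1)[OF assms(1)]] linear_mapD[OF lin_functorD(2)[OF assms(1)]]
  unfolding nat_trans_def nt_scale_def
  by (auto simp: linear_map_def algebra_simps fun_vs.scale_right_distrib)

lemma nt_scale_minus_one: "nt_scale (-1) \<alpha> = - \<alpha>"
  by (auto simp: nt_scale_def fun_eq_iff fscale_apply)

lemma nat_trans_diff:
  assumes "lin_functor G" "\<alpha> \<in> nat_trans F G" "\<beta> \<in> nat_trans F G"
  shows "\<alpha> - \<beta> \<in> nat_trans F G"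
  using nat_trans_add[OF assms(1,2) nat_trans_scale[OF assms(1,3), of "-1"]]
  by (simp add: nt_scale_minus_one)

lemma nat_trans_zero:
  assumes "lin_functor G"
  shows "0 \<in> nat_trans F G"
  using fun_vs.subspace_0[OF lin_functorD(1)[OF assms]]
    linear_map_zero[OF lin_functorD(2)[OF assms] lin_functorD(1)[OF assms]]
  by (auto simp: nat_trans_def linear_map_def fun_eq_iff)

lemma nat_trans_comp:
  assumes "\<alpha> \<in> nat_trans F G" "\<beta> \<in> nat_trans G H"
  shows "\<beta> \<circ>\<^sub>N \<alpha> \<in> nat_trans F H"
  using nat_transD[OF assms(1)] nat_transD[OF assms(2)] nat_trans_zero_vec'[OF assms(2)]
  unfolding nat_trans_def nt_comp_def by (auto simp: linear_map_def)

lemma nt_comp_apply [simp]: "(\<beta> \<circ>\<^sub>N \<alpha>) n v = \<beta> n (\<alpha> n v)"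
  by (simp add: nt_comp_def)

lemma nt_comp_assoc: "(\<gamma> \<circ>\<^sub>N \<beta>) \<circ>\<^sub>N \<alpha> = \<gamma> \<circ>\<^sub>N (\<beta> \<circ>\<^sub>N \<alpha>)"
  by (simp add: fun_eq_iff)

lemma nat_trans_eqI:
  assumes "\<alpha> \<in> nat_trans F G" "\<beta> \<in> nat_trans F G" "\<And>n v. v \<in> val F n \<Longrightarrow> \<alpha> n v = \<beta> n v"
  shows "\<alpha> = \<beta>"
proof (rule ext, rule ext)
  fix n v show "\<alpha> n v = \<beta> n v"
    using assms(3) nat_transD(2)[OF assms(1)] nat_transD(2)[OF assms(2)] by (cases "v \<in> val F n") auto
qed

lemma nat_trans_diff_vec:
  assumes "\<beta> \<in> nat_trans G H" "lin_functor G" "x \<in> val G n" "y \<in> val G n"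
  shows "\<beta> n (x - y) = \<beta> n x - \<beta> n y"
  using linear_map_diff[OF nat_transD(1)[OF assms(1)] lin_functorD(1)[OF assms(2)] assms(3,4)] .

text \<open>The plain identity would violate the normalisation off the values.\<close>

definition nt_id :: "('b, 'k::field) spf \<Rightarrow> nat \<Rightarrow> ('b \<Rightarrow> 'k) \<Rightarrow> ('b \<Rightarrow> 'k)"
  where "nt_id F = (\<lambda>n v. if v \<in> val F n then v else 0)"

lemma nt_id_nat_trans:
  assumes "lin_functor F"
  shows "nt_id F \<in> nat_trans F F"
  using linear_map_mem[OF lin_functorD(2)[OF assms]] fun_vs.subspace_add[OF lin_functorD(1)[OF assms]]
    fun_vs.subspace_scale[OF lin_functorD(1)[OF assms]]
  by (auto simp: nat_trans_def nt_id_def linear_map_def)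

text \<open>An element of the image is \<beta> of an element of \<open>E\<close>, where the axioms
  are known, and \<beta> is linear and commutes with the formal action. Later this also yields the
  functor axioms of the Schur functor, as an image of a term of its resolution.\<close>

lemma is_spf_image:
  assumes E: "is_spf e E" and \<beta>: "\<beta> \<in> nat_trans E F"
  shows "is_spf e (spf_image E F \<beta>)"
proof -
  note \<beta>D = nat_transD[OF \<beta>]
  note lE = is_spf_lin_functor[OF E]
  note lin = lin_functorD(2)[OF lE] and sub = lin_functorD(1)[OF lE]
  have cmem: "coef E m n \<mu> v \<in> val E n" if "v \<in> val E m" for m n \<mu> v
    using linear_map_mem[OF lin that] .
  have fd: "fd_subspace (\<beta> n ` val E n)" for n
    using E fd_subspace_image[OF \<beta>D(1)] by (auto simp: is_spf_def)
  have lm: "linear_map (\<beta> m ` val E m) (\<beta> n ` val E n) (coef F m n \<mu>)" for m n \<mu>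
    unfolding linear_map_def
  proof (intro conjI ballI allI)
    fix x assume "x \<in> \<beta> m ` val E m"
    then obtain v where v: "v \<in> val E m" "x = \<beta> m v" by auto
    show "coef F m n \<mu> x \<in> \<beta> n ` val E n"
      using v \<beta>D(3)[OF v(1), of n \<mu>] cmem[OF v(1)] by (metis image_eqI)
    fix c
    have "coef F m n \<mu> (fscale c x) = coef F m n \<mu> (\<beta> m (fscale c v))"
      using v linear_map_scale[OF \<beta>D(1)] by simp
    also have "\<dots> = \<beta> n (coef E m n \<mu> (fscale c v))"
      using \<beta>D(3)[OF fun_vs.subspace_scale[OF sub v(1)]] by simp
    also have "\<dots> = fscale c (\<beta> n (coef E m n \<mu> v))"
      using linear_map_scale[OF lin v(1)] linear_map_scale[OF \<beta>D(1) cmem[OF v(1)]] by simp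
    also have "\<dots> = fscale c (coef F m n \<mu> x)"
      using v \<beta>D(3)[OF v(1)] by simp
    finally show "coef F m n \<mu> (fscale c x) = fscale c (coef F m n \<mu> x)" .
  next
    fix x y assume "x \<in> \<beta> m ` val E m" "y \<in> \<beta> m ` val E m"
    then obtain v w where v: "v \<in> val E m" "x = \<beta> m v" "w \<in> val E m" "y = \<beta> m w" by auto
    have "coef F m n \<mu> (x + y) = coef F m n \<mu> (\<beta> m (v + w))"
      using v linear_map_add[OF \<beta>D(1)] by simp
    also have "\<dots> = \<beta> n (coef E m n \<mu> (v + w))"
      using \<beta>D(3)[OF fun_vs.subspace_add[OF sub v(1,3)]] by simp
    also have "\<dots> = \<beta> n (coef E m n \<mu> v) + \<beta> n (coef E m n \<mu> w)"
      using linear_map_add[OF lin v(1,3)] linear_map_add[OF \<beta>D(1) cmem[OF v(1)] cmem[OF v(3)]] by simp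
    finally show "coef F m n \<mu> (x + y) = coef F m n \<mu> x + coef F m n \<mu> y"
      using v \<beta>D(3)[OF v(1)] \<beta>D(3)[OF v(3)] by simp
  qed
  have idn: "spf_map e (spf_image E F \<beta>) n n (\<lambda>i j. if i = j then 1 else 0) x = x"
    if "x \<in> \<beta> n ` val E n" for n x
  proof -
    obtain v where v: "v \<in> val E n" "x = \<beta> n v" using \<open>x \<in> _\<close> by auto
    have "spf_map e (spf_image E F \<beta>) n n (\<lambda>i j. if i = j then 1 else 0) x
        = \<beta> n (spf_map e E n n (\<lambda>i j. if i = j then 1 else 0) v)"
      unfolding spf_map_def using v cmem[OF v(1)]
      by (subst linear_map_sum[OF \<beta>D(1) sub]) (auto simp: spf_image_def \<beta>D(3))
    then show ?thesis
      using E v by (auto simp: is_spf_def)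
  qed
  have comp: "coef F m n \<mu> (coef F l m \<nu> x) =
       (\<Sum>\<rho>\<in>monomials e l n.
          fscale (Poly_Mapping.lookup (matmul_monomial m \<rho>) (image_mset Inl \<mu> + image_mset Inr \<nu>))
            (coef F l n \<rho> x))" if "x \<in> \<beta> l ` val E l" for l m n \<mu> \<nu> x
  proof -
    obtain v where v: "v \<in> val E l" "x = \<beta> l v" using \<open>x \<in> _\<close> by auto
    have "coef F m n \<mu> (coef F l m \<nu> x) = \<beta> n (coef E m n \<mu> (coef E l m \<nu> v))"
      using v \<beta>D(3) cmem by simp
    also have "coef E m n \<mu> (coef E l m \<nu> v) = (\<Sum>\<rho>\<in>monomials e l n.
          fscale (Poly_Mapping.lookup (matmul_monomial m \<rho>) (image_mset Inl \<mu> + image_mset Inr \<nu>))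
            (coef E l n \<rho> v))"
      using E v by (auto simp: is_spf_def)
    finally show ?thesis
      using v cmem by (subst (asm) linear_map_sum[OF \<beta>D(1) sub]) (auto simp: \<beta>D(3))
  qed
  have van: "coef F m n \<mu> x = 0" if "\<mu> \<notin> monomials e m n" "x \<in> \<beta> m ` val E m" for m n \<mu> x
  proof -
    obtain v where v: "v \<in> val E m" "x = \<beta> m v" using \<open>x \<in> _\<close> by blast
    have "coef F m n \<mu> x = \<beta> n (coef E m n \<mu> v)"
      using v \<beta>D(3) by simp
    also have "coef E m n \<mu> v = 0"
      using E v that by (auto simp: is_spf_def)
    finally show ?thesis
      by (simp only: nat_trans_zero_vec[OF \<beta> lE])
  qed
  have eqs: "val (spf_image E F \<beta>) n = \<beta> n ` val E n" "coef (spf_image E F \<beta>) = coef F" for n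
    by (simp_all add: spf_image_def)
  show ?thesis
    unfolding is_spf_def eqs
    by (intro conjI allI impI ballI; (rule fd lm)?; (rule van, assumption, assumption | rule idn comp, assumption)?)
qed

section \<open>Comparison of projective resolutions\<close>

text \<open>Projectivity speaks of epimorphisms only, so \<beta> is first restricted to its image,
  which is a functor by \<open>is_spf_image\<close>.\<close>

lemma projective_lift:
  fixes P E F :: "'k::field pfun"
  assumes P: "projective e P" and E: "is_spf e E" and \<beta>: "\<beta> \<in> nat_trans E F"
    and \<gamma>: "\<gamma> \<in> nat_trans P F"
    and im: "\<And>n v. v \<in> val P n \<Longrightarrow> \<gamma> n v \<in> \<beta> n ` val E n"
  obtains \<delta> where "\<delta> \<in> nat_trans P E" "\<beta> \<circ>\<^sub>N \<delta> = \<gamma>"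
proof -
  let ?I = "spf_image E F \<beta>"
  have "val ?I n = \<beta> n ` val E n" "coef ?I = coef F" for n
    by (simp_all add: spf_image_def)
  note I = this
  have "is_spf e ?I"
    by (rule is_spf_image[OF E \<beta>])
  moreover have "nt_epi E ?I \<beta>"
    using \<beta> unfolding nt_epi_def nat_trans_def linear_map_def I by blast
  moreover have "\<gamma> \<in> nat_trans P ?I"
    using \<gamma> im unfolding nat_trans_def linear_map_def I by blast
  ultimately show ?thesis
    using P E that unfolding projective_def by meson
qed

text \<open>With the augmentation in front of the differentials, exactness has the same form at
  every term.\<close>

definition aug :: "(nat \<Rightarrow> 'a) \<Rightarrow> 'a \<Rightarrow> nat \<Rightarrow> 'a"
  where "aug d \<epsilon> i = (case i of 0 \<Rightarrow> \<epsilon> | Suc k \<Rightarrow> d k)"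

lemma aug_simps [simp]: "aug d \<epsilon> 0 = \<epsilon>" "aug d \<epsilon> (Suc k) = d k"
  by (simp_all add: aug_def)

lemma proj_resolutionD:
  fixes F :: "'k::field pfun"
  assumes "proj_resolution e F P d \<epsilon>"
  shows "projective e (P i)" "is_spf e (P i)" "lin_functor (P i)"
    and "d i \<in> nat_trans (P (Suc i)) (P i)" "\<epsilon> \<in> nat_trans (P 0) F" "\<epsilon> n ` val (P 0) n = val F n"
    and "d i n ` val (P (Suc i)) n = {v \<in> val (P i) n. aug d \<epsilon> i n v = 0}"
proof -
  show "projective e (P i)"
    using assms by (simp add: proj_resolution_def)
  then show "is_spf e (P i)"
    by (simp add: projective_def)
  then show "lin_functor (P i)"
    by (rule is_spf_lin_functor)
  show "d i \<in> nat_trans (P (Suc i)) (P i)" "\<epsilon> \<in> nat_trans (P 0) F" "\<epsilon> n ` val (P 0) n = val F n"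
    using assms by (auto simp: proj_resolution_def nt_epi_def)
  show "d i n ` val (P (Suc i)) n = {v \<in> val (P i) n. aug d \<epsilon> i n v = 0}"
    using assms by (cases i) (simp_all add: proj_resolution_def)
qed

lemma proj_resolution_dd:
  fixes F :: "'k::field pfun"
  assumes "proj_resolution e F P d \<epsilon>" "v \<in> val (P (Suc i)) n"
  shows "aug d \<epsilon> i n (d i n v) = 0"
  using proj_resolutionD(7)[OF assms(1), of i n] assms(2) by blast

lemma chain_map_exists:
  fixes F :: "'k::field pfun"
  assumes R: "proj_resolution e F P d \<epsilon>" and R': "proj_resolution e F P' d' \<epsilon>'"
  obtains \<phi> where "\<And>i. \<phi> i \<in> nat_trans (P i) (P' i)" "\<epsilon>' \<circ>\<^sub>N \<phi> 0 = \<epsilon>"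
    "\<And>i. d' i \<circ>\<^sub>N \<phi> (Suc i) = \<phi> i \<circ>\<^sub>N d i"
proof -
  note D = proj_resolutionD[OF R] and D' = proj_resolutionD[OF R']
  \<comment> \<open>The last clause is the induction invariant: \<phi> carries the image of
    \<open>d i\<close> into the kernel of the next map of the other resolution, so that exactness
    there permits the next lift.\<close>
  define Q where "Q i \<phi> \<longleftrightarrow> \<phi> \<in> nat_trans (P i) (P' i) \<and> (i = 0 \<longrightarrow> \<epsilon>' \<circ>\<^sub>N \<phi> = \<epsilon>) \<and>
    (\<forall>n. \<forall>v\<in>val (P (Suc i)) n. aug d' \<epsilon>' i n (\<phi> n (d i n v)) = 0)" for i \<phi>
  have "\<exists>\<phi>. \<forall>i. Q i (\<phi> i) \<and> d' i \<circ>\<^sub>N \<phi> (Suc i) = \<phi> i \<circ>\<^sub>N d i"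
  proof (rule dependent_nat_choice)
    have "\<epsilon> n v \<in> \<epsilon>' n ` val (P' 0) n" if "v \<in> val (P 0) n" for n v
      using D'(6)[of n] D(6)[of n] that by blast
    then obtain \<phi> where \<phi>: "\<phi> \<in> nat_trans (P 0) (P' 0)" "\<epsilon>' \<circ>\<^sub>N \<phi> = \<epsilon>"
      using projective_lift[OF D(1) D'(2) D'(5) D(5)] by metis
    have "aug d' \<epsilon>' 0 n (\<phi> n (d 0 n v)) = 0" if "v \<in> val (P (Suc 0)) n" for n v
    proof -
      have "\<epsilon>' n (\<phi> n (d 0 n v)) = \<epsilon> n (d 0 n v)"
        using \<phi>(2) by (metis nt_comp_apply)
      then show ?thesis
        using proj_resolution_dd[OF R that] by (metis aug_simps(1))
    qed
    then show "\<exists>\<phi>. Q 0 \<phi>"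
      using \<phi> unfolding Q_def by blast
  next
    fix \<phi> i assume Q: "Q i \<phi>"
    then have \<phi>: "\<phi> \<in> nat_trans (P i) (P' i)"
      unfolding Q_def by blast
    have "(\<phi> \<circ>\<^sub>N d i) n v \<in> d' i n ` val (P' (Suc i)) n" if v: "v \<in> val (P (Suc i)) n" for n v
      unfolding D'(7) nt_comp_apply
      using Q v nat_transD(4)[OF \<phi> nat_transD(4)[OF D(4) v]] unfolding Q_def by blast
    then obtain \<psi> where \<psi>: "\<psi> \<in> nat_trans (P (Suc i)) (P' (Suc i))" "d' i \<circ>\<^sub>N \<psi> = \<phi> \<circ>\<^sub>N d i"
      using projective_lift[OF D(1) D'(2) D'(4) nat_trans_comp[OF D(4) \<phi>]] by metis
    have "aug d' \<epsilon>' (Suc i) n (\<psi> n (d (Suc i) n v)) = 0" if v: "v \<in> val (P (Suc (Suc i))) n" for n v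
    proof -
      have "d' i n (\<psi> n (d (Suc i) n v)) = \<phi> n (d i n (d (Suc i) n v))"
        using \<psi>(2) by (metis nt_comp_apply)
      also have "d i n (d (Suc i) n v) = 0"
        using proj_resolution_dd[OF R v] by (simp only: aug_simps)
      also have "\<phi> n 0 = 0"
        by (rule nat_trans_zero_vec'[OF \<phi>])
      finally show ?thesis
        by (simp only: aug_simps)
    qed
    then show "\<exists>\<psi>. Q (Suc i) \<psi> \<and> d' i \<circ>\<^sub>N \<psi> = \<phi> \<circ>\<^sub>N d i"
      using \<psi> unfolding Q_def by blast
  qed
  then obtain \<phi> where "\<forall>i. Q i (\<phi> i) \<and> d' i \<circ>\<^sub>N \<phi> (Suc i) = \<phi> i \<circ>\<^sub>N d i" ..
  then show ?thesis
    using that unfolding Q_def by metis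
qed

lemma chain_homotopy_exists:
  fixes F :: "'k::field pfun"
  assumes R: "proj_resolution e F P d \<epsilon>"
    and \<chi>: "\<And>i. \<chi> i \<in> nat_trans (P i) (P i)" "\<epsilon> \<circ>\<^sub>N \<chi> 0 = \<epsilon>"
      "\<And>i. d i \<circ>\<^sub>N \<chi> (Suc i) = \<chi> i \<circ>\<^sub>N d i"
  obtains s where "\<And>i. s i \<in> nat_trans (P i) (P (Suc i))"
    "\<And>n v. v \<in> val (P 0) n \<Longrightarrow> \<chi> 0 n v - v = d 0 n (s 0 n v)"
    "\<And>i n v. v \<in> val (P (Suc i)) n \<Longrightarrow>
       \<chi> (Suc i) n v - v = d (Suc i) n (s (Suc i) n v) + s i n (d i n v)"
proof -
  note D = proj_resolutionD[OF R]
  define \<theta> where "\<theta> i = \<chi> i - nt_id (P i)" for i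
  have \<theta>: "\<theta> i \<in> nat_trans (P i) (P i)" for i
    unfolding \<theta>_def by (intro nat_trans_diff D \<chi> nt_id_nat_trans)
  have \<theta>_eq: "\<theta> i n v = \<chi> i n v - v" if "v \<in> val (P i) n" for i n v
    using that by (simp add: \<theta>_def nt_id_def)
  have \<epsilon>\<theta>: "\<epsilon> n (\<theta> 0 n v) = 0" if v: "v \<in> val (P 0) n" for n v
  proof -
    have "\<epsilon> n (\<theta> 0 n v) = \<epsilon> n (\<chi> 0 n v) - \<epsilon> n v"
      unfolding \<theta>_eq[OF v] by (intro nat_trans_diff_vec[OF D(5) D(3)] v nat_transD(4)[OF \<chi>(1)])
    also have "\<epsilon> n (\<chi> 0 n v) = \<epsilon> n v"
      using \<chi>(2) by (metis nt_comp_apply)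
    finally show ?thesis
      by (simp only: diff_self)
  qed
  have d\<theta>: "d i n (\<theta> (Suc i) n v) = \<theta> i n (d i n v)" if v: "v \<in> val (P (Suc i)) n" for i n v
  proof -
    have "d i n (\<theta> (Suc i) n v) = d i n (\<chi> (Suc i) n v) - d i n v"
      unfolding \<theta>_eq[OF v] by (intro nat_trans_diff_vec[OF D(4) D(3)] v nat_transD(4)[OF \<chi>(1)])
    also have "d i n (\<chi> (Suc i) n v) = \<chi> i n (d i n v)"
      using \<chi>(3) by (metis nt_comp_apply)
    finally show ?thesis
      by (simp only: \<theta>_eq[OF nat_transD(4)[OF D(4) v]])
  qed
  \<comment> \<open>\<theta> is the deviation of \<chi> from the identity. The last clause says that
    \<open>s\<close> already solves the homotopy equation on the image of \<open>d i\<close>, which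
    puts \<open>\<theta> (Suc i) - s \<circ>\<^sub>N d i\<close> into the kernel of
    \<open>d i\<close>.\<close>
  define Q where "Q i s \<longleftrightarrow> s \<in> nat_trans (P i) (P (Suc i)) \<and>
    (i = 0 \<longrightarrow> (\<forall>n. \<forall>v\<in>val (P 0) n. d 0 n (s n v) = \<theta> 0 n v)) \<and>
    (\<forall>n. \<forall>v\<in>val (P (Suc i)) n. d i n (s n (d i n v)) = \<theta> i n (d i n v))" for i s
  have "\<exists>s. \<forall>i. Q i (s i) \<and> d (Suc i) \<circ>\<^sub>N s (Suc i) = \<theta> (Suc i) - (s i \<circ>\<^sub>N d i)"
  proof (rule dependent_nat_choice)
    have "\<theta> 0 n v \<in> d 0 n ` val (P (Suc 0)) n" if v: "v \<in> val (P 0) n" for n v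
      unfolding D(7) using \<epsilon>\<theta>[OF v] nat_transD(4)[OF \<theta> v] by (simp only: aug_simps) blast
    then obtain s where s: "s \<in> nat_trans (P 0) (P (Suc 0))" "d 0 \<circ>\<^sub>N s = \<theta> 0"
      using projective_lift[OF D(1) D(2) D(4) \<theta>] by metis
    then have "d 0 n (s n v) = \<theta> 0 n v" for n v
      by (metis nt_comp_apply)
    then show "\<exists>s. Q 0 s"
      using s unfolding Q_def by blast
  next
    fix s i assume Q: "Q i s"
    then have s: "s \<in> nat_trans (P i) (P (Suc i))"
      unfolding Q_def by blast
    let ?\<gamma> = "\<theta> (Suc i) - (s \<circ>\<^sub>N d i)"
    have \<gamma>: "?\<gamma> \<in> nat_trans (P (Suc i)) (P (Suc i))"
      by (intro nat_trans_diff D \<theta> nat_trans_comp[OF D(4) s])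
    have "?\<gamma> n v \<in> d (Suc i) n ` val (P (Suc (Suc i))) n" if v: "v \<in> val (P (Suc i)) n" for n v
    proof -
      have "d i n (?\<gamma> n v) = d i n (\<theta> (Suc i) n v) - d i n (s n (d i n v))"
        unfolding fun_diff_def nt_comp_apply
        using nat_trans_diff_vec[OF D(4) D(3) nat_transD(4)[OF \<theta> v]
            nat_transD(4)[OF s nat_transD(4)[OF D(4) v]]]
        by (simp only: fun_diff_def)
      also have "\<dots> = 0"
        using Q v unfolding Q_def d\<theta>[OF v] by (metis diff_self)
      finally show ?thesis
        unfolding D(7) aug_simps using nat_transD(4)[OF \<gamma> v] by blast
    qed
    then obtain t where t: "t \<in> nat_trans (P (Suc i)) (P (Suc (Suc i)))" "d (Suc i) \<circ>\<^sub>N t = ?\<gamma>"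
      using projective_lift[OF D(1) D(2) D(4) \<gamma>] by metis
    have "d (Suc i) n (t n (d (Suc i) n v)) = \<theta> (Suc i) n (d (Suc i) n v)"
      if v: "v \<in> val (P (Suc (Suc i))) n" for n v
    proof -
      have "d (Suc i) n (t n (d (Suc i) n v)) = ?\<gamma> n (d (Suc i) n v)"
        using t(2) by (metis nt_comp_apply)
      also have "\<dots> = \<theta> (Suc i) n (d (Suc i) n v) - s n (d i n (d (Suc i) n v))"
        by (simp only: fun_diff_def nt_comp_apply)
      also have "d i n (d (Suc i) n v) = 0"
        using proj_resolution_dd[OF R v] by (simp only: aug_simps)
      also have "s n 0 = 0"
        by (rule nat_trans_zero_vec'[OF s])
      finally show ?thesis
        by (simp only: diff_zero)
    qed
    then show "\<exists>t. Q (Suc i) t \<and> d (Suc i) \<circ>\<^sub>N t = ?\<gamma>"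
      using t unfolding Q_def by blast
  qed
  then obtain s where s: "\<And>i. Q i (s i)" "\<And>i. d (Suc i) \<circ>\<^sub>N s (Suc i) = \<theta> (Suc i) - (s i \<circ>\<^sub>N d i)"
    by blast
  show ?thesis
  proof (rule that[of s])
    show "s i \<in> nat_trans (P i) (P (Suc i))" for i
      using s(1)[of i] unfolding Q_def by blast
    show "\<chi> 0 n v - v = d 0 n (s 0 n v)" if "v \<in> val (P 0) n" for n v
      using s(1)[of 0] that \<theta>_eq[OF that] unfolding Q_def by metis
    show "\<chi> (Suc i) n v - v = d (Suc i) n (s (Suc i) n v) + s i n (d i n v)"
      if v: "v \<in> val (P (Suc i)) n" for i n v
    proof -
      have "d (Suc i) n (s (Suc i) n v) = (d (Suc i) \<circ>\<^sub>N s (Suc i)) n v"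
        by (simp only: nt_comp_apply)
      also have "\<dots> = \<theta> (Suc i) n v - s i n (d i n v)"
        unfolding s(2) by (simp only: fun_diff_def nt_comp_apply)
      finally show ?thesis
        by (simp only: \<theta>_eq[OF v] diff_add_cancel)
    qed
  qed
qed

section \<open>Cohomology of Hom under homotopies and change of resolution\<close>

lemma coboundaries_zero:
  assumes "lin_functor G"
  shows "0 \<in> coboundaries P d G q"
proof (cases q)
  case (Suc r)
  have "(0 :: nat \<Rightarrow> _) \<circ>\<^sub>N d r = 0"
    by (simp add: fun_eq_iff)
  then show ?thesis
    using Suc nat_trans_zero[OF assms, of "P r"] by (auto intro!: image_eqI)
qed simp

text \<open>Composing the homotopy formula with a cocycle kills the term that begins with a
  differential; the other term is a coboundary.\<close>

lemma cocycle_homotopy: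
  fixes F :: "'k::field pfun"
  assumes R: "proj_resolution e F P d \<epsilon>"
    and \<chi>: "\<And>i. \<chi> i \<in> nat_trans (P i) (P i)" "\<epsilon> \<circ>\<^sub>N \<chi> 0 = \<epsilon>"
      "\<And>i. d i \<circ>\<^sub>N \<chi> (Suc i) = \<chi> i \<circ>\<^sub>N d i"
    and G: "lin_functor G" and \<alpha>: "\<alpha> \<in> cocycles P d G q"
  obtains b where "b \<in> coboundaries P d G q" "\<alpha> \<circ>\<^sub>N \<chi> q = \<alpha> + b"
proof -
  note D = proj_resolutionD[OF R]
  obtain s where s: "\<And>i. s i \<in> nat_trans (P i) (P (Suc i))"
    "\<And>n v. v \<in> val (P 0) n \<Longrightarrow> \<chi> 0 n v - v = d 0 n (s 0 n v)"
    "\<And>i n v. v \<in> val (P (Suc i)) n \<Longrightarrow>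
       \<chi> (Suc i) n v - v = d (Suc i) n (s (Suc i) n v) + s i n (d i n v)"
    using chain_homotopy_exists[OF R \<chi>] by blast
  have \<alpha>': "\<alpha> \<in> nat_trans (P q) G" and \<alpha>d: "\<alpha> \<circ>\<^sub>N d q = 0"
    using \<alpha> unfolding cocycles_def by blast+
  have \<alpha>d': "\<alpha> n (d q n v) = 0" for n v
    using fun_cong[OF fun_cong[OF \<alpha>d], of n v] by (simp only: nt_comp_apply zero_fun_apply)
  have diff: "\<alpha> n (\<chi> q n v) = \<alpha> n v + \<alpha> n (\<chi> q n v - v)" if v: "v \<in> val (P q) n" for n v
    unfolding nat_trans_diff_vec[OF \<alpha>' D(3) nat_transD(4)[OF \<chi>(1) v] v]
    by (simp only: add_diff_cancel_left' add_diff_eq)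
  show ?thesis
  proof (cases q)
    case 0
    have "\<alpha> n (\<chi> 0 n v) = \<alpha> n v" if v: "v \<in> val (P 0) n" for n v
      using diff[unfolded 0, OF v] unfolding s(2)[OF v] \<alpha>d'[unfolded 0] by (simp only: add_0_right)
    then have "\<alpha> \<circ>\<^sub>N \<chi> q = \<alpha> + 0"
      unfolding 0 add_0_right
      by (intro nat_trans_eqI[OF nat_trans_comp[OF \<chi>(1) \<alpha>'[unfolded 0]] \<alpha>'[unfolded 0]])
        (simp only: nt_comp_apply)
    then show ?thesis
      by (rule that[OF coboundaries_zero[OF G]])
  next
    case (Suc r)
    have as: "\<alpha> \<circ>\<^sub>N s r \<in> nat_trans (P r) G"
      by (rule nat_trans_comp[OF s(1) \<alpha>'[unfolded Suc]])
    have asd: "(\<alpha> \<circ>\<^sub>N s r) \<circ>\<^sub>N d r \<in> nat_trans (P (Suc r)) G"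
      by (rule nat_trans_comp[OF D(4) as])
    have "\<alpha> n (\<chi> (Suc r) n v) = \<alpha> n v + \<alpha> n (s r n (d r n v))" if v: "v \<in> val (P (Suc r)) n" for n v
    proof -
      have "\<alpha> n (d (Suc r) n (s (Suc r) n v) + s r n (d r n v))
        = \<alpha> n (d (Suc r) n (s (Suc r) n v)) + \<alpha> n (s r n (d r n v))"
        using v by (intro linear_map_add[OF nat_transD(1)[OF \<alpha>'[unfolded Suc]]]
            nat_transD(4)[OF D(4)] nat_transD(4)[OF s(1)])
      then show ?thesis
        using diff[unfolded Suc, OF v] unfolding s(3)[OF v] \<alpha>d'[unfolded Suc] by (simp only: add_0_left)
    qed
    then have "\<alpha> \<circ>\<^sub>N \<chi> q = \<alpha> + ((\<alpha> \<circ>\<^sub>N s r) \<circ>\<^sub>N d r)"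
      unfolding Suc
      by (intro nat_trans_eqI[OF nat_trans_comp[OF \<chi>(1) \<alpha>'[unfolded Suc]]
            nat_trans_add[OF G \<alpha>'[unfolded Suc] asd]])
        (simp only: nt_comp_apply plus_fun_apply)
    moreover have "(\<alpha> \<circ>\<^sub>N s r) \<circ>\<^sub>N d r \<in> coboundaries P d G q"
      unfolding Suc coboundaries.simps by (rule imageI[OF as])
    ultimately show ?thesis
      by (intro that)
  qed
qed

text \<open>Every cohomology group below has dimension at most 1; \<open>lam\<close> is its isomorphism with \<open>k\<close> or \<open>0\<close>,
  read on cocycles.\<close>

definition cohomology_coordinate ::
    "(nat \<Rightarrow> 'k::field pfun) \<Rightarrow> (nat \<Rightarrow> nat \<Rightarrow> (nat list \<Rightarrow> 'k) \<Rightarrow> (nat list \<Rightarrow> 'k)) \<Rightarrow>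
     ('c, 'k) spf \<Rightarrow> nat \<Rightarrow> bool \<Rightarrow> ((nat \<Rightarrow> (nat list \<Rightarrow> 'k) \<Rightarrow> ('c \<Rightarrow> 'k)) \<Rightarrow> 'k) \<Rightarrow> bool"
  where "cohomology_coordinate P d G q b lam \<longleftrightarrow>
    (\<forall>\<alpha>\<in>cocycles P d G q. \<forall>\<beta>\<in>cocycles P d G q. lam (\<alpha> + \<beta>) = lam \<alpha> + lam \<beta>) \<and>
    (\<forall>c. \<forall>\<alpha>\<in>cocycles P d G q. lam (nt_scale c \<alpha>) = c * lam \<alpha>) \<and>
    (\<forall>\<alpha>\<in>cocycles P d G q. lam \<alpha> = 0 \<longleftrightarrow> \<alpha> \<in> coboundaries P d G q) \<and>
    lam ` cocycles P d G q = (if b then UNIV else {0})"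

lemma cohomology_coordinateD:
  assumes "cohomology_coordinate P d G q b lam"
  shows "\<alpha> \<in> cocycles P d G q \<Longrightarrow> \<beta> \<in> cocycles P d G q \<Longrightarrow> lam (\<alpha> + \<beta>) = lam \<alpha> + lam \<beta>"
    and "\<alpha> \<in> cocycles P d G q \<Longrightarrow> lam (nt_scale c \<alpha>) = c * lam \<alpha>"
    and "\<alpha> \<in> cocycles P d G q \<Longrightarrow> lam \<alpha> = 0 \<longleftrightarrow> \<alpha> \<in> coboundaries P d G q"
    and "lam ` cocycles P d G q = (if b then UNIV else {0})"
  using assms unfolding cohomology_coordinate_def by blast+

lemma nt_comp_add_left: "(\<alpha> + \<beta>) \<circ>\<^sub>N \<gamma> = (\<alpha> \<circ>\<^sub>N \<gamma>) + (\<beta> \<circ>\<^sub>N \<gamma>)"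
  by (simp add: fun_eq_iff)

lemma nt_comp_scale_left: "nt_scale c \<alpha> \<circ>\<^sub>N \<gamma> = nt_scale c (\<alpha> \<circ>\<^sub>N \<gamma>)"
  by (simp add: fun_eq_iff nt_scale_def)

lemma cocycles_comp:
  assumes "\<And>i. \<phi> i \<in> nat_trans (P i) (P' i)" "\<And>i. d' i \<circ>\<^sub>N \<phi> (Suc i) = \<phi> i \<circ>\<^sub>N d i"
    and "\<alpha> \<in> cocycles P' d' G q"
  shows "\<alpha> \<circ>\<^sub>N \<phi> q \<in> cocycles P d G q"
proof -
  have \<alpha>: "\<alpha> \<in> nat_trans (P' q) G" "\<alpha> \<circ>\<^sub>N d' q = 0"
    using assms(3) by (auto simp: cocycles_def)
  have "(\<alpha> \<circ>\<^sub>N \<phi> q) \<circ>\<^sub>N d q = (\<alpha> \<circ>\<^sub>N d' q) \<circ>\<^sub>N \<phi> (Suc q)"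
    unfolding nt_comp_assoc assms(2) ..
  also have "\<dots> = 0"
    unfolding \<alpha>(2) by (simp add: fun_eq_iff)
  finally show ?thesis
    using nat_trans_comp[OF assms(1) \<alpha>(1)] by (simp add: cocycles_def)
qed

lemma coboundaries_comp:
  assumes "\<And>i. \<phi> i \<in> nat_trans (P i) (P' i)" "\<And>i. d' i \<circ>\<^sub>N \<phi> (Suc i) = \<phi> i \<circ>\<^sub>N d i"
    and "b \<in> coboundaries P' d' G q"
  shows "b \<circ>\<^sub>N \<phi> q \<in> coboundaries P d G q"
proof (cases q)
  case 0
  then show ?thesis
    using assms(3) by (simp add: fun_eq_iff)
next
  case (Suc r)
  then obtain \<beta> where \<beta>: "\<beta> \<in> nat_trans (P' r) G" "b = \<beta> \<circ>\<^sub>N d' r"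
    using assms(3) by auto
  have "b \<circ>\<^sub>N \<phi> q = (\<beta> \<circ>\<^sub>N \<phi> r) \<circ>\<^sub>N d r"
    unfolding \<beta>(2) Suc nt_comp_assoc assms(2) ..
  then show ?thesis
    using nat_trans_comp[OF assms(1) \<beta>(1)] unfolding Suc coboundaries.simps by blast
qed

lemma cocycles_add:
  assumes "lin_functor G" "\<alpha> \<in> cocycles P d G q" "\<beta> \<in> cocycles P d G q"
  shows "\<alpha> + \<beta> \<in> cocycles P d G q"
  using assms(2,3) nat_trans_add[OF assms(1)]
  unfolding cocycles_def mem_Collect_eq nt_comp_add_left by (metis add_0_left)

lemma cocycles_scale:
  assumes "lin_functor G" "\<alpha> \<in> cocycles P d G q"
  shows "nt_scale c \<alpha> \<in> cocycles P d G q"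
proof -
  have "nt_scale c 0 = 0"
    by (simp add: fun_eq_iff nt_scale_def fscale_def)
  then show ?thesis
    using assms(2) nat_trans_scale[OF assms(1)]
    unfolding cocycles_def mem_Collect_eq nt_comp_scale_left by metis
qed

lemma coboundaries_add:
  assumes "lin_functor G" "\<alpha> \<in> coboundaries P d G q" "\<beta> \<in> coboundaries P d G q"
  shows "\<alpha> + \<beta> \<in> coboundaries P d G q"
proof (cases q)
  case (Suc r)
  then obtain a b where ab: "a \<in> nat_trans (P r) G" "b \<in> nat_trans (P r) G" "\<alpha> = a \<circ>\<^sub>N d r" "\<beta> = b \<circ>\<^sub>N d r"
    using assms by auto
  then have "\<alpha> + \<beta> = (a + b) \<circ>\<^sub>N d r"
    by (simp only: nt_comp_add_left)
  then show ?thesis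
    using nat_trans_add[OF assms(1) ab(1,2)] unfolding Suc coboundaries.simps by blast
qed (use assms in simp)

lemma coboundaries_scale:
  assumes "lin_functor G" "\<alpha> \<in> coboundaries P d G q"
  shows "nt_scale c \<alpha> \<in> coboundaries P d G q"
proof (cases q)
  case 0
  then show ?thesis
    using assms by (simp add: fun_eq_iff nt_scale_def fscale_def)
next
  case (Suc r)
  then obtain a where a: "a \<in> nat_trans (P r) G" "\<alpha> = a \<circ>\<^sub>N d r"
    using assms by auto
  then have "nt_scale c \<alpha> = nt_scale c a \<circ>\<^sub>N d r"
    by (simp only: nt_comp_scale_left)
  then show ?thesis
    using nat_trans_scale[OF assms(1) a(1)] unfolding Suc coboundaries.simps by blast
qed

lemma coboundaries_cocycles:
  fixes F :: "'k::field pfun"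
  assumes R: "proj_resolution e F P d \<epsilon>" and G: "lin_functor G" and b: "b \<in> coboundaries P d G q"
  shows "b \<in> cocycles P d G q"
proof (cases q)
  case 0
  then have "b = 0"
    using b by simp
  moreover have "(0 :: nat \<Rightarrow> _) \<circ>\<^sub>N d q = 0"
    by (simp add: fun_eq_iff)
  ultimately show ?thesis
    using nat_trans_zero[OF G] unfolding cocycles_def mem_Collect_eq by blast
next
  case (Suc r)
  note D = proj_resolutionD[OF R]
  obtain \<beta> where \<beta>: "\<beta> \<in> nat_trans (P r) G" "b = \<beta> \<circ>\<^sub>N d r"
    using b Suc by auto
  have "(d r \<circ>\<^sub>N d (Suc r)) n v = 0" for n v
  proof (cases "v \<in> val (P (Suc (Suc r))) n")
    case True
    show ?thesis
      using proj_resolution_dd[OF R True] by (simp only: aug_simps nt_comp_apply)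
  next
    case False
    show ?thesis
      unfolding nt_comp_apply nat_transD(2)[OF D(4) False] by (rule nat_trans_zero_vec'[OF D(4)])
  qed
  then have "(b \<circ>\<^sub>N d q) n v = 0" for n v
    unfolding \<beta>(2) Suc nt_comp_assoc by (metis nt_comp_apply nat_trans_zero_vec'[OF \<beta>(1)])
  then have "b \<circ>\<^sub>N d q = 0"
    by (intro ext) (simp only: zero_fun_apply)
  then show ?thesis
    using nat_trans_comp[OF D(4) \<beta>(1)] \<beta>(2) Suc by (simp add: cocycles_def)
qed

text \<open>The coordinate is pulled back along a chain map \<phi>. Both composites with a chain map
  \<psi> in the other direction are homotopic to the identity; one of them shows that coboundaries
  are detected, the other that the range is unchanged.\<close>

lemma cohomology_coordinate_transfer:
  fixes F :: "'k::field pfun"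
  assumes R: "proj_resolution e F P d \<epsilon>" and R': "proj_resolution e F P' d' \<epsilon>'"
    and G: "lin_functor G" and lam: "cohomology_coordinate P d G q b lam"
  obtains lam' where "cohomology_coordinate P' d' G q b lam'"
proof -
  note D = proj_resolutionD[OF R] and D' = proj_resolutionD[OF R']
  obtain \<phi> where \<phi>: "\<And>i. \<phi> i \<in> nat_trans (P i) (P' i)" "\<epsilon>' \<circ>\<^sub>N \<phi> 0 = \<epsilon>"
    "\<And>i. d' i \<circ>\<^sub>N \<phi> (Suc i) = \<phi> i \<circ>\<^sub>N d i"
    using chain_map_exists[OF R R'] by metis
  obtain \<psi> where \<psi>: "\<And>i. \<psi> i \<in> nat_trans (P' i) (P i)" "\<epsilon> \<circ>\<^sub>N \<psi> 0 = \<epsilon>'"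
    "\<And>i. d i \<circ>\<^sub>N \<psi> (Suc i) = \<psi> i \<circ>\<^sub>N d' i"
    using chain_map_exists[OF R' R] by metis
  have \<psi>\<phi>: "\<psi> i \<circ>\<^sub>N \<phi> i \<in> nat_trans (P i) (P i)" "\<epsilon> \<circ>\<^sub>N (\<psi> 0 \<circ>\<^sub>N \<phi> 0) = \<epsilon>"
    "d i \<circ>\<^sub>N (\<psi> (Suc i) \<circ>\<^sub>N \<phi> (Suc i)) = (\<psi> i \<circ>\<^sub>N \<phi> i) \<circ>\<^sub>N d i" for i
  proof -
    show "\<psi> i \<circ>\<^sub>N \<phi> i \<in> nat_trans (P i) (P i)"
      by (rule nat_trans_comp[OF \<phi>(1) \<psi>(1)])
    show "\<epsilon> \<circ>\<^sub>N (\<psi> 0 \<circ>\<^sub>N \<phi> 0) = \<epsilon>"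
      unfolding nt_comp_assoc[symmetric] \<psi>(2) \<phi>(2) ..
    show "d i \<circ>\<^sub>N (\<psi> (Suc i) \<circ>\<^sub>N \<phi> (Suc i)) = (\<psi> i \<circ>\<^sub>N \<phi> i) \<circ>\<^sub>N d i"
      unfolding nt_comp_assoc[symmetric] \<psi>(3) unfolding nt_comp_assoc \<phi>(3) ..
  qed
  have \<phi>\<psi>: "\<phi> i \<circ>\<^sub>N \<psi> i \<in> nat_trans (P' i) (P' i)" "\<epsilon>' \<circ>\<^sub>N (\<phi> 0 \<circ>\<^sub>N \<psi> 0) = \<epsilon>'"
    "d' i \<circ>\<^sub>N (\<phi> (Suc i) \<circ>\<^sub>N \<psi> (Suc i)) = (\<phi> i \<circ>\<^sub>N \<psi> i) \<circ>\<^sub>N d' i" for i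
  proof -
    show "\<phi> i \<circ>\<^sub>N \<psi> i \<in> nat_trans (P' i) (P' i)"
      by (rule nat_trans_comp[OF \<psi>(1) \<phi>(1)])
    show "\<epsilon>' \<circ>\<^sub>N (\<phi> 0 \<circ>\<^sub>N \<psi> 0) = \<epsilon>'"
      unfolding nt_comp_assoc[symmetric] \<psi>(2) \<phi>(2) ..
    show "d' i \<circ>\<^sub>N (\<phi> (Suc i) \<circ>\<^sub>N \<psi> (Suc i)) = (\<phi> i \<circ>\<^sub>N \<psi> i) \<circ>\<^sub>N d' i"
      unfolding nt_comp_assoc[symmetric] \<phi>(3) unfolding nt_comp_assoc \<psi>(3) ..
  qed
  note lamD = cohomology_coordinateD[OF lam]
  define lam' where "lam' \<alpha> = lam (\<alpha> \<circ>\<^sub>N \<phi> q)" for \<alpha>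
  have Z: "\<alpha> \<circ>\<^sub>N \<phi> q \<in> cocycles P d G q" if "\<alpha> \<in> cocycles P' d' G q" for \<alpha>
    by (rule cocycles_comp[OF \<phi>(1,3) that])
  have Z': "\<alpha> \<circ>\<^sub>N \<psi> q \<in> cocycles P' d' G q" if "\<alpha> \<in> cocycles P d G q" for \<alpha>
    by (rule cocycles_comp[OF \<psi>(1,3) that])
  have "cohomology_coordinate P' d' G q b lam'"
    unfolding cohomology_coordinate_def
  proof (intro conjI ballI allI)
    fix \<alpha> \<beta> assume "\<alpha> \<in> cocycles P' d' G q" "\<beta> \<in> cocycles P' d' G q"
    then show "lam' (\<alpha> + \<beta>) = lam' \<alpha> + lam' \<beta>"
      unfolding lam'_def nt_comp_add_left by (intro lamD(1) Z)
  next
    fix c \<alpha> assume "\<alpha> \<in> cocycles P' d' G q"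
    then show "lam' (nt_scale c \<alpha>) = c * lam' \<alpha>"
      unfolding lam'_def nt_comp_scale_left by (intro lamD(2) Z)
  next
    fix \<alpha> assume \<alpha>: "\<alpha> \<in> cocycles P' d' G q"
    show "lam' \<alpha> = 0 \<longleftrightarrow> \<alpha> \<in> coboundaries P' d' G q"
    proof
      assume "lam' \<alpha> = 0"
      then have "\<alpha> \<circ>\<^sub>N \<phi> q \<in> coboundaries P d G q"
        unfolding lam'_def lamD(3)[OF Z[OF \<alpha>]] .
      then have c: "(\<alpha> \<circ>\<^sub>N \<phi> q) \<circ>\<^sub>N \<psi> q \<in> coboundaries P' d' G q"
        using coboundaries_comp[where \<phi>=\<psi> and P'=P and d'=d and P=P' and d=d', OF \<psi>(1,3)] by blast
      obtain b where b: "b \<in> coboundaries P' d' G q" "\<alpha> \<circ>\<^sub>N (\<phi> q \<circ>\<^sub>N \<psi> q) = \<alpha> + b"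
        by (rule cocycle_homotopy[OF R' \<phi>\<psi> G \<alpha>])
      have "\<alpha> = ((\<alpha> \<circ>\<^sub>N \<phi> q) \<circ>\<^sub>N \<psi> q) + nt_scale (-1) b"
        unfolding nt_comp_assoc b(2) nt_scale_minus_one by simp
      then show "\<alpha> \<in> coboundaries P' d' G q"
        using coboundaries_add[OF G c coboundaries_scale[OF G b(1), of "-1"]] by (simp only:)
    next
      assume "\<alpha> \<in> coboundaries P' d' G q"
      then show "lam' \<alpha> = 0"
        unfolding lam'_def lamD(3)[OF Z[OF \<alpha>]]
        using coboundaries_comp[where \<phi>=\<phi> and P=P and d=d and P'=P' and d'=d', OF \<phi>(1,3)] by blast
    qed
  next
    show "lam' ` cocycles P' d' G q = (if b then UNIV else {0})"
    proof
      show "lam' ` cocycles P' d' G q \<subseteq> (if b then UNIV else {0})"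
        unfolding lamD(4)[symmetric] lam'_def using Z by blast
      show "(if b then UNIV else {0}) \<subseteq> lam' ` cocycles P' d' G q"
      proof
        fix c assume "c \<in> (if b then UNIV else {0 :: 'k})"
        then obtain \<alpha> where \<alpha>: "\<alpha> \<in> cocycles P d G q" "c = lam \<alpha>"
          unfolding lamD(4)[symmetric] by blast
        obtain b where b: "b \<in> coboundaries P d G q" "\<alpha> \<circ>\<^sub>N (\<psi> q \<circ>\<^sub>N \<phi> q) = \<alpha> + b"
          by (rule cocycle_homotopy[OF R \<psi>\<phi> G \<alpha>(1)])
        have "lam' (\<alpha> \<circ>\<^sub>N \<psi> q) = lam (\<alpha> + b)"
          unfolding lam'_def nt_comp_assoc b(2) ..
        also have "\<dots> = lam \<alpha> + lam b"
          by (rule lamD(1)[OF \<alpha>(1) coboundaries_cocycles[OF R G b(1)]])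
        also have "lam b = 0"
          using b(1) lamD(3)[OF coboundaries_cocycles[OF R G b(1)]] by blast
        finally have "c = lam' (\<alpha> \<circ>\<^sub>N \<psi> q)"
          unfolding \<alpha>(2) by (simp only: add_0_right)
        then show "c \<in> lam' ` cocycles P' d' G q"
          using Z'[OF \<alpha>(1)] by blast
      qed
    qed
  qed
  then show ?thesis
    using that by blast
qed

lemma Hom_cohomology_iso:
  fixes F :: "'k::field pfun"
  assumes R: "proj_resolution e F P d \<epsilon>" and G: "lin_functor G"
    and lam: "cohomology_coordinate P d G q b lam"
  shows "Hom_cohomology P d G q \<cong>\<^sub>k (if b then base_field else zero_space)"
proof -
  let ?Z = "cocycles P d G q" and ?B = "coboundaries P d G q"
  let ?cl = "\<lambda>\<alpha>. {\<alpha> + b | b. b \<in> ?B}"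
  note lamD = cohomology_coordinateD[OF lam]
  have BZ: "?B \<subseteq> ?Z"
    using coboundaries_cocycles[OF R G] by blast
  have lam_B: "lam \<beta> = 0" if "\<beta> \<in> ?B" for \<beta>
    using lamD(3) BZ that by blast
  have lam_cl: "lam x = lam \<alpha>" if a: "\<alpha> \<in> ?Z" "x \<in> ?cl \<alpha>" for \<alpha> x
  proof -
    obtain c where c: "c \<in> ?B" "x = \<alpha> + c"
      using a(2) by blast
    have "lam x = lam \<alpha> + lam c"
      unfolding c(2) using a(1) c(1) BZ by (intro lamD(1)) blast+
    then show ?thesis
      unfolding lam_B[OF c(1)] by (simp only: add_0_right)
  qed
  have self: "\<alpha> \<in> ?cl \<alpha>" for \<alpha>
    using coboundaries_zero[OF G] by force
  \<comment> \<open>On a coset \<open>lam\<close> is constant, so any representative may be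
    taken.\<close>
  define f where "f A = lam (SOME \<alpha>. \<alpha> \<in> A)" for A
  have f: "f (?cl \<alpha>) = lam \<alpha>" if "\<alpha> \<in> ?Z" for \<alpha>
    unfolding f_def by (rule lam_cl[OF that someI[of "\<lambda>x. x \<in> ?cl \<alpha>", OF self]])
  have cl_eq: "?cl \<alpha> = ?cl \<beta>" if ab: "\<alpha> \<in> ?Z" "\<beta> \<in> ?Z" "lam \<alpha> = lam \<beta>" for \<alpha> \<beta>
  proof -
    have sub: "?cl \<alpha> \<subseteq> ?cl \<beta>" if ab: "\<alpha> \<in> ?Z" "\<beta> \<in> ?Z" "lam \<alpha> = lam \<beta>" for \<alpha> \<beta>
    proof
      fix x assume "x \<in> ?cl \<alpha>"
      then obtain c where c: "c \<in> ?B" "x = \<alpha> + c" by blast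
      have z: "nt_scale (-1) \<beta> \<in> ?Z"
        by (rule cocycles_scale[OF G ab(2)])
      have "lam (\<alpha> + nt_scale (-1) \<beta>) = lam \<alpha> + lam (nt_scale (-1) \<beta>)"
        by (rule lamD(1)[OF ab(1) z])
      also have "lam (nt_scale (-1) \<beta>) = - 1 * lam \<beta>"
        by (rule lamD(2)[OF ab(2)])
      finally have "lam (\<alpha> + nt_scale (-1) \<beta>) = 0"
        unfolding ab(3) by (simp only: mult_minus1 right_minus)
      then have "\<alpha> + nt_scale (-1) \<beta> \<in> ?B"
        unfolding lamD(3)[OF cocycles_add[OF G ab(1) z]] .
      then have "\<alpha> + nt_scale (-1) \<beta> + c \<in> ?B"
        using coboundaries_add[OF G _ c(1)] by blast
      moreover have "x = \<beta> + (\<alpha> + nt_scale (-1) \<beta> + c)"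
        unfolding c(2) nt_scale_minus_one by simp
      ultimately show "x \<in> ?cl \<beta>" by blast
    qed
    show ?thesis
      by (rule subset_antisym[OF sub[OF ab] sub[OF ab(2,1) ab(3)[symmetric]]])
  qed
  have add: "{a + c | a c. a \<in> ?cl \<alpha> \<and> c \<in> ?cl \<beta>} = ?cl (\<alpha> + \<beta>)" for \<alpha> \<beta>
  proof (intro set_eqI iffI)
    fix x assume "x \<in> {a + c | a c. a \<in> ?cl \<alpha> \<and> c \<in> ?cl \<beta>}"
    then obtain b c where "b \<in> ?B" "c \<in> ?B" "x = (\<alpha> + b) + (\<beta> + c)" by blast
    then show "x \<in> ?cl (\<alpha> + \<beta>)"
      using coboundaries_add[OF G, of b P d q c] by (auto intro!: exI[of _ "b + c"] simp: algebra_simps)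
  next
    fix x assume "x \<in> ?cl (\<alpha> + \<beta>)"
    then obtain b where "b \<in> ?B" "x = (\<alpha> + b) + \<beta>" by (auto simp: algebra_simps)
    then show "x \<in> {a + c | a c. a \<in> ?cl \<alpha> \<and> c \<in> ?cl \<beta>}"
      using self[of \<beta>] by blast
  qed
  have scale: "{nt_scale c a + b | a b. a \<in> ?cl \<alpha> \<and> b \<in> ?B} = ?cl (nt_scale c \<alpha>)" for c \<alpha>
  proof (intro set_eqI iffI)
    fix x assume "x \<in> {nt_scale c a + b | a b. a \<in> ?cl \<alpha> \<and> b \<in> ?B}"
    then obtain a b where ab: "a \<in> ?B" "b \<in> ?B" "x = nt_scale c (\<alpha> + a) + b" by blast
    then have "x = nt_scale c \<alpha> + (nt_scale c a + b)"
      by (simp add: nt_scale_def fun_eq_iff fscale_apply algebra_simps)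
    then show "x \<in> ?cl (nt_scale c \<alpha>)"
      using coboundaries_add[OF G coboundaries_scale[OF G ab(1)] ab(2)] by blast
  next
    fix x assume "x \<in> ?cl (nt_scale c \<alpha>)"
    then show "x \<in> {nt_scale c a + b | a b. a \<in> ?cl \<alpha> \<and> b \<in> ?B}"
      using self[of \<alpha>] by blast
  qed
  let ?T = "(if b then base_field else zero_space) :: ('k, 'k) vspace"
  have T: "elems ?T = lam ` ?Z" "vadd ?T = (+)" "vscale ?T = (*)"
    using lamD(4) by (auto simp: base_field_def zero_space_def)
  have E: "elems (Hom_cohomology P d G q) = ?cl ` ?Z"
    "vadd (Hom_cohomology P d G q) = (\<lambda>A B. {a + b | a b. a \<in> A \<and> b \<in> B})"
    "vscale (Hom_cohomology P d G q) = (\<lambda>c A. {nt_scale c a + b | a b. a \<in> A \<and> b \<in> ?B})"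
    by (simp_all add: Hom_cohomology_def)
  show ?thesis
    unfolding vspace_iso_def E T
  proof (intro exI[of _ f] conjI ballI allI)
    have "inj_on f (?cl ` ?Z)"
    proof (rule inj_onI)
      fix A B assume "A \<in> ?cl ` ?Z" "B \<in> ?cl ` ?Z" and eq: "f A = f B"
      then obtain \<alpha> \<beta> where ab: "\<alpha> \<in> ?Z" "\<beta> \<in> ?Z" "A = ?cl \<alpha>" "B = ?cl \<beta>" by blast
      show "A = B"
        using eq unfolding ab(3,4) f[OF ab(1)] f[OF ab(2)] by (rule cl_eq[OF ab(1,2)])
    qed
    moreover have "f ` (?cl ` ?Z) = lam ` ?Z"
      unfolding image_image by (rule image_cong[OF refl f])
    ultimately show "bij_betw f (?cl ` ?Z) (lam ` ?Z)"
      unfolding bij_betw_def ..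
  next
    fix A B assume "A \<in> ?cl ` ?Z" "B \<in> ?cl ` ?Z"
    then obtain \<alpha> \<beta> where ab: "\<alpha> \<in> ?Z" "\<beta> \<in> ?Z" "A = ?cl \<alpha>" "B = ?cl \<beta>" by blast
    show "f {a + b | a b. a \<in> A \<and> b \<in> B} = f A + f B"
      unfolding ab(3,4) add f[OF ab(1)] f[OF ab(2)] f[OF cocycles_add[OF G ab(1,2)]]
      by (rule lamD(1)[OF ab(1,2)])
  next
    fix c A assume "A \<in> ?cl ` ?Z"
    then obtain \<alpha> where a: "\<alpha> \<in> ?Z" "A = ?cl \<alpha>" by blast
    show "f {nt_scale c a + b | a b. a \<in> A \<and> b \<in> ?B} = c * f A"
      unfolding a(2) scale f[OF a(1)] f[OF cocycles_scale[OF G a(1)]]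
      by (rule lamD(2)[OF a(1)])
  qed
qed

text \<open>The given resolution shows that the choice in \<open>Ext\<close> does return a
  resolution; the coordinate is then transferred to that one.\<close>

lemma Ext_iso:
  fixes F :: "'k::field pfun"
  assumes R: "proj_resolution e F P d \<epsilon>" and G: "lin_functor G"
    and lam: "cohomology_coordinate P d G q b lam"
  shows "Ext e q F G \<cong>\<^sub>k (if b then base_field else zero_space)"
proof -
  obtain P' d' \<epsilon>' where S: "(SOME (P, d, \<epsilon>). proj_resolution e F P d \<epsilon>) = (P', d', \<epsilon>')"
    by (rule prod_cases3)
  have "\<exists>x. (case x of (P, d, \<epsilon>) \<Rightarrow> proj_resolution e F P d \<epsilon>)"
    using R by (intro exI[of _ "(P, d, \<epsilon>)"]) simp
  from someI_ex[OF this] have R': "proj_resolution e F P' d' \<epsilon>'"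
    unfolding S by simp
  obtain lam' where "cohomology_coordinate P' d' G q b lam'"
    by (rule cohomology_coordinate_transfer[OF R R' G lam])
  from Hom_cohomology_iso[OF R' G this] show ?thesis
    unfolding Ext_def S Let_def prod.case .
qed

section \<open>Words and the tensor power\<close>

lemma words_0 [simp]: "words 0 n = {[]}"
  by (auto simp: words_def)

lemma words_Suc: "words (Suc e) n = (\<lambda>(j, w). j # w) ` ({..<n} \<times> words e n)"
  by (auto simp: words_def length_Suc_conv image_iff)

lemma finite_words [simp]: "finite (words e n)"
  by (induction e) (auto simp: words_Suc)

lemma length_words: "w \<in> words e n \<Longrightarrow> length w = e"
  by (simp add: words_def)

lemma zip_monomials:
  assumes "u \<in> words e n" "w \<in> words e m"
  shows "mset (zip u w) \<in> monomials e m n"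
proof -
  have "set (zip u w) \<subseteq> set u \<times> set w"
    by (auto dest: set_zip_leftD set_zip_rightD)
  also have "\<dots> \<subseteq> {..<n} \<times> {..<m}"
    using assms by (auto simp: words_def)
  finally show ?thesis
    using assms by (simp add: words_def monomials_def)
qed

lemma finite_monomials [simp]: "finite (monomials e m n)"
proof -
  have "monomials e m n \<subseteq> mset ` {xs. set xs \<subseteq> {..<n} \<times> {..<m} \<and> length xs = e}"
  proof
    fix \<mu> assume "\<mu> \<in> monomials e m n"
    then show "\<mu> \<in> mset ` {xs. set xs \<subseteq> {..<n} \<times> {..<m} \<and> length xs = e}"
      by (metis (mono_tags, lifting) ex_mset image_eqI mem_Collect_eq monomials_def set_mset_mset size_mset)
  qed
  then show ?thesis
    by (rule finite_subset) (intro finite_imageI finite_lists_length_eq, simp)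
qed

lemma sum_words_Suc: "(\<Sum>w\<in>words (Suc e) n. f w) = (\<Sum>j<n. \<Sum>w\<in>words e n. f (j # w))"
  unfolding words_Suc
  by (subst sum.reindex) (auto simp: inj_on_def sum.cartesian_product intro!: sum.cong)

text \<open>Multiplying out a product over the positions chooses an inner index for each of them;
  these choices are the words \<open>w\<close> between \<open>u\<close> and
  \<open>x\<close>.\<close>

lemma matmul_monomial_words:
  assumes "length u = length x"
  shows "(matmul_monomial m (mset (zip u x)) :: _ \<Rightarrow>\<^sub>0 'k::field) =
    (\<Sum>w\<in>words (length x) m. Poly_Mapping.single
       (image_mset Inl (mset (zip u w)) + image_mset Inr (mset (zip w x))) 1)"
  using assms
proof (induction u x rule: list_induct2)
  case Nil
  then show ?case
    by (simp add: matmul_monomial_def)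
next
  case (Cons i u l x)
  have "(matmul_monomial m (mset (zip (i # u) (l # x))) :: _ \<Rightarrow>\<^sub>0 'k) =
      (\<Sum>j<m. Poly_Mapping.single {#Inl (i, j)#} 1 * Poly_Mapping.single {#Inr (j, l)#} 1) *
      matmul_monomial m (mset (zip u x))"
    by (simp add: matmul_monomial_def)
  also have "\<dots> = (\<Sum>j<m. \<Sum>w\<in>words (length x) m.
      Poly_Mapping.single {#Inl (i, j)#} 1 * Poly_Mapping.single {#Inr (j, l)#} 1 *
      Poly_Mapping.single (image_mset Inl (mset (zip u w)) + image_mset Inr (mset (zip w x))) 1)"
    unfolding Cons.IH sum_product ..
  also have "\<dots> = (\<Sum>j<m. \<Sum>w\<in>words (length x) m.
      Poly_Mapping.single (image_mset Inl (mset (zip (i # u) (j # w))) +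
        image_mset Inr (mset (zip (j # w) (l # x)))) 1)"
    by (intro sum.cong refl) (simp add: mult_single)
  finally show ?case
    by (simp add: sum_words_Suc)
qed

lemma image_mset_Inl_Inr_eq_iff:
  "image_mset Inl A + image_mset Inr B = image_mset Inl C + image_mset Inr D \<longleftrightarrow> A = C \<and> B = D"
proof
  have 1: "filter_mset isl (image_mset Inl A + image_mset Inr B) = image_mset Inl A" for A :: "'x multiset" and B :: "'y multiset"
    by (simp add: filter_mset_image_mset)
  have 2: "filter_mset (\<lambda>x. \<not> isl x) (image_mset Inl A + image_mset Inr B) = image_mset Inr B" for A :: "'x multiset" and B :: "'y multiset"
    by (simp add: filter_mset_image_mset)
  assume *: "image_mset Inl A + image_mset Inr B = image_mset Inl C + image_mset Inr D"
  have "image_mset Inl A = (image_mset Inl C :: ('a + 'b) multiset)"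
    using 1[of A B] 1[of C D] * by simp
  from arg_cong[OF this, of "image_mset projl"] have "A = C"
    by (simp add: multiset.map_comp o_def)
  have "image_mset Inr B = (image_mset Inr D :: ('a + 'b) multiset)"
    using 2[of A B] 2[of C D] * by simp
  from arg_cong[OF this, of "image_mset projr"] have "B = D"
    by (simp add: multiset.map_comp o_def)
  with \<open>A = C\<close> show "A = C \<and> B = D" ..
qed simp

lemma lookup_matmul_monomial:
  assumes "length u = length x"
  shows "Poly_Mapping.lookup (matmul_monomial m (mset (zip u x)) :: _ \<Rightarrow>\<^sub>0 'k::field)
      (image_mset Inl \<mu> + image_mset Inr \<nu>) =
    of_nat (card {w \<in> words (length x) m. mset (zip u w) = \<mu> \<and> mset (zip w x) = \<nu>})"
proof -
  have "Poly_Mapping.lookup (matmul_monomial m (mset (zip u x)) :: _ \<Rightarrow>\<^sub>0 'k::field)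
      (image_mset Inl \<mu> + image_mset Inr \<nu>) =
    (\<Sum>w\<in>words (length x) m. if mset (zip u w) = \<mu> \<and> mset (zip w x) = \<nu> then 1 else 0)"
    unfolding matmul_monomial_words[OF assms] lookup_sum
    by (intro sum.cong refl) (auto simp: lookup_single when_def image_mset_Inl_Inr_eq_iff)
  also have "\<dots> = of_nat (card {w \<in> words (length x) m. mset (zip u w) = \<mu> \<and> mset (zip w x) = \<nu>})"
    by (simp add: sum.If_cases Int_def)
  finally show ?thesis .
qed

lemma tensor_power_coef:
  "coef (tensor_power e) m n \<mu> f u =
    (if u \<in> words e n then \<Sum>w | w \<in> words e m \<and> mset (zip u w) = \<mu>. f w else 0)"
  by (simp add: tensor_power_def)

lemma tensor_power_val [simp]: "val (tensor_power e) n = coords (words e n)"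
  by (simp add: tensor_power_def)

lemma sum_monomials_coef:
  assumes "u \<in> words e n"
  shows "(\<Sum>\<mu>\<in>monomials e m n. c \<mu> * coef (tensor_power e) m n \<mu> f u) =
    (\<Sum>w\<in>words e m. c (mset (zip u w)) * f w)"
proof -
  have "(\<Sum>\<mu>\<in>monomials e m n. c \<mu> * coef (tensor_power e) m n \<mu> f u) =
    (\<Sum>\<mu>\<in>monomials e m n. \<Sum>w | w \<in> words e m \<and> mset (zip u w) = \<mu>. c (mset (zip u w)) * f w)"
    using assms by (intro sum.cong refl) (simp add: tensor_power_coef sum_distrib_left)
  also have "\<dots> = (\<Sum>w\<in>words e m. c (mset (zip u w)) * f w)"
    using zip_monomials[OF assms] by (intro sum.group) auto
  finally show ?thesis .
qed

lemma prod_diagonal: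
  assumes "length u = length w"
  shows "(\<Prod>(i, j)\<in>#mset (zip u w). if i = j then 1 else 0) = (if u = w then 1 else 0 :: 'k::field)"
  using assms by (induction u w rule: list_induct2) auto

text \<open>Exchange of the two summations: \<open>f x\<close> is counted once for every
  intermediate \<open>w\<close>.\<close>

lemma sum_card_fibre:
  fixes f :: "'x \<Rightarrow> 'k::field"
  assumes "finite A" "finite B"
  shows "(\<Sum>w\<in>{w\<in>A. P w}. \<Sum>x\<in>{x\<in>B. Q w x}. f x) = (\<Sum>x\<in>B. of_nat (card {w\<in>A. P w \<and> Q w x}) * f x)"
proof -
  have "(\<Sum>w\<in>{w\<in>A. P w}. \<Sum>x\<in>{x\<in>B. Q w x}. f x) = (\<Sum>w\<in>A. \<Sum>x\<in>B. if P w \<and> Q w x then f x else 0)"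
    using assms by (auto simp: sum.inter_filter intro!: sum.cong)
  also have "\<dots> = (\<Sum>x\<in>B. \<Sum>w\<in>A. if P w \<and> Q w x then f x else 0)"
    by (rule sum.swap)
  also have "\<dots> = (\<Sum>x\<in>B. of_nat (card {w\<in>A. P w \<and> Q w x}) * f x)"
    using assms by (intro sum.cong refl) (simp add: sum.inter_filter[symmetric])
  finally show ?thesis .
qed

lemma is_spf_tensor_power: "is_spf e (tensor_power e :: 'k::field pfun)"
  unfolding is_spf_def
proof (intro conjI allI ballI impI)
  let ?T = "tensor_power e :: 'k pfun"
  show "fd_subspace (val ?T n)" for n
    by (simp add: fd_subspace_coords)
  show "linear_map (val ?T m) (val ?T n) (coef ?T m n \<mu>)" for m n \<mu>
    unfolding linear_map_def
    by (auto simp: coords_def tensor_power_coef fun_eq_iff fscale_apply sum.distrib sum_distrib_left)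
  show "coef ?T m n \<mu> v = 0" if "\<mu> \<notin> monomials e m n" for m n \<mu> v
  proof
    fix u
    have "{w \<in> words e m. mset (zip u w) = \<mu>} = {}" if "u \<in> words e n"
      using zip_monomials[OF that] \<open>\<mu> \<notin> _\<close> by blast
    then show "coef ?T m n \<mu> v u = 0 u"
      by (cases "u \<in> words e n") (simp_all only: tensor_power_coef if_True if_False sum.empty zero_fun_apply)
  qed
  show "spf_map e ?T n n (\<lambda>i j. if i = j then 1 else 0) v = v" if "v \<in> val ?T n" for n v
  proof
    fix u
    show "spf_map e ?T n n (\<lambda>i j. if i = j then 1 else 0) v u = v u"
    proof (cases "u \<in> words e n")
      case True
      have "spf_map e ?T n n (\<lambda>i j. if i = j then 1 else 0) v u =
          (\<Sum>w\<in>words e n. (\<Prod>(i, j)\<in>#mset (zip u w). if i = j then 1 else 0) * v w)"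
        unfolding spf_map_def sum_fun_apply fscale_apply by (rule sum_monomials_coef[OF True])
      also have "\<dots> = (\<Sum>w\<in>words e n. if u = w then v w else 0)"
        using True by (intro sum.cong refl) (simp add: prod_diagonal length_words)
      also have "\<dots> = v u"
        using True by simp
      finally show ?thesis .
    next
      case False
      then show ?thesis
        using that by (simp add: spf_map_def sum_fun_apply fscale_apply tensor_power_coef coords_def)
    qed
  qed
  show "coef ?T m n \<mu> (coef ?T l m \<nu> v) =
       (\<Sum>\<rho>\<in>monomials e l n.
          fscale (Poly_Mapping.lookup (matmul_monomial m \<rho>) (image_mset Inl \<mu> + image_mset Inr \<nu>))
            (coef ?T l n \<rho> v))" for l m n \<mu> \<nu> v
  proof
    fix u
    show "coef ?T m n \<mu> (coef ?T l m \<nu> v) u =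
       (\<Sum>\<rho>\<in>monomials e l n.
          fscale (Poly_Mapping.lookup (matmul_monomial m \<rho>) (image_mset Inl \<mu> + image_mset Inr \<nu>))
            (coef ?T l n \<rho> v)) u"
    proof (cases "u \<in> words e n")
      case True
      \<comment> \<open>Double counting over the intermediate words \<open>w\<close>. Their number
        is the structure constant of \<open>lookup_matmul_monomial\<close>, which makes the
        composition law an identity of integers mapped to \<open>k\<close>.\<close>
      have "coef ?T m n \<mu> (coef ?T l m \<nu> v) u =
          (\<Sum>w\<in>{w\<in>words e m. mset (zip u w) = \<mu>}. \<Sum>x\<in>{x\<in>words e l. mset (zip w x) = \<nu>}. v x)"
        using True by (simp add: tensor_power_coef)
      also have "\<dots> = (\<Sum>x\<in>words e l. of_nat (card {w\<in>words e m. mset (zip u w) = \<mu> \<and> mset (zip w x) = \<nu>}) * v x)"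
        by (rule sum_card_fibre) auto
      also have "\<dots> = (\<Sum>x\<in>words e l. Poly_Mapping.lookup (matmul_monomial m (mset (zip u x)))
          (image_mset Inl \<mu> + image_mset Inr \<nu>) * v x)"
        using True by (intro sum.cong refl) (simp add: lookup_matmul_monomial length_words)
      also have "\<dots> = (\<Sum>\<rho>\<in>monomials e l n. Poly_Mapping.lookup (matmul_monomial m \<rho>)
          (image_mset Inl \<mu> + image_mset Inr \<nu>) * coef ?T l n \<rho> v u)"
        by (rule sum_monomials_coef[OF True, symmetric])
      finally show ?thesis
        by (simp only: sum_fun_apply fscale_apply)
    next
      case False
      then show ?thesis
        by (simp add: sum_fun_apply fscale_apply tensor_power_coef)
    qed
  qed
qed

section \<open>Alternating and symmetric tensors\<close>

definition swp :: "nat \<Rightarrow> nat \<Rightarrow> 'a list \<Rightarrow> 'a list"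
  where "swp a b w = w[a := w ! b, b := w ! a]"

lemma length_swp [simp]: "length (swp a b w) = length w"
  by (simp add: swp_def)

lemma nth_swp:
  assumes "a < length w" "b < length w" "i < length w"
  shows "swp a b w ! i = (if i = a then w ! b else if i = b then w ! a else w ! i)"
  using assms by (auto simp: swp_def nth_list_update)

lemma swp_same [simp]: "swp a a w = w"
  by (simp add: swp_def)

lemma swp_comm: "swp a b w = swp b a w"
  by (cases "a = b") (simp_all add: swp_def list_update_swap)

lemma swp_swp [simp]:
  assumes "a < length w" "b < length w"
  shows "swp a b (swp a b w) = w"
  using assms by (intro nth_equalityI) (auto simp: nth_swp)

lemma mset_swp [simp]:
  assumes "a < length w" "b < length w"
  shows "mset (swp a b w) = mset w"
  using assms by (simp add: swp_def mset_swap)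

lemma set_swp [simp]:
  assumes "a < length w" "b < length w"
  shows "set (swp a b w) = set w"
  using assms by (metis mset_swp set_mset_mset)

lemma swp_eq_self:
  assumes "a < length w" "b < length w" "w ! a = w ! b"
  shows "swp a b w = w"
  using assms by (intro nth_equalityI) (auto simp: nth_swp)

lemma swp_disjoint:
  assumes "a < length w" "b < length w" "c < length w" "d < length w"
    "a \<noteq> c" "a \<noteq> d" "b \<noteq> c" "b \<noteq> d"
  shows "swp a b (swp c d w) = swp c d (swp a b w)"
  using assms by (intro nth_equalityI) (auto simp: nth_swp)

lemma swp_conj:
  assumes "a < length w" "b < length w" "c < length w" "a \<noteq> b" "a \<noteq> c" "b \<noteq> c"
  shows "swp a b (swp b c w) = swp b c (swp a c w)"
  using assms by (intro nth_equalityI) (auto simp: nth_swp)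

lemma swp_words_iff:
  assumes "a < p" "b < p"
  shows "swp a b w \<in> words p n \<longleftrightarrow> w \<in> words p n"
  using assms by (auto simp: words_def)

lemma zip_swp:
  assumes "length u = length w" "a < length w" "b < length w"
  shows "zip (swp a b u) (swp a b w) = swp a b (zip u w)"
  using assms by (intro nth_equalityI) (auto simp: nth_swp)

text \<open>The second clause matters in characteristic 2, where a change of sign does not force the
  value at a repeated letter to be 0.\<close>

definition alt_below :: "nat \<Rightarrow> nat \<Rightarrow> (nat list \<Rightarrow> 'k::field) \<Rightarrow> bool"
  where "alt_below p j f \<longleftrightarrow> (\<forall>w a b. length w = p \<longrightarrow> a < b \<longrightarrow> b < j \<longrightarrow>
    f (swp a b w) = - f w \<and> (w ! a = w ! b \<longrightarrow> f w = 0))"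

definition sym_above :: "nat \<Rightarrow> nat \<Rightarrow> (nat list \<Rightarrow> 'k::field) \<Rightarrow> bool"
  where "sym_above p i f \<longleftrightarrow> (\<forall>w a b. length w = p \<longrightarrow> i \<le> a \<longrightarrow> a < b \<longrightarrow> b < p \<longrightarrow> f (swp a b w) = f w)"

lemma altD:
  assumes "alt_below p j f" "length w = p" "a < j" "b < j" "a \<noteq> b"
  shows "f (swp a b w) = - f w" "w ! a = w ! b \<Longrightarrow> f w = 0"
  using assms swp_comm[of a b w] unfolding alt_below_def by (metis nat_neq_iff)+

lemma symD:
  assumes "sym_above p i f" "length w = p" "i \<le> a" "i \<le> b" "a < p" "b < p"
  shows "f (swp a b w) = f w"
  using assms swp_comm[of a b w] swp_same[of a w] unfolding sym_above_def by (metis nat_neq_iff)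

lemma alt_mono: "alt_below p j f \<Longrightarrow> i \<le> j \<Longrightarrow> alt_below p i f"
  unfolding alt_below_def by (metis less_le_trans)

lemma sym_mono: "sym_above p i f \<Longrightarrow> i \<le> j \<Longrightarrow> sym_above p j f"
  unfolding sym_above_def by (metis le_trans)

text \<open>\<open>kap j\<close> antisymmetrises a tensor alternating in the first \<open>j\<close> positions over coset
  representatives of \<open>S\<^sub>j\<close> in \<open>S\<^bsub>j+1\<^esub>\<close>: it is the Koszul differential. Likewise \<open>del p j\<close>
  symmetrises in the positions from \<open>j\<close> on.\<close>

definition kap :: "nat \<Rightarrow> (nat list \<Rightarrow> 'k::field) \<Rightarrow> nat list \<Rightarrow> 'k"
  where "kap j f w = f w - (\<Sum>t<j. f (swp t j w))"

definition del :: "nat \<Rightarrow> nat \<Rightarrow> (nat list \<Rightarrow> 'k::field) \<Rightarrow> nat list \<Rightarrow> 'k"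
  where "del p j f w = (\<Sum>s\<in>{j..<p}. f (swp j s w))"

text \<open>The weight depends on the letter in position \<open>t\<close> and on the content of the
  word, and exchanges of positions preserve the content.\<close>

definition wt :: "(nat \<Rightarrow> nat multiset \<Rightarrow> 'k) \<Rightarrow> nat \<Rightarrow> (nat list \<Rightarrow> 'k::field) \<Rightarrow> nat list \<Rightarrow> 'k"
  where "wt c t f w = c (w ! t) (mset w) * f w"

lemma del_first:
  assumes "j < p"
  shows "del p j f w = f w + (\<Sum>s\<in>{Suc j..<p}. f (swp j s w))"
  using assms by (simp add: del_def sum.atLeast_Suc_lessThan)

section \<open>Alternation and symmetry under the Koszul differentials and weights\<close>

lemma kap_sym:
  assumes f: "sym_above p (Suc j) f" and j: "j < p"
  shows "sym_above p (Suc j) (kap j f)"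
proof -
  show "sym_above p (Suc j) (kap j f)"
    unfolding sym_above_def
  proof (intro allI impI)
    fix w :: "nat list" and a b assume w: "length w = p" and ab: "Suc j \<le> a" "a < b" "b < p"
    have "f (swp t j (swp a b w)) = f (swp t j w)" if "t < j" for t
      using that w ab symD[OF f, of "swp t j w" a b] by (subst swp_disjoint) auto
    then show "kap j f (swp a b w) = kap j f w"
      using symD[OF f w, of a b] ab by (simp add: kap_def)
  qed
qed

text \<open>An exchange of \<open>a\<close> and \<open>b\<close> below \<open>j\<close> permutes the
  summands by \<open>transpose a b\<close>, each with a sign. An exchange with position
  \<open>j\<close> trades the leading term for the summand \<open>t = a\<close> and changes the sign
  of the other summands.\<close>

lemma kap_alt:
  assumes f: "alt_below p j f" and j: "j < p"
  shows "alt_below p (Suc j) (kap j f)"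
proof -
  show "alt_below p (Suc j) (kap j f)"
    unfolding alt_below_def
  proof (intro allI impI conjI)
    fix w :: "nat list" and a b assume w: "length w = p" and ab: "a < b" "b < Suc j"
    show "kap j f (swp a b w) = - kap j f w"
    proof (cases "b = j")
      case True
      have eq: "f (swp t j (swp a j w)) = - f (swp t j w)" if "t < j" "t \<noteq> a" for t
      proof -
        have "swp t j (swp a j w) = swp a t (swp t j w)"
          using that ab True w j by (intro nth_equalityI) (auto simp: nth_swp)
        then show ?thesis
          using altD(1)[OF f, of "swp t j w" a t] that ab True w by simp
      qed
      have a: "{..<j} = insert a ({..<j} - {a})"
        using ab True by auto
      have "(\<Sum>t<j. f (swp t j (swp a j w))) = f w + (\<Sum>t\<in>{..<j}-{a}. - f (swp t j w))"
        using ab True w j eq by (subst a, subst sum.insert) auto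
      moreover have "(\<Sum>t<j. f (swp t j w)) = f (swp a j w) + (\<Sum>t\<in>{..<j}-{a}. f (swp t j w))"
        by (subst a, subst sum.insert) auto
      ultimately show ?thesis
        by (simp add: kap_def True sum_negf)
    next
      case False
      then have b: "b < j"
        using ab by simp
      have eq: "f (swp t j (swp a b w)) = - f (swp (transpose a b t) j w)" if t: "t < j" for t
      proof -
        have "swp t j (swp a b w) = swp a b (swp (transpose a b t) j w)"
          using t ab b w j by (intro nth_equalityI) (auto simp: nth_swp transpose_def)
        then show ?thesis
          using altD(1)[OF f, of "swp (transpose a b t) j w" a b] ab b w by simp
      qed
      have "bij_betw (transpose a b) {..<j} {..<j}"
        using ab b by (intro permutes_imp_bij permutes_swap_id) auto
      then have "(\<Sum>t<j. f (swp (transpose a b t) j w)) = (\<Sum>t<j. f (swp t j w))"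
        by (rule sum.reindex_bij_betw)
      then show ?thesis
        using altD(1)[OF f w, of a b] ab b eq by (simp add: kap_def sum_negf)
    qed
  next
    fix w :: "nat list" and a b assume w: "length w = p" and ab: "a < b" "b < Suc j" and eq: "w ! a = w ! b"
    show "kap j f w = 0"
    proof (cases "b = j")
      case True
      have "f (swp t j w) = 0" if "t < j" "t \<noteq> a" for t
        using altD(2)[OF f, of "swp t j w" a t] that ab True w j eq by (simp add: nth_swp)
      then have "(\<Sum>t<j. f (swp t j w)) = (\<Sum>t\<in>{a}. f (swp t j w))"
        using ab True by (intro sum.mono_neutral_right) auto
      also have "\<dots> = f w"
        using swp_eq_self[of a w j] ab True w j eq by simp
      finally show ?thesis
        by (simp add: kap_def)
    next
      case False
      then have b: "b < j"
        using ab by simp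
      have "f (swp t j w) = 0" if "t < j" "t \<noteq> a" "t \<noteq> b" for t
        using altD(2)[OF f, of "swp t j w" a b] that ab b w j eq by (simp add: nth_swp)
      then have "(\<Sum>t<j. f (swp t j w)) = (\<Sum>t\<in>{a, b}. f (swp t j w))"
        using ab b by (intro sum.mono_neutral_right) auto
      also have "\<dots> = f (swp a j w) + f (swp b j w)"
        using ab by simp
      also have "swp b j w = swp a b (swp a j w)"
        using ab b w j eq by (intro nth_equalityI) (auto simp: nth_swp)
      also have "f \<dots> = - f (swp a j w)"
        using altD(1)[OF f, of "swp a j w" a b] ab b w by simp
      finally show ?thesis
        using altD(2)[OF f w, of a b] ab b eq by (simp add: kap_def)
    qed
  qed
qed

lemma kap_alt_sym:
  assumes f: "alt_below p j f" "sym_above p (Suc j) f" and j: "j < p"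
  shows "alt_below p (Suc j) (kap j f)" "sym_above p (Suc j) (kap j f)"
  using assms by (auto intro: kap_alt kap_sym)

lemma del_alt:
  assumes f: "alt_below p k f" and k: "k \<le> j" and j: "j < p"
  shows "alt_below p k (del p j f)"
proof -
  show "alt_below p k (del p j f)"
    unfolding alt_below_def
  proof (intro allI impI conjI)
    fix w :: "nat list" and a b assume w: "length w = p" and ab: "a < b" "b < k"
    have "f (swp j s (swp a b w)) = - f (swp j s w)" if "s \<in> {j..<p}" for s
      using that w ab k altD(1)[OF f, of "swp j s w" a b] by (subst swp_disjoint) auto
    then show "del p j f (swp a b w) = - del p j f w"
      by (simp add: del_def sum_negf)
    assume "w ! a = w ! b"
    then have "f (swp j s w) = 0" if "s \<in> {j..<p}" for s
      using that w ab k altD(2)[OF f, of "swp j s w" a b] by (simp add: nth_swp)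
    then show "del p j f w = 0"
      by (simp add: del_def)
  qed
qed

text \<open>An exchange of \<open>a\<close> and \<open>b\<close> permutes the summands by
  \<open>transpose a b\<close>, up to a further exchange of positions above \<open>j\<close>, which
  \<open>f\<close> does not see.\<close>

lemma del_sym:
  assumes f: "sym_above p (Suc j) f" and j: "j < p"
  shows "sym_above p j (del p j f)"
proof -
  show "sym_above p j (del p j f)"
    unfolding sym_above_def
  proof (intro allI impI)
    fix w :: "nat list" and a b assume w: "length w = p" and ab: "j \<le> a" "a < b" "b < p"
    have eq: "f (swp j s (swp a b w)) = f (swp j (transpose a b s) w)" if s: "s \<in> {j..<p}" for s
    proof (cases "a = j")
      case True
      consider "s = j" | "s = b" | "s \<noteq> j" "s \<noteq> b" by blast
      then show ?thesis
      proof cases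
        case 3
        have "swp j s (swp a b w) = swp b s (swp j s w)"
          using 3 True s ab w by (intro nth_equalityI) (auto simp: nth_swp)
        then show ?thesis
          using 3 True s ab w symD[OF f, of "swp j s w" b s] by (simp add: transpose_def)
      qed (use True s ab w in \<open>simp_all add: transpose_def\<close>)
    next
      case False
      have "swp j s (swp a b w) = swp a b (swp j (transpose a b s) w)"
        using False s ab w by (intro nth_equalityI) (auto simp: nth_swp transpose_def)
      then show ?thesis
        using False ab w symD[OF f, of "swp j (transpose a b s) w" a b] by simp
    qed
    have "bij_betw (transpose a b) {j..<p} {j..<p}"
      using ab by (intro permutes_imp_bij permutes_swap_id) auto
    then have "(\<Sum>s\<in>{j..<p}. f (swp j (transpose a b s) w)) = (\<Sum>s\<in>{j..<p}. f (swp j s w))"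
      by (rule sum.reindex_bij_betw)
    then show "del p j f (swp a b w) = del p j f w"
      using eq by (simp add: del_def)
  qed
qed

lemma del_alt_sym:
  assumes f: "alt_below p j f" "sym_above p (Suc j) f" and j: "j < p"
  shows "alt_below p j (del p j f)" "sym_above p j (del p j f)"
  using assms by (auto intro: del_alt del_sym)

text \<open>The weight singles out position \<open>j\<close>: exchanges below \<open>j\<close> or
  above \<open>j\<close> leave it alone, while those involving \<open>j\<close> do not.\<close>

lemma wt_alt_sym:
  assumes f: "alt_below p j f" "sym_above p (Suc j) f" and j: "j < p"
  shows "alt_below p j (wt c j f)" "sym_above p (Suc j) (wt c j f)"
proof -
  show "alt_below p j (wt c j f)"
    unfolding alt_below_def
  proof (intro allI impI conjI)
    fix w :: "nat list" and a b assume w: "length w = p" and ab: "a < b" "b < j"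
    show "wt c j f (swp a b w) = - wt c j f w"
      using altD(1)[OF f(1) w, of a b] w ab j by (simp add: wt_def nth_swp)
    show "wt c j f w = 0" if "w ! a = w ! b"
      using altD(2)[OF f(1) w, of a b] that ab by (simp add: wt_def)
  qed
  show "sym_above p (Suc j) (wt c j f)"
    unfolding sym_above_def wt_def using symD[OF f(2)] j by (auto simp: nth_swp)
qed

lemma sym_swp_swp:
  assumes "sym_above p j f" "length w = p" "t < j" "j \<le> s" "s < p"
  shows "f (swp t j (swp j s w)) = f (swp t s w)"
proof (cases "s = j")
  case False
  then have "swp t j (swp j s w) = swp j s (swp t s w)"
    using assms by (intro swp_conj) auto
  then show ?thesis
    using assms symD[OF assms(1), of "swp t s w" j s] by simp
qed simp

lemma alt_swp_swp:
  assumes "alt_below p (Suc i) f" "length w = p" "t < i" "i < s" "s < p"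
  shows "f (swp i s (swp t i w)) = - f (swp t s w)"
proof -
  have "swp i s (swp t i w) = swp t i (swp t s w)"
    using assms by (intro nth_equalityI) (auto simp: nth_swp)
  then show ?thesis
    using assms altD(1)[OF assms(1), of "swp t s w" t i] by simp
qed

text \<open>The weights \<open>c\<close> turn the two differentials into contracting homotopies for each other.\<close>

lemma del_kap_homotopy:
  assumes f: "alt_below p (Suc i) f" "sym_above p (Suc i) f" and i: "Suc i < p" and w: "length w = p"
  shows "del p (Suc i) (kap (Suc i) (wt c (Suc i) f)) w + kap i (wt c i (del p i f)) w
    = (\<Sum>t<p. c (w ! t) (mset w)) * f w"
proof -
  \<comment> \<open>\<open>C t\<close> is the weight of the letter at \<open>t\<close> in the
    original word. The first composite leaves the diagonal terms with \<open>t > i\<close>, the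
    second those with \<open>t \<le> i\<close>, and the mixed double sums over
    \<open>f (swp t s w)\<close> cancel.\<close>
  define C where "C t = c (w ! t) (mset w)" for t
  let ?j = "Suc i"
  have 1: "kap ?j (wt c ?j f) (swp ?j s w) = C s * f w - (\<Sum>t<?j. C t * f (swp t s w))"
    if s: "s \<in> {?j..<p}" for s
  proof -
    have "wt c ?j f (swp ?j s w) = C s * f w"
      using s w i symD[OF f(2) w, of ?j s] by (simp add: wt_def C_def nth_swp)
    moreover have "wt c ?j f (swp t ?j (swp ?j s w)) = C t * f (swp t s w)" if "t < ?j" for t
      using that s w i sym_swp_swp[OF f(2) w that, of s] by (simp add: wt_def C_def nth_swp)
    ultimately show ?thesis
      by (simp add: kap_def)
  qed
  have "del p ?j (kap ?j (wt c ?j f)) w =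
      (\<Sum>s\<in>{?j..<p}. C s * f w) - (\<Sum>s\<in>{?j..<p}. \<Sum>t<?j. C t * f (swp t s w))"
    using 1 by (simp add: del_def sum_subtractf)
  moreover have "kap i (wt c i (del p i f)) w =
      (\<Sum>t<?j. C t * f w) + (\<Sum>t<?j. \<Sum>s\<in>{?j..<p}. C t * f (swp t s w))"
  proof -
    have "wt c i (del p i f) w = C i * f w + (\<Sum>s\<in>{?j..<p}. C i * f (swp i s w))"
      using i by (simp add: wt_def C_def del_first algebra_simps sum_distrib_left)
    moreover have "wt c i (del p i f) (swp t i w) = - (C t * f w + (\<Sum>s\<in>{?j..<p}. C t * f (swp t s w)))"
      if t: "t < i" for t
    proof -
      have "del p i f (swp t i w) = - f w + (\<Sum>s\<in>{?j..<p}. - f (swp t s w))"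
        using i t w altD(1)[OF f(1) w, of t i] alt_swp_swp[OF f(1) w t]
        by (simp add: del_first)
      moreover have "wt c i (del p i f) (swp t i w) = C t * del p i f (swp t i w)"
        using t i w by (simp add: wt_def C_def nth_swp)
      ultimately show ?thesis
        by (simp add: sum_negf sum_distrib_left right_diff_distrib)
    qed
    ultimately show ?thesis
      by (simp add: kap_def sum_negf sum_subtractf)
  qed
  moreover have "(\<Sum>t<p. C t) = (\<Sum>t<?j. C t) + (\<Sum>t\<in>{?j..<p}. C t)"
    using i by (subst sum.union_disjoint[symmetric]) (auto simp: ivl_disj_un intro: sum.cong)
  ultimately show ?thesis
    using sum.swap[of "\<lambda>s t. C t * f (swp t s w)" "{..<?j}" "{?j..<p}"]
    by (simp add: C_def[symmetric] sum_distrib_right distrib_right)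
qed

text \<open>Here the weight follows \<open>kap\<close> instead of preceding it, as exactness at the
  kernel of \<open>kap\<close> requires; the mixed terms now carry \<open>C s\<close> and cancel in
  the same way. The constant weight 1 gives the relation between \<open>kap\<close> and
  \<open>del\<close> with the factor \<open>p\<close>.\<close>

lemma del_kap_homotopy':
  assumes f: "alt_below p (Suc i) f" "sym_above p (Suc i) f" and i: "Suc i < p" and w: "length w = p"
  shows "del p (Suc i) (wt c (Suc i) (kap (Suc i) f)) w + kap i (del p i (wt c i f)) w
    = (\<Sum>t<p. c (w ! t) (mset w)) * f w"
proof -
  define C where "C t = c (w ! t) (mset w)" for t
  let ?j = "Suc i"
  have 1: "wt c ?j (kap ?j f) (swp ?j s w) = C s * f w - (\<Sum>t<?j. C s * f (swp t s w))"
    if s: "s \<in> {?j..<p}" for s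
  proof -
    have "kap ?j f (swp ?j s w) = f w - (\<Sum>t<?j. f (swp t s w))"
      using s w symD[OF f(2) w, of ?j s] sym_swp_swp[OF f(2) w, of _ s] by (simp add: kap_def)
    moreover have "wt c ?j (kap ?j f) (swp ?j s w) = C s * kap ?j f (swp ?j s w)"
      using s w i by (simp add: wt_def C_def nth_swp)
    ultimately show ?thesis
      by (simp add: sum_distrib_left right_diff_distrib distrib_left)
  qed
  have "del p ?j (wt c ?j (kap ?j f)) w =
      (\<Sum>s\<in>{?j..<p}. C s * f w) - (\<Sum>s\<in>{?j..<p}. \<Sum>t<?j. C s * f (swp t s w))"
    using 1 by (simp add: del_def sum_subtractf)
  moreover have "kap i (del p i (wt c i f)) w =
      (\<Sum>t<?j. C t * f w) + (\<Sum>t<?j. \<Sum>s\<in>{?j..<p}. C s * f (swp t s w))"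
  proof -
    have "del p i (wt c i f) w = C i * f w + (\<Sum>s\<in>{?j..<p}. C s * f (swp i s w))"
      using i w by (simp add: del_first wt_def C_def nth_swp)
    moreover have "del p i (wt c i f) (swp t i w) = - (C t * f w + (\<Sum>s\<in>{?j..<p}. C s * f (swp t s w)))"
      if t: "t < i" for t
    proof -
      have "wt c i f (swp t i w) = - (C t * f w)"
        using i t w altD(1)[OF f(1) w, of t i] by (simp add: wt_def C_def nth_swp)
      moreover have "wt c i f (swp i s (swp t i w)) = - (C s * f (swp t s w))" if "s \<in> {?j..<p}" for s
        using i t w that alt_swp_swp[OF f(1) w t, of s] by (simp add: wt_def C_def nth_swp)
      ultimately show ?thesis
        using i by (simp add: del_first sum_negf)
    qed
    ultimately show ?thesis
      by (simp add: kap_def sum_negf sum_subtractf)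
  qed
  moreover have "(\<Sum>t<p. C t) = (\<Sum>t<?j. C t) + (\<Sum>t\<in>{?j..<p}. C t)"
    using i by (subst sum.union_disjoint[symmetric]) (auto simp: ivl_disj_un intro: sum.cong)
  ultimately show ?thesis
    using sum.swap[of "\<lambda>s t. C s * f (swp t s w)" "{..<?j}" "{?j..<p}"]
    by (simp add: C_def[symmetric] sum_distrib_right distrib_right)
qed

lemma kap_of_alt:
  assumes "alt_below p (Suc j) f" "length w = p"
  shows "kap j f w = of_nat (Suc j) * f w"
  using altD(1)[OF assms, of _ j] by (simp add: kap_def sum_negf algebra_simps)

lemma del_of_sym:
  assumes "sym_above p j f" "length w = p" "j < p"
  shows "del p j f w = of_nat (p - j) * f w"
  using symD[OF assms(1,2), of j] assms by (simp add: del_def)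

lemma of_nat_eq_0_char:
  assumes "CHAR('k::field) = p"
  shows "of_nat p = (0::'k)" "0 < k \<Longrightarrow> k < p \<Longrightarrow> of_nat k \<noteq> (0::'k)"
  using assms by (auto simp: of_nat_eq_0_iff_char_dvd dest: dvd_imp_le)

text \<open>Orbits of length two cancel and fixed points are assumed to contribute 0; there is no
  division by 2, so this covers characteristic 2.\<close>

lemma sum_involution_zero:
  fixes f :: "'a \<Rightarrow> 'b::ab_group_add"
  assumes "finite S" "\<And>x. x \<in> S \<Longrightarrow> \<tau> x \<in> S" "\<And>x. x \<in> S \<Longrightarrow> \<tau> (\<tau> x) = x"
    "\<And>x. x \<in> S \<Longrightarrow> f (\<tau> x) = - f x" "\<And>x. x \<in> S \<Longrightarrow> \<tau> x = x \<Longrightarrow> f x = 0"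
  shows "sum f S = 0"
  using assms
proof (induction "card S" arbitrary: S rule: less_induct)
  case less
  show ?case
  proof (cases "S = {}")
    case False
    then obtain x where x: "x \<in> S" by blast
    let ?S = "S - {x, \<tau> x}"
    have "sum f ?S = 0"
    proof (rule less.hyps)
      show "card ?S < card S"
        using x less.prems(1) by (intro psubset_card_mono) auto
      show "\<tau> y \<in> ?S" if "y \<in> ?S" for y
        using that less.prems(2)[of y] less.prems(3)[of y] less.prems(3)[OF x] x by auto
    qed (use less.prems in auto)
    moreover have "sum f S = sum f ?S + sum f {x, \<tau> x}"
      using x less.prems(1,2) by (intro sum.subset_diff) auto
    moreover have "sum f {x, \<tau> x} = 0"
      using less.prems(4)[OF x] less.prems(5)[OF x] by (cases "\<tau> x = x") auto
    ultimately show ?thesis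
      by simp
  qed simp
qed

section \<open>Subfunctors of the tensor power; naturality of the Koszul differentials\<close>

lemma is_spf_subfunctor:
  fixes U :: "nat \<Rightarrow> (nat list \<Rightarrow> 'k::field) set"
  assumes "\<And>n. fun_vs.subspace (U n)" "\<And>n. U n \<subseteq> coords (words e n)"
    and cl: "\<And>m n \<mu> f. f \<in> U m \<Longrightarrow> coef (tensor_power e) m n \<mu> f \<in> U n"
  shows "is_spf e \<lparr>val = U, coef = coef (tensor_power e)\<rparr>"
proof -
  let ?T = "tensor_power e :: 'k pfun" and ?U = "\<lparr>val = U, coef = coef (tensor_power e)\<rparr>"
  have T: "is_spf e ?T"
    by (rule is_spf_tensor_power)
  have sub: "f \<in> val ?T n" if "f \<in> U n" for f n
    using assms(2) that by auto
  have fd: "fd_subspace (U n)" for n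
    by (rule fd_subspace_mono[OF assms(1,2) fd_subspace_coords[OF finite_words]])
  have lm: "linear_map (val ?T m) (val ?T n) (coef ?T m n \<mu>)" for m n \<mu>
    by (rule lin_functorD(2)[OF is_spf_lin_functor[OF T]])
  note TD = T[unfolded is_spf_def]
  note van = TD[THEN conjunct2, THEN conjunct2, THEN conjunct1, rule_format]
  note idn = TD[THEN conjunct2, THEN conjunct2, THEN conjunct2, THEN conjunct1, rule_format]
  note comp = TD[THEN conjunct2, THEN conjunct2, THEN conjunct2, THEN conjunct2, rule_format]
  have lmU: "linear_map (U m) (U n) (coef ?T m n \<mu>)" for m n \<mu>
    unfolding linear_map_def
    by (intro conjI ballI allI cl linear_map_add[OF lm] linear_map_scale[OF lm] sub)
  have eqs: "spf_map e ?U = spf_map e ?T" "val ?U = U" "coef ?U = coef ?T"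
    by (simp_all add: spf_map_def fun_eq_iff)
  show ?thesis
    unfolding is_spf_def eqs
  proof (intro conjI allI impI ballI)
    show "fd_subspace (U n)" "linear_map (U m) (U n) (coef ?T m n \<mu>)" for m n \<mu>
      by (rule fd, rule lmU)
    show "coef ?T m n \<mu> v = 0" if "\<mu> \<notin> monomials e m n" "v \<in> U m" for m n \<mu> v
      by (rule van[OF that(1) sub[OF that(2)]])
    show "spf_map e ?T n n (\<lambda>i j. if i = j then 1 else 0) v = v" if "v \<in> U n" for n v
      by (rule idn[OF sub[OF that]])
    show "coef ?T m n \<mu> (coef ?T l m \<nu> v) = (\<Sum>\<rho>\<in>monomials e l n.
      fscale (Poly_Mapping.lookup (matmul_monomial m \<rho>) (image_mset Inl \<mu> + image_mset Inr \<nu>))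
        (coef ?T l n \<rho> v))" if "v \<in> U l" for l m n \<mu> \<nu> v
      by (rule comp[OF sub[OF that]])
  qed
qed

text \<open>Place permutations commute with the functorial action, since a monomial ignores the
  order of its factors. The invariance of \<open>alt_below\<close> and \<open>sym_above\<close> and
  the naturality of \<open>kap\<close> and \<open>del\<close> come from this.\<close>

lemma coef_swp:
  assumes "length u = p" "a < p" "b < p"
  shows "coef (tensor_power p) m n \<mu> (\<lambda>w. f (swp a b w)) u =
    coef (tensor_power p) m n \<mu> f (swp a b u)"
proof -
  have "(\<Sum>w | w \<in> words p m \<and> mset (zip u w) = \<mu>. f (swp a b w)) =
    (\<Sum>w | w \<in> words p m \<and> mset (zip (swp a b u) w) = \<mu>. f w)"
  proof (rule sum.reindex_bij_witness[of _ "swp a b" "swp a b"])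
    fix w assume w: "w \<in> {w \<in> words p m. mset (zip u w) = \<mu>}"
    then have len: "length w = p"
      by (auto dest: length_words)
    then show "swp a b (swp a b w) = w"
      using assms by simp
    have "zip (swp a b u) (swp a b w) = swp a b (zip u w)"
      using assms len by (intro zip_swp) auto
    then show "swp a b w \<in> {w \<in> words p m. mset (zip (swp a b u) w) = \<mu>}"
      using assms w len by (simp add: swp_words_iff)
  next
    fix w assume w: "w \<in> {w \<in> words p m. mset (zip (swp a b u) w) = \<mu>}"
    then have len: "length w = p"
      by (auto dest: length_words)
    then show "swp a b (swp a b w) = w"
      using assms by simp
    have "zip (swp a b (swp a b u)) (swp a b w) = swp a b (zip (swp a b u) w)"
      using assms len by (intro zip_swp) auto
    then show "swp a b w \<in> {w \<in> words p m. mset (zip u w) = \<mu>}"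
      using assms w len by (simp add: swp_words_iff)
  qed simp
  then show ?thesis
    using assms by (simp add: tensor_power_coef swp_words_iff)
qed

lemma coef_cong:
  assumes "\<And>w. length w = p \<Longrightarrow> f w = g w"
  shows "coef (tensor_power p) m n \<mu> f = coef (tensor_power p) m n \<mu> g"
  using assms by (intro ext) (auto simp: tensor_power_coef length_words intro!: sum.cong)

lemma coef_uminus: "coef (tensor_power p) m n \<mu> (\<lambda>w. - f w) u = - coef (tensor_power p) m n \<mu> f u"
  by (simp add: tensor_power_coef sum_negf)

lemma coef_length:
  assumes "length u \<noteq> p"
  shows "coef (tensor_power p) m n \<mu> f u = 0"
  using assms by (auto simp: tensor_power_coef length_words)

lemma coef_alt_below:
  assumes f: "alt_below p j f" and j: "j \<le> p"
  shows "alt_below p j (coef (tensor_power p) m n \<mu> f)"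
  unfolding alt_below_def
proof (intro allI impI conjI)
  fix u :: "nat list" and a b assume u: "length u = p" and ab: "a < b" "b < j"
  have "coef (tensor_power p) m n \<mu> f (swp a b u) = coef (tensor_power p) m n \<mu> (\<lambda>w. f (swp a b w)) u"
    using u ab j by (simp add: coef_swp)
  also have "\<dots> = coef (tensor_power p) m n \<mu> (\<lambda>w. - f w) u"
    by (rule fun_cong[OF coef_cong]) (use altD(1)[OF f] ab in auto)
  finally show "coef (tensor_power p) m n \<mu> f (swp a b u) = - coef (tensor_power p) m n \<mu> f u"
    by (simp only: coef_uminus)
  assume eq: "u ! a = u ! b"
  have "(\<Sum>w | w \<in> words p m \<and> mset (zip u w) = \<mu>. f w) = 0"
  proof (rule sum_involution_zero[where \<tau> = "swp a b"])
    show "finite {w \<in> words p m. mset (zip u w) = \<mu>}" by simp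
    fix w assume w: "w \<in> {w \<in> words p m. mset (zip u w) = \<mu>}"
    then have len: "length w = p"
      by (auto dest: length_words)
    have "zip u (swp a b w) = swp a b (zip u w)"
      using zip_swp[of u w a b] swp_eq_self[of a u b] u len ab j eq by simp
    then show "swp a b w \<in> {w \<in> words p m. mset (zip u w) = \<mu>}"
      using w ab j len u by (simp add: swp_words_iff)
    show "swp a b (swp a b w) = w" "f (swp a b w) = - f w"
      using len ab j altD(1)[OF f len, of a b] by auto
    assume "swp a b w = w"
    then have "w ! a = w ! b"
      using nth_swp[of a w b a] len ab j by simp
    then show "f w = 0"
      using altD(2)[OF f len, of a b] ab by auto
  qed
  then show "coef (tensor_power p) m n \<mu> f u = 0"
    by (simp add: tensor_power_coef)
qed

lemma coef_sym_above:
  assumes f: "sym_above p i f"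
  shows "sym_above p i (coef (tensor_power p) m n \<mu> f)"
  unfolding sym_above_def
proof (intro allI impI)
  fix u :: "nat list" and a b assume u: "length u = p" and ab: "i \<le> a" "a < b" "b < p"
  have "coef (tensor_power p) m n \<mu> f (swp a b u) = coef (tensor_power p) m n \<mu> (\<lambda>w. f (swp a b w)) u"
    using u ab by (simp add: coef_swp)
  also have "\<dots> = coef (tensor_power p) m n \<mu> f u"
    by (rule fun_cong[OF coef_cong]) (use symD[OF f] ab in auto)
  finally show "coef (tensor_power p) m n \<mu> f (swp a b u) = coef (tensor_power p) m n \<mu> f u" .
qed

lemma coef_kap:
  assumes "j < p"
  shows "coef (tensor_power p) m n \<mu> (kap j f) = kap j (coef (tensor_power p) m n \<mu> f)"
proof
  fix u
  show "coef (tensor_power p) m n \<mu> (kap j f) u = kap j (coef (tensor_power p) m n \<mu> f) u"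
  proof (cases "length u = p")
    case True
    have "coef (tensor_power p) m n \<mu> (kap j f) u =
        coef (tensor_power p) m n \<mu> f u - (\<Sum>t<j. coef (tensor_power p) m n \<mu> (\<lambda>w. f (swp t j w)) u)"
      using sum.swap[of "\<lambda>t w. f (swp t j w)" "{w. w \<in> words p m \<and> mset (zip u w) = \<mu>}" "{..<j}"]
      by (simp add: tensor_power_coef kap_def sum_subtractf)
    then show ?thesis
      using True assms by (simp add: kap_def coef_swp)
  qed (simp add: kap_def coef_length)
qed

lemma coef_del:
  "coef (tensor_power p) m n \<mu> (del p j f) = del p j (coef (tensor_power p) m n \<mu> f)"
proof
  fix u
  show "coef (tensor_power p) m n \<mu> (del p j f) u = del p j (coef (tensor_power p) m n \<mu> f) u"
  proof (cases "length u = p")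
    case True
    have "coef (tensor_power p) m n \<mu> (del p j f) u =
        (\<Sum>s\<in>{j..<p}. coef (tensor_power p) m n \<mu> (\<lambda>w. f (swp j s w)) u)"
      using sum.swap[of "\<lambda>t w. f (swp j t w)" "{w. w \<in> words p m \<and> mset (zip u w) = \<mu>}" "{j..<p}"]
      by (simp add: tensor_power_coef del_def)
    then show ?thesis
      using True by (simp add: del_def coef_swp)
  qed (simp add: del_def coef_length)
qed

text \<open>The two bounds are kept apart because weighting leaves a position between them that is
  subject to no condition.\<close>

definition tens :: "nat \<Rightarrow> nat \<Rightarrow> nat \<Rightarrow> nat \<Rightarrow> (nat list \<Rightarrow> 'k::field) set"
  where "tens p j i n = {f \<in> coords (words p n). alt_below p j f \<and> sym_above p i f}"

text \<open>This is \<open>\<Lambda>\<^sup>j \<otimes> \<Gamma>\<^bsup>p-j\<^esup>\<close>, with \<open>\<Gamma>\<close> the divided power, inside the tensor power.\<close>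

definition ext_div :: "nat \<Rightarrow> nat \<Rightarrow> 'k::field pfun"
  where "ext_div p j = \<lparr>val = tens p j j, coef = coef (tensor_power p)\<rparr>"

lemma ext_div_simps [simp]:
  "val (ext_div p j) = tens p j j" "coef (ext_div p j) = coef (tensor_power p)"
  by (simp_all add: ext_div_def)

lemma tensD:
  assumes "f \<in> tens p j i n"
  shows "f \<in> coords (words p n)" "alt_below p j f" "sym_above p i f"
  using assms by (auto simp: tens_def)

lemma tens_mono: "f \<in> tens p j i n \<Longrightarrow> j' \<le> j \<Longrightarrow> i \<le> i' \<Longrightarrow> f \<in> tens p j' i' n"
  by (auto simp: tens_def intro: alt_mono sym_mono)

text \<open>A single position carries no symmetry condition, so \<open>\<Lambda>\<^sup>p\<close>
  sits inside the term with index \<open>p - 1\<close>. This inclusion joins the two halves of the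
  resolution.\<close>

lemma tens_p_mono: "f \<in> tens p p p n \<Longrightarrow> f \<in> tens p (p - 1) (p - 1) n"
  by (auto simp: tens_def sym_above_def intro: alt_mono)

lemma tens_subspace: "fun_vs.subspace (tens p j i n)"
  unfolding fun_vs.subspace_def
  by (auto simp: tens_def coords_def alt_below_def sym_above_def fscale_apply)

lemma coef_tens:
  assumes "f \<in> tens p j i m" "j \<le> p"
  shows "coef (tensor_power p) m n \<mu> f \<in> tens p j i n"
  using assms coef_alt_below coef_sym_above by (auto simp: tens_def coords_def tensor_power_coef)

lemma is_spf_ext_div:
  assumes "j \<le> p"
  shows "is_spf p (ext_div p j :: 'k::field pfun)"
  unfolding ext_div_def using assms
  by (intro is_spf_subfunctor tens_subspace coef_tens) (auto simp: tens_def)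

lemma coords_swp:
  assumes "f \<in> coords (words p n)" "w \<notin> words p n" "a < p" "b < p"
  shows "f (swp a b w) = 0"
  using assms swp_words_iff[of a p b w n] by (auto simp: coords_def)

lemma kap_coords:
  assumes "f \<in> coords (words p n)" "j < p"
  shows "kap j f \<in> coords (words p n)"
  using assms coords_swp[OF assms(1)] by (auto simp: coords_def kap_def)

lemma del_coords:
  assumes "f \<in> coords (words p n)" "j < p"
  shows "del p j f \<in> coords (words p n)"
  using assms coords_swp[OF assms(1)] by (auto simp: coords_def del_def)

lemma wt_coords: "f \<in> coords (words p n) \<Longrightarrow> wt c j f \<in> coords (words p n)"
  by (auto simp: coords_def wt_def)

lemma kap_tens: "f \<in> tens p j (Suc j) n \<Longrightarrow> j < p \<Longrightarrow> kap j f \<in> tens p (Suc j) (Suc j) n"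
  using kap_alt_sym kap_coords by (auto simp: tens_def)

lemma del_tens: "f \<in> tens p j (Suc j) n \<Longrightarrow> j < p \<Longrightarrow> del p j f \<in> tens p j j n"
  using del_alt_sym del_coords by (auto simp: tens_def)

lemma wt_tens: "f \<in> tens p j (Suc j) n \<Longrightarrow> j < p \<Longrightarrow> wt c j f \<in> tens p j (Suc j) n"
  using wt_alt_sym wt_coords by (auto simp: tens_def)

definition nt_of :: "('b, 'k::field) spf \<Rightarrow> (('b \<Rightarrow> 'k) \<Rightarrow> ('c \<Rightarrow> 'k)) \<Rightarrow> nat \<Rightarrow> ('b \<Rightarrow> 'k) \<Rightarrow> ('c \<Rightarrow> 'k)"
  where "nt_of F h = (\<lambda>n v. if v \<in> val F n then h v else 0)"

lemma nt_of_nat_trans: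
  assumes F: "lin_functor F"
    and "\<And>n v. v \<in> val F n \<Longrightarrow> h v \<in> val G n"
    and "\<And>x y. h (x + y) = h x + h y" "\<And>c x. h (fscale c x) = fscale c (h x)"
    and "\<And>m n \<mu> v. v \<in> val F m \<Longrightarrow> h (coef F m n \<mu> v) = coef G m n \<mu> (h v)"
  shows "nt_of F h \<in> nat_trans F G"
proof -
  have lin: "linear_map (val F n) (val G n) (nt_of F h n)" for n
    unfolding linear_map_def nt_of_def
  proof (intro conjI ballI allI)
    fix x assume x: "x \<in> val F n"
    then show "(if x \<in> val F n then h x else 0) \<in> val G n"
      using assms(2) by (simp only: if_True)
    show "(if fscale c x \<in> val F n then h (fscale c x) else 0) = fscale c (if x \<in> val F n then h x else 0)" for c
      by (simp only: x fun_vs.subspace_scale[OF lin_functorD(1)[OF F] x] if_True assms(4))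
    fix y assume y: "y \<in> val F n"
    show "(if x + y \<in> val F n then h (x + y) else 0) =
       (if x \<in> val F n then h x else 0) + (if y \<in> val F n then h y else 0)"
      by (simp only: x y fun_vs.subspace_add[OF lin_functorD(1)[OF F] x y] if_True assms(3))
  qed
  have "nt_of F h n (coef F m n \<mu> v) = coef G m n \<mu> (nt_of F h m v)" if v: "v \<in> val F m" for m n \<mu> v
    by (simp only: nt_of_def v linear_map_mem[OF lin_functorD(2)[OF F] v] if_True assms(5))
  moreover have "nt_of F h n v = 0" if "v \<notin> val F n" for n v
    using that by (simp only: nt_of_def if_False)
  ultimately show ?thesis
    unfolding nat_trans_def using lin by blast
qed

lemma kap_add: "kap j (f + g) = kap j f + kap j g"
  by (auto simp: fun_eq_iff kap_def sum.distrib)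

lemma kap_scale: "kap j (fscale c f) = fscale c (kap j f)"
  by (auto simp: fun_eq_iff kap_def fscale_apply sum_distrib_left algebra_simps)

lemma del_add: "del p j (f + g) = del p j f + del p j g"
  by (auto simp: fun_eq_iff del_def sum.distrib)

lemma del_scale: "del p j (fscale c f) = fscale c (del p j f)"
  by (auto simp: fun_eq_iff del_def fscale_apply sum_distrib_left)

lemma kap_tens': "f \<in> tens p j j n \<Longrightarrow> j < p \<Longrightarrow> kap j f \<in> tens p (Suc j) (Suc j) n"
  by (rule kap_tens[OF tens_mono]) auto

lemma del_tens': "f \<in> tens p (Suc j) (Suc j) n \<Longrightarrow> j < p \<Longrightarrow> del p j f \<in> tens p j j n"
  by (rule del_tens[OF tens_mono]) auto

lemma del_nat_trans:
  assumes "j < p"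
  shows "nt_of (ext_div p (Suc j)) (del p j) \<in> nat_trans (ext_div p (Suc j) :: 'k::field pfun) (ext_div p j)"
  using assms
  by (intro nt_of_nat_trans is_spf_lin_functor[OF is_spf_ext_div] del_add del_scale)
    (auto simp: coef_del intro: del_tens')


section \<open>Exactness of the two Koszul complexes\<close>

text \<open>On a word with at least two distinct letters the weights add up to 1; on a constant word
  they vanish because the multiplicity \<open>p\<close> of its letter is 0 in \<open>k\<close>.\<close>

definition min_weight :: "nat \<Rightarrow> nat multiset \<Rightarrow> 'k::field"
  where "min_weight x M = (if x = Min (set_mset M) then inverse (of_nat (count M x)) else 0)"

definition constant_word :: "'a list \<Rightarrow> bool"
  where "constant_word w \<longleftrightarrow> (\<forall>x\<in>set w. \<forall>y\<in>set w. x = y)"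

text \<open>Any letter of the word would serve; the smallest is a choice that depends on the content
  alone. A multiplicity strictly between 0 and \<open>p\<close> is invertible in
  \<open>k\<close>.\<close>

lemma sum_min_weight:
  assumes char: "CHAR('k::field) = p" and p: "p > 0" and w: "length w = p"
  shows "(\<Sum>t<p. min_weight (w ! t) (mset w)) = (if constant_word w then 0 else 1 :: 'k)"
proof -
  define x where "x = Min (set w)"
  have x: "x \<in> set w"
    using w p unfolding x_def by (intro Min_in) auto
  have "(\<Sum>t<p. min_weight (w ! t) (mset w)) =
      (\<Sum>t\<in>{t. t < p \<and> x = w ! t}. inverse (of_nat (count_list w x)) :: 'k)"
    by (intro sum.mono_neutral_cong_right) (auto simp: min_weight_def x_def count_mset)
  also have "\<dots> = of_nat (count_list w x) * inverse (of_nat (count_list w x))"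
  proof -
    have "card {t. t < p \<and> x = w ! t} = count_list w x"
      using w by (simp add: count_list_eq_length_filter length_filter_conv_card)
    then show ?thesis
      by (simp only: sum_constant)
  qed
  finally have eq: "(\<Sum>t<p. min_weight (w ! t) (mset w)) =
    of_nat (count_list w x) * inverse (of_nat (count_list w x) :: 'k)" .
  show ?thesis
  proof (cases "constant_word w")
    case True
    then have "filter (\<lambda>y. x = y) w = w"
      using x unfolding constant_word_def by (intro filter_True) auto
    then have "count_list w x = p"
      using w by (simp add: count_list_eq_length_filter)
    then show ?thesis
      using True eq of_nat_eq_0_char(1)[OF char] by simp
  next
    case False
    then obtain y where y: "y \<in> set w" "x \<noteq> y"
      using x unfolding constant_word_def by metis
    have "count_list w x < p"
      using length_filter_less[of y w "\<lambda>y. x = y"] y w by (simp add: count_list_eq_length_filter)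
    moreover have "count_list w x > 0"
      using x by (simp add: count_list_0_iff zero_less_iff_neq_zero)
    ultimately show ?thesis
      using eq of_nat_eq_0_char(2)[OF char, of "count_list w x"] False by simp
  qed
qed

lemma alt_constant_word:
  assumes "alt_below p j f" "length w = p" "2 \<le> j" "j \<le> p" "constant_word w"
  shows "f w = 0"
  using altD(2)[OF assms(1,2), of 0 1] assms by (auto simp: constant_word_def)

lemma coords_eqI:
  assumes "f \<in> coords (words p n)" "g \<in> coords (words p n)" "\<And>w. length w = p \<Longrightarrow> f w = g w"
  shows "f = g"
proof
  fix w show "f w = g w"
  proof (cases "length w = p")
    case False
    then have "w \<notin> words p n"
      by (auto dest: length_words)
    then show ?thesis
      using assms(1,2) by (simp add: coords_def)
  qed (rule assms(3))
qed

text \<open>In the homotopy formula the term through \<open>del p i f\<close> vanishes, so the other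
  one reproduces \<open>f\<close> wherever the weights add up to 1. The values on constant words
  have to be excluded separately: for \<open>i = 0\<close> nothing forces them to vanish on the
  kernel of \<open>del p 0\<close>.\<close>

lemma del_exact:
  fixes f :: "nat list \<Rightarrow> 'k::field"
  assumes char: "CHAR('k) = p" and i: "Suc i < p" and f: "f \<in> tens p (Suc i) (Suc i) n"
    and d: "\<And>w. length w = p \<Longrightarrow> del p i f w = 0"
    and const: "\<And>w. length w = p \<Longrightarrow> constant_word w \<Longrightarrow> f w = 0"
  obtains g where "g \<in> tens p (Suc i) (Suc (Suc i)) n" "f = del p (Suc i) (kap (Suc i) g)"
proof -
  let ?g = "wt min_weight (Suc i) f"
  have Q: "f \<in> tens p (Suc i) (Suc (Suc i)) n"
    using tens_mono[OF f] by simp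
  have g: "?g \<in> tens p (Suc i) (Suc (Suc i)) n"
    by (rule wt_tens[OF Q i])
  have "f = del p (Suc i) (kap (Suc i) ?g)"
  proof (rule coords_eqI[of _ p n])
    show "f \<in> coords (words p n)" "del p (Suc i) (kap (Suc i) ?g) \<in> coords (words p n)"
      using tensD(1)[OF f] tensD(1)[OF g] i by (auto intro!: del_coords kap_coords)
    fix w :: "nat list" assume w: "length w = p"
    have "wt min_weight i (del p i f) v = 0" if "length v = p" for v
      using d[OF that] by (simp add: wt_def)
    then have "kap i (wt min_weight i (del p i f)) w = 0"
      using w by (simp add: kap_def)
    then have "del p (Suc i) (kap (Suc i) ?g) w = (\<Sum>t<p. min_weight (w ! t) (mset w)) * f w"
      using del_kap_homotopy[OF tensD(2,3)[OF f] i w, of min_weight] by simp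
    also have "\<dots> = f w"
      using const[OF w] sum_min_weight[OF char _ w] i by auto
    finally show "f w = del p (Suc i) (kap (Suc i) ?g) w" ..
  qed
  then show ?thesis
    using g that by blast
qed

lemma kap_exact:
  fixes f :: "nat list \<Rightarrow> 'k::field"
  assumes char: "CHAR('k) = p" and i: "Suc i < p" and f: "f \<in> tens p (Suc i) (Suc i) n"
    and d: "\<And>w. length w = p \<Longrightarrow> kap (Suc i) f w = 0"
  obtains g where "g \<in> tens p i i n" "f = kap i g"
proof (cases i)
  case 0
  \<comment> \<open>\<open>f\<close> alternates in one position only, so it may be non-zero on
    constant words and the homotopy is of no use. Instead, the vanishing of \<open>kap 1 f\<close>
    says that \<open>f\<close> is symmetric in positions 0 and 1, hence in all.\<close>
  have 01: "f (swp 0 1 w) = f w" if "length w = p" for w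
    using d[OF that] 0 by (simp add: kap_def)
  have swap0: "f (swp 0 b w) = f w" if w: "length w = p" and b: "0 < b" "b < p" for w b
  proof (cases "b = 1")
    case False
    have "swp 0 b w = swp 1 b (swp 0 1 (swp 1 b w))"
      using False w b by (intro nth_equalityI) (auto simp: nth_swp)
    then show ?thesis
      using 01 symD[OF tensD(3)[OF f], of _ 1 b] 0 w b by simp
  qed (use 01 w in simp)
  have "sym_above p 0 f"
    unfolding sym_above_def
  proof (intro allI impI)
    fix w :: "nat list" and a b assume "length w = p" "0 \<le> a" "a < b" "b < p"
    then show "f (swp a b w) = f w"
      using swap0[of w b] symD[OF tensD(3)[OF f], of w a b] 0 by (cases "a = 0") auto
  qed
  then have "f \<in> tens p 0 0 n"
    using f by (auto simp: tens_def alt_below_def)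
  moreover have "f = kap 0 f"
    by (simp add: kap_def fun_eq_iff)
  ultimately show ?thesis
    using that[of f] 0 by blast
next
  case (Suc k)
  let ?h = "wt min_weight i f"
  have Q: "f \<in> tens p i (Suc i) n"
    using tens_mono[OF f] by simp
  have h: "?h \<in> tens p i (Suc i) n"
    using i by (intro wt_tens[OF Q]) simp
  have g: "del p i ?h \<in> tens p i i n"
    using i by (intro del_tens[OF h]) simp
  have "f = kap i (del p i ?h)"
  proof (rule coords_eqI[of _ p n])
    show "f \<in> coords (words p n)" "kap i (del p i ?h) \<in> coords (words p n)"
      using tensD(1)[OF f] tensD(1)[OF g] i by (auto intro!: kap_coords)
    fix w :: "nat list" assume w: "length w = p"
    have "wt min_weight (Suc i) (kap (Suc i) f) v = 0" if "length v = p" for v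
      using d[OF that] by (simp add: wt_def)
    then have "del p (Suc i) (wt min_weight (Suc i) (kap (Suc i) f)) w = 0"
      using w by (simp add: del_def)
    then have "kap i (del p i ?h) w = (\<Sum>t<p. min_weight (w ! t) (mset w)) * f w"
      using del_kap_homotopy'[OF tensD(2,3)[OF f] i w, of min_weight] by simp
    also have "\<dots> = f w"
      using alt_constant_word[OF tensD(2)[OF f] w] sum_min_weight[OF char _ w] i Suc by auto
    finally show "f w = kap i (del p i ?h) w" ..
  qed
  then show ?thesis
    using g that by blast
qed

section \<open>Antisymmetrisation\<close>

definition asymm :: "nat \<Rightarrow> (nat list \<Rightarrow> 'k::field) \<Rightarrow> nat list \<Rightarrow> 'k"
  where "asymm j f w = (\<Sum>\<sigma> | \<sigma> permutes {..<j}. of_int (sign \<sigma>) * f (permute_list \<sigma> w))"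

lemma permute_list_transpose:
  assumes "a < length w" "b < length w"
  shows "permute_list (transpose a b) w = swp a b w"
  using assms by (intro nth_equalityI) (auto simp: permute_list_def nth_swp transpose_def)

lemma permutes_lessThan_mono:
  assumes "\<sigma> permutes {..<j}" "j \<le> (p::nat)"
  shows "\<sigma> permutes {..<p}"
  using assms by (intro permutes_subset[OF assms(1)]) auto

lemma asymm_0: "asymm 0 f w = f w"
  by (simp add: asymm_def)

text \<open>Coset decomposition of the symmetric group on \<open>j + 1\<close> positions: the
  identity and the transpositions of \<open>j\<close> with a smaller position represent the
  cosets.\<close>

lemma asymm_Suc:
  assumes w: "length w = p" and j: "j < p"
  shows "asymm (Suc j) f w = kap j (asymm j f) w"
proof -
  have eq: "of_int (sign (transpose j b \<circ> q)) * f (permute_list (transpose j b \<circ> q) w) =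
      (if b = j then 1 else -1) * (of_int (sign q) * f (permute_list q (swp j b w)))"
    if "b \<in> insert j {..<j}" "q permutes {..<j}" for b q
  proof -
    have q: "q permutes {..<length w}"
      using permutes_lessThan_mono[OF that(2), of p] w j by simp
    have "sign (transpose j b \<circ> q) = sign (transpose j b) * sign q"
      using permutation_permutes[of q] that(2) permutation_swap_id by (intro sign_compose) (auto intro: permutation_permutes[THEN iffD2])
    then show ?thesis
      using that(1) j w permute_list_compose[OF q, of "transpose j b" ]
      by (auto simp: sign_swap_id permute_list_transpose)
  qed
  have "asymm (Suc j) f w =
      (\<Sum>b\<in>insert j {..<j}. \<Sum>q | q permutes {..<j}.
        of_int (sign (transpose j b \<circ> q)) * f (permute_list (transpose j b \<circ> q) w))"
    unfolding asymm_def lessThan_Suc by (subst sum_over_permutations_insert) auto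
  also have "\<dots> = (\<Sum>b\<in>insert j {..<j}. (if b = j then 1 else -1) * asymm j f (swp j b w))"
    unfolding asymm_def sum_distrib_left using eq by (intro sum.cong refl) auto
  also have "\<dots> = asymm j f w - (\<Sum>b<j. asymm j f (swp b j w))"
    by (simp add: sum_negf swp_comm[of j])
  finally show ?thesis
    by (simp add: kap_def)
qed

lemma kap_cong:
  assumes "\<And>w. length w = p \<Longrightarrow> f w = g w" "length w = p"
  shows "kap j f w = kap j g w"
  using assms by (simp add: kap_def)

lemma alt_below_cong:
  assumes "alt_below p j f" "\<And>w. length w = p \<Longrightarrow> f w = g w"
  shows "alt_below p j g"
  using assms unfolding alt_below_def by (metis length_swp)

lemma asymm_alt:
  assumes "j \<le> p"
  shows "alt_below p j (asymm j f)"
  using assms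
proof (induction j)
  case (Suc j)
  then have "alt_below p (Suc j) (kap j (asymm j f))"
    by (intro kap_alt) auto
  then show ?case
    by (rule alt_below_cong) (rule asymm_Suc[symmetric], use Suc.prems in auto)
qed (simp add: alt_below_def)

lemma asymm_coords:
  assumes f: "f \<in> coords (words p n)" and j: "j \<le> p"
  shows "asymm j f \<in> coords (words p n)"
  unfolding coords_def
proof (intro CollectI allI impI)
  fix w assume w: "w \<notin> words p n"
  have "permute_list \<sigma> w \<notin> words p n" if "\<sigma> permutes {..<j}" for \<sigma>
  proof (cases "length w = p")
    case True
    then have "set (permute_list \<sigma> w) = set w"
      using permutes_lessThan_mono[OF that j] by (intro set_permute_list) simp
    then show ?thesis
      using w by (simp add: words_def)
  qed (auto dest: length_words)
  then show "asymm j f w = 0"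
    using f by (simp add: asymm_def coords_def)
qed

lemma asymm_of_alt:
  assumes f: "alt_below p j f" and j: "j \<le> p" and w: "length w = p"
  shows "asymm j f w = of_nat (fact j) * f w"
  using f j w
proof (induction j arbitrary: w)
  case (Suc j)
  have IH: "asymm j f v = of_nat (fact j) * f v" if "length v = p" for v
    using Suc alt_mono[OF Suc.prems(1), of j] that by auto
  have "asymm (Suc j) f w = kap j (\<lambda>v. of_nat (fact j) * f v) w"
    using Suc.prems IH kap_cong[of p "asymm j f"] by (simp add: asymm_Suc[of w p])
  also have "\<dots> = of_nat (fact j) * kap j f w"
    by (simp add: kap_def right_diff_distrib sum_distrib_left)
  finally show ?case
    using kap_of_alt[OF Suc.prems(1,3)] by (simp add: algebra_simps)
qed (simp add: asymm_0)

lemma asymm_swp_above: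
  assumes "length w = p" "j \<le> a" "j \<le> b" "a < p" "b < p"
  shows "asymm j f (swp a b w) = asymm j (\<lambda>v. f (swp a b v)) w"
  unfolding asymm_def
proof (intro sum.cong refl)
  fix \<sigma> assume "\<sigma> \<in> {\<sigma>. \<sigma> permutes {..<j}}"
  then have \<sigma>: "\<sigma> permutes {..<j}" by simp
  have fixd: "\<sigma> i = i" if "j \<le> i" for i
    using permutes_not_in[OF \<sigma>] that by auto
  have ne: "\<sigma> i \<noteq> a \<and> \<sigma> i \<noteq> b \<and> \<sigma> i < p" if "i < j" for i
    using permutes_in_image[OF \<sigma>, of i] that assms by auto
  have "permute_list \<sigma> (swp a b w) = swp a b (permute_list \<sigma> w)"
  proof (rule nth_equalityI)
    fix i assume "i < length (permute_list \<sigma> (swp a b w))"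
    then show "permute_list \<sigma> (swp a b w) ! i = swp a b (permute_list \<sigma> w) ! i"
      using assms fixd[of i] ne[of i] fixd[of a] fixd[of b]
      by (cases "i < j") (auto simp: permute_list_def nth_swp)
  qed simp
  then show "of_int (sign \<sigma>) * f (permute_list \<sigma> (swp a b w)) =
      of_int (sign \<sigma>) * f (swp a b (permute_list \<sigma> w))"
    by simp
qed

lemma asymm_sym:
  assumes "sym_above p j f"
  shows "sym_above p j (asymm j f)"
  unfolding sym_above_def
proof (intro allI impI)
  fix w :: "nat list" and a b assume w: "length w = p" and ab: "j \<le> a" "a < b" "b < p"
  have "asymm j f (swp a b w) = asymm j (\<lambda>v. f (swp a b v)) w"
    using w ab by (intro asymm_swp_above) auto
  also have "\<dots> = asymm j f w"
    using symD[OF assms, of _ a b] w ab by (simp add: asymm_def)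
  finally show "asymm j f (swp a b w) = asymm j f w" .
qed

section \<open>The matrix of the antisymmetriser and straightening\<close>

lemma asymm_expand:
  assumes "f \<in> coords (words p n)"
  shows "asymm j f v = (\<Sum>w\<in>words p n. f w * asymm j (unit_vec w) v)"
proof -
  have "f u = (\<Sum>w\<in>words p n. f w * unit_vec w u)" for u
    using fun_cong[OF coords_expand[OF finite_words assms], of u] unfolding sum_fun_apply fscale_apply .
  then have "asymm j f v = (\<Sum>\<sigma> | \<sigma> permutes {..<j}. of_int (sign \<sigma>) *
      (\<Sum>w\<in>words p n. f w * unit_vec w (permute_list \<sigma> v)))"
    unfolding asymm_def by (intro sum.cong refl arg_cong2[of _ _ _ _ "(*)"])
  also have "\<dots> = (\<Sum>\<sigma> | \<sigma> permutes {..<j}. \<Sum>w\<in>words p n.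
      of_int (sign \<sigma>) * (f w * unit_vec w (permute_list \<sigma> v)))"
    by (simp add: sum_distrib_left)
  also have "\<dots> = (\<Sum>w\<in>words p n. \<Sum>\<sigma> | \<sigma> permutes {..<j}.
      of_int (sign \<sigma>) * (f w * unit_vec w (permute_list \<sigma> v)))"
    by (rule sum.swap)
  also have "\<dots> = (\<Sum>w\<in>words p n. f w * asymm j (unit_vec w) v)"
    by (simp add: asymm_def sum_distrib_left algebra_simps)
  finally show ?thesis .
qed

text \<open>Inverting a permutation keeps its sign and interchanges the two words. Thus properties
  of the argument of \<open>asymm\<close> become properties of the indexing basis word.\<close>

lemma asymm_unit_sym:
  assumes "length v = p" "length w = p" "j \<le> p"
  shows "asymm j (unit_vec w) v = (asymm j (unit_vec v) w :: 'k::field)"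
proof -
  have "asymm j (unit_vec w) v =
      (\<Sum>\<sigma> | \<sigma> permutes {..<j}. of_int (sign (inv \<sigma>)) * unit_vec w (permute_list (inv \<sigma>) v) :: 'k)"
    unfolding asymm_def by (rule sum_permutations_inverse)
  also have "\<dots> = asymm j (unit_vec v) w"
    unfolding asymm_def
  proof (intro sum.cong refl)
    fix \<sigma> assume "\<sigma> \<in> {\<sigma>. \<sigma> permutes {..<j}}"
    then have \<sigma>: "\<sigma> permutes {..<j}" by simp
    have \<sigma>p: "\<sigma> permutes {..<p}" "inv \<sigma> permutes {..<p}"
      using permutes_lessThan_mono[OF \<sigma> assms(3)] by (auto intro: permutes_inv)
    have "sign (inv \<sigma>) = sign \<sigma>"
      using \<sigma> by (intro sign_inverse) (auto intro: permutation_permutes[THEN iffD2])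
    moreover have "permute_list \<sigma> (permute_list (inv \<sigma>) v) = v"
      using permute_list_compose[of \<sigma> v "inv \<sigma>"] \<sigma>p assms permutes_inv_o(2)[OF \<sigma>p(1)] by simp
    moreover have "permute_list (inv \<sigma>) (permute_list \<sigma> w) = w"
      using permute_list_compose[of "inv \<sigma>" w \<sigma>] \<sigma>p assms permutes_inv_o(1)[OF \<sigma>p(1)] by simp
    ultimately have "sign (inv \<sigma>) = sign \<sigma>" "permute_list (inv \<sigma>) v = w \<longleftrightarrow> permute_list \<sigma> w = v"
      by (blast, metis)
    then show "of_int (sign (inv \<sigma>)) * unit_vec w (permute_list (inv \<sigma>) v) =
        of_int (sign \<sigma>) * (unit_vec v (permute_list \<sigma> w) :: 'k)"
      by (simp add: unit_vec_def)
  qed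
  finally show ?thesis .
qed

lemma unit_vec_coords: "w \<in> A \<Longrightarrow> unit_vec w \<in> coords A"
  by (auto simp: unit_vec_def coords_def)

lemma asymm_unit_length:
  assumes "length w = p" "length v \<noteq> p"
  shows "asymm j (unit_vec w) v = 0"
proof -
  have "permute_list \<sigma> v \<noteq> w" for \<sigma>
    using assms length_permute_list by metis
  then show ?thesis
    by (simp add: asymm_def unit_vec_def)
qed

lemma asymm_unit_swp:
  assumes w: "length w = p" and j: "j \<le> p" and ab: "a < j" "b < j" "a \<noteq> b"
  shows "asymm j (unit_vec (swp a b w)) = - asymm j (unit_vec w :: nat list \<Rightarrow> 'k::field)"
proof
  fix v
  show "asymm j (unit_vec (swp a b w)) v = (- asymm j (unit_vec w :: nat list \<Rightarrow> 'k)) v"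
  proof (cases "length v = p")
    case True
    then have "asymm j (unit_vec (swp a b w)) v = (asymm j (unit_vec v) (swp a b w) :: 'k)"
      using w j by (intro asymm_unit_sym) auto
    also have "\<dots> = - asymm j (unit_vec v) w"
      by (rule altD(1)[OF asymm_alt[OF j] w ab])
    also have "asymm j (unit_vec v) w = (asymm j (unit_vec w) v :: 'k)"
      using True w j by (intro asymm_unit_sym) auto
    finally show ?thesis
      by simp
  qed (use w in \<open>simp add: asymm_unit_length\<close>)
qed

lemma asymm_unit_repeat:
  assumes w: "length w = p" and j: "j \<le> p" and ab: "a < j" "b < j" "a \<noteq> b" "w ! a = w ! b"
  shows "asymm j (unit_vec w) = (0 :: nat list \<Rightarrow> 'k::field)"
proof
  fix v
  show "asymm j (unit_vec w) v = (0 :: nat list \<Rightarrow> 'k) v"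
  proof (cases "length v = p")
    case True
    then have "asymm j (unit_vec w) v = (asymm j (unit_vec v) w :: 'k)"
      using w j by (intro asymm_unit_sym) auto
    then show ?thesis
      using altD(2)[OF asymm_alt[OF j] w ab(1-3), of "unit_vec v"] ab(4) by simp
  qed (use w in \<open>simp add: asymm_unit_length\<close>)
qed

lemma asymm_unit_swp_above:
  assumes w: "length w = p" and ab: "j \<le> a" "j \<le> b" "a < p" "b < p"
  shows "asymm j (unit_vec (swp a b w)) = (\<lambda>v. asymm j (unit_vec w) (swp a b v) :: 'k::field)"
proof
  fix v
  show "asymm j (unit_vec (swp a b w)) v = (asymm j (unit_vec w) (swp a b v) :: 'k)"
  proof (cases "length v = p")
    case True
    have eq: "u = swp a b w \<longleftrightarrow> swp a b u = w" if "length u = p" for u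
      using that w ab swp_swp[of a u b] swp_swp[of a w b] by auto
    have "asymm j (unit_vec w) (swp a b v) = (asymm j (\<lambda>u. unit_vec w (swp a b u)) v :: 'k)"
      using True ab by (intro asymm_swp_above)
    also have "\<dots> = asymm j (unit_vec (swp a b w)) v"
      unfolding asymm_def using True eq by (intro sum.cong refl) (simp add: unit_vec_def)
    finally show ?thesis ..
  qed (use w in \<open>simp add: asymm_unit_length\<close>)
qed

lemma asymm_unit_permute:
  assumes \<sigma>: "\<sigma> permutes {..<j}" and j: "j \<le> p" and w: "length w = p"
  shows "asymm j (unit_vec (permute_list \<sigma> w)) = (asymm j (unit_vec w) :: nat list \<Rightarrow> 'k::field) \<or>
    asymm j (unit_vec (permute_list \<sigma> w)) = - (asymm j (unit_vec w) :: nat list \<Rightarrow> 'k::field)"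
  using \<sigma> finite_lessThan w
proof (induction \<sigma> arbitrary: w rule: permutes_induct)
  case id
  show ?case by (simp add: id_def)
next
  case (swap a b q)
  have eq: "permute_list (transpose a b \<circ> q) w = permute_list q (swp a b w)"
    using permute_list_compose[of q w "transpose a b"] permutes_lessThan_mono[OF swap.hyps(4) j]
      swap.hyps(1,2) swap.prems j by (simp add: permute_list_transpose)
  have neg: "asymm j (unit_vec (swp a b w)) = - (asymm j (unit_vec w) :: nat list \<Rightarrow> 'k)"
    using swap.hyps by (intro asymm_unit_swp[OF swap.prems j]) auto
  have "length (swp a b w) = p"
    using swap.prems by simp
  from swap.IH[OF this] show ?case
    unfolding eq neg minus_minus by blast
qed

text \<open>The basis of \<open>j\<close> exterior factors followed by \<open>p - j\<close> free
  tensor factors; for a hook these are the \<open>ext_words\<close>.\<close>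

definition incr_words :: "nat \<Rightarrow> nat \<Rightarrow> nat \<Rightarrow> nat list set"
  where "incr_words p j n = {w \<in> words p n. sorted_wrt (<) (take j w)}"

text \<open>A repeated letter among the first \<open>j\<close> gives 0; otherwise sorting these
  letters changes the antisymmetrisation at most by a sign.\<close>

lemma asymm_straighten:
  assumes w: "w \<in> words p n" and j: "j \<le> p"
  obtains g :: "nat list \<Rightarrow> 'k::field" where "g \<in> coords (incr_words p j n)" "asymm j (unit_vec w) = asymm j g"
proof (cases "distinct (take j w)")
  case False
  then obtain a b where "a < j" "b < j" "a \<noteq> b" "w ! a = w ! b"
    by (auto simp: distinct_conv_nth)
  then have "asymm j (unit_vec w) = (0 :: nat list \<Rightarrow> 'k)"
    by (rule asymm_unit_repeat[OF length_words[OF w] j])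
  moreover have "asymm j (0 :: nat list \<Rightarrow> 'k) = 0"
    by (simp add: asymm_def fun_eq_iff)
  moreover have "(0 :: nat list \<Rightarrow> 'k) \<in> coords (incr_words p j n)"
    by (simp add: coords_def)
  ultimately show ?thesis
    by (intro that[of 0]) (simp_all only:)
next
  case True
  have len: "length w = p"
    using w by (rule length_words)
  have "mset (sort (take j w)) = mset (take j w)"
    by simp
  then obtain \<sigma> where "\<sigma> permutes {..<length (take j w)}" and perm: "permute_list \<sigma> (take j w) = sort (take j w)"
    by (rule mset_eq_permutation)
  then have \<sigma>: "\<sigma> permutes {..<j}"
    using len j by simp
  have take: "take j (permute_list \<sigma> w) = sort (take j w)"
  proof (rule nth_equalityI)
    fix i assume "i < length (take j (permute_list \<sigma> w))"
    then have i: "i < j"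
      by simp
    then have "\<sigma> i < j"
      using permutes_in_image[OF \<sigma>, of i] by simp
    then have "take j (permute_list \<sigma> w) ! i = permute_list \<sigma> (take j w) ! i"
      using i len j by (simp add: permute_list_def)
    then show "take j (permute_list \<sigma> w) ! i = sort (take j w) ! i"
      by (simp only: perm)
  qed simp
  have "sorted_wrt (<) (sort (take j w))"
    using True by (simp add: strict_sorted_iff)
  moreover have "set (permute_list \<sigma> w) = set w"
    using permutes_lessThan_mono[OF \<sigma> j] len by (intro set_permute_list) simp
  ultimately have mem: "permute_list \<sigma> w \<in> incr_words p j n"
    using w take by (simp add: incr_words_def words_def)
  then have c: "unit_vec (permute_list \<sigma> w) \<in> coords (incr_words p j n)"
    "fscale (-1) (unit_vec (permute_list \<sigma> w)) \<in> (coords (incr_words p j n) :: (nat list \<Rightarrow> 'k) set)"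
    by (rule unit_vec_coords, intro fun_vs.subspace_scale[OF coords_subspace] unit_vec_coords)
  have m: "asymm j (fscale (-1) (unit_vec (permute_list \<sigma> w))) = - (asymm j (unit_vec (permute_list \<sigma> w)) :: nat list \<Rightarrow> 'k)"
    by (auto simp: asymm_def fun_eq_iff fscale_apply sum_negf)
  show ?thesis
    using asymm_unit_permute[OF \<sigma> j len]
  proof
    assume "asymm j (unit_vec (permute_list \<sigma> w)) = (asymm j (unit_vec w) :: nat list \<Rightarrow> 'k)"
    then show ?thesis
      by (intro that[OF c(1)]) (rule sym)
  next
    assume "asymm j (unit_vec (permute_list \<sigma> w)) = - (asymm j (unit_vec w) :: nat list \<Rightarrow> 'k)"
    then show ?thesis
      by (intro that[OF c(2)]) (simp only: m minus_minus)
  qed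
qed

text \<open>This replaces the exterior power in the definition of the Schur functor by the whole
  tensor power.\<close>

lemma asymm_image:
  assumes j: "j \<le> p"
  shows "asymm j ` coords (incr_words p j n) = (asymm j ` coords (words p n) :: (nat list \<Rightarrow> 'k::field) set)"
proof
  have "coords (incr_words p j n) \<subseteq> coords (words p n)"
    by (auto simp: coords_def incr_words_def)
  then show "asymm j ` coords (incr_words p j n) \<subseteq> (asymm j ` coords (words p n) :: (nat list \<Rightarrow> 'k) set)"
    by blast
  show "asymm j ` coords (words p n) \<subseteq> (asymm j ` coords (incr_words p j n) :: (nat list \<Rightarrow> 'k) set)"
  proof
    fix h :: "nat list \<Rightarrow> 'k" assume "h \<in> asymm j ` coords (words p n)"
    then obtain f :: "nat list \<Rightarrow> 'k" where f: "f \<in> coords (words p n)" "h = asymm j f" by blast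
    have "\<forall>w\<in>words p n. \<exists>g :: nat list \<Rightarrow> 'k. g \<in> coords (incr_words p j n) \<and> asymm j (unit_vec w) = asymm j g"
      using asymm_straighten[OF _ j] by blast
    from bchoice[OF this] obtain g :: "nat list \<Rightarrow> nat list \<Rightarrow> 'k" where
      g: "\<And>w. w \<in> words p n \<Longrightarrow> g w \<in> coords (incr_words p j n)"
        "\<And>w. w \<in> words p n \<Longrightarrow> asymm j (unit_vec w) = asymm j (g w)"
      by blast
    let ?G = "\<lambda>u. \<Sum>w\<in>words p n. f w * g w u"
    have G: "?G \<in> coords (incr_words p j n)"
      using g(1) by (simp add: coords_def)
    have "asymm j f v = asymm j ?G v" for v
    proof -
      have "asymm j f v = (\<Sum>w\<in>words p n. f w * asymm j (g w) v)"
        using asymm_expand[OF f(1), of j v] g(2) by simp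
      also have "\<dots> = (\<Sum>w\<in>words p n. \<Sum>\<sigma> | \<sigma> permutes {..<j}. of_int (sign \<sigma>) * (f w * g w (permute_list \<sigma> v)))"
        by (simp add: asymm_def sum_distrib_left algebra_simps)
      also have "\<dots> = asymm j ?G v"
        unfolding asymm_def sum_distrib_left by (rule sum.swap)
      finally show ?thesis .
    qed
    then have "h = asymm j ?G"
      unfolding f(2) by (rule ext)
    then show "h \<in> asymm j ` coords (incr_words p j n)"
      using G by (rule image_eqI)
  qed
qed

lemma sum_swp:
  assumes "a < p" "b < p"
  shows "(\<Sum>w\<in>words p n. F (swp a b w)) = (\<Sum>w\<in>words p n. F w)"
  using assms
  by (intro sum.reindex_bij_witness[of _ "swp a b" "swp a b"]) (auto simp: swp_words_iff dest: length_words)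

text \<open>By \<open>asymm_unit_sym\<close> the matrix is symmetric.\<close>

lemma asymm_adjoint:
  assumes j: "j \<le> p" and f: "f \<in> coords (words p n)" and g: "g \<in> coords (words p n)"
  shows "(\<Sum>w\<in>words p n. asymm j f w * g w) = (\<Sum>w\<in>words p n. f w * asymm j g w :: 'k::field)"
proof -
  have "(\<Sum>w\<in>words p n. asymm j f w * g w) =
      (\<Sum>w\<in>words p n. \<Sum>v\<in>words p n. f v * asymm j (unit_vec v) w * g w)"
    unfolding asymm_expand[OF f] by (simp add: sum_distrib_right)
  also have "\<dots> = (\<Sum>v\<in>words p n. \<Sum>w\<in>words p n. f v * asymm j (unit_vec v) w * g w)"
    by (rule sum.swap)
  also have "\<dots> = (\<Sum>v\<in>words p n. \<Sum>w\<in>words p n. f v * (g w * asymm j (unit_vec w) v))"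
  proof (intro sum.cong refl)
    fix v w assume "v \<in> words p n" "w \<in> words p n"
    then have "asymm j (unit_vec v) w = (asymm j (unit_vec w) v :: 'k)"
      using j by (intro asymm_unit_sym[of _ p]) (auto dest: length_words)
    then show "f v * asymm j (unit_vec v) w * g w = f v * (g w * asymm j (unit_vec w) v)"
      by simp
  qed
  also have "\<dots> = (\<Sum>v\<in>words p n. f v * asymm j g v)"
    unfolding asymm_expand[OF g] by (simp add: sum_distrib_left)
  finally show ?thesis .
qed

section \<open>Hooks\<close>

text \<open>The first column of the hook \<open>(m + 1, 1\<^bsup>p-m-1\<^esup>)\<close> consists of the boxes \<open>0\<close> and \<open>m + 1, \<dots>, p - 1\<close> of
  the row reading; \<open>rho m\<close> is the column reading followed by sorting of the columns, and \<open>qop p m\<close>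
  below is the map that it induces from the tensor power to \<open>S\<^bsup>p-m\<^esup> \<otimes> I\<^bsup>\<otimes>m\<^esup>\<close>.\<close>

definition rho :: "nat \<Rightarrow> nat list \<Rightarrow> nat list"
  where "rho m w = sort (w ! 0 # drop (Suc m) w) @ take m (tl w)"

text \<open>The reindexing of positions that turns the row reading of a hook into its column reading.\<close>

definition hook_perm :: "nat \<Rightarrow> nat \<Rightarrow> nat \<Rightarrow> nat"
  where "hook_perm p m i =
    (if i = 0 then 0 else if i < p - m then m + i else if i < p then Suc (i - (p - m)) else i)"

lemma hook_perm_permutes:
  assumes "m < p"
  shows "hook_perm p m permutes {..<p}"
proof (rule bij_imp_permutes)
  have "inj_on (hook_perm p m) {..<p}"
    using assms by (auto simp: inj_on_def hook_perm_def split: if_splits)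
  moreover have "hook_perm p m ` {..<p} \<subseteq> {..<p}"
    using assms by (auto simp: hook_perm_def)
  ultimately show "bij_betw (hook_perm p m) {..<p} {..<p}"
    by (simp add: bij_betw_def endo_inj_surj)
qed (use assms in \<open>auto simp: hook_perm_def\<close>)

lemma permute_hook_perm:
  assumes "m < p" "length w = p"
  shows "permute_list (hook_perm p m) w = w ! 0 # drop (Suc m) w @ take m (tl w)"
proof (rule nth_equalityI)
  show "length (permute_list (hook_perm p m) w) = length (w ! 0 # drop (Suc m) w @ take m (tl w))"
    using assms by simp
  fix i assume "i < length (permute_list (hook_perm p m) w)"
  then show "permute_list (hook_perm p m) w ! i = (w ! 0 # drop (Suc m) w @ take m (tl w)) ! i"
    using assms by (cases i) (auto simp: permute_list_def hook_perm_def nth_append nth_tl)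
qed

section \<open>Boxes of a hook and its column reading\<close>

lemma foldr_max_replicate: "foldr max (replicate k (1::nat)) 0 \<le> 1"
  by (induction k) auto

lemma foldr_max_hook: "foldr max (hook p m) 0 = Suc m"
  using foldr_max_replicate[of "p - m - 1"] by (simp add: hook_def max_def)

lemma sum_list_hook:
  assumes "m < p"
  shows "sum_list (hook p m) = p"
  using assms by (simp add: hook_def sum_list_replicate)

lemma length_hook:
  assumes "m < p"
  shows "length (hook p m) = p - m"
  using assms by (simp add: hook_def)

lemma conjugate_hook:
  assumes "m < p"
  shows "conjugate_partition (hook p m) = (p - m) # replicate m 1"
proof (rule nth_equalityI)
  fix i assume "i < length (conjugate_partition (hook p m))"
  then have "i < Suc m"
    by (simp add: conjugate_partition_def foldr_max_hook)
  then show "conjugate_partition (hook p m) ! i = ((p - m) # replicate m 1) ! i"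
    using assms unfolding conjugate_partition_def foldr_max_hook
    by (cases i) (auto simp: hook_def filter_replicate simp del: upt_Suc)
qed (simp add: conjugate_partition_def foldr_max_hook)

lemma hook_nth:
  assumes "m < p" "r < p - m"
  shows "hook p m ! r = (if r = 0 then Suc m else 1)"
  using assms by (cases r) (auto simp: hook_def)

lemma row_boxes_hook:
  assumes "m < p"
  shows "row_boxes (hook p m) = map (Pair 0) [0..<Suc m] @ map (\<lambda>r. (r, 0)) [1..<p - m]"
proof -
  have "[0..<p - m] = 0 # [1..<p - m]"
    using assms by (simp add: upt_conv_Cons)
  then have "row_boxes (hook p m) = concat (map (\<lambda>r. map (Pair r) [0..<hook p m ! r]) (0 # [1..<p - m]))"
    unfolding row_boxes_def length_hook[OF assms] by (simp only:)
  also have "\<dots> = map (Pair 0) [0..<Suc m] @ concat (map (\<lambda>r. map (Pair r) [0..<hook p m ! r]) [1..<p - m])"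
    using assms by (simp add: hook_nth del: upt_Suc)
  also have "map (\<lambda>r. map (Pair r) [0..<hook p m ! r]) [1..<p - m] = map (\<lambda>r. [(r, 0)]) [1..<p - m]"
    using assms by (intro map_cong refl) (simp add: hook_nth)
  finally show ?thesis
    by (simp del: upt_Suc)
qed

lemma col_boxes_hook:
  assumes "m < p"
  shows "col_boxes (hook p m) = map (\<lambda>r. (r, 0)) [0..<p - m] @ map (Pair 0) [1..<Suc m]"
proof -
  define g where "g c = concat (map (\<lambda>r. if c < hook p m ! r then [(r, c)] else []) [0..<p - m])" for c
  have "g 0 = concat (map (\<lambda>r. [(r, 0)]) [0..<p - m])"
    unfolding g_def using assms by (intro arg_cong[of _ _ concat] map_cong refl) (simp add: hook_nth)
  then have g0: "g 0 = map (\<lambda>r. (r, 0)) [0..<p - m]"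
    by simp
  have gS: "g c = [(0, c)]" if "c \<in> set [1..<Suc m]" for c
  proof -
    have "[0..<p - m] = 0 # [1..<p - m]"
      using assms by (simp add: upt_conv_Cons)
    moreover have "map (\<lambda>r. if c < hook p m ! r then [(r, c)] else []) [1..<p - m] = map (\<lambda>r. []) [1..<p - m]"
      using assms that by (intro map_cong refl) (auto simp: hook_nth)
    ultimately show ?thesis
      using assms that unfolding g_def by (auto simp: hook_nth)
  qed
  have "col_boxes (hook p m) = concat (map g [0..<Suc m])"
    unfolding col_boxes_def g_def foldr_max_hook length_hook[OF assms] ..
  also have "[0..<Suc m] = 0 # [1..<Suc m]"
    by (simp add: upt_conv_Cons del: upt_Suc)
  also have "concat (map g (0 # [1..<Suc m])) = g 0 @ concat (map g [1..<Suc m])"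
    by (simp del: upt_Suc)
  also have "map g [1..<Suc m] = map (\<lambda>c. [(0, c)]) [1..<Suc m]"
    by (intro map_cong refl gS)
  finally show ?thesis
    using g0 by (simp del: upt_Suc)
qed

lemma row_to_col_word_hook:
  assumes m: "m < p" and w: "length w = p"
  shows "row_to_col_word (hook p m) w = permute_list (hook_perm p m) w"
proof -
  let ?R = "row_boxes (hook p m)"
  have len: "length ?R = p"
    using m by (simp add: row_boxes_hook)
  have dist: "distinct ?R"
    using m by (auto simp: row_boxes_hook distinct_map inj_on_def simp del: upt_Suc)
  have get: "the (map_of (zip ?R w) (?R ! i)) = w ! i" if "i < p" for i
    using map_of_zip_nth[of ?R w i] len dist w that by simp
  have R: "?R ! i = (if i \<le> m then (0, i) else (i - m, 0))" if "i < p" for i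
    using that m by (auto simp: row_boxes_hook nth_append simp del: upt_Suc)
  have first: "the (map_of (zip ?R w) (r, 0)) = w ! (if r = 0 then 0 else m + r)" if "r < p - m" for r
    using get[of "if r = 0 then 0 else m + r"] R[of "if r = 0 then 0 else m + r"] that m
    by (auto split: if_splits)
  have second: "the (map_of (zip ?R w) (0, c)) = w ! c" if "c \<le> m" for c
    using get[of c] R[of c] that m by auto
  show ?thesis
  proof (rule nth_equalityI)
    show "length (row_to_col_word (hook p m) w) = length (permute_list (hook_perm p m) w)"
      using m w by (simp add: row_to_col_word_def col_boxes_hook del: upt_Suc)
    fix i assume "i < length (row_to_col_word (hook p m) w)"
    then have i: "i < p"
      using m by (simp add: row_to_col_word_def col_boxes_hook del: upt_Suc)
    show "row_to_col_word (hook p m) w ! i = permute_list (hook_perm p m) w ! i"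
    proof (cases "i < p - m")
      case True
      then show ?thesis
        using i w first[of i] m unfolding row_to_col_word_def col_boxes_hook[OF m]
        by (simp add: nth_append permute_list_def hook_perm_def del: upt_Suc)
    next
      case False
      then have "Suc (i - (p - m)) \<le> m" "i \<noteq> 0"
        using i m by auto
      then show ?thesis
        using False i w second[of "Suc (i - (p - m))"] m unfolding row_to_col_word_def col_boxes_hook[OF m]
        by (simp add: nth_append permute_list_def hook_perm_def del: upt_Suc)
    qed
  qed
qed

lemma concat_sort_blocks_ones:
  assumes "length y = m"
  shows "concat (map sort (blocks (replicate m (Suc 0)) y)) = y"
  using assms
proof (induction m arbitrary: y)
  case (Suc m)
  then show ?case
    by (cases y) auto
qed simp

lemma sort_blocks_hook:
  assumes "m < p" "length u = p"
  shows "sort_blocks ((p - m) # replicate m 1) u = sort (take (p - m) u) @ drop (p - m) u"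
  using assms concat_sort_blocks_ones[of "drop (p - m) u" m] by (simp add: sort_blocks_def)

lemma sort_blocks_rho:
  assumes "m < p" "length w = p"
  shows "sort_blocks ((p - m) # replicate m 1) (permute_list (hook_perm p m) w) = rho m w"
proof -
  have "take (p - m) (w ! 0 # drop (Suc m) w @ take m (tl w)) = w ! 0 # drop (Suc m) w"
    "drop (p - m) (w ! 0 # drop (Suc m) w @ take m (tl w)) = take m (tl w)"
    using assms by (simp_all add: take_Cons' drop_Cons')
  moreover have "length (w ! 0 # drop (Suc m) w @ take m (tl w)) = p"
    using assms by simp
  ultimately show ?thesis
    by (simp only: permute_hook_perm[OF assms] sort_blocks_hook[OF assms(1)] rho_def)
qed

lemma mset_split_rho:
  assumes "m < p" "length w = p"
  shows "mset w = mset (w ! 0 # drop (Suc m) w) + mset (take m (tl w))"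
proof -
  have "mset (permute_list (hook_perm p m) w) = mset w"
    using hook_perm_permutes[OF assms(1)] assms(2) by simp
  then show ?thesis
    using permute_hook_perm[OF assms] by simp
qed

lemma mset_rho:
  assumes "m < p" "length w = p"
  shows "mset (rho m w) = mset w"
  using mset_split_rho[OF assms] by (simp add: rho_def)

text \<open>The positions \<open>1, ..., m\<close> are kept in order; the first column is kept as a
  multiset, which is the total content minus that of these positions.\<close>

lemma rho_eq_iff:
  assumes m: "m < p" and w: "length w = p" "length w' = p"
  shows "rho m w = rho m w' \<longleftrightarrow> mset w = mset w' \<and> take m (tl w) = take m (tl w')"
proof
  assume eq: "rho m w = rho m w'"
  have "length (sort (w ! 0 # drop (Suc m) w)) = length (sort (w' ! 0 # drop (Suc m) w'))"
    using w by simp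
  then have "take m (tl w) = take m (tl w')"
    using eq append_eq_append_conv unfolding rho_def by blast
  then show "mset w = mset w' \<and> take m (tl w) = take m (tl w')"
    using mset_rho[OF m w(1)] mset_rho[OF m w(2)] eq by simp
next
  assume eq: "mset w = mset w' \<and> take m (tl w) = take m (tl w')"
  then have "mset (w ! 0 # drop (Suc m) w) = mset (w' ! 0 # drop (Suc m) w')"
    using mset_split_rho[OF m w(1)] mset_split_rho[OF m w(2)] by (metis add_right_cancel)
  then have "sort (w ! 0 # drop (Suc m) w) = sort (w' ! 0 # drop (Suc m) w')"
    by (metis sorted_list_of_multiset_mset)
  then show "rho m w = rho m w'"
    using eq by (simp only: rho_def)
qed

lemma rho_swp:
  assumes m: "m < p" and w: "length w = p" and ab: "a = 0 \<or> m < a" "b = 0 \<or> m < b" "a < p" "b < p"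
  shows "rho m (swp a b w) = rho m w"
proof -
  have "take m (tl (swp a b w)) = take m (tl w)"
    using assms by (intro nth_equalityI) (auto simp: nth_tl nth_swp)
  then show ?thesis
    using assms by (subst rho_eq_iff[OF m]) auto
qed

section \<open>The projection from the tensor power and its naturality\<close>

definition qop :: "nat \<Rightarrow> nat \<Rightarrow> (nat list \<Rightarrow> 'k::field) \<Rightarrow> nat list \<Rightarrow> 'k"
  where "qop p m f u = (\<Sum>w | length w = p \<and> rho m w = u. f w)"

lemma finite_rho_fibre:
  assumes "m < p"
  shows "finite {w. length w = p \<and> rho m w = u}"
proof (rule finite_subset)
  show "{w. length w = p \<and> rho m w = u} \<subseteq> {w. set w \<subseteq> set u \<and> length w = p}"
    using mset_rho[OF assms] by (auto dest: mset_eq_setD)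
  show "finite {w. set w \<subseteq> set u \<and> length w = p}"
    by (rule finite_lists_length_eq) simp
qed

lemma basis_map_comp:
  assumes "finite A" "finite B" "\<And>w. w \<in> A \<Longrightarrow> h w \<in> B"
  shows "basis_map B g (basis_map A h f) = basis_map A (\<lambda>w. g (h w)) f"
proof
  fix u
  have "basis_map B g (basis_map A h f) u = (\<Sum>v\<in>{v\<in>B. g v = u}. \<Sum>w\<in>{w\<in>{w\<in>A. g (h w) = u}. h w = v}. f w)"
    unfolding basis_map_def by (intro sum.cong refl) auto
  also have "\<dots> = (\<Sum>w\<in>{w\<in>A. g (h w) = u}. f w)"
    using assms by (intro sum.group) auto
  finally show "basis_map B g (basis_map A h f) u = basis_map A (\<lambda>w. g (h w)) f u"
    by (simp add: basis_map_def)
qed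

lemma basis_map_qop:
  assumes m: "m < p" and f: "f \<in> coords (words p n)"
  shows "basis_map (words p n) (rho m) f = qop p m f"
proof
  fix u
  show "basis_map (words p n) (rho m) f u = qop p m f u"
    unfolding basis_map_def qop_def
    using f finite_rho_fibre[OF m]
    by (intro sum.mono_neutral_left) (auto simp: coords_def dest: length_words)
qed

lemma sum_list_conjugate: "m < p \<Longrightarrow> sum_list ((p - m) # replicate m 1) = p"
  by (simp add: sum_list_replicate)

lemma permute_list_words:
  assumes "\<sigma> permutes {..<p}" "w \<in> words p n"
  shows "permute_list \<sigma> w \<in> words p n"
  using assms set_permute_list[of \<sigma> w] by (simp add: words_def)

lemma sym_epi_row_to_col:
  assumes m: "m < p" and f: "f \<in> coords (words p n)"
  shows "sym_epi ((p - m) # replicate m 1) n (row_to_col (hook p m) n f) = qop p m f"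
proof -
  have "sym_epi ((p - m) # replicate m 1) n (row_to_col (hook p m) n f) =
    basis_map (words p n) (\<lambda>w. sort_blocks ((p - m) # replicate m 1) (row_to_col_word (hook p m) w)) f"
    unfolding sym_epi_def row_to_col_def sum_list_conjugate[OF m] sum_list_hook[OF m]
  proof (rule basis_map_comp)
    show "row_to_col_word (hook p m) w \<in> words p n" if "w \<in> words p n" for w
      using permute_list_words[OF hook_perm_permutes[OF m] that] row_to_col_word_hook[OF m length_words[OF that]]
      by simp
  qed auto
  also have "\<dots> = basis_map (words p n) (rho m) f"
    unfolding basis_map_def
  proof (intro ext sum.cong refl Collect_cong conj_cong)
    fix u w assume "w \<in> words p n"
    then have "length w = p" by (rule length_words)
    then show "(sort_blocks ((p - m) # replicate m 1) (row_to_col_word (hook p m) w) = u) = (rho m w = u)"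
      using m by (simp only: row_to_col_word_hook sort_blocks_rho)
  qed
  finally show ?thesis
    using basis_map_qop[OF m f] by simp
qed

lemma permute_list_prefix:
  assumes "\<pi> permutes {..<k}" "k \<le> length y"
  shows "take k (permute_list \<pi> y) = permute_list \<pi> (take k y)" "drop k (permute_list \<pi> y) = drop k y"
proof -
  show "take k (permute_list \<pi> y) = permute_list \<pi> (take k y)"
  proof (rule nth_equalityI)
    fix i assume "i < length (take k (permute_list \<pi> y))"
    then show "take k (permute_list \<pi> y) ! i = permute_list \<pi> (take k y) ! i"
      using assms permutes_in_image[OF assms(1), of i] by (simp add: permute_list_def)
  qed (use assms in simp)
  show "drop k (permute_list \<pi> y) = drop k y"
  proof (rule nth_equalityI)
    fix i assume "i < length (drop k (permute_list \<pi> y))"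
    then have "k + i < length y"
      by simp
    then show "drop k (permute_list \<pi> y) ! i = drop k y ! i"
      using assms permutes_not_in[OF assms(1), of "k + i"] by (simp add: permute_list_def)
  qed simp
qed

text \<open>For a fixed \<open>w\<close>, sorting its first column is a permutation \<pi> of
  positions. The same \<pi> need not sort another word \<open>x\<close>, but
  \<open>sort_blocks\<close> forgets the difference.\<close>

lemma rho_permutation:
  assumes m: "m < p" and w: "length w = p"
  obtains \<theta> where "\<theta> permutes {..<p}" "permute_list \<theta> w = rho m w"
    "\<And>x :: nat list. length x = p \<Longrightarrow> sort_blocks ((p - m) # replicate m 1) (permute_list \<theta> x) = rho m x"
proof -
  let ?\<gamma> = "hook_perm p m"
  let ?y = "permute_list ?\<gamma> w"
  have "mset (sort (take (p - m) ?y)) = mset (take (p - m) ?y)"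
    by simp
  then obtain \<pi> where "\<pi> permutes {..<length (take (p - m) ?y)}"
    and perm: "permute_list \<pi> (take (p - m) ?y) = sort (take (p - m) ?y)"
    by (rule mset_eq_permutation)
  then have \<pi>: "\<pi> permutes {..<p - m}"
    using w by simp
  have \<pi>p: "\<pi> permutes {..<p}"
    by (rule permutes_lessThan_mono[OF \<pi>]) simp
  have comp: "permute_list (?\<gamma> \<circ> \<pi>) x = permute_list \<pi> (take (p - m) (permute_list ?\<gamma> x)) @ drop (p - m) (permute_list ?\<gamma> x)"
    if "length x = p" for x :: "nat list"
  proof -
    have "permute_list (?\<gamma> \<circ> \<pi>) x = permute_list \<pi> (permute_list ?\<gamma> x)"
      using \<pi>p that by (intro permute_list_compose) simp
    also have "\<dots> = take (p - m) (permute_list \<pi> (permute_list ?\<gamma> x)) @ drop (p - m) (permute_list \<pi> (permute_list ?\<gamma> x))"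
      by simp
    finally show ?thesis
      using permute_list_prefix[OF \<pi>, of "permute_list ?\<gamma> x"] that by simp
  qed
  show ?thesis
  proof (rule that[of "?\<gamma> \<circ> \<pi>"])
    show "?\<gamma> \<circ> \<pi> permutes {..<p}"
      by (rule permutes_compose[OF \<pi>p hook_perm_permutes[OF m]])
    show "permute_list (?\<gamma> \<circ> \<pi>) w = rho m w"
      using comp[OF w] perm sort_blocks_rho[OF m w] sort_blocks_hook[OF m, of ?y] w by simp
    fix x :: "nat list" assume x: "length x = p"
    let ?z = "permute_list ?\<gamma> x"
    have "mset (permute_list \<pi> (take (p - m) ?z)) = mset (take (p - m) ?z)"
      using \<pi> x by (intro mset_permute_list) simp
    then have "sort (permute_list \<pi> (take (p - m) ?z)) = sort (take (p - m) ?z)"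
      by (metis sorted_list_of_multiset_mset)
    then have "sort_blocks ((p - m) # replicate m 1) (permute_list (?\<gamma> \<circ> \<pi>) x) = sort (take (p - m) ?z) @ drop (p - m) ?z"
      using sort_blocks_hook[OF m, of "permute_list (?\<gamma> \<circ> \<pi>) x"] comp[OF x] x by simp
    then show "sort_blocks ((p - m) # replicate m 1) (permute_list (?\<gamma> \<circ> \<pi>) x) = rho m x"
      using sort_blocks_rho[OF m x] sort_blocks_hook[OF m, of ?z] x by simp
  qed
qed

text \<open>Applying one permutation of positions to both words preserves the monomial of the pair,
  so the \<theta> of \<open>rho_permutation\<close> is a bijection between the two sets.\<close>

lemma card_rho_fibre:
  assumes m: "m < p" and w: "w \<in> words p a"
  shows "card {v \<in> words p b. sort_blocks ((p - m) # replicate m 1) v = u \<and> mset (zip v (rho m w)) = \<mu>}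
    = card {x \<in> words p b. rho m x = u \<and> mset (zip x w) = \<mu>}"
proof -
  have len: "length w = p"
    by (rule length_words[OF w])
  obtain \<theta> where \<theta>: "\<theta> permutes {..<p}" "permute_list \<theta> w = rho m w"
    and sb: "\<And>x :: nat list. length x = p \<Longrightarrow> sort_blocks ((p - m) # replicate m 1) (permute_list \<theta> x) = rho m x"
    using rho_permutation[OF m len] by blast
  have \<theta>': "inv \<theta> permutes {..<p}"
    by (rule permutes_inv[OF \<theta>(1)])
  have inv1: "permute_list \<theta> (permute_list (inv \<theta>) v) = v" if "length v = p" for v :: "nat list"
    using permute_list_compose[of \<theta> v "inv \<theta>"] \<theta>(1) that permutes_inv_o(2)[OF \<theta>(1)] by simp
  have inv2: "permute_list (inv \<theta>) (permute_list \<theta> v) = v" if "length v = p" for v :: "nat list"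
    using permute_list_compose[of "inv \<theta>" v \<theta>] \<theta>' that permutes_inv_o(1)[OF \<theta>(1)] by simp
  have zip: "mset (zip (permute_list \<theta> x) (rho m w)) = mset (zip x w)" if "length x = p" for x :: "nat list"
  proof -
    have "zip (permute_list \<theta> x) (permute_list \<theta> w) = permute_list \<theta> (zip x w)"
      using \<theta>(1) that len by (intro permute_list_zip[symmetric]) auto
    then show ?thesis
      using \<theta>(1) that len unfolding \<theta>(2) by simp
  qed
  have "bij_betw (permute_list \<theta>) {x \<in> words p b. rho m x = u \<and> mset (zip x w) = \<mu>}
     {v \<in> words p b. sort_blocks ((p - m) # replicate m 1) v = u \<and> mset (zip v (rho m w)) = \<mu>}"
  proof (rule bij_betw_byWitness[of _ "permute_list (inv \<theta>)"])
    show "\<forall>x\<in>{x \<in> words p b. rho m x = u \<and> mset (zip x w) = \<mu>}. permute_list (inv \<theta>) (permute_list \<theta> x) = x"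
      using inv2 by (auto dest: length_words)
    show "\<forall>v\<in>{v \<in> words p b. sort_blocks ((p - m) # replicate m 1) v = u \<and> mset (zip v (rho m w)) = \<mu>}.
        permute_list \<theta> (permute_list (inv \<theta>) v) = v"
      using inv1 by (auto dest: length_words)
    show "permute_list \<theta> ` {x \<in> words p b. rho m x = u \<and> mset (zip x w) = \<mu>} \<subseteq>
        {v \<in> words p b. sort_blocks ((p - m) # replicate m 1) v = u \<and> mset (zip v (rho m w)) = \<mu>}"
    proof
      fix v assume "v \<in> permute_list \<theta> ` {x \<in> words p b. rho m x = u \<and> mset (zip x w) = \<mu>}"
      then obtain x where x: "x \<in> words p b" "rho m x = u" "mset (zip x w) = \<mu>" "v = permute_list \<theta> x"
        by blast
      show "v \<in> {v \<in> words p b. sort_blocks ((p - m) # replicate m 1) v = u \<and> mset (zip v (rho m w)) = \<mu>}"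
        using permute_list_words[OF \<theta>(1) x(1)] sb[OF length_words[OF x(1)]] zip[OF length_words[OF x(1)]] x(2-4)
        by simp
    qed
    show "permute_list (inv \<theta>) ` {v \<in> words p b. sort_blocks ((p - m) # replicate m 1) v = u \<and> mset (zip v (rho m w)) = \<mu>}
        \<subseteq> {x \<in> words p b. rho m x = u \<and> mset (zip x w) = \<mu>}"
    proof
      fix x assume "x \<in> permute_list (inv \<theta>) ` {v \<in> words p b. sort_blocks ((p - m) # replicate m 1) v = u \<and> mset (zip v (rho m w)) = \<mu>}"
      then obtain v where v: "v \<in> words p b" "sort_blocks ((p - m) # replicate m 1) v = u"
        "mset (zip v (rho m w)) = \<mu>" "x = permute_list (inv \<theta>) v"
        by blast
      have xw: "x \<in> words p b" and v_eq: "v = permute_list \<theta> x"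
        using permute_list_words[OF \<theta>' v(1)] inv1[OF length_words[OF v(1)]] v(4) by auto
      show "x \<in> {x \<in> words p b. rho m x = u \<and> mset (zip x w) = \<mu>}"
        using xw sb[OF length_words[OF xw]] zip[OF length_words[OF xw]] v(2,3) unfolding v_eq by simp
    qed
  qed
  then show ?thesis
    by (simp add: bij_betw_same_card)
qed

lemma rho_words:
  assumes "m < p" "length w = p"
  shows "rho m w \<in> words p n \<longleftrightarrow> w \<in> words p n"
  using mset_eq_setD[OF mset_rho[OF assms]] mset_eq_length[OF mset_rho[OF assms]] assms by (simp add: words_def)

text \<open>\<open>sym_power\<close> acts through the representative \<open>rho m w\<close> of the
  class of \<open>w\<close>. By \<open>card_rho_fibre\<close> the number of contributing words is
  the same as for \<open>w\<close> itself, so the choice of representative has no effect.\<close>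

lemma coef_sym_power_qop:
  assumes m: "m < p" and f: "f \<in> coords (words p a)"
  shows "coef (sym_power ((p - m) # replicate m 1)) a b \<mu> (qop p m f) =
    qop p m (coef (tensor_power p) a b \<mu> f)"
proof
  fix u
  let ?sb = "sort_blocks ((p - m) # replicate m 1)"
  have q: "qop p m f = basis_map (words p a) (rho m) f"
    by (rule basis_map_qop[OF m f, symmetric])
  have "coef (tensor_power p) a b \<mu> (qop p m f) v = (\<Sum>w\<in>{w\<in>words p a. mset (zip v (rho m w)) = \<mu>}. f w)"
    if v: "v \<in> words p b" for v
  proof -
    have "coef (tensor_power p) a b \<mu> (qop p m f) v =
        (\<Sum>y\<in>{y\<in>words p a. mset (zip v y) = \<mu>}. \<Sum>w\<in>{w\<in>{w\<in>words p a. mset (zip v (rho m w)) = \<mu>}. rho m w = y}. f w)"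
      unfolding q using v by (auto simp: tensor_power_coef basis_map_def intro!: sum.cong)
    also have "\<dots> = (\<Sum>w\<in>{w\<in>words p a. mset (zip v (rho m w)) = \<mu>}. f w)"
      using rho_words[OF m] by (intro sum.group) (auto dest: length_words)
    finally show ?thesis .
  qed
  then have "coef (sym_power ((p - m) # replicate m 1)) a b \<mu> (qop p m f) u =
      (\<Sum>v\<in>{v\<in>words p b. ?sb v = u}. \<Sum>w\<in>{w\<in>words p a. mset (zip v (rho m w)) = \<mu>}. f w)"
    using sum_list_conjugate[OF m] by (simp add: sym_power_def sym_epi_def basis_map_def)
  also have "\<dots> = (\<Sum>w\<in>words p a. of_nat (card {v\<in>words p b. ?sb v = u \<and> mset (zip v (rho m w)) = \<mu>}) * f w)"
    by (rule sum_card_fibre) auto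
  also have "\<dots> = (\<Sum>w\<in>words p a. of_nat (card {x\<in>words p b. rho m x = u \<and> mset (zip x w) = \<mu>}) * f w)"
    using card_rho_fibre[OF m] by (intro sum.cong refl) simp
  also have "\<dots> = (\<Sum>x\<in>{x\<in>words p b. rho m x = u}. \<Sum>w\<in>{w\<in>words p a. mset (zip x w) = \<mu>}. f w)"
    by (rule sum_card_fibre[symmetric]) auto
  also have "\<dots> = (\<Sum>x\<in>{x\<in>words p b. rho m x = u}. coef (tensor_power p) a b \<mu> f x)"
    by (intro sum.cong refl) (simp add: tensor_power_coef)
  also have "\<dots> = qop p m (coef (tensor_power p) a b \<mu> f) u"
    unfolding qop_def using finite_rho_fibre[OF m]
    by (intro sum.mono_neutral_left) (auto simp: tensor_power_coef dest: length_words)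
  finally show "coef (sym_power ((p - m) # replicate m 1)) a b \<mu> (qop p m f) u =
    qop p m (coef (tensor_power p) a b \<mu> f) u" .
qed

section \<open>The exterior side of a hook and the values of its Schur functor\<close>

lemma young_subgroup_hook:
  assumes m: "m < p"
  shows "young_subgroup (hook p m) = {\<sigma>. \<sigma> permutes {..<Suc m}}"
proof -
  have R: "fst (row_boxes (hook p m) ! i) = (if i \<le> m then 0 else i - m)" if "i < p" for i
    using that m by (auto simp: row_boxes_hook nth_append simp del: upt_Suc)
  show ?thesis
  proof (intro set_eqI iffI)
    fix \<sigma> assume "\<sigma> \<in> young_subgroup (hook p m)"
    then have \<sigma>: "\<sigma> permutes {..<p}" and eq: "\<And>i. i < p \<Longrightarrow> fst (row_boxes (hook p m) ! \<sigma> i) = fst (row_boxes (hook p m) ! i)"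
      using m by (auto simp: young_subgroup_def sum_list_hook)
    have "\<sigma> i = i" if "i \<notin> {..<Suc m}" for i
    proof (cases "i < p")
      case True
      then have "\<sigma> i < p"
        using permutes_in_image[OF \<sigma>, of i] by simp
      then show ?thesis
        using eq[OF True] R[OF True] R[of "\<sigma> i"] that by (auto split: if_splits)
    qed (use permutes_not_in[OF \<sigma>, of i] in auto)
    then show "\<sigma> \<in> {\<sigma>. \<sigma> permutes {..<Suc m}}"
      using permutes_superset[OF \<sigma>, of "{..<Suc m}"] by auto
  next
    fix \<sigma> assume "\<sigma> \<in> {\<sigma>. \<sigma> permutes {..<Suc m}}"
    then have \<sigma>: "\<sigma> permutes {..<Suc m}" by simp
    have "fst (row_boxes (hook p m) ! \<sigma> i) = fst (row_boxes (hook p m) ! i)" if "i < p" for i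
    proof (cases "i < Suc m")
      case True
      then have "\<sigma> i < Suc m"
        using permutes_in_image[OF \<sigma>, of i] by simp
      then show ?thesis
        using True R[OF that] R[of "\<sigma> i"] m by simp
    qed (use permutes_not_in[OF \<sigma>, of i] in auto)
    then show "\<sigma> \<in> young_subgroup (hook p m)"
      using permutes_lessThan_mono[OF \<sigma>, of p] m by (simp add: young_subgroup_def sum_list_hook)
  qed
qed

lemma blocks_ones_sorted: "b \<in> set (blocks (replicate k (Suc 0)) y) \<Longrightarrow> sorted_wrt (<) b"
proof (induction k arbitrary: y)
  case (Suc k)
  then show ?case
    by (cases y) auto
qed simp

lemma ext_words_hook:
  assumes "m < p"
  shows "ext_words (hook p m) n = incr_words p (Suc m) n"
  using assms blocks_ones_sorted
  by (auto simp: ext_words_def incr_words_def sum_list_hook) (auto simp: hook_def)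

text \<open>\<open>ext_mono\<close> pushes basis words forward along \<sigma> while
  \<open>asymm\<close> pulls back; the two differ by inversion, which preserves signs.\<close>

lemma ext_mono_hook:
  assumes m: "m < p" and f: "f \<in> coords (incr_words p (Suc m) n)"
  shows "ext_mono (hook p m) n f = asymm (Suc m) f"
proof
  fix v
  have f0: "f w = 0" if "length w \<noteq> p" for w
    using f that by (auto simp: coords_def incr_words_def dest: length_words)
  have bm: "basis_map (incr_words p (Suc m) n) (permute_list \<sigma>) f v = f (permute_list (inv \<sigma>) v)"
    if "\<sigma> permutes {..<Suc m}" for \<sigma>
  proof (cases "length v = p")
    case True
    have \<sigma>: "\<sigma> permutes {..<p}" "inv \<sigma> permutes {..<p}"
      using permutes_lessThan_mono[OF that, of p] m by (auto intro: permutes_inv)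
    have inv1: "permute_list \<sigma> (permute_list (inv \<sigma>) v) = v"
      using permute_list_compose[of \<sigma> v "inv \<sigma>"] \<sigma> True permutes_inv_o(2)[OF \<sigma>(1)] by simp
    have inv2: "permute_list (inv \<sigma>) (permute_list \<sigma> w) = w" if "length w = p" for w :: "nat list"
      using permute_list_compose[of "inv \<sigma>" w \<sigma>] \<sigma> that permutes_inv_o(1)[OF \<sigma>(1)] by simp
    have "w = permute_list (inv \<sigma>) v" if "w \<in> incr_words p (Suc m) n" "permute_list \<sigma> w = v" for w
    proof -
      have "length w = p"
        using that(1) by (auto simp: incr_words_def dest: length_words)
      from inv2[OF this] show ?thesis
        unfolding that(2) by (rule sym)
    qed
    then have S: "{w. w \<in> incr_words p (Suc m) n \<and> permute_list \<sigma> w = v} =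
        {permute_list (inv \<sigma>) v} \<inter> incr_words p (Suc m) n"
      using inv1 by blast
    show ?thesis
    proof (cases "permute_list (inv \<sigma>) v \<in> incr_words p (Suc m) n")
      case True
      then show ?thesis
        unfolding basis_map_def S by simp
    next
      case False
      then have "f (permute_list (inv \<sigma>) v) = 0"
        using f unfolding coords_def by blast
      then show ?thesis
        using False unfolding basis_map_def S by simp
    qed
  next
    case False
    then have S: "{w. w \<in> incr_words p (Suc m) n \<and> permute_list \<sigma> w = v} = {}"
      by (auto simp: incr_words_def dest: length_words)
    show ?thesis
      using f0[of "permute_list (inv \<sigma>) v"] False unfolding basis_map_def S by simp
  qed
  have "ext_mono (hook p m) n f v =
      (\<Sum>\<sigma> | \<sigma> permutes {..<Suc m}. of_int (sign \<sigma>) * f (permute_list (inv \<sigma>) v))"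
    unfolding ext_mono_def young_subgroup_hook[OF m] ext_words_hook[OF m] sum_fun_apply fscale_apply
    using bm by (intro sum.cong refl) simp
  also have "\<dots> = (\<Sum>\<sigma> | \<sigma> permutes {..<Suc m}. of_int (sign (inv \<sigma>)) * f (permute_list (inv \<sigma>) v))"
  proof (intro sum.cong refl)
    fix \<sigma> assume "\<sigma> \<in> {\<sigma>. \<sigma> permutes {..<Suc m}}"
    then have "permutation \<sigma>"
      by (intro permutation_permutes[THEN iffD2]) auto
    then show "of_int (sign \<sigma>) * f (permute_list (inv \<sigma>) v) = of_int (sign (inv \<sigma>)) * f (permute_list (inv \<sigma>) v)"
      by (simp only: sign_inverse)
  qed
  also have "\<dots> = asymm (Suc m) f v"
    unfolding asymm_def by (rule sum_permutations_inverse[symmetric])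
  finally show "ext_mono (hook p m) n f v = asymm (Suc m) f v" .
qed

lemma schur_hook_val:
  assumes m: "m < p"
  shows "val (schur_functor (hook p m)) n = qop p m ` asymm (Suc m) ` (coords (words p n) :: (nat list \<Rightarrow> 'k::field) set)"
proof -
  let ?E = "coords (incr_words p (Suc m) n) :: (nat list \<Rightarrow> 'k) set"
  have sub: "?E \<subseteq> coords (words p n)"
    by (auto simp: coords_def incr_words_def)
  have "val (schur_functor (hook p m)) n =
      (\<lambda>f. sym_epi ((p - m) # replicate m 1) n (row_to_col (hook p m) n (ext_mono (hook p m) n f))) ` ?E"
    using m by (simp add: schur_functor_def spf_image_def ext_power_def ext_words_hook conjugate_hook)
  also have "\<dots> = (\<lambda>f. qop p m (asymm (Suc m) f)) ` ?E"
  proof (rule image_cong[OF refl])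
    fix f assume f: "f \<in> ?E"
    have "asymm (Suc m) f \<in> coords (words p n)"
      using f sub m by (intro asymm_coords) auto
    then show "sym_epi ((p - m) # replicate m 1) n (row_to_col (hook p m) n (ext_mono (hook p m) n f)) =
        qop p m (asymm (Suc m) f)"
      unfolding ext_mono_hook[OF m f] by (rule sym_epi_row_to_col[OF m])
  qed
  also have "\<dots> = qop p m ` asymm (Suc m) ` ?E"
    by (simp only: image_image)
  also have "asymm (Suc m) ` ?E = asymm (Suc m) ` coords (words p n)"
    using m by (intro asymm_image) simp
  finally show ?thesis .
qed

lemma schur_hook_coef:
  assumes "m < p"
  shows "coef (schur_functor (hook p m)) = coef (sym_power ((p - m) # replicate m 1))"
  using assms by (simp add: schur_functor_def spf_image_def conjugate_hook)

section \<open>The epimorphism onto the Schur functor of a hook\<close>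

lemma qop_add: "qop p m (f + g) = qop p m f + qop p m g"
  by (simp add: qop_def fun_eq_iff sum.distrib)

lemma qop_scale: "qop p m (fscale c f) = fscale c (qop p m f)"
  by (simp add: qop_def fun_eq_iff fscale_apply sum_distrib_left)

lemma qop_cong:
  assumes "\<And>w. length w = p \<Longrightarrow> f w = g w"
  shows "qop p m f = qop p m g"
  using assms by (auto simp: qop_def fun_eq_iff intro!: sum.cong)

lemma qop_swp:
  assumes m: "m < p" and ab: "a = 0 \<or> m < a" "b = 0 \<or> m < b" "a < p" "b < p"
  shows "qop p m (\<lambda>w. f (swp a b w)) = qop p m f"
proof
  fix u
  show "qop p m (\<lambda>w. f (swp a b w)) u = qop p m f u"
    unfolding qop_def
    by (rule sum.reindex_bij_witness[of _ "swp a b" "swp a b"]) (use assms rho_swp[OF m _ ab] in auto)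
qed

text \<open>Positions 0 and \<open>m + 1\<close> both lie in the first column: their exchange
  preserves the class under \<open>rho\<close> and changes the sign of \<open>f\<close>.\<close>

lemma qop_alt_zero:
  assumes f: "alt_below p (Suc (Suc m)) f" and m: "Suc m < p"
  shows "qop p m f u = 0"
  unfolding qop_def
proof (rule sum_involution_zero[where \<tau> = "swp 0 (Suc m)"])
  show "finite {w. length w = p \<and> rho m w = u}"
    using m by (intro finite_rho_fibre) simp
  fix w assume w: "w \<in> {w. length w = p \<and> rho m w = u}"
  then show "swp 0 (Suc m) w \<in> {w. length w = p \<and> rho m w = u}"
    using m rho_swp[of m p w 0 "Suc m"] by auto
  show "swp 0 (Suc m) (swp 0 (Suc m) w) = w" "f (swp 0 (Suc m) w) = - f w"
    using w m altD(1)[OF f, of w 0 "Suc m"] by auto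
  assume "swp 0 (Suc m) w = w"
  from arg_cong[OF this, of "\<lambda>x. x ! 0"] have "w ! 0 = w ! Suc m"
    using w m by (simp add: nth_swp)
  then show "f w = 0"
    using w altD(2)[OF f, of w 0 "Suc m"] by auto
qed

text \<open>As \<open>i > m\<close>, all exchanges in \<open>del p i\<close> take place inside the
  first column, so each of the \<open>p - i\<close> summands has the same image.\<close>

lemma qop_del:
  assumes m: "m < i" and i: "i \<le> p"
  shows "qop p m (del p i f) u = of_nat (p - i) * qop p m f u"
proof -
  have "qop p m (del p i f) u = (\<Sum>s\<in>{i..<p}. qop p m (\<lambda>w. f (swp i s w)) u)"
    unfolding qop_def del_def by (rule sum.swap)
  also have "\<dots> = (\<Sum>s\<in>{i..<p}. qop p m f u)"
    using assms by (intro sum.cong refl) (subst qop_swp, auto)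
  finally show ?thesis
    by simp
qed

section \<open>The kernel of the projection, and symmetrisation\<close>

lemma sym_above_mset:
  assumes "sym_above p i f" "length w = p" "length w' = p" "take i w = take i w'"
    "mset (drop i w) = mset (drop i w')"
  shows "f w = f w'"
  using assms
proof (induction "p - i" arbitrary: i w)
  case 0
  then have "w = w'" by simp
  then show ?case by simp
next
  case (Suc k)
  then have i: "i < p" by simp
  have "w' ! i \<in> set (drop i w')"
    using Cons_nth_drop_Suc[of i w'] i Suc.prems(3) by (metis list.set_intros(1))
  then have "w' ! i \<in> set (drop i w)"
    using mset_eq_setD[OF Suc.prems(5)] by simp
  then obtain c where "c < length (drop i w)" "drop i w ! c = w' ! i"
    by (auto simp: in_set_conv_nth)
  then have "i + c < p" "w ! (i + c) = w' ! i"
    using Suc.prems(2) by simp_all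
  then obtain b where b: "i \<le> b" "b < p" "w ! b = w' ! i"
    using le_add1 by blast
  let ?v = "swp i b w"
  have v: "length ?v = p" "?v ! i = w' ! i"
    using b i Suc.prems(2) by (auto simp: nth_swp)
  have tk: "take i ?v = take i w'"
    using b i Suc.prems(2,4) by (simp add: swp_def)
  have "mset ?v = mset w"
    using b i Suc.prems(2) by simp
  also have "\<dots> = mset (take i w) + mset (drop i w)"
    by (simp flip: mset_append)
  also have "\<dots> = mset (take i w') + mset (drop i w')"
    unfolding Suc.prems(4,5) ..
  also have "\<dots> = mset w'"
    by (simp flip: mset_append)
  finally have "mset (take i ?v @ ?v ! i # drop (Suc i) ?v) = mset (take i w' @ w' ! i # drop (Suc i) w')"
    using i v(1) Suc.prems(3) by (simp only: id_take_nth_drop[symmetric])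
  then have "mset (drop (Suc i) ?v) = mset (drop (Suc i) w')"
    using tk v(2) by simp
  moreover have "take (Suc i) ?v = take (Suc i) w'"
    using i tk v Suc.prems(3) by (simp add: take_Suc_conv_app_nth)
  moreover have "sym_above p (Suc i) f"
    using sym_mono[OF Suc.prems(1), of "Suc i"] by simp
  ultimately have "f ?v = f w'"
    using Suc.hyps(2) v(1) Suc.prems(3) by (intro Suc.hyps(1)[of "Suc i"]) simp_all
  then show ?case
    using symD[OF Suc.prems(1,2), of i b] b i by simp
qed

lemma of_nat_fact_neq_0:
  assumes char: "CHAR('k::field) = p" and "k < p"
  shows "of_nat (fact k) \<noteq> (0 :: 'k)"
  using assms(2)
proof (induction k)
  case (Suc k)
  have "of_nat (fact (Suc k)) = of_nat (Suc k) * (of_nat (fact k) :: 'k)"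
    by (simp only: fact_Suc of_nat_mult of_nat_id)
  then show ?case
    using Suc of_nat_eq_0_char(2)[OF char, of "Suc k"] by (simp del: of_nat_Suc fact_Suc)
qed simp

text \<open>Multinomial counting with the denominators cleared, so that the identity can be mapped
  to \<open>k\<close>, where a factorial may vanish.\<close>

lemma card_permutations_remove:
  assumes "x \<in># C"
  shows "(\<Prod>y\<in>set_mset C. fact (count C y)) * card (permutations_of_multiset (C - {#x#}))
    = fact (size C - 1) * count C x"
proof -
  let ?K = "\<Prod>y\<in>set_mset C. fact (count C y) :: nat"
  obtain N where N: "size C = Suc N"
    using assms by (metis size_Suc_Diff1)
  have r: "card (permutations_of_multiset C) * count C x = Suc N * card (permutations_of_multiset (C - {#x#}))"
    using card_permutations_of_multiset_remove_aux[OF assms] unfolding N .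
  have "Suc N * (?K * card (permutations_of_multiset (C - {#x#}))) = ?K * (card (permutations_of_multiset C) * count C x)"
    unfolding r by (rule mult.left_commute)
  also have "\<dots> = fact (Suc N) * count C x"
    using card_permutations_of_multiset_aux[of C] N by (metis mult.assoc mult.commute)
  also have "\<dots> = Suc N * (fact N * count C x)"
    by (simp only: fact_Suc mult.assoc of_nat_id)
  finally have "?K * card (permutations_of_multiset (C - {#x#})) = fact N * count C x"
    using mult_left_cancel[of "Suc N"] by blast
  then show ?thesis
    using N by simp
qed

text \<open>Evaluating \<open>qop\<close> at the class of \<open>v\<close> sums over the arrangements of the first column; for a tensor
  symmetric from position \<open>m + 1\<close> on only the letter in position \<open>0\<close> matters.\<close>

lemma qop_fibre_sum:
  fixes f :: "nat list \<Rightarrow> 'k::field"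
  assumes m: "m < p" and f: "sym_above p (Suc m) f" and v: "length v = p"
  shows "(\<Prod>y\<in>set_mset (mset (v ! 0 # drop (Suc m) v)). of_nat (fact (count (mset (v ! 0 # drop (Suc m) v)) y))) * qop p m f (rho m v)
    = of_nat (fact (p - m - 1)) * (\<Sum>s\<in>insert 0 {Suc m..<p}. f (swp 0 s v))"
proof -
  define C where "C = mset (v ! 0 # drop (Suc m) v)"
  define mid where "mid = take m (tl v)"
  \<comment> \<open>The common value of \<open>f\<close> at the words of the class of
    \<open>v\<close> with letter \<open>x\<close> in position 0; the sorted tail is just one
    arrangement of the remaining letters.\<close>
  define F where "F x = f (x # mid @ sorted_list_of_multiset (C - {#x#}))" for x
  let ?S = "insert 0 {Suc m..<p}"
  have lmid: "length mid = m"
    using v m by (simp add: mid_def)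
  have sC: "size C = p - m"
    using v m by (simp add: C_def)
  have mv: "mset v = C + mset mid"
    unfolding C_def mid_def by (rule mset_split_rho[OF m v])
  have fF: "f w = F (w ! 0)" if w: "length w = p" "take m (tl w) = mid" "mset w = mset v" for w
  proof -
    have sp: "mset w = mset (w ! 0 # drop (Suc m) w) + mset mid"
      using mset_split_rho[OF m w(1)] w(2) by simp
    then have C: "mset (w ! 0 # drop (Suc m) w) = C"
      using mv w(3) by simp
    have x: "w ! 0 \<in># C"
      unfolding C[symmetric] by simp
    have "length (sorted_list_of_multiset (C - {#w ! 0#})) = p - m - 1"
      using x sC by (metis mset_sorted_list_of_multiset size_Diff_singleton size_mset)
    then have lenr: "length (w ! 0 # mid @ sorted_list_of_multiset (C - {#w ! 0#})) = p"
      using lmid m by simp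
    have "take (Suc m) w = w ! 0 # take m (tl w)"
      using w(1) m by (cases w) auto
    then have "take (Suc m) w = w ! 0 # mid"
      unfolding w(2) .
    moreover have "mset (drop (Suc m) w) = C - {#w ! 0#}"
      unfolding C[symmetric] by simp
    ultimately show ?thesis
      unfolding F_def using lmid by (intro sym_above_mset[OF f w(1) lenr]) auto
  qed
  have "qop p m f (rho m v) = (\<Sum>w\<in>(\<lambda>(x, r). x # mid @ r) ` (SIGMA x:set_mset C. permutations_of_multiset (C - {#x#})). f w)"
    unfolding qop_def
  proof (rule sum.cong[OF _ refl], intro set_eqI iffI)
    fix w assume "w \<in> {w. length w = p \<and> rho m w = rho m v}"
    then have w: "length w = p" "mset w = mset v" "take m (tl w) = mid"
      using rho_eq_iff[OF m _ v, of w] by (auto simp: mid_def)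
    have "mset w = mset (w ! 0 # drop (Suc m) w) + mset mid"
      using mset_split_rho[OF m w(1)] w(3) by simp
    then have C: "mset (w ! 0 # drop (Suc m) w) = C"
      using mv w(2) by simp
    have "w = w ! 0 # take m (tl w) @ drop (Suc m) w"
      using w(1) m by (cases w) auto
    then have e: "w = (\<lambda>(x, r). x # mid @ r) (w ! 0, drop (Suc m) w)"
      unfolding case_prod_conv w(3) .
    have r: "mset (drop (Suc m) w) = C - {#w ! 0#}"
      unfolding C[symmetric] by simp
    have x: "w ! 0 \<in># C"
      unfolding C[symmetric] by simp
    show "w \<in> (\<lambda>(x, r). x # mid @ r) ` (SIGMA x:set_mset C. permutations_of_multiset (C - {#x#}))"
      using e by (rule image_eqI) (use r x in \<open>simp add: permutations_of_multiset_def\<close>)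
  next
    fix w assume "w \<in> (\<lambda>(x, r). x # mid @ r) ` (SIGMA x:set_mset C. permutations_of_multiset (C - {#x#}))"
    then obtain x r where w: "x \<in># C" "mset r = C - {#x#}" "w = x # mid @ r"
      by (auto simp: permutations_of_multiset_def)
    have "size (mset r) = p - m - 1"
      using w(1,2) sC by (simp add: size_Diff_singleton)
    then have "length w = p"
      using w(3) lmid m by simp
    moreover have "mset w = mset v"
      using w mv by simp
    moreover have "take m (tl w) = mid"
      using w(3) lmid by simp
    ultimately show "w \<in> {w. length w = p \<and> rho m w = rho m v}"
      using rho_eq_iff[OF m _ v, of w] by (simp add: mid_def)
  qed
  also have "\<dots> = (\<Sum>(x, r)\<in>(SIGMA x:set_mset C. permutations_of_multiset (C - {#x#})). f (x # mid @ r))"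
  proof -
    have inj: "inj_on (\<lambda>(x, r). x # mid @ r) (SIGMA x:set_mset C. permutations_of_multiset (C - {#x#}))"
      by (auto simp: inj_on_def)
    show ?thesis
      unfolding sum.reindex[OF inj] by (intro sum.cong refl) (simp add: case_prod_unfold)
  qed
  also have "\<dots> = (\<Sum>x\<in>set_mset C. \<Sum>r\<in>permutations_of_multiset (C - {#x#}). f (x # mid @ r))"
    by (rule sum.Sigma[symmetric]) auto
  also have "\<dots> = (\<Sum>x\<in>set_mset C. of_nat (card (permutations_of_multiset (C - {#x#}))) * F x)"
  proof (intro sum.cong refl)
    fix x assume x: "x \<in> set_mset C"
    have "f (x # mid @ r) = F x" if r: "r \<in> permutations_of_multiset (C - {#x#})" for r
    proof -
      have mr: "mset r = C - {#x#}"
        using r by (simp add: permutations_of_multiset_def)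
      have "size (mset r) = p - m - 1"
        unfolding mr using x sC by (simp add: size_Diff_singleton)
      then have "length (x # mid @ r) = p"
        using lmid m by simp
      then show ?thesis
        using fF[of "x # mid @ r"] lmid mr x mv by simp
    qed
    then show "(\<Sum>r\<in>permutations_of_multiset (C - {#x#}). f (x # mid @ r)) =
        of_nat (card (permutations_of_multiset (C - {#x#}))) * F x"
      by simp
  qed
  finally have q: "qop p m f (rho m v) = (\<Sum>x\<in>set_mset C. of_nat (card (permutations_of_multiset (C - {#x#}))) * F x)" .
  have "(\<Sum>s\<in>?S. f (swp 0 s v)) = (\<Sum>s\<in>?S. F (v ! s))"
  proof (intro sum.cong refl)
    fix s assume s: "s \<in> ?S"
    have "swp 0 s v ! Suc i = v ! Suc i" if "i < m" for i
      using that s v m by (subst nth_swp) auto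
    then have "take m (tl (swp 0 s v)) = mid"
      unfolding mid_def using v m by (intro nth_equalityI) (auto simp: nth_tl)
    moreover have "mset (swp 0 s v) = mset v"
      using s v m by (intro mset_swp) auto
    moreover have "swp 0 s v ! 0 = v ! s"
      using s v m by (subst nth_swp) auto
    ultimately show "f (swp 0 s v) = F (v ! s)"
      using fF[of "swp 0 s v"] v by simp
  qed
  also have "\<dots> = (\<Sum>x\<in>set_mset C. \<Sum>s\<in>{s\<in>?S. v ! s = x}. F (v ! s))"
  proof (rule sum.group[symmetric])
    show "(!) v ` ?S \<subseteq> set_mset C"
    proof
      fix x assume "x \<in> (!) v ` ?S"
      then obtain s where s: "s \<in> ?S" "x = v ! s" by blast
      show "x \<in> set_mset C"
      proof (cases "s = 0")
        case False
        then have "v ! s = drop (Suc m) v ! (s - Suc m)" "s - Suc m < length (drop (Suc m) v)"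
          using s v by auto
        then have "v ! s \<in> set (drop (Suc m) v)"
          by (metis nth_mem)
        then show ?thesis
          using s by (simp add: C_def)
      qed (use s in \<open>simp add: C_def\<close>)
    qed
  qed auto
  also have "\<dots> = (\<Sum>x\<in>set_mset C. of_nat (count C x) * F x)"
  proof (intro sum.cong refl)
    fix x
    have "drop (Suc m) v = map ((!) v) [Suc m..<p]"
      using v by (intro nth_equalityI) auto
    then have "C = mset (map ((!) v) (0 # [Suc m..<p]))"
      by (simp add: C_def)
    then have "count C x = length (filter (\<lambda>s. x = v ! s) (0 # [Suc m..<p]))"
      unfolding count_mset count_list_eq_length_filter filter_map o_def
      by (simp only: count_mset count_list_eq_length_filter filter_map o_def length_map)
    also have "\<dots> = card (set (filter (\<lambda>s. x = v ! s) (0 # [Suc m..<p])))"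
      by (rule distinct_card[symmetric]) simp
    also have "set (filter (\<lambda>s. x = v ! s) (0 # [Suc m..<p])) = {s\<in>?S. v ! s = x}"
      by auto
    finally have c: "count C x = card {s\<in>?S. v ! s = x}" .
    have "(\<Sum>s\<in>{s\<in>?S. v ! s = x}. F (v ! s)) = (\<Sum>s\<in>{s\<in>?S. v ! s = x}. F x)"
      by (intro sum.cong) auto
    then show "(\<Sum>s\<in>{s\<in>?S. v ! s = x}. F (v ! s)) = of_nat (count C x) * F x"
      by (simp only: sum_constant c)
  qed
  finally have d: "(\<Sum>s\<in>?S. f (swp 0 s v)) = (\<Sum>x\<in>set_mset C. of_nat (count C x) * F x)" .
  let ?K = "\<Prod>y\<in>set_mset C. fact (count C y) :: nat"
  have "of_nat ?K * qop p m f (rho m v) =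
      (\<Sum>x\<in>set_mset C. of_nat (?K * card (permutations_of_multiset (C - {#x#}))) * F x)"
    unfolding q sum_distrib_left by (intro sum.cong refl) (simp only: of_nat_mult mult.assoc)
  also have "\<dots> = (\<Sum>x\<in>set_mset C. of_nat (fact (p - m - 1) * count C x) * F x)"
    using card_permutations_remove[of _ C] sC by (intro sum.cong refl) simp
  also have "\<dots> = of_nat (fact (p - m - 1)) * (\<Sum>s\<in>?S. f (swp 0 s v))"
    unfolding d sum_distrib_left by (intro sum.cong refl) (simp only: of_nat_mult mult.assoc)
  finally show ?thesis
    by (simp only: C_def of_nat_prod)
qed

text \<open>\<open>qop_fibre_sum\<close> turns the vanishing of \<open>qop\<close> into that of a
  sum over exchanges with position 0. A constant word is alone in its class under
  \<open>rho\<close>, so there \<open>qop\<close> returns the value of \<open>f\<close>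
  itself.\<close>

lemma qop_kernel:
  fixes f :: "nat list \<Rightarrow> 'k::field"
  assumes char: "CHAR('k) = p" and m: "m < p" and f: "alt_below p (Suc m) f" "sym_above p (Suc m) f"
    and q: "\<And>u. qop p m f u = 0" and w: "length w = p"
  shows "del p m f w = 0" "constant_word w \<Longrightarrow> f w = 0"
proof -
  \<comment> \<open>Only \<open>fact (p - m - 1)\<close> on the right has to be cancelled. The
    product of factorials on the left may vanish in \<open>k\<close>, but it is multiplied by
    0.\<close>
  have D0: "(\<Sum>s\<in>insert 0 {Suc m..<p}. f (swp 0 s v)) = 0" if "length v = p" for v
    using qop_fibre_sum[OF m f(2) that] q of_nat_fact_neq_0[OF char, of "p - m - 1"] m by simp
  show "del p m f w = 0"
  proof (cases "m = 0")
    case True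
    have "{0..<p} = insert 0 {Suc 0..<p}"
      using m by auto
    then show ?thesis
      using D0[OF w] True by (simp add: del_def)
  next
    case False
    \<comment> \<open>The known sum exchanges with position 0, \<open>del p m\<close> with position
      \<open>m\<close>; as \<open>f\<close> alternates in both, passing to \<open>?v\<close> costs
      only a sign.\<close>
    let ?v = "swp 0 m w"
    have v: "length ?v = p"
      using w by simp
    have "f (swp m s w) = - f (swp 0 s ?v)" if s: "s \<in> {Suc m..<p}" for s
    proof -
      have "swp 0 m (swp m s w) = swp 0 s ?v"
        using s w m False by (intro nth_equalityI) (auto simp: nth_swp)
      then show ?thesis
        using altD(1)[OF f(1), of "swp m s w" 0 m] w False by simp
    qed
    moreover have "f w = - f ?v"
      using altD(1)[OF f(1) w, of 0 m] False by simp
    ultimately have "del p m f w = - (f ?v + (\<Sum>s\<in>{Suc m..<p}. f (swp 0 s ?v)))"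
      using m by (simp add: del_first sum_negf)
    also have "f ?v + (\<Sum>s\<in>{Suc m..<p}. f (swp 0 s ?v)) = (\<Sum>s\<in>insert 0 {Suc m..<p}. f (swp 0 s ?v))"
      by (subst sum.insert) auto
    finally show ?thesis
      using D0[OF v] by simp
  qed
  assume const: "constant_word w"
  have "w' = w" if "length w' = p" "rho m w' = rho m w" for w'
  proof -
    have "mset w' = mset w"
      using rho_eq_iff[OF m that(1) w] that(2) by simp
    then have "set w' = set w"
      by (rule mset_eq_setD)
    then show ?thesis
      using const that(1) w unfolding constant_word_def by (intro nth_equalityI) (metis nth_mem)+
  qed
  then have "{w'. length w' = p \<and> rho m w' = rho m w} = {w}"
    using w by blast
  then show "f w = 0"
    using q[of "rho m w"] by (simp add: qop_def)
qed

text \<open>Going down from \<open>i = p\<close>, each step averages over the exchanges in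
  \<open>del p i\<close>, which \<open>qop\<close> does not see. The divisors \<open>p - i\<close>
  lie between 1 and \<open>p - m - 1\<close> and are therefore invertible.\<close>

lemma symmetrise:
  fixes f :: "nat list \<Rightarrow> 'k::field"
  assumes char: "CHAR('k) = p" and m: "m < p" and f: "f \<in> coords (words p n)" "alt_below p (Suc m) f"
  obtains g where "g \<in> tens p (Suc m) (Suc m) n" "qop p m g = qop p m f"
proof -
  have "\<exists>g\<in>tens p (Suc m) i n. qop p m g = qop p m f" if "Suc m \<le> i" "i \<le> p" for i
    using that
  proof (induction "p - i" arbitrary: i)
    case 0
    then have "sym_above p i f"
      by (simp add: sym_above_def)
    then show ?case
      using f by (auto simp: tens_def)
  next
    case (Suc k)
    have "\<exists>g\<in>tens p (Suc m) (Suc i) n. qop p m g = qop p m f"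
      using Suc.hyps(2) Suc.prems by (intro Suc.hyps(1)) simp_all
    then obtain g where g: "g \<in> tens p (Suc m) (Suc i) n" "qop p m g = qop p m f"
      by blast
    let ?c = "of_nat (p - i) :: 'k"
    have i: "i < p"
      using Suc.hyps(2) by simp
    have c: "?c \<noteq> 0"
      using of_nat_eq_0_char(2)[OF char, of "p - i"] i Suc.prems by simp
    have "del p i g \<in> tens p (Suc m) i n"
      using g(1) i Suc.prems unfolding tens_def by (auto intro: del_coords del_alt del_sym)
    then have "fscale (inverse ?c) (del p i g) \<in> tens p (Suc m) i n"
      by (rule fun_vs.subspace_scale[OF tens_subspace])
    moreover have "qop p m (fscale (inverse ?c) (del p i g)) = qop p m f"
    proof
      fix u
      show "qop p m (fscale (inverse ?c) (del p i g)) u = qop p m f u"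
        unfolding qop_scale fscale_apply using c g(2) qop_del[of m i p g u] i Suc.prems by simp
    qed
    ultimately show ?case by blast
  qed
  from this[of "Suc m"] show ?thesis
    using m that by auto
qed

lemma kap_mult: "kap j (\<lambda>v. c * f v) = (\<lambda>v. c * kap j f v)"
  by (simp add: fun_eq_iff kap_def right_diff_distrib sum_distrib_left)

text \<open>Up to the invertible factor \<open>fact i\<close> the composite is the antisymmetriser
  on \<open>i + 2\<close> positions. It kills \<open>g\<close>, which is symmetric in positions
  \<open>i\<close> and \<open>i + 1\<close>.\<close>

lemma kap_kap:
  fixes g :: "nat list \<Rightarrow> 'k::field"
  assumes char: "CHAR('k) = p" and i: "Suc i < p" and g: "g \<in> tens p i i n" and w: "length w = p"
  shows "kap (Suc i) (kap i g) w = 0"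
proof -
  have "asymm (Suc (Suc i)) g w = kap (Suc i) (asymm (Suc i) g) w"
    using w i by (intro asymm_Suc)
  also have "\<dots> = kap (Suc i) (kap i (asymm i g)) w"
    using i by (intro kap_cong[OF _ w] asymm_Suc) auto
  also have "\<dots> = kap (Suc i) (kap i (\<lambda>v. of_nat (fact i) * g v)) w"
    using i tensD(2)[OF g] by (intro kap_cong[OF _ w] kap_cong asymm_of_alt) auto
  also have "\<dots> = of_nat (fact i) * kap (Suc i) (kap i g) w"
    by (simp only: kap_mult)
  finally have 1: "asymm (Suc (Suc i)) g w = of_nat (fact i) * kap (Suc i) (kap i g) w" .
  have "asymm (Suc (Suc i)) g w = (\<Sum>v\<in>words p n. g v * asymm (Suc (Suc i)) (unit_vec v) w)"
    by (rule asymm_expand[OF tensD(1)[OF g]])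
  also have "\<dots> = (\<Sum>v\<in>words p n. g v * asymm (Suc (Suc i)) (unit_vec w) v)"
  proof (intro sum.cong refl)
    fix v assume "v \<in> words p n"
    then have "asymm (Suc (Suc i)) (unit_vec v) w = (asymm (Suc (Suc i)) (unit_vec w) v :: 'k)"
      using w i by (intro asymm_unit_sym[of _ p]) (auto dest: length_words)
    then show "g v * asymm (Suc (Suc i)) (unit_vec v) w = g v * asymm (Suc (Suc i)) (unit_vec w) v"
      by simp
  qed
  also have "\<dots> = 0"
  proof (rule sum_involution_zero[where \<tau> = "swp i (Suc i)"])
    have alt: "alt_below p (Suc (Suc i)) (asymm (Suc (Suc i)) (unit_vec w) :: nat list \<Rightarrow> 'k)"
      using i by (intro asymm_alt) simp
    fix v assume v: "v \<in> words p n"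
    then have len: "length v = p"
      by (rule length_words)
    show "swp i (Suc i) v \<in> words p n" "swp i (Suc i) (swp i (Suc i) v) = v"
      using v i len by (simp_all add: swp_words_iff)
    show "g (swp i (Suc i) v) * asymm (Suc (Suc i)) (unit_vec w) (swp i (Suc i) v) =
        - (g v * asymm (Suc (Suc i)) (unit_vec w) v)"
      using altD(1)[OF alt len, of i "Suc i"] symD[OF tensD(3)[OF g] len, of i "Suc i"] i by simp
    assume "swp i (Suc i) v = v"
    from arg_cong[OF this, of "\<lambda>x. x ! i"] have "v ! i = v ! Suc i"
      using len i by (simp add: nth_swp)
    then show "g v * asymm (Suc (Suc i)) (unit_vec w) v = 0"
      using altD(2)[OF alt len, of i "Suc i"] by simp
  qed simp
  finally show ?thesis
    using 1 of_nat_fact_neq_0[OF char, of i] i by simp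
qed

section \<open>A resolution of the Schur functor of a hook\<close>

text \<open>The terms \<open>\<Lambda>\<^sup>j \<otimes> \<Gamma>\<^bsup>p-j\<^esup>\<close> appear with \<open>j = 1, \<dots>, p - 1\<close>, linked by \<open>del\<close>, followed by
  \<open>j = p - 1, \<dots>, 0\<close>, linked by \<open>kap\<close>; the two halves are glued through \<open>\<Lambda>\<^sup>p\<close>. The tail of this
  sequence from position \<open>m + 1\<close> on resolves the Schur functor of the hook \<open>(m + 1, 1\<^bsup>p-m-1\<^esup>)\<close>.\<close>

definition zero_spf :: "nat \<Rightarrow> 'k::field pfun"
  where "zero_spf p = \<lparr>val = \<lambda>n. {0}, coef = coef (tensor_power p)\<rparr>"

definition hres :: "nat \<Rightarrow> nat \<Rightarrow> 'k::field pfun"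
  where "hres p a = (if a < p then ext_div p a else if a < 2 * p then ext_div p (2 * p - 1 - a) else zero_spf p)"

text \<open>In the second case \<open>2 * p - 2 - a\<close> is the index of the source. At
  \<open>a = p - 1\<close> it equals \<open>p - 1\<close>, which is the gluing map; past the end it
  is truncated to 0, but there the source is zero.\<close>

definition hop :: "nat \<Rightarrow> nat \<Rightarrow> (nat list \<Rightarrow> 'k::field) \<Rightarrow> nat list \<Rightarrow> 'k"
  where "hop p a = (if Suc a < p then del p a else kap (2 * p - 2 - a))"

definition hdiff :: "nat \<Rightarrow> nat \<Rightarrow> nat \<Rightarrow> (nat list \<Rightarrow> 'k::field) \<Rightarrow> nat list \<Rightarrow> 'k"
  where "hdiff p a = nt_of (hres p (Suc a)) (hop p a)"

lemma coef_zero: "coef (tensor_power p) m n \<mu> 0 = 0"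
  by (simp add: fun_eq_iff tensor_power_coef)

lemma is_spf_zero: "is_spf p (zero_spf p)"
  unfolding zero_spf_def
  by (intro is_spf_subfunctor) (auto simp: fun_vs.subspace_def coords_def coef_zero fscale_def)

lemma is_spf_hres: "is_spf p (hres p a)"
  by (auto simp: hres_def is_spf_zero intro!: is_spf_ext_div)

lemma hres_coef: "coef (hres p a) = coef (tensor_power p)"
  by (simp add: hres_def zero_spf_def)

lemma hres_val_low: "a < p \<Longrightarrow> val (hres p a) n = tens p a a n"
  by (simp add: hres_def)

lemma hres_val_high: "p \<le> a \<Longrightarrow> a < 2 * p \<Longrightarrow> val (hres p a) n = tens p (2 * p - 1 - a) (2 * p - 1 - a) n"
  by (simp add: hres_def)

lemma hres_val_zero: "2 * p \<le> a \<Longrightarrow> val (hres p a) n = {0}"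
  by (simp add: hres_def zero_spf_def)

lemma hres_coords: "f \<in> val (hres p a) n \<Longrightarrow> f \<in> coords (words p n)"
  by (auto simp: hres_def zero_spf_def tens_def coords_def split: if_splits)

lemma hop_add: "hop p a (f + g) = hop p a f + hop p a g"
  by (simp add: hop_def del_add kap_add)

lemma hop_scale: "hop p a (fscale c f) = fscale c (hop p a f)"
  by (simp add: hop_def del_scale kap_scale)

lemma hop_zero: "hop p a 0 = 0"
  by (simp add: hop_def fun_eq_iff del_def kap_def)

lemma hop_coef:
  assumes "p > 0"
  shows "coef (tensor_power p) m n \<mu> (hop p a f) = hop p a (coef (tensor_power p) m n \<mu> f)"
  using assms by (auto simp: hop_def coef_del coef_kap)

lemma hop_mem:
  assumes p: "p > 0" and f: "f \<in> val (hres p (Suc a)) n"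
  shows "hop p a f \<in> val (hres p a) n"
proof -
  consider "Suc a < p" | "Suc a = p" | "p \<le> a" "Suc a < 2 * p" | "2 * p \<le> Suc a"
    by linarith
  then show ?thesis
  proof cases
    case 1
    then have "f \<in> tens p (Suc a) (Suc a) n" "a < p"
      using f by (simp_all add: hres_val_low)
    then show ?thesis
      using 1 by (simp add: hop_def hres_val_low del_tens')
  next
    case 2
    then have f': "f \<in> tens p a a n" and a: "a = p - 1"
      using f p by (auto simp: hres_val_high)
    \<comment> \<open>At the gluing position \<open>kap\<close> takes values in
      \<open>\<Lambda>\<^sup>p\<close>, which is contained in the target.\<close>
    have "kap a f \<in> tens p (Suc a) (Suc a) n"
      using 2 by (intro kap_tens'[OF f']) simp
    then have "kap a f \<in> tens p p p n"
      using 2 by simp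
    then have "kap a f \<in> tens p a a n"
      unfolding a by (rule tens_p_mono)
    moreover have "2 * p - 2 - a = a"
      using 2 by simp
    ultimately show ?thesis
      using 2 by (simp add: hop_def hres_val_low)
  next
    case 3
    let ?j = "2 * p - 2 - a"
    have j: "?j < p" "2 * p - 1 - Suc a = ?j" "2 * p - 1 - a = Suc ?j"
      using 3 by auto
    then have "f \<in> tens p ?j ?j n"
      using f 3 by (simp add: hres_val_high)
    then have "kap ?j f \<in> tens p (Suc ?j) (Suc ?j) n"
      using j by (intro kap_tens')
    then show ?thesis
      using 3 j by (simp add: hop_def hres_val_high)
  next
    case 4
    then have "f = 0"
      using f by (simp add: hres_val_zero)
    then show ?thesis
      using fun_vs.subspace_0[OF lin_functorD(1)[OF is_spf_lin_functor[OF is_spf_hres]]] by (simp add: hop_zero)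
  qed
qed

lemma hdiff_nat_trans:
  assumes "p > 0"
  shows "(hdiff p a :: nat \<Rightarrow> (nat list \<Rightarrow> 'k::field) \<Rightarrow> _) \<in> nat_trans (hres p (Suc a)) (hres p a)"
  unfolding hdiff_def
proof (rule nt_of_nat_trans)
  show "lin_functor (hres p (Suc a) :: 'k pfun)"
    by (rule is_spf_lin_functor[OF is_spf_hres])
  show "hop p a v \<in> val (hres p a) n" if "v \<in> val (hres p (Suc a)) n" for n and v :: "nat list \<Rightarrow> 'k"
    by (rule hop_mem[OF assms that])
  show "hop p a (x + y) = hop p a x + hop p a y" for x y :: "nat list \<Rightarrow> 'k"
    by (rule hop_add)
  show "hop p a (fscale c x) = fscale c (hop p a x)" for c and x :: "nat list \<Rightarrow> 'k"
    by (rule hop_scale)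
  show "hop p a (coef (hres p (Suc a)) m n \<mu> v) = coef (hres p a) m n \<mu> (hop p a v)" for m n \<mu> and v :: "nat list \<Rightarrow> 'k"
    unfolding hres_coef by (rule hop_coef[OF assms, symmetric])
qed

lemma hdiff_image: "hdiff p a n ` val (hres p (Suc a)) n = hop p a ` val (hres p (Suc a)) n"
  by (simp add: hdiff_def nt_of_def)

lemma tens_length: "f \<in> tens p j i n \<Longrightarrow> length w \<noteq> p \<Longrightarrow> f w = 0"
  by (auto simp: tens_def coords_def dest: length_words)

text \<open>Both kernels are contained in the image by \<open>del_exact\<close>, where constant
  words are handled by \<open>qop_kernel\<close>, or by alternation if \<open>i > 0\<close>.
  Conversely, \<open>qop\<close> kills the image because that comes from tensors alternating in
  \<open>i + 2\<close> positions.\<close>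

lemma qop_zero_iff_image:
  fixes f :: "nat list \<Rightarrow> 'k::field"
  assumes char: "CHAR('k) = p" and i: "Suc i < p" and f: "f \<in> tens p (Suc i) (Suc i) n"
  shows "qop p i f = 0 \<longleftrightarrow> f \<in> hop p (Suc i) ` val (hres p (Suc (Suc i))) n"
    and "0 < i \<Longrightarrow> del p i f = 0 \<longleftrightarrow> f \<in> hop p (Suc i) ` val (hres p (Suc (Suc i))) n"
proof -
  have ex: "f \<in> hop p (Suc i) ` val (hres p (Suc (Suc i))) n"
    if d: "\<And>w. length w = p \<Longrightarrow> del p i f w = 0"
      and const: "\<And>w. length w = p \<Longrightarrow> constant_word w \<Longrightarrow> f w = 0"
  proof -
    obtain g where g: "g \<in> tens p (Suc i) (Suc (Suc i)) n" "f = del p (Suc i) (kap (Suc i) g)"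
      using del_exact[OF char i f d const] by blast
    have kg: "kap (Suc i) g \<in> tens p (Suc (Suc i)) (Suc (Suc i)) n"
      by (rule kap_tens[OF g(1) i])
    show ?thesis
    proof (cases "Suc (Suc i) < p")
      case True
      then show ?thesis
        using kg g(2) by (auto simp: hop_def hres_val_low)
    next
      case False
      then have p: "p = Suc (Suc i)"
        using i by simp
      \<comment> \<open>For \<open>i = p - 2\<close> the outer \<open>del p (p - 1)\<close> has a
        single summand and is the identity, so \<open>f\<close> is in the image of the gluing
        map.\<close>
      have "f = kap (Suc i) g"
      proof (rule coords_eqI[OF tensD(1)[OF f] tensD(1)[OF kg]])
        fix w :: "nat list" assume w: "length w = p"
        have "{Suc i..<p} = {Suc i}"
          using p by auto
        then show "f w = kap (Suc i) g w"
          unfolding g(2) del_def by simp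
      qed
      moreover have "g \<in> tens p (Suc i) (Suc i) n"
        using g(1) p unfolding tens_def sym_above_def by auto
      ultimately show ?thesis
        using p by (auto simp: hop_def hres_val_high)
    qed
  qed
  have im: "qop p i f = 0" if im: "f \<in> hop p (Suc i) ` val (hres p (Suc (Suc i))) n"
  proof (cases "Suc (Suc i) < p")
    case True
    then obtain g where g: "g \<in> tens p (Suc (Suc i)) (Suc (Suc i)) n" "f = del p (Suc i) g"
      using im by (auto simp: hop_def hres_val_low)
    show ?thesis
    proof
      fix u
      have "qop p i f u = of_nat (p - Suc i) * qop p i g u"
        unfolding g(2) using i by (intro qop_del) auto
      then show "qop p i f u = 0 u"
        using qop_alt_zero[OF tensD(2)[OF g(1)], of u] i by simp
    qed
  next
    case False
    then have p: "p = Suc (Suc i)"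
      using i by simp
    then obtain g where g: "g \<in> tens p (Suc i) (Suc i) n" "f = kap (Suc i) g"
      using im by (auto simp: hop_def hres_val_high)
    have "f \<in> tens p (Suc (Suc i)) (Suc (Suc i)) n"
      unfolding g(2) by (rule kap_tens'[OF g(1) i])
    then show ?thesis
      using qop_alt_zero[OF tensD(2) i] by (intro ext) (simp only: zero_fun_apply)
  qed
  have ker: "del p i f w = 0" "constant_word w \<Longrightarrow> f w = 0" if "qop p i f = 0" "length w = p" for w
    using qop_kernel[OF char _ tensD(2,3)[OF f] _ that(2)] i that(1) by simp_all
  show "qop p i f = 0 \<longleftrightarrow> f \<in> hop p (Suc i) ` val (hres p (Suc (Suc i))) n"
    using ex im ker by blast
  show "del p i f = 0 \<longleftrightarrow> f \<in> hop p (Suc i) ` val (hres p (Suc (Suc i))) n" if "0 < i"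
  proof
    assume d: "del p i f = 0"
    show "f \<in> hop p (Suc i) ` val (hres p (Suc (Suc i))) n"
    proof (rule ex)
      show "del p i f w = 0" for w
        unfolding d by simp
      show "f w = 0" if "length w = p" "constant_word w" for w
        using alt_constant_word[OF tensD(2)[OF f] that(1) _ _ that(2)] \<open>0 < i\<close> i by simp
    qed
  next
    assume "f \<in> hop p (Suc i) ` val (hres p (Suc (Suc i))) n"
    then have q: "qop p i f = 0"
      by (rule im)
    have "del p i f \<in> tens p i i n"
      using i by (intro del_tens'[OF f]) simp
    note d = this
    show "del p i f = 0"
    proof
      fix w show "del p i f w = 0 w"
        by (cases "length w = p") (simp_all add: ker(1)[OF q] tens_length[OF d])
    qed
  qed
qed

lemma kap_zero_iff_image:
  fixes f :: "nat list \<Rightarrow> 'k::field"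
  assumes char: "CHAR('k) = p" and i: "Suc i < p" and f: "f \<in> tens p (Suc i) (Suc i) n"
  shows "kap (Suc i) f = 0 \<longleftrightarrow> f \<in> kap i ` tens p i i n"
proof
  assume k: "kap (Suc i) f = 0"
  then have "kap (Suc i) f w = 0" for w
    by simp
  then show "f \<in> kap i ` tens p i i n"
    using kap_exact[OF char i f] by blast
next
  assume "f \<in> kap i ` tens p i i n"
  then obtain g where g: "g \<in> tens p i i n" "f = kap i g" by blast
  have kf: "kap (Suc i) f \<in> tens p (Suc (Suc i)) (Suc (Suc i)) n"
    by (rule kap_tens'[OF f i])
  show "kap (Suc i) f = 0"
  proof
    fix w show "kap (Suc i) f w = 0 w"
      using kap_kap[OF char i g(1), of w] tens_length[OF kf, of w] unfolding g(2)
      by (cases "length w = p") auto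
  qed
qed

text \<open>The condition \<open>b > 0\<close> leaves out the differential \<open>del p 0\<close>:
  its kernel contains tensors supported on constant words, because \<open>p\<close> is 0 in
  \<open>k\<close>, and the preceding differential does not reach them.\<close>

lemma hres_exact:
  assumes char: "CHAR('k::field) = p" and p: "p > 0" and b: "b > 0"
  shows "hdiff p (Suc b) n ` val (hres p (Suc (Suc b))) n =
    {v \<in> val (hres p (Suc b)) n. hdiff p b n v = (0 :: nat list \<Rightarrow> 'k)}"
proof -
  have e: "hdiff p b n v = hop p b v" if "v \<in> val (hres p (Suc b)) n" for v :: "nat list \<Rightarrow> 'k"
    using that by (simp add: hdiff_def nt_of_def)
  have z: "hop p b v = 0 \<longleftrightarrow> v \<in> hop p (Suc b) ` val (hres p (Suc (Suc b))) n"
    if v: "v \<in> val (hres p (Suc b)) n" for v :: "nat list \<Rightarrow> 'k"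
  proof -
    consider "Suc b < p" | "p \<le> Suc b" "Suc b < 2 * p - 1" | "Suc b = 2 * p - 1" | "2 * p \<le> Suc b"
      by linarith
    then show ?thesis
    proof cases
      case 1
      then show ?thesis
        using qop_zero_iff_image(2)[OF char 1 _ b] v by (simp add: hop_def hres_val_low)
    next
      case 2
      let ?i = "2 * p - 2 - Suc b"
      have i: "Suc ?i < p" "2 * p - 1 - Suc b = Suc ?i" "2 * p - 2 - b = Suc ?i" "2 * p - 1 - Suc (Suc b) = ?i"
        using 2 b by auto
      have v': "v \<in> tens p (Suc ?i) (Suc ?i) n"
        using v 2 i by (simp add: hres_val_high)
      have "hop p b v = kap (Suc ?i) v" "hop p (Suc b) = (kap ?i :: (nat list \<Rightarrow> 'k) \<Rightarrow> _)"
        "val (hres p (Suc (Suc b))) n = (tens p ?i ?i n :: (nat list \<Rightarrow> 'k) set)"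
        using 2 i by (simp_all add: hop_def hres_val_high)
      then show ?thesis
        using kap_zero_iff_image[OF char i(1) v'] by simp
    next
      case 3
      then have "\<not> Suc b < p" "2 * p - 2 - b = 0"
        using p by auto
      then have "hop p b v = kap 0 v"
        by (simp add: hop_def)
      moreover have "val (hres p (Suc (Suc b))) n = ({0} :: (nat list \<Rightarrow> 'k) set)"
        using 3 by (simp add: hres_val_zero)
      moreover have "kap 0 v = v"
        by (simp add: kap_def fun_eq_iff)
      ultimately show ?thesis
        by (simp add: hop_zero)
    next
      case 4
      then show ?thesis
        using v by (simp add: hres_val_zero hop_zero)
    qed
  qed
  show ?thesis
    unfolding hdiff_image
  proof (intro set_eqI iffI)
    fix v :: "nat list \<Rightarrow> 'k" assume v: "v \<in> hop p (Suc b) ` val (hres p (Suc (Suc b))) n"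
    then have mem: "v \<in> val (hres p (Suc b)) n"
      using hop_mem[OF p] by blast
    then show "v \<in> {v \<in> val (hres p (Suc b)) n. hdiff p b n v = 0}"
      unfolding mem_Collect_eq e[OF mem] z[OF mem] using v by blast
  next
    fix v :: "nat list \<Rightarrow> 'k" assume "v \<in> {v \<in> val (hres p (Suc b)) n. hdiff p b n v = 0}"
    then have v: "v \<in> val (hres p (Suc b)) n" "hdiff p b n v = 0"
      by (simp_all only: mem_Collect_eq)
    show "v \<in> hop p (Suc b) ` val (hres p (Suc (Suc b))) n"
      using v(2) unfolding e[OF v(1)] z[OF v(1)] .
  qed
qed

section \<open>The augmentation\<close>

definition heps :: "nat \<Rightarrow> nat \<Rightarrow> (nat list \<Rightarrow> 'k::field) \<Rightarrow> nat list \<Rightarrow> 'k"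
  where "heps p m f = qop p m (if Suc m < p then f else kap m f)"

lemma tens_asymm:
  fixes f :: "nat list \<Rightarrow> 'k::field"
  assumes char: "CHAR('k) = p" and j: "j < p" and f: "f \<in> tens p j i n"
  obtains g where "g \<in> coords (words p n)" "f = asymm j g"
proof -
  let ?g = "fscale (inverse (of_nat (fact j))) f"
  have g: "?g \<in> tens p j i n"
    by (rule fun_vs.subspace_scale[OF tens_subspace f])
  have "f = asymm j ?g"
  proof (rule coords_eqI[OF tensD(1)[OF f]])
    show "asymm j ?g \<in> coords (words p n)"
      using j by (intro asymm_coords tensD(1)[OF g]) simp
    fix w :: "nat list" assume w: "length w = p"
    have "asymm j ?g w = of_nat (fact j) * ?g w"
      using j by (intro asymm_of_alt[OF tensD(2)[OF g] _ w]) simp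
    then show "f w = asymm j ?g w"
      using of_nat_fact_neq_0[OF char j] by (simp add: fscale_apply)
  qed
  then show ?thesis
    using that tensD(1)[OF g] by blast
qed

lemma asymm_Suc_fun:
  assumes "f \<in> coords (words p n)" "j < p"
  shows "asymm (Suc j) f = kap j (asymm j f)"
proof (rule coords_eqI)
  show "asymm (Suc j) f \<in> coords (words p n)" "kap j (asymm j f) \<in> coords (words p n)"
    using assms by (auto intro!: asymm_coords kap_coords)
  show "asymm (Suc j) f w = kap j (asymm j f) w" if "length w = p" for w
    by (rule asymm_Suc[OF that assms(2)])
qed

text \<open>An antisymmetrised tensor need not be symmetric in the remaining positions;
  \<open>symmetrise\<close> replaces it by an element of the term with the same image. For
  \<open>m = p - 1\<close> at most one position remains, and \<open>kap m\<close> supplies the last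
  step of antisymmetrisation.\<close>

lemma heps_image:
  assumes char: "CHAR('k::field) = p" and m: "m < p"
  shows "heps p m ` val (hres p (Suc m)) n = (val (schur_functor (hook p m)) n :: (nat list \<Rightarrow> 'k) set)"
proof (cases "Suc m < p")
  case True
  have h: "heps p m = (qop p m :: (nat list \<Rightarrow> 'k) \<Rightarrow> _)"
    using True by (simp add: heps_def fun_eq_iff)
  show ?thesis
    unfolding schur_hook_val[OF m] h hres_val_low[OF True]
  proof
    show "qop p m ` tens p (Suc m) (Suc m) n \<subseteq> qop p m ` asymm (Suc m) ` (coords (words p n) :: (nat list \<Rightarrow> 'k) set)"
      using tens_asymm[OF char True] by blast
    show "qop p m ` asymm (Suc m) ` (coords (words p n) :: (nat list \<Rightarrow> 'k) set) \<subseteq> qop p m ` tens p (Suc m) (Suc m) n"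
    proof
      fix y :: "nat list \<Rightarrow> 'k" assume "y \<in> qop p m ` asymm (Suc m) ` coords (words p n)"
      then obtain f where f: "f \<in> coords (words p n)" "y = qop p m (asymm (Suc m) f)" by blast
      have "asymm (Suc m) f \<in> coords (words p n)" "alt_below p (Suc m) (asymm (Suc m) f)"
        using m f(1) by (auto intro!: asymm_coords asymm_alt)
      then obtain g where "g \<in> tens p (Suc m) (Suc m) n" "qop p m g = qop p m (asymm (Suc m) f)"
        by (rule symmetrise[OF char m])
      then show "y \<in> qop p m ` tens p (Suc m) (Suc m) n"
        unfolding f(2) by (metis image_eqI)
    qed
  qed
next
  case False
  then have p: "p = Suc m"
    using m by simp
  have h: "heps p m f = qop p m (kap m f)" for f :: "nat list \<Rightarrow> 'k"
    using p by (simp add: heps_def)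
  have v: "val (hres p (Suc m)) n = (tens p m m n :: (nat list \<Rightarrow> 'k) set)"
    using p by (simp add: hres_val_high)
  have "kap m ` tens p m m n = asymm (Suc m) ` (coords (words p n) :: (nat list \<Rightarrow> 'k) set)"
  proof
    show "kap m ` tens p m m n \<subseteq> asymm (Suc m) ` (coords (words p n) :: (nat list \<Rightarrow> 'k) set)"
    proof
      fix y :: "nat list \<Rightarrow> 'k" assume "y \<in> kap m ` tens p m m n"
      then obtain f where f: "f \<in> tens p m m n" "y = kap m f" by blast
      obtain g where g: "g \<in> coords (words p n)" "f = asymm m g"
        by (rule tens_asymm[OF char m f(1)])
      show "y \<in> asymm (Suc m) ` coords (words p n)"
        unfolding f(2) g(2) asymm_Suc_fun[OF g(1) m, symmetric] using g(1) by blast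
    qed
    show "asymm (Suc m) ` (coords (words p n) :: (nat list \<Rightarrow> 'k) set) \<subseteq> kap m ` tens p m m n"
    proof
      fix y :: "nat list \<Rightarrow> 'k" assume "y \<in> asymm (Suc m) ` coords (words p n)"
      then obtain f where f: "f \<in> coords (words p n)" "y = asymm (Suc m) f" by blast
      have "sym_above p m (asymm m f)"
        using p by (simp add: sym_above_def)
      then have "asymm m f \<in> tens p m m n"
        using m asymm_coords[OF f(1), of m] asymm_alt[of m p f] by (simp add: tens_def)
      then show "y \<in> kap m ` tens p m m n"
        unfolding f(2) asymm_Suc_fun[OF f(1) m] by blast
    qed
  qed
  moreover have "heps p m ` tens p m m n = qop p m ` kap m ` (tens p m m n :: (nat list \<Rightarrow> 'k) set)"
    unfolding image_image by (intro image_cong refl h)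
  ultimately show ?thesis
    unfolding schur_hook_val[OF m] v by (simp only:)
qed

lemma rho_last: "length w = Suc m \<Longrightarrow> rho m w = w"
  by (cases w) (auto simp: rho_def)

lemma qop_last: "length w = Suc m \<Longrightarrow> qop (Suc m) m f w = f w"
proof -
  assume w: "length w = Suc m"
  have "{v. length v = Suc m \<and> rho m v = w} = {w}"
    using w rho_last by force
  then show ?thesis
    by (simp add: qop_def)
qed

lemma heps_kernel:
  assumes char: "CHAR('k::field) = p" and m: "m < p"
  shows "hdiff p (Suc m) n ` val (hres p (Suc (Suc m))) n =
    {v \<in> val (hres p (Suc m)) n. heps p m v = (0 :: nat list \<Rightarrow> 'k)}"
proof -
  have p: "p > 0" using m by simp
  have z: "heps p m v = 0 \<longleftrightarrow> v \<in> hop p (Suc m) ` val (hres p (Suc (Suc m))) n"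
    if v: "v \<in> val (hres p (Suc m)) n" for v :: "nat list \<Rightarrow> 'k"
  proof (cases "Suc m < p")
    case True
    then show ?thesis
      using qop_zero_iff_image(1)[OF char True, of v n] v by (simp add: heps_def hres_val_low)
  next
    case False
    then have pm: "p = Suc m"
      using m by simp
    \<comment> \<open>A characteristic is never 1, so \<open>m = p - 1\<close> is positive and the
      term with index \<open>m - 1\<close> exists.\<close>
    moreover have "p \<noteq> 1"
      using CHAR_not_1'[where ?'a = 'k] char by simp
    ultimately obtain i where i: "m = Suc i"
      by (cases m) auto
    have v': "v \<in> tens p (Suc i) (Suc i) n"
      using v pm i by (simp add: hres_val_high)
    have kv: "kap m v \<in> tens p (Suc m) (Suc m) n"
      using v' m unfolding i by (intro kap_tens')
    have "heps p m v = 0 \<longleftrightarrow> kap m v = 0"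
    proof
      assume h: "heps p m v = 0"
      show "kap m v = 0"
      proof
        fix w show "kap m v w = 0 w"
          using fun_cong[OF h, of w] qop_last[of w m "kap m v"] tens_length[OF kv, of w] pm
          by (cases "length w = p") (auto simp: heps_def)
      qed
    next
      assume "kap m v = 0"
      then show "heps p m v = 0"
        using pm by (simp add: heps_def qop_def fun_eq_iff)
    qed
    also have "\<dots> \<longleftrightarrow> v \<in> kap i ` tens p i i n"
      unfolding i using m i by (intro kap_zero_iff_image[OF char _ v']) simp
    also have "kap i ` tens p i i n = hop p (Suc m) ` val (hres p (Suc (Suc m))) n"
      using pm i by (simp add: hop_def hres_val_high)
    finally show ?thesis .
  qed
  show ?thesis
    unfolding hdiff_image
  proof (intro set_eqI iffI)
    fix v :: "nat list \<Rightarrow> 'k" assume v: "v \<in> hop p (Suc m) ` val (hres p (Suc (Suc m))) n"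
    then have mem: "v \<in> val (hres p (Suc m)) n"
      using hop_mem[OF p] by blast
    then show "v \<in> {v \<in> val (hres p (Suc m)) n. heps p m v = 0}"
      unfolding mem_Collect_eq z[OF mem] using v by blast
  next
    fix v :: "nat list \<Rightarrow> 'k" assume "v \<in> {v \<in> val (hres p (Suc m)) n. heps p m v = 0}"
    then have v: "v \<in> val (hres p (Suc m)) n" "heps p m v = 0"
      by (simp_all only: mem_Collect_eq)
    show "v \<in> hop p (Suc m) ` val (hres p (Suc (Suc m))) n"
      using v(2) unfolding z[OF v(1)] .
  qed
qed

lemma heps_nat_trans:
  assumes char: "CHAR('k::field) = p" and m: "m < p"
  shows "nt_epi (hres p (Suc m)) (schur_functor (hook p m) :: 'k pfun) (nt_of (hres p (Suc m)) (heps p m))"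
  unfolding nt_epi_def
proof (intro conjI allI)
  let ?F = "hres p (Suc m) :: 'k pfun" and ?S = "schur_functor (hook p m) :: 'k pfun"
  show "nt_of ?F (heps p m) n ` val ?F n = val ?S n" for n
    using heps_image[OF char m, of n] by (simp add: nt_of_def)
  show "nt_of ?F (heps p m) \<in> nat_trans ?F ?S"
  proof (rule nt_of_nat_trans)
    show "lin_functor ?F"
      by (rule is_spf_lin_functor[OF is_spf_hres])
    show "heps p m v \<in> val ?S n" if "v \<in> val ?F n" for n v
      using heps_image[OF char m, of n] that by blast
    show "heps p m (x + y) = heps p m x + heps p m y" for x y :: "nat list \<Rightarrow> 'k"
      by (simp add: heps_def qop_add kap_add)
    show "heps p m (fscale c x) = fscale c (heps p m x)" for c and x :: "nat list \<Rightarrow> 'k"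
      by (simp add: heps_def qop_scale kap_scale)
    show "heps p m (coef ?F a b \<mu> v) = coef ?S a b \<mu> (heps p m v)" if v: "v \<in> val ?F a" for a b \<mu> v
    proof -
      have "v \<in> coords (words p a)" "kap m v \<in> coords (words p a)"
        using hres_coords[OF v] kap_coords[OF _ m] by auto
      note vc = this
      show ?thesis
        unfolding hres_coef schur_hook_coef[OF m] heps_def
        by (cases "Suc m < p")
          (simp_all only: if_True if_False coef_kap[OF m, symmetric] coef_sym_power_qop[OF m vc(1)] coef_sym_power_qop[OF m vc(2)])
    qed
  qed
qed

lemma is_spf_epi:
  assumes E: "is_spf e E" and \<beta>: "nt_epi E (F :: ('c, 'k::field) spf) \<beta>"
  shows "is_spf e F"
proof -
  have "spf_image E F \<beta> = F"
    using \<beta> by (intro spf.equality) (auto simp: spf_image_def nt_epi_def fun_eq_iff)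
  then show ?thesis
    using is_spf_image[OF E, of \<beta> F] \<beta> by (simp add: nt_epi_def)
qed

lemma is_spf_schur_hook:
  assumes char: "CHAR('k::field) = p" and m: "m < p"
  shows "is_spf p (schur_functor (hook p m) :: 'k pfun)"
  by (rule is_spf_epi[OF is_spf_hres heps_nat_trans[OF char m]])

lemma projective_zero: "projective p (zero_spf p :: 'k::field pfun)"
  unfolding projective_def
proof (intro conjI allI impI is_spf_zero)
  fix E F :: "'k pfun" and \<beta> \<gamma>
  assume as: "is_spf p E \<and> is_spf p F \<and> nt_epi E F \<beta> \<and> \<gamma> \<in> nat_trans (zero_spf p) F"
  then have \<beta>: "\<beta> \<in> nat_trans E F" and \<gamma>: "\<gamma> \<in> nat_trans (zero_spf p) F"
    by (auto simp: nt_epi_def)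
  have "\<gamma> n v = 0" for n v
  proof (cases "v = 0")
    case False
    then have "v \<notin> val (zero_spf p) n"
      by (simp add: zero_spf_def)
    then show ?thesis
      by (rule nat_transD(2)[OF \<gamma>])
  qed (simp only: nat_trans_zero_vec'[OF \<gamma>])
  then have "\<beta> \<circ>\<^sub>N 0 = \<gamma>"
    using nat_trans_zero_vec'[OF \<beta>] by (intro ext) (simp only: nt_comp_apply zero_fun_apply)
  moreover have "0 \<in> nat_trans (zero_spf p) E"
    using as by (intro nat_trans_zero is_spf_lin_functor[of p]) simp
  ultimately show "\<exists>\<delta>\<in>nat_trans (zero_spf p) E. \<beta> \<circ>\<^sub>N \<delta> = \<gamma>"
    by blast
qed

lemma hres_proj_resolution:
  assumes char: "CHAR('k::field) = p" and m: "m < p"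
    and proj: "\<And>j. j < p \<Longrightarrow> projective p (ext_div p j :: 'k pfun)"
  shows "proj_resolution p (schur_functor (hook p m) :: 'k pfun) (\<lambda>i. hres p (Suc m + i))
    (\<lambda>i. hdiff p (Suc m + i)) (nt_of (hres p (Suc m)) (heps p m))"
  unfolding proj_resolution_def
proof (intro conjI allI)
  have p: "p > 0" using m by simp
  show "projective p (hres p (Suc m + i) :: 'k pfun)" for i
    by (auto simp: hres_def intro!: proj projective_zero)
  show "hdiff p (Suc m + i) \<in> nat_trans (hres p (Suc m + Suc i)) (hres p (Suc m + i) :: 'k pfun)" for i
    using hdiff_nat_trans[OF p, of "Suc m + i"] by simp
  show "nt_epi (hres p (Suc m + 0)) (schur_functor (hook p m) :: 'k pfun) (nt_of (hres p (Suc m)) (heps p m))"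
    using heps_nat_trans[OF char m] by simp
  show "hdiff p (Suc m + 0) n ` val (hres p (Suc m + 1)) n =
      {v \<in> val (hres p (Suc m + 0)) n. nt_of (hres p (Suc m)) (heps p m) n v = (0 :: nat list \<Rightarrow> 'k)}" for n
    using heps_kernel[OF char m, of n] by (auto simp: nt_of_def)
  show "hdiff p (Suc m + Suc i) n ` val (hres p (Suc m + Suc (Suc i))) n =
      {v \<in> val (hres p (Suc m + Suc i)) n. hdiff p (Suc m + i) n v = (0 :: nat list \<Rightarrow> 'k)}" for i n
    using hres_exact[OF char p, of "Suc m + i" n] by simp
qed

section \<open>Projectivity\<close>

text \<open>For \<open>j < p\<close> the functor \<open>\<Lambda>\<^sup>j \<otimes> \<Gamma>\<^bsup>p-j\<^esup>\<close> is generated by the antisymmetrisation of the word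
  \<open>0 1 \<dots> j-1 j j \<dots> j\<close>, and this generator can be sent to an arbitrary element: by Yoneda's lemma
  the functor is a direct summand of a representable one.\<close>

definition base_word :: "nat \<Rightarrow> nat \<Rightarrow> nat list"
  where "base_word p j = [0..<j] @ replicate (p - j) j"

definition gen_vec :: "nat \<Rightarrow> nat \<Rightarrow> nat list \<Rightarrow> 'k::field"
  where "gen_vec p j = asymm j (unit_vec (base_word p j))"

text \<open>The monomial in front of \<open>u\<close> in the image of the base word under a generic
  matrix.\<close>

definition base_mon :: "nat \<Rightarrow> nat \<Rightarrow> nat list \<Rightarrow> (nat \<times> nat) multiset"
  where "base_mon p j u = mset (zip u (base_word p j))"

definition tail_sort :: "nat \<Rightarrow> nat list \<Rightarrow> nat list"
  where "tail_sort j u = take j u @ sort (drop j u)"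

text \<open>Representatives of the words up to permutations of the symmetric positions; an element
  of \<open>tens p j j n\<close> is determined by its values on them.\<close>

definition tail_sorted :: "nat \<Rightarrow> nat \<Rightarrow> nat \<Rightarrow> nat list set"
  where "tail_sorted p j n = {u \<in> words p n. sorted (drop j u)}"

lemma length_base_word [simp]: "j \<le> p \<Longrightarrow> length (base_word p j) = p"
  by (simp add: base_word_def)

lemma base_word_words: "j \<le> p \<Longrightarrow> base_word p j \<in> words p (Suc j)"
  by (auto simp: words_def base_word_def)

lemma base_word_nth: "i < p \<Longrightarrow> j \<le> p \<Longrightarrow> base_word p j ! i = (if i < j then i else j)"
  by (simp add: base_word_def nth_append)

lemma finite_tail_sorted [simp]: "finite (tail_sorted p j n)"
  by (simp add: tail_sorted_def)

lemma base_mon_split: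
  assumes "j \<le> p" "length u = p"
  shows "base_mon p j u = mset (zip (take j u) [0..<j]) + image_mset (\<lambda>x. (x, j)) (mset (drop j u))"
proof -
  have "zip u (base_word p j) = zip (take j u @ drop j u) ([0..<j] @ replicate (p - j) j)"
    by (simp add: base_word_def)
  also have "\<dots> = zip (take j u) [0..<j] @ zip (drop j u) (replicate (p - j) j)"
    using assms by (intro zip_append) simp
  also have "zip (drop j u) (replicate (p - j) j) = map (\<lambda>x. (x, j)) (drop j u)"
    using assms by (simp add: zip_replicate2)
  finally show ?thesis
    by (simp add: base_mon_def)
qed

text \<open>The letters below \<open>j\<close> of the base word are distinct and mark the first
  \<open>j\<close> positions; the repeated letter \<open>j\<close> records the letters in the other
  positions without their order.\<close>

lemma base_mon_eq_iff:
  assumes j: "j \<le> p" and u: "length u = p" "length v = p"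
  shows "base_mon p j u = base_mon p j v \<longleftrightarrow> take j u = take j v \<and> mset (drop j u) = mset (drop j v)"
proof
  assume eq: "base_mon p j u = base_mon p j v"
  have low: "filter_mset (\<lambda>x. snd x < j) (base_mon p j w) = mset (zip (take j w) [0..<j])"
    and high: "filter_mset (\<lambda>x. snd x = j) (base_mon p j w) = image_mset (\<lambda>x. (x, j)) (mset (drop j w))"
    if "length w = p" for w
  proof -
    have s: "snd x < j" if "x \<in># mset (zip (take j w) [0..<j])" for x
      using that by (cases x) (auto dest: set_zip_rightD)
    have "filter_mset (\<lambda>x. snd x < j) (mset (zip (take j w) [0..<j])) = mset (zip (take j w) [0..<j])"
      using s by (simp add: filter_mset_eq_conv)
    moreover have "filter_mset (\<lambda>x. snd x < j) (image_mset (\<lambda>x. (x, j)) (mset (drop j w))) = {#}"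
      by (simp add: filter_mset_image_mset)
    ultimately show "filter_mset (\<lambda>x. snd x < j) (base_mon p j w) = mset (zip (take j w) [0..<j])"
      unfolding base_mon_split[OF j that] filter_union_mset by (simp only: add_0_right)
    have "filter_mset (\<lambda>x. snd x = j) (mset (zip (take j w) [0..<j])) = {#}"
      using s by (auto simp: filter_mset_eq_conv)
    moreover have "filter_mset (\<lambda>x. snd x = j) (image_mset (\<lambda>x. (x, j)) (mset (drop j w))) =
        image_mset (\<lambda>x. (x, j)) (mset (drop j w))"
      by (simp add: filter_mset_image_mset)
    ultimately show "filter_mset (\<lambda>x. snd x = j) (base_mon p j w) = image_mset (\<lambda>x. (x, j)) (mset (drop j w))"
      unfolding base_mon_split[OF j that] filter_union_mset by (simp only: add_0_left)
  qed
  have "mset (zip (take j u) [0..<j]) = mset (zip (take j v) [0..<j])"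
    unfolding low[OF u(1), symmetric] low[OF u(2), symmetric] eq ..
  then have set: "set (zip (take j u) [0..<j]) = set (zip (take j v) [0..<j])"
    by (rule mset_eq_setD)
  have "take j u = take j v"
  proof (rule nth_equalityI)
    show "length (take j u) = length (take j v)"
      using u by simp
    fix i assume i: "i < length (take j u)"
    then have "(take j u ! i, i) \<in> set (zip (take j u) [0..<j])"
      using u j by (auto simp: in_set_zip intro!: exI[of _ i])
    then show "take j u ! i = take j v ! i"
      unfolding set using i by (auto simp: in_set_zip)
  qed
  moreover have "image_mset (\<lambda>x. (x, j)) (mset (drop j u)) = image_mset (\<lambda>x. (x, j)) (mset (drop j v))"
    unfolding high[OF u(1), symmetric] high[OF u(2), symmetric] eq ..
  from arg_cong[OF this, of "image_mset fst"] have "mset (drop j u) = mset (drop j v)"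
    by (simp only: multiset.map_comp o_def fst_conv image_mset.identity multiset.map_ident id_apply)
  ultimately show "take j u = take j v \<and> mset (drop j u) = mset (drop j v)" ..
next
  assume "take j u = take j v \<and> mset (drop j u) = mset (drop j v)"
  then show "base_mon p j u = base_mon p j v"
    unfolding base_mon_split[OF j u(1)] base_mon_split[OF j u(2)] by (elim conjE) (simp only:)
qed

lemma tail_sort_facts:
  assumes "j \<le> p" "length u = p"
  shows "length (tail_sort j u) = p" "take j (tail_sort j u) = take j u"
    "mset (drop j (tail_sort j u)) = mset (drop j u)" "sorted (drop j (tail_sort j u))"
    "set (tail_sort j u) = set u"
proof -
  have l: "length (take j u) = j"
    using assms by simp
  show "length (tail_sort j u) = p" "take j (tail_sort j u) = take j u"
    "mset (drop j (tail_sort j u)) = mset (drop j u)" "sorted (drop j (tail_sort j u))"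
    using assms l by (simp_all add: tail_sort_def)
  have "set (take j u) \<union> set (drop j u) = set u"
    by (metis append_take_drop_id set_append)
  then show "set (tail_sort j u) = set u"
    by (simp add: tail_sort_def)
qed

lemma tail_sort_mem:
  assumes "j \<le> p" "u \<in> words p n"
  shows "tail_sort j u \<in> tail_sorted p j n"
  using assms tail_sort_facts[OF assms(1), of u] by (simp add: tail_sorted_def words_def)

lemma base_mon_fibre:
  assumes j: "j \<le> p" and v: "v \<in> words p n"
  shows "{u \<in> tail_sorted p j n. base_mon p j v = base_mon p j u} = {tail_sort j v}"
proof -
  have len: "length v = p"
    by (rule length_words[OF v])
  note f = tail_sort_facts[OF j len]
  have "u = tail_sort j v" if u: "u \<in> tail_sorted p j n" "base_mon p j v = base_mon p j u" for u
  proof -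
    have lu: "length u = p" "sorted (drop j u)"
      using u(1) by (auto simp: tail_sorted_def dest: length_words)
    have e: "take j v = take j u" "mset (drop j v) = mset (drop j u)"
      using base_mon_eq_iff[OF j len lu(1)] u(2) by auto
    have "sort (drop j v) = drop j u"
      using lu(2) e(2) by (intro properties_for_sort) simp_all
    then show ?thesis
      unfolding tail_sort_def e(1) by (simp only: append_take_drop_id)
  qed
  moreover have "base_mon p j v = base_mon p j (tail_sort j v)"
    using base_mon_eq_iff[OF j len f(1)] f(2,3) by simp
  ultimately show ?thesis
    using tail_sort_mem[OF j v] by blast
qed

lemma sum_base_mon_fibre:
  assumes j: "j \<le> p" and v: "v \<in> words p n" and f: "sym_above p j f"
  shows "(\<Sum>u | u \<in> tail_sorted p j n \<and> base_mon p j v = base_mon p j u. f u) = f v"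
proof -
  have len: "length v = p"
    by (rule length_words[OF v])
  note t = tail_sort_facts[OF j len]
  have "f (tail_sort j v) = f v"
    using t len by (intro sym_above_mset[OF f]) auto
  then show ?thesis
    unfolding base_mon_fibre[OF j v] by simp
qed

section \<open>Yoneda maps and the lifting property\<close>

lemma monomial_words:
  assumes "\<rho> \<in> monomials e m n"
  obtains u y where "u \<in> words e n" "y \<in> words e m" "\<rho> = mset (zip u y)"
proof -
  obtain xs where xs: "mset xs = \<rho>"
    using ex_mset by blast
  then have "length xs = e" "set xs \<subseteq> {..<n} \<times> {..<m}"
    using assms by (auto simp: monomials_def)
  then have "map fst xs \<in> words e n" "map snd xs \<in> words e m" "\<rho> = mset (zip (map fst xs) (map snd xs))"
    using xs by (auto simp: words_def zip_map_fst_snd)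
  then show ?thesis
    by (rule that)
qed

lemma rearrange_base_mon:
  assumes j: "j \<le> p" and u: "u \<in> words p n" and y: "mset y = mset (base_word p j)"
  obtains v where "v \<in> tail_sorted p j n" "mset (zip u y) = base_mon p j v"
proof -
  have len: "length y = p" "length u = p"
    using mset_eq_length[OF y] j length_words[OF u] by simp_all
  obtain \<sigma> where \<sigma>: "\<sigma> permutes {..<length y}" "permute_list \<sigma> y = base_word p j"
    by (rule mset_eq_permutation[OF y[symmetric]])
  have "zip (permute_list \<sigma> u) (base_word p j) = permute_list \<sigma> (zip u y)"
    unfolding \<sigma>(2)[symmetric] using \<sigma>(1) len by (intro permute_list_zip[symmetric]) auto
  then have "base_mon p j (permute_list \<sigma> u) = mset (zip u y)"
    using \<sigma>(1) len by (simp add: base_mon_def)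
  moreover have pu: "permute_list \<sigma> u \<in> words p n"
    using \<sigma>(1) len u by (intro permute_list_words) auto
  moreover have "base_mon p j (permute_list \<sigma> u) = base_mon p j (tail_sort j (permute_list \<sigma> u))"
    using base_mon_fibre[OF j pu] by blast
  ultimately show ?thesis
    using that[of "tail_sort j (permute_list \<sigma> u)"] tail_sort_mem[OF j pu] by simp
qed

lemma base_mon_monomials:
  assumes "j \<le> p" "u \<in> words p n"
  shows "base_mon p j u \<in> monomials p (Suc j) n"
  unfolding base_mon_def by (rule zip_monomials[OF assms(2) base_word_words[OF assms(1)]])

lemma inj_base_mon:
  assumes "j \<le> p"
  shows "inj_on (base_mon p j) (tail_sorted p j n)"
proof (rule inj_onI)
  fix u v assume uv: "u \<in> tail_sorted p j n" "v \<in> tail_sorted p j n" "base_mon p j u = base_mon p j v"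
  then have "u \<in> words p n"
    by (simp add: tail_sorted_def)
  from base_mon_fibre[OF assms this] obtain t
    where t: "{v \<in> tail_sorted p j n. base_mon p j u = base_mon p j v} = {t}" ..
  have "u \<in> {t}" "v \<in> {t}"
    unfolding t[symmetric] using uv by simp_all
  then show "u = v"
    by simp
qed

text \<open>The composition law sums over all monomials \<open>mset (zip u y)\<close>. The
  coefficient vanishes unless \<open>y\<close> has the letters of the base word, and then
  rearranging the positions turns the monomial into some \<open>base_mon\<close>.\<close>

lemma coef_coef_base_mon:
  fixes G :: "('c, 'k::field) spf"
  assumes G: "is_spf p G" and j: "j \<le> p" and w: "w \<in> words p m" and x: "x \<in> val G (Suc j)"
  shows "coef G m n \<nu> (coef G (Suc j) m (base_mon p j w) x) = (\<Sum>u\<in>tail_sorted p j n.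
    fscale (of_nat (card {v \<in> words p m. mset (zip u v) = \<nu> \<and> base_mon p j v = base_mon p j w}))
      (coef G (Suc j) n (base_mon p j u) x))"
proof -
  let ?c = "\<lambda>\<rho>. Poly_Mapping.lookup (matmul_monomial m \<rho> :: _ \<Rightarrow>\<^sub>0 'k) (image_mset Inl \<nu> + image_mset Inr (base_mon p j w))"
  let ?t = "\<lambda>\<rho>. fscale (?c \<rho>) (coef G (Suc j) n \<rho> x)"
  have "coef G m n \<nu> (coef G (Suc j) m (base_mon p j w) x) = (\<Sum>\<rho>\<in>monomials p (Suc j) n. ?t \<rho>)"
    by (rule G[unfolded is_spf_def, THEN conjunct2, THEN conjunct2, THEN conjunct2, THEN conjunct2, rule_format, OF x])
  also have "\<dots> = (\<Sum>\<rho>\<in>base_mon p j ` tail_sorted p j n. ?t \<rho>)"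
  proof (rule sum.mono_neutral_right)
    show "base_mon p j ` tail_sorted p j n \<subseteq> monomials p (Suc j) n"
      using base_mon_monomials[OF j] by (auto simp: tail_sorted_def)
    show "\<forall>\<rho>\<in>monomials p (Suc j) n - base_mon p j ` tail_sorted p j n. ?t \<rho> = 0"
    proof
      fix \<rho> assume \<rho>: "\<rho> \<in> monomials p (Suc j) n - base_mon p j ` tail_sorted p j n"
      then obtain u y where uy: "u \<in> words p n" "y \<in> words p (Suc j)" "\<rho> = mset (zip u y)"
        using monomial_words[of \<rho> p "Suc j" n] by blast
      have len: "length u = p" "length y = p" "length w = p"
        using uy w by (auto dest: length_words)
      have "{v \<in> words p m. mset (zip u v) = \<nu> \<and> mset (zip v y) = base_mon p j w} = {}"
      proof (rule ccontr)
        assume "{v \<in> words p m. mset (zip u v) = \<nu> \<and> mset (zip v y) = base_mon p j w} \<noteq> {}"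
        then obtain v where v: "v \<in> words p m" "mset (zip v y) = mset (zip w (base_word p j))"
          by (auto simp: base_mon_def)
        have lv: "length v = p"
          by (rule length_words[OF v(1)])
        have "mset (map snd (zip v y)) = mset (map snd (zip w (base_word p j)))"
          unfolding mset_map v(2) ..
        then have "mset y = mset (base_word p j)"
          using len lv j by simp
        from rearrange_base_mon[OF j uy(1) this] obtain u' where "u' \<in> tail_sorted p j n" "\<rho> = base_mon p j u'"
          unfolding uy(3) by blast
        then show False
          using \<rho> by blast
      qed
      note empty = this
      have "length u = length y"
        using len by simp
      from lookup_matmul_monomial[OF this, of m \<nu> "base_mon p j w", where ?'k = 'k]
      have "?c \<rho> = 0"
        unfolding uy(3) len(2) empty card.empty of_nat_0 .
      then show "?t \<rho> = 0"
        by (simp only: fun_vs.scale_zero_left)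
    qed
  qed simp
  also have "\<dots> = (\<Sum>u\<in>tail_sorted p j n. ?t (base_mon p j u))"
    using sum.reindex[OF inj_base_mon[OF j]] by (simp only: o_def)
  also have "\<dots> = (\<Sum>u\<in>tail_sorted p j n.
    fscale (of_nat (card {v \<in> words p m. mset (zip u v) = \<nu> \<and> base_mon p j v = base_mon p j w}))
      (coef G (Suc j) n (base_mon p j u) x))"
  proof (rule sum.cong[OF refl])
    fix u assume "u \<in> tail_sorted p j n"
    then have "length u = length (base_word p j)"
      using j by (auto simp: tail_sorted_def dest: length_words)
    from lookup_matmul_monomial[OF this, of m \<nu> "base_mon p j w", where ?'k = 'k]
    show "?t (base_mon p j u) = fscale (of_nat (card {v \<in> words p m. mset (zip u v) = \<nu> \<and> base_mon p j v = base_mon p j w}))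
      (coef G (Suc j) n (base_mon p j u) x)"
      unfolding length_base_word[OF j] base_mon_def[symmetric] by (simp only:)
  qed
  finally show ?thesis .
qed

text \<open>\<open>x\<close> may be arbitrary: for given first letters \<open>u\<close> runs through
  all their \<open>fact j\<close> orders, and the signs of \<open>f\<close> antisymmetrise the
  contribution of \<open>x\<close>. The division turns this into a projection.\<close>

definition yoneda :: "nat \<Rightarrow> nat \<Rightarrow> ('c, 'k::field) spf \<Rightarrow> ('c \<Rightarrow> 'k) \<Rightarrow> nat \<Rightarrow> (nat list \<Rightarrow> 'k) \<Rightarrow> ('c \<Rightarrow> 'k)"
  where "yoneda p j G x n f = (if f \<in> tens p j j n then
    \<Sum>u\<in>tail_sorted p j n. fscale (f u / of_nat (fact j)) (coef G (Suc j) n (base_mon p j u) x) else 0)"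

lemma yoneda_nat_trans:
  fixes G :: "('c, 'k::field) spf"
  assumes G: "is_spf p G" and j: "j \<le> p" and x: "x \<in> val G (Suc j)"
  shows "yoneda p j G x \<in> nat_trans (ext_div p j) G"
proof -
  note lG = is_spf_lin_functor[OF G]
  note sub = lin_functorD(1)[OF lG] and lin = lin_functorD(2)[OF lG]
  have cm: "coef G (Suc j) n \<mu> x \<in> val G n" for n \<mu>
    by (rule linear_map_mem[OF lin x])
  have "linear_map (tens p j j n) (val G n) (yoneda p j G x n)" for n
    unfolding linear_map_def
  proof (intro conjI ballI allI)
    fix f :: "nat list \<Rightarrow> 'k" assume f: "f \<in> tens p j j n"
    show "yoneda p j G x n f \<in> val G n"
      using f unfolding yoneda_def
      by (simp only: if_True) (intro fun_vs.subspace_sum[OF sub] fun_vs.subspace_scale[OF sub] cm)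
    have "fscale c f \<in> tens p j j n" for c
      by (rule fun_vs.subspace_scale[OF tens_subspace f])
    then show "yoneda p j G x n (fscale c f) = fscale c (yoneda p j G x n f)" for c
      using f unfolding yoneda_def
      by (simp only: if_True) (auto simp: fun_eq_iff sum_fun_apply fscale_apply sum_distrib_left intro!: sum.cong)
    fix g :: "nat list \<Rightarrow> 'k" assume g: "g \<in> tens p j j n"
    have "f + g \<in> tens p j j n"
      by (rule fun_vs.subspace_add[OF tens_subspace f g])
    then show "yoneda p j G x n (f + g) = yoneda p j G x n f + yoneda p j G x n g"
      using f g unfolding yoneda_def
      by (simp only: if_True) (auto simp: fun_eq_iff sum_fun_apply fscale_apply sum.distrib[symmetric] add_divide_distrib distrib_right intro!: sum.cong)
  qed
  moreover have "yoneda p j G x n (coef (tensor_power p) m n \<nu> f) = coef G m n \<nu> (yoneda p j G x m f)"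
    if f: "f \<in> tens p j j m" for m n \<nu> f
  proof
    fix b
    let ?X = "\<lambda>u. coef G (Suc j) n (base_mon p j u) x b"
    let ?N = "\<lambda>u w. card {v \<in> words p m. mset (zip u v) = \<nu> \<and> base_mon p j v = base_mon p j w}"
    have cf: "coef (tensor_power p) m n \<nu> f \<in> tens p j j n"
      by (rule coef_tens[OF f j])
    \<comment> \<open>Every word \<open>v\<close> is collected under its tail-sorted representative,
      where \<open>f\<close> has the same value.\<close>
    have inner: "(\<Sum>w\<in>tail_sorted p j m. f w * of_nat (?N u w)) = coef (tensor_power p) m n \<nu> f u"
      if u: "u \<in> tail_sorted p j n" for u
    proof -
      let ?V = "{v \<in> words p m. mset (zip u v) = \<nu>}"
      have "coef (tensor_power p) m n \<nu> f u = (\<Sum>v\<in>?V. f v)"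
        using u by (simp add: tensor_power_coef tail_sorted_def)
      also have "\<dots> = (\<Sum>v\<in>?V. \<Sum>w | w \<in> tail_sorted p j m \<and> base_mon p j v = base_mon p j w. f w)"
        using sum_base_mon_fibre[OF j _ tensD(3)[OF f]] by (intro sum.cong refl) simp
      also have "\<dots> = (\<Sum>v\<in>?V. \<Sum>w\<in>tail_sorted p j m. if base_mon p j v = base_mon p j w then f w else 0)"
        by (rule sum.cong[OF refl], rule sum.inter_filter, rule finite_tail_sorted)
      also have "\<dots> = (\<Sum>w\<in>tail_sorted p j m. \<Sum>v\<in>?V. if base_mon p j v = base_mon p j w then f w else 0)"
        by (rule sum.swap)
      also have "\<dots> = (\<Sum>w\<in>tail_sorted p j m. f w * of_nat (?N u w))"
      proof (rule sum.cong[OF refl])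
        fix w
        have "(\<Sum>v\<in>?V. if base_mon p j v = base_mon p j w then f w else 0) = (\<Sum>v\<in>{v\<in>?V. base_mon p j v = base_mon p j w}. f w)"
          by (rule sum.inter_filter[symmetric]) simp
        also have "{v\<in>?V. base_mon p j v = base_mon p j w} = {v \<in> words p m. mset (zip u v) = \<nu> \<and> base_mon p j v = base_mon p j w}"
          by blast
        finally show "(\<Sum>v\<in>?V. if base_mon p j v = base_mon p j w then f w else 0) = f w * of_nat (?N u w)"
          by (simp add: mult.commute)
      qed
      finally show ?thesis ..
    qed
    have "coef G m n \<nu> (yoneda p j G x m f) =
        (\<Sum>w\<in>tail_sorted p j m. fscale (f w / of_nat (fact j)) (coef G m n \<nu> (coef G (Suc j) m (base_mon p j w) x)))"
      using f unfolding yoneda_def by (simp only: if_True) (rule linear_map_sum[OF lin sub cm])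
    then have "coef G m n \<nu> (yoneda p j G x m f) b = (\<Sum>w\<in>tail_sorted p j m. f w / of_nat (fact j) *
        coef G m n \<nu> (coef G (Suc j) m (base_mon p j w) x) b)"
      by (simp only: sum_fun_apply fscale_apply)
    also have "\<dots> = (\<Sum>w\<in>tail_sorted p j m. f w / of_nat (fact j) *
        (\<Sum>u\<in>tail_sorted p j n. of_nat (?N u w) * ?X u))"
    proof (rule sum.cong[OF refl])
      fix w assume "w \<in> tail_sorted p j m"
      then have w: "w \<in> words p m"
        by (simp add: tail_sorted_def)
      show "f w / of_nat (fact j) * coef G m n \<nu> (coef G (Suc j) m (base_mon p j w) x) b =
          f w / of_nat (fact j) * (\<Sum>u\<in>tail_sorted p j n. of_nat (?N u w) * ?X u)"
        by (simp only: coef_coef_base_mon[OF G j w x] sum_fun_apply fscale_apply)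
    qed
    also have "\<dots> = (\<Sum>w\<in>tail_sorted p j m. \<Sum>u\<in>tail_sorted p j n. f w * of_nat (?N u w) / of_nat (fact j) * ?X u)"
      unfolding sum_distrib_left by (intro sum.cong refl) simp
    also have "\<dots> = (\<Sum>u\<in>tail_sorted p j n. \<Sum>w\<in>tail_sorted p j m. f w * of_nat (?N u w) / of_nat (fact j) * ?X u)"
      by (rule sum.swap)
    also have "\<dots> = (\<Sum>u\<in>tail_sorted p j n. coef (tensor_power p) m n \<nu> f u / of_nat (fact j) * ?X u)"
    proof (rule sum.cong[OF refl])
      fix u assume u: "u \<in> tail_sorted p j n"
      show "(\<Sum>w\<in>tail_sorted p j m. f w * of_nat (?N u w) / of_nat (fact j) * ?X u) =
          coef (tensor_power p) m n \<nu> f u / of_nat (fact j) * ?X u"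
        unfolding inner[OF u, symmetric] sum_divide_distrib sum_distrib_right ..
    qed
    also have "\<dots> = yoneda p j G x n (coef (tensor_power p) m n \<nu> f) b"
      using cf unfolding yoneda_def by (simp only: if_True sum_fun_apply fscale_apply)
    finally show "yoneda p j G x n (coef (tensor_power p) m n \<nu> f) b = coef G m n \<nu> (yoneda p j G x m f) b" ..
  qed
  moreover have "yoneda p j G x n f = 0" if "f \<notin> tens p j j n" for n f
    using that by (simp only: yoneda_def if_False)
  ultimately show ?thesis
    unfolding nat_trans_def ext_div_simps by blast
qed

lemma gen_vec_tens:
  assumes j: "j \<le> p"
  shows "(gen_vec p j :: nat list \<Rightarrow> 'k::field) \<in> tens p j j (Suc j)"
proof -
  have "sym_above p j (unit_vec (base_word p j) :: nat list \<Rightarrow> 'k)"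
    unfolding sym_above_def
  proof (intro allI impI)
    fix w :: "nat list" and a b assume w: "length w = p" and ab: "j \<le> a" "a < b" "b < p"
    have b: "swp a b (base_word p j) = base_word p j"
      using ab j by (intro swp_eq_self) (auto simp: base_word_nth)
    have "swp a b w = base_word p j \<longleftrightarrow> w = base_word p j"
    proof
      assume "swp a b w = base_word p j"
      then have "swp a b (swp a b w) = base_word p j"
        using b by simp
      then show "w = base_word p j"
        using w ab by simp
    qed (simp add: b)
    then show "unit_vec (base_word p j) (swp a b w) = (unit_vec (base_word p j) w :: 'k)"
      by (simp add: unit_vec_def)
  qed
  then show ?thesis
    using j by (simp add: tens_def gen_vec_def asymm_sym asymm_alt asymm_coords unit_vec_coords base_word_words)
qed

text \<open>Evaluated at \<open>v\<close>, the sum is a pairing of the generator with the function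
  \<open>F\<close>. By \<open>asymm_adjoint\<close> the antisymmetriser moves over to
  \<open>F\<close>, where it produces \<open>asymm j f v\<close>, which is \<open>fact j\<close>
  times \<open>f v\<close>.\<close>

lemma generated_by_gen_vec:
  fixes f :: "nat list \<Rightarrow> 'k::field"
  assumes char: "CHAR('k) = p" and j: "j < p" and f: "f \<in> tens p j j n"
  shows "f = (\<Sum>u\<in>tail_sorted p j n. fscale (f u / of_nat (fact j))
    (coef (tensor_power p) (Suc j) n (base_mon p j u) (gen_vec p j)))"
proof
  have j': "j \<le> p" using j by simp
  fix v
  let ?S = "\<Sum>u\<in>tail_sorted p j n. f u / of_nat (fact j) * coef (tensor_power p) (Suc j) n (base_mon p j u) (gen_vec p j) v"
  have "f v = ?S"
  proof (cases "v \<in> words p n")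
    case False
    then show ?thesis
      using tensD(1)[OF f] by (simp add: tensor_power_coef coords_def)
  next
    case True
    have len: "length v = p"
      by (rule length_words[OF True])
    define F where "F y = (if y \<in> words p (Suc j) then
      \<Sum>u | u \<in> tail_sorted p j n \<and> mset (zip v y) = base_mon p j u. f u else 0)" for y
    have F: "F \<in> coords (words p (Suc j))"
      by (simp add: F_def coords_def)
    have e: "unit_vec (base_word p j) \<in> (coords (words p (Suc j)) :: (nat list \<Rightarrow> 'k) set)"
      by (rule unit_vec_coords[OF base_word_words[OF j']])
    have "(\<Sum>u\<in>tail_sorted p j n. f u * coef (tensor_power p) (Suc j) n (base_mon p j u) (gen_vec p j) v) =
        (\<Sum>u\<in>tail_sorted p j n. \<Sum>y\<in>words p (Suc j). if mset (zip v y) = base_mon p j u then f u * gen_vec p j y else 0)"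
      using True by (intro sum.cong refl) (simp add: tensor_power_coef sum_distrib_left sum.inter_filter if_distrib cong: if_cong)
    also have "\<dots> = (\<Sum>y\<in>words p (Suc j). \<Sum>u\<in>tail_sorted p j n. if mset (zip v y) = base_mon p j u then f u * gen_vec p j y else 0)"
      by (rule sum.swap)
    also have "\<dots> = (\<Sum>y\<in>words p (Suc j). asymm j (unit_vec (base_word p j)) y * F y)"
    proof (rule sum.cong[OF refl])
      fix y assume y: "y \<in> words p (Suc j)"
      have "(\<Sum>u\<in>tail_sorted p j n. if mset (zip v y) = base_mon p j u then f u * gen_vec p j y else 0) =
          (\<Sum>u | u \<in> tail_sorted p j n \<and> mset (zip v y) = base_mon p j u. f u * gen_vec p j y)"
        by (simp add: sum.inter_filter)
      also have "\<dots> = F y * gen_vec p j y"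
        using y by (simp add: F_def sum_distrib_right)
      finally show "(\<Sum>u\<in>tail_sorted p j n. if mset (zip v y) = base_mon p j u then f u * gen_vec p j y else 0) =
          asymm j (unit_vec (base_word p j)) y * F y"
        by (simp add: gen_vec_def)
    qed
    also have "\<dots> = (\<Sum>y\<in>words p (Suc j). unit_vec (base_word p j) y * asymm j F y)"
      by (rule asymm_adjoint[OF j' e F])
    also have "\<dots> = asymm j F (base_word p j)"
      using base_word_words[OF j'] by (simp add: unit_vec_def if_distribR if_distrib[of "\<lambda>c. c * _"] cong: if_cong)
    also have "\<dots> = (\<Sum>\<sigma> | \<sigma> permutes {..<j}. of_int (sign (inv \<sigma>)) * f (permute_list (inv \<sigma>) v))"
      unfolding asymm_def
    proof (rule sum.cong[OF refl])
      fix \<sigma> assume "\<sigma> \<in> {\<sigma>. \<sigma> permutes {..<j}}"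
      then have \<sigma>j: "\<sigma> permutes {..<j}" by simp
      have \<sigma>: "\<sigma> permutes {..<p}" "inv \<sigma> permutes {..<p}"
        using permutes_lessThan_mono[OF \<sigma>j j'] by (auto intro: permutes_inv)
      have "permutation \<sigma>"
        using \<sigma>j by (intro permutation_permutes[THEN iffD2]) auto
      then have sg: "sign (inv \<sigma>) = sign \<sigma>"
        by (rule sign_inverse)
      have bw: "permute_list \<sigma> (base_word p j) \<in> words p (Suc j)"
        by (rule permute_list_words[OF \<sigma>(1) base_word_words[OF j']])
      have pv: "permute_list (inv \<sigma>) v \<in> words p n"
        by (rule permute_list_words[OF \<sigma>(2) True])
      have "permute_list \<sigma> (permute_list (inv \<sigma>) v) = v"
        using permute_list_compose[of \<sigma> v "inv \<sigma>"] \<sigma> len permutes_inv_o(2)[OF \<sigma>(1)] by simp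
      then have "zip v (permute_list \<sigma> (base_word p j)) = permute_list \<sigma> (zip (permute_list (inv \<sigma>) v) (base_word p j))"
        using \<sigma>(1) len j' by (subst permute_list_zip) auto
      then have "mset (zip v (permute_list \<sigma> (base_word p j))) = base_mon p j (permute_list (inv \<sigma>) v)"
        using \<sigma>(1) len j' by (simp add: base_mon_def)
      then have "F (permute_list \<sigma> (base_word p j)) = f (permute_list (inv \<sigma>) v)"
        using bw sum_base_mon_fibre[OF j' pv tensD(3)[OF f]] by (simp add: F_def)
      then show "of_int (sign \<sigma>) * F (permute_list \<sigma> (base_word p j)) =
          of_int (sign (inv \<sigma>)) * f (permute_list (inv \<sigma>) v)"
        by (simp only: sg)
    qed
    also have "\<dots> = asymm j f v"
      unfolding asymm_def by (rule sum_permutations_inverse[symmetric])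
    also have "\<dots> = of_nat (fact j) * f v"
      by (rule asymm_of_alt[OF tensD(2)[OF f] j' len])
    finally have eq: "(\<Sum>u\<in>tail_sorted p j n. f u * coef (tensor_power p) (Suc j) n (base_mon p j u) (gen_vec p j) v) = of_nat (fact j) * f v" .
    have "?S = (\<Sum>u\<in>tail_sorted p j n. f u * coef (tensor_power p) (Suc j) n (base_mon p j u) (gen_vec p j) v) / of_nat (fact j)"
      unfolding sum_divide_distrib by (intro sum.cong refl) simp
    also have "\<dots> = f v"
      unfolding eq using of_nat_fact_neq_0[OF char j] by simp
    finally show ?thesis ..
  qed
  then show "f v = (\<Sum>u\<in>tail_sorted p j n. fscale (f u / of_nat (fact j))
    (coef (tensor_power p) (Suc j) n (base_mon p j u) (gen_vec p j))) v"
    by (simp only: sum_fun_apply fscale_apply)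
qed

lemma nat_trans_gen_vec:
  fixes G :: "('c, 'k::field) spf"
  assumes char: "CHAR('k) = p" and j: "j < p" and \<gamma>: "\<gamma> \<in> nat_trans (ext_div p j) G" and f: "f \<in> tens p j j n"
  shows "\<gamma> n f = (\<Sum>u\<in>tail_sorted p j n. fscale (f u / of_nat (fact j))
    (coef G (Suc j) n (base_mon p j u) (\<gamma> (Suc j) (gen_vec p j))))"
proof -
  have j': "j \<le> p" using j by simp
  note g = gen_vec_tens[OF j', where ?'k = 'k]
  note \<gamma>D = nat_transD[OF \<gamma>, unfolded ext_div_simps]
  have "\<gamma> n f = \<gamma> n (\<Sum>u\<in>tail_sorted p j n. fscale (f u / of_nat (fact j))
    (coef (tensor_power p) (Suc j) n (base_mon p j u) (gen_vec p j)))"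
    by (rule arg_cong[OF generated_by_gen_vec[OF char j f]])
  also have "\<dots> = (\<Sum>u\<in>tail_sorted p j n. fscale (f u / of_nat (fact j))
    (\<gamma> n (coef (tensor_power p) (Suc j) n (base_mon p j u) (gen_vec p j))))"
    by (rule linear_map_sum[OF \<gamma>D(1) tens_subspace]) (rule coef_tens[OF g j'])
  also have "\<dots> = (\<Sum>u\<in>tail_sorted p j n. fscale (f u / of_nat (fact j))
    (coef G (Suc j) n (base_mon p j u) (\<gamma> (Suc j) (gen_vec p j))))"
    by (simp only: \<gamma>D(3)[OF g])
  finally show ?thesis .
qed

lemma nat_trans_eq_gen_vec:
  fixes G :: "('c, 'k::field) spf"
  assumes char: "CHAR('k) = p" and j: "j < p"
    and \<gamma>: "\<gamma> \<in> nat_trans (ext_div p j) G" and \<delta>: "\<delta> \<in> nat_trans (ext_div p j) G"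
    and eq: "\<gamma> (Suc j) (gen_vec p j) = \<delta> (Suc j) (gen_vec p j)"
  shows "\<gamma> = \<delta>"
proof (rule nat_trans_eqI[OF \<gamma> \<delta>], unfold ext_div_simps)
  fix n and f :: "nat list \<Rightarrow> 'k" assume f: "f \<in> tens p j j n"
  show "\<gamma> n f = \<delta> n f"
    unfolding nat_trans_gen_vec[OF char j \<gamma> f] nat_trans_gen_vec[OF char j \<delta> f] eq ..
qed

text \<open>Surjectivity of \<beta> is applied to the image of the generator. A preimage defines the
  lift by \<open>yoneda\<close>, and \<open>nat_trans_gen_vec\<close> shows that the composite is
  \<gamma>.\<close>

lemma projective_ext_div:
  assumes char: "CHAR('k::field) = p" and j: "j < p"
  shows "projective p (ext_div p j :: 'k pfun)"
  unfolding projective_def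
proof (intro conjI allI impI)
  have j': "j \<le> p" using j by simp
  show "is_spf p (ext_div p j :: 'k pfun)"
    by (rule is_spf_ext_div[OF j'])
  fix E F :: "'k pfun" and \<beta> \<gamma>
  assume as: "is_spf p E \<and> is_spf p F \<and> nt_epi E F \<beta> \<and> \<gamma> \<in> nat_trans (ext_div p j) F"
  then have E: "is_spf p E" and \<beta>: "\<beta> \<in> nat_trans E F" and \<gamma>: "\<gamma> \<in> nat_trans (ext_div p j) F"
    and epi: "\<beta> (Suc j) ` val E (Suc j) = val F (Suc j)"
    by (auto simp: nt_epi_def)
  note g = gen_vec_tens[OF j', where ?'k = 'k]
  have "\<gamma> (Suc j) (gen_vec p j) \<in> val F (Suc j)"
    using nat_transD(4)[OF \<gamma>] g unfolding ext_div_simps by blast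
  then obtain x where x: "x \<in> val E (Suc j)" "\<beta> (Suc j) x = \<gamma> (Suc j) (gen_vec p j)"
    unfolding epi[symmetric] by (metis imageE)
  note lE = is_spf_lin_functor[OF E]
  have \<delta>: "yoneda p j E x \<in> nat_trans (ext_div p j) E"
    by (rule yoneda_nat_trans[OF E j' x(1)])
  have "\<beta> \<circ>\<^sub>N yoneda p j E x = \<gamma>"
  proof (rule nat_trans_eqI[OF nat_trans_comp[OF \<delta> \<beta>] \<gamma>], unfold ext_div_simps nt_comp_apply)
    fix n and f :: "nat list \<Rightarrow> 'k" assume f: "f \<in> tens p j j n"
    have "\<beta> n (yoneda p j E x n f) = (\<Sum>u\<in>tail_sorted p j n. fscale (f u / of_nat (fact j))
        (\<beta> n (coef E (Suc j) n (base_mon p j u) x)))"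
      using f unfolding yoneda_def
      by (simp only: if_True)
        (rule linear_map_sum[OF nat_transD(1)[OF \<beta>] lin_functorD(1)[OF lE] linear_map_mem[OF lin_functorD(2)[OF lE] x(1)]])
    also have "\<dots> = \<gamma> n f"
      unfolding nat_trans_gen_vec[OF char j \<gamma> f] nat_transD(3)[OF \<beta> x(1)] x(2) ..
    finally show "\<beta> n (yoneda p j E x n f) = \<gamma> n f" .
  qed
  then show "\<exists>\<delta>\<in>nat_trans (ext_div p j) E. \<beta> \<circ>\<^sub>N \<delta> = \<gamma>"
    using \<delta> by blast
qed

section \<open>The Weyl functor of a hook as a functor of tensors\<close>

lemma kuhn_dual_val:
  "\<phi> \<in> val (kuhn_dual G) n \<longleftrightarrow> (\<forall>x\<in>val G n. \<forall>y\<in>val G n. \<phi> (x + y) = \<phi> x + \<phi> y) \<and>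
    (\<forall>c. \<forall>x\<in>val G n. \<phi> (fscale c x) = c * \<phi> x) \<and> (\<forall>x. x \<notin> val G n \<longrightarrow> \<phi> x = 0)"
  by (simp add: kuhn_dual_def)

lemma kuhn_dual_coef:
  "coef (kuhn_dual G) m n \<mu> \<phi> x = (if x \<in> val G n then \<phi> (coef G n m (image_mset prod.swap \<mu>) x) else 0)"
  by (simp add: kuhn_dual_def)

lemma kuhn_dualD:
  assumes "\<phi> \<in> val (kuhn_dual G) n"
  shows "x \<in> val G n \<Longrightarrow> y \<in> val G n \<Longrightarrow> \<phi> (x + y) = \<phi> x + \<phi> y"
    and "x \<in> val G n \<Longrightarrow> \<phi> (fscale c x) = c * \<phi> x"
    and "x \<notin> val G n \<Longrightarrow> \<phi> x = 0"
  using assms unfolding kuhn_dual_val by blast+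

lemma lin_functor_kuhn_dual:
  assumes G: "lin_functor G"
  shows "lin_functor (kuhn_dual G)"
proof -
  note sub = lin_functorD(1)[OF G] and lin = lin_functorD(2)[OF G]
  have subs: "fun_vs.subspace (val (kuhn_dual G) n)" for n
    unfolding fun_vs.subspace_def
  proof (intro conjI ballI allI)
    show "0 \<in> val (kuhn_dual G) n"
      unfolding kuhn_dual_val by simp
  next
    fix \<phi> \<psi> assume "\<phi> \<in> val (kuhn_dual G) n" "\<psi> \<in> val (kuhn_dual G) n"
    note 1 = kuhn_dualD[OF this(1)] and 2 = kuhn_dualD[OF this(2)]
    show "\<phi> + \<psi> \<in> val (kuhn_dual G) n"
      unfolding kuhn_dual_val
    proof (intro conjI ballI allI impI)
      fix x y assume xy: "x \<in> val G n" "y \<in> val G n"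
      show "(\<phi> + \<psi>) (x + y) = (\<phi> + \<psi>) x + (\<phi> + \<psi>) y"
        unfolding plus_fun_apply[of \<phi> \<psi>] 1(1)[OF xy] 2(1)[OF xy] by (simp only: add_ac)
    next
      fix c x assume x: "x \<in> val G n"
      show "(\<phi> + \<psi>) (fscale c x) = c * (\<phi> + \<psi>) x"
        unfolding plus_fun_apply[of \<phi> \<psi>] 1(2)[OF x] 2(2)[OF x] by (rule distrib_left[symmetric])
    next
      fix x assume x: "x \<notin> val G n"
      show "(\<phi> + \<psi>) x = 0"
        unfolding plus_fun_apply[of \<phi> \<psi>] 1(3)[OF x] 2(3)[OF x] by (rule add_0_left)
    qed
  next
    fix c \<phi> assume "\<phi> \<in> val (kuhn_dual G) n"
    note 1 = kuhn_dualD[OF this]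
    show "fscale c \<phi> \<in> val (kuhn_dual G) n"
      unfolding kuhn_dual_val
    proof (intro conjI ballI allI impI)
      fix x y assume xy: "x \<in> val G n" "y \<in> val G n"
      show "fscale c \<phi> (x + y) = fscale c \<phi> x + fscale c \<phi> y"
        unfolding fscale_apply[of c \<phi>] 1(1)[OF xy] by (rule distrib_left)
    next
      fix d x assume x: "x \<in> val G n"
      show "fscale c \<phi> (fscale d x) = d * fscale c \<phi> x"
        unfolding fscale_apply[of c \<phi>] 1(2)[OF x] by (rule mult.left_commute)
    next
      fix x assume x: "x \<notin> val G n"
      show "fscale c \<phi> x = 0"
        unfolding fscale_apply[of c \<phi>] 1(3)[OF x] by (rule mult_zero_right)
    qed
  qed
  have "linear_map (val (kuhn_dual G) m) (val (kuhn_dual G) n) (coef (kuhn_dual G) m n \<mu>)" for m n \<mu>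
    unfolding linear_map_def
  proof (intro conjI ballI allI)
    fix \<phi> assume "\<phi> \<in> val (kuhn_dual G) m"
    note 1 = kuhn_dualD[OF this]
    note mem = linear_map_mem[OF lin]
    show "coef (kuhn_dual G) m n \<mu> \<phi> \<in> val (kuhn_dual G) n"
      unfolding kuhn_dual_val kuhn_dual_coef
    proof (intro conjI ballI allI impI)
      fix x y assume xy: "x \<in> val G n" "y \<in> val G n"
      show "(if x + y \<in> val G n then \<phi> (coef G n m (image_mset prod.swap \<mu>) (x + y)) else 0) =
         (if x \<in> val G n then \<phi> (coef G n m (image_mset prod.swap \<mu>) x) else 0) +
         (if y \<in> val G n then \<phi> (coef G n m (image_mset prod.swap \<mu>) y) else 0)"
        by (simp only: xy fun_vs.subspace_add[OF sub xy] if_True linear_map_add[OF lin xy] 1(1)[OF mem[OF xy(1)] mem[OF xy(2)]])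
    next
      fix c x assume x: "x \<in> val G n"
      show "(if fscale c x \<in> val G n then \<phi> (coef G n m (image_mset prod.swap \<mu>) (fscale c x)) else 0) =
         c * (if x \<in> val G n then \<phi> (coef G n m (image_mset prod.swap \<mu>) x) else 0)"
        by (simp only: x fun_vs.subspace_scale[OF sub x] if_True linear_map_scale[OF lin x] 1(2)[OF mem[OF x]])
    qed (simp only: if_False)
  qed (auto simp: fun_eq_iff kuhn_dual_coef fscale_apply)
  then show ?thesis
    using subs unfolding lin_functor_def by blast
qed

lemma functional_sum:
  assumes \<phi>: "\<phi> \<in> val (kuhn_dual G) n" and G: "fun_vs.subspace (val G n)" and x: "\<And>i. i \<in> A \<Longrightarrow> x i \<in> val G n"
  shows "\<phi> (\<Sum>i\<in>A. fscale (c i) (x i)) = (\<Sum>i\<in>A. c i * \<phi> (x i))"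
proof -
  \<comment> \<open>A scalar is viewed as a function on the one-point type, so that
    \<open>linear_map_sum\<close> applies to functionals.\<close>
  have "linear_map (val G n) UNIV (\<lambda>x (_ :: unit). \<phi> x)"
    unfolding linear_map_def by (auto simp: fun_eq_iff fscale_apply kuhn_dualD[OF \<phi>])
  then have "(\<lambda>_ :: unit. \<phi> (\<Sum>i\<in>A. fscale (c i) (x i))) = (\<Sum>i\<in>A. fscale (c i) (\<lambda>_. \<phi> (x i)))"
    by (rule linear_map_sum[OF _ G x])
  from fun_cong[OF this, of "()"] show ?thesis
    by (simp only: sum_fun_apply fscale_apply)
qed

lemma functional_zero:
  assumes \<phi>: "\<phi> \<in> val (kuhn_dual G) n" and G: "fun_vs.subspace (val G n)"
  shows "\<phi> 0 = 0"
  using functional_sum[OF \<phi> G, of "{}"] by simp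

context
  fixes p n :: nat
  assumes n: "n < p"
begin

abbreviation (input) schur_h :: "'k::field pfun"
  where "schur_h \<equiv> schur_functor (hook p n)"

abbreviation (input) weyl_h :: "(nat list \<Rightarrow> 'k::field, 'k) spf"
  where "weyl_h \<equiv> weyl_functor (hook p n)"

text \<open>A functional on the Schur functor is determined by its values on the images \<open>proj_vec\<close> of the
  words. This embeds the Weyl functor into the tensor power, with image in \<open>\<Lambda>\<^bsup>n+1\<^esup> \<otimes> \<Gamma>\<^bsup>p-n-1\<^esup>\<close> and
  there in the kernel of \<open>kap (n + 1)\<close>.\<close>

definition proj_vec :: "(nat list \<Rightarrow> 'k::field) \<Rightarrow> nat list \<Rightarrow> 'k"
  where "proj_vec f = qop p n (asymm (Suc n) f)"

definition weyl_tensor :: "nat \<Rightarrow> ((nat list \<Rightarrow> 'k::field) \<Rightarrow> 'k) \<Rightarrow> nat list \<Rightarrow> 'k"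
  where "weyl_tensor r \<phi> w = (if w \<in> words p r then \<phi> (proj_vec (unit_vec w)) else 0)"

lemma schur_h_val: "val schur_h r = (proj_vec ` coords (words p r) :: (nat list \<Rightarrow> 'k::field) set)"
  unfolding schur_hook_val[OF n] proj_vec_def image_image ..

lemma proj_vec_mem: "f \<in> coords (words p r) \<Longrightarrow> proj_vec f \<in> val schur_h r"
  unfolding schur_h_val by (rule imageI)

lemma asymm_add: "asymm j (f + g) = asymm j f + asymm j g"
  by (simp add: asymm_def fun_eq_iff sum.distrib distrib_left)

lemma asymm_scale: "asymm j (fscale c f) = fscale c (asymm j f)"
  by (simp add: asymm_def fun_eq_iff fscale_apply sum_distrib_left algebra_simps)

lemma proj_vec_add: "proj_vec (f + g) = proj_vec f + proj_vec g"
  by (simp only: proj_vec_def asymm_add qop_add)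

lemma proj_vec_scale: "proj_vec (fscale c f) = fscale c (proj_vec f)"
  by (simp only: proj_vec_def asymm_scale qop_scale)

lemma proj_vec_expand:
  assumes f: "f \<in> coords (words p r)"
  shows "proj_vec f = (\<Sum>u\<in>words p r. fscale (f u) (proj_vec (unit_vec u)))"
proof -
  have "linear_map UNIV UNIV (proj_vec :: (nat list \<Rightarrow> 'a) \<Rightarrow> _)"
    unfolding linear_map_def by (intro conjI ballI allI proj_vec_add proj_vec_scale UNIV_I)
  from linear_map_sum[OF this fun_vs.subspace_UNIV, of "words p r" unit_vec f]
  show ?thesis
    unfolding coords_expand[OF finite_words f, symmetric] by simp
qed

context
  assumes S: "lin_functor (schur_h :: 'k::field pfun)"
begin

lemma weyl_h_val: "val weyl_h r = val (kuhn_dual (schur_h :: 'k pfun)) r"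
  by (simp add: weyl_functor_def)

lemma lin_functor_weyl: "lin_functor (weyl_h :: (nat list \<Rightarrow> 'k, 'k) spf)"
  unfolding weyl_functor_def by (rule lin_functor_kuhn_dual[OF S])

lemma weyl_expand:
  assumes \<phi>: "\<phi> \<in> val weyl_h r" and f: "(f :: nat list \<Rightarrow> 'k) \<in> coords (words p r)"
  shows "\<phi> (proj_vec f) = (\<Sum>u\<in>words p r. f u * weyl_tensor r \<phi> u)"
proof -
  have "\<phi> (proj_vec f) = \<phi> (\<Sum>u\<in>words p r. fscale (f u) (proj_vec (unit_vec u)))"
    by (rule arg_cong[OF proj_vec_expand[OF f]])
  also have "\<dots> = (\<Sum>u\<in>words p r. f u * \<phi> (proj_vec (unit_vec u)))"
    by (rule functional_sum[OF \<phi>[unfolded weyl_h_val] lin_functorD(1)[OF S] proj_vec_mem[OF unit_vec_coords]])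
  also have "\<dots> = (\<Sum>u\<in>words p r. f u * weyl_tensor r \<phi> u)"
    by (intro sum.cong refl) (simp add: weyl_tensor_def)
  finally show ?thesis .
qed

lemma weyl_tensor_add: "weyl_tensor r (\<phi> + \<psi>) = weyl_tensor r \<phi> + weyl_tensor r \<psi>"
  by (simp add: weyl_tensor_def fun_eq_iff)

lemma weyl_tensor_scale: "weyl_tensor r (fscale c \<phi>) = fscale c (weyl_tensor r \<phi>)"
  by (simp add: weyl_tensor_def fun_eq_iff fscale_apply)

lemma weyl_tensor_coords: "weyl_tensor r \<phi> \<in> coords (words p r)"
  by (simp add: weyl_tensor_def coords_def)

lemma weyl_tensor_inject:
  assumes \<phi>: "\<phi> \<in> val weyl_h r" and z: "weyl_tensor r \<phi> = (0 :: nat list \<Rightarrow> 'k)"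
  shows "\<phi> = 0"
proof
  fix x
  show "\<phi> x = 0 x"
  proof (cases "x \<in> val schur_h r")
    case True
    then obtain f where f: "f \<in> coords (words p r)" "x = proj_vec f"
      unfolding schur_h_val by blast
    show ?thesis
      unfolding f(2) weyl_expand[OF \<phi> f(1)] z by simp
  next
    case False
    then show ?thesis
      using kuhn_dualD(3)[OF \<phi>[unfolded weyl_h_val]] by simp
  qed
qed

lemma weyl_tensor_eqD:
  assumes \<phi>: "\<phi> \<in> val weyl_h r" and \<psi>: "\<psi> \<in> val weyl_h r"
    and e: "weyl_tensor r \<phi> = (weyl_tensor r \<psi> :: nat list \<Rightarrow> 'k)"
  shows "\<phi> = \<psi>"
proof -
  have d: "\<phi> - \<psi> \<in> val weyl_h r"
    by (rule fun_vs.subspace_diff[OF lin_functorD(1)[OF lin_functor_weyl] \<phi> \<psi>])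
  have "weyl_tensor r (\<phi> - \<psi>) w = 0" for w
    using fun_cong[OF e, of w] by (simp add: weyl_tensor_def split: if_splits)
  then have "weyl_tensor r (\<phi> - \<psi>) = 0"
    by (intro ext) (simp only: zero_fun_apply)
  from weyl_tensor_inject[OF d this] show ?thesis
    by (simp only: right_minus_eq)
qed

lemma coef_asymm:
  fixes f :: "nat list \<Rightarrow> 'k"
  assumes f: "f \<in> coords (words p a)" and j: "j \<le> p"
  shows "coef (tensor_power p) a b \<mu> (asymm j f) = asymm j (coef (tensor_power p) a b \<mu> f)"
  using j
proof (induction j)
  case 0
  have "asymm 0 g = g" for g :: "nat list \<Rightarrow> 'k"
    by (intro ext) (rule asymm_0)
  then show ?case
    by (simp only:)
next
  case (Suc j)
  have c: "coef (tensor_power p) a b \<mu> f \<in> coords (words p b)"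
    by (simp add: coords_def tensor_power_coef)
  have j: "j < p" using Suc.prems by simp
  show ?case
    unfolding asymm_Suc_fun[OF f j] asymm_Suc_fun[OF c j] coef_kap[OF j] Suc.IH[OF less_imp_le[OF j]] ..
qed

text \<open>Two transpositions compensate each other: the dual acts by the swapped monomial, and
  evaluating at basis words transposes the matrix of the tensor power back.\<close>

lemma weyl_tensor_coef:
  assumes \<phi>: "\<phi> \<in> val weyl_h a"
  shows "weyl_tensor b (coef weyl_h a b \<mu> \<phi>) = (coef (tensor_power p) a b \<mu> (weyl_tensor a \<phi>) :: nat list \<Rightarrow> 'k)"
proof
  fix w
  show "weyl_tensor b (coef weyl_h a b \<mu> \<phi>) w = coef (tensor_power p) a b \<mu> (weyl_tensor a \<phi>) w"
  proof (cases "w \<in> words p b")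
    case True
    let ?\<mu>' = "image_mset prod.swap \<mu>" and ?e = "unit_vec w :: nat list \<Rightarrow> 'k"
    let ?h = "coef (tensor_power p) b a ?\<mu>' ?e"
    have e: "?e \<in> coords (words p b)"
      by (rule unit_vec_coords[OF True])
    have h: "?h \<in> coords (words p a)"
      by (simp add: coords_def tensor_power_coef)
    have ae: "asymm (Suc n) ?e \<in> coords (words p b)"
      using n by (intro asymm_coords[OF e]) simp
    have "coef schur_h b a ?\<mu>' (proj_vec ?e) = qop p n (coef (tensor_power p) b a ?\<mu>' (asymm (Suc n) ?e))"
      unfolding proj_vec_def schur_hook_coef[OF n] by (rule coef_sym_power_qop[OF n ae])
    also have "\<dots> = proj_vec ?h"
      unfolding proj_vec_def using n by (subst coef_asymm[OF e]) auto
    finally have 1: "coef schur_h b a ?\<mu>' (proj_vec ?e) = proj_vec ?h" .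
    have "weyl_tensor b (coef weyl_h a b \<mu> \<phi>) w = \<phi> (coef schur_h b a ?\<mu>' (proj_vec ?e))"
      using True proj_vec_mem[OF e] unfolding weyl_tensor_def weyl_functor_def kuhn_dual_coef by (simp only: if_True)
    also have "\<dots> = (\<Sum>u\<in>words p a. ?h u * weyl_tensor a \<phi> u)"
      unfolding 1 by (rule weyl_expand[OF \<phi> h])
    also have "\<dots> = (\<Sum>u\<in>words p a. if mset (zip w u) = \<mu> then weyl_tensor a \<phi> u else 0)"
    proof (rule sum.cong[OF refl])
      fix u assume u: "u \<in> words p a"
      have len: "length u = p" "length w = p"
        using u True by (auto dest: length_words)
      have "image_mset prod.swap (mset (zip w u)) = mset (zip u w)"
        using len by (simp add: zip_commute[of u w] flip: mset_map) (simp add: case_prod_unfold prod.swap_def[abs_def])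
      moreover have "image_mset prod.swap (image_mset prod.swap \<nu>) = \<nu>" for \<nu> :: "(nat \<times> nat) multiset"
        by (simp add: multiset.map_comp)
      ultimately have eq: "mset (zip u w) = ?\<mu>' \<longleftrightarrow> mset (zip w u) = \<mu>"
        by metis
      have "?h u = (\<Sum>v | v \<in> words p b \<and> mset (zip u v) = ?\<mu>'. if v = w then 1 else 0)"
        using u by (simp add: tensor_power_coef unit_vec_def)
      also have "\<dots> = (if mset (zip u w) = ?\<mu>' then 1 else 0)"
        using True by (subst sum.delta) auto
      finally have "?h u = (if mset (zip w u) = \<mu> then 1 else 0)"
        unfolding eq .
      then show "?h u * weyl_tensor a \<phi> u = (if mset (zip w u) = \<mu> then weyl_tensor a \<phi> u else 0)"
        by simp
    qed
    also have "\<dots> = (\<Sum>u | u \<in> words p a \<and> mset (zip w u) = \<mu>. weyl_tensor a \<phi> u)"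
      by (rule sum.inter_filter[symmetric]) simp
    also have "\<dots> = coef (tensor_power p) a b \<mu> (weyl_tensor a \<phi>) w"
      using True by (simp add: tensor_power_coef)
    finally show ?thesis .
  next
    case False
    then show ?thesis
      by (simp add: weyl_tensor_def tensor_power_coef)
  qed
qed

text \<open>Alternation comes from antisymmetrising the basis word, symmetry from
  \<open>qop\<close>, which does not see exchanges within the first column.\<close>

lemma weyl_tensor_tens:
  assumes \<phi>: "\<phi> \<in> val weyl_h r"
  shows "(weyl_tensor r \<phi> :: nat list \<Rightarrow> 'k) \<in> tens p (Suc n) (Suc n) r"
proof -
  note \<phi>' = \<phi>[unfolded weyl_h_val]
  note sub = lin_functorD(1)[OF S]
  have "alt_below p (Suc n) (weyl_tensor r \<phi>)"
    unfolding alt_below_def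
  proof (intro allI impI conjI)
    fix w :: "nat list" and a b assume w: "length w = p" and ab: "a < b" "b < Suc n"
    have iff: "swp a b w \<in> words p r \<longleftrightarrow> w \<in> words p r"
      using ab n by (intro swp_words_iff) auto
    show "weyl_tensor r \<phi> (swp a b w) = - weyl_tensor r \<phi> w"
    proof (cases "w \<in> words p r")
      case True
      have "asymm (Suc n) (unit_vec (swp a b w)) = - (asymm (Suc n) (unit_vec w) :: nat list \<Rightarrow> 'k)"
        using w ab n by (intro asymm_unit_swp) auto
      also have "\<dots> = fscale (-1) (asymm (Suc n) (unit_vec w))"
        by (simp add: fscale_def fun_eq_iff)
      finally have "proj_vec (unit_vec (swp a b w)) = fscale (-1) (proj_vec (unit_vec w) :: nat list \<Rightarrow> 'k)"
        unfolding proj_vec_def by (simp only: qop_scale)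
      then show ?thesis
        using True iff kuhn_dualD(2)[OF \<phi>' proj_vec_mem[OF unit_vec_coords[OF True]], of "-1"]
        by (simp add: weyl_tensor_def)
    qed (use iff in \<open>simp add: weyl_tensor_def\<close>)
    assume eq: "w ! a = w ! b"
    have "asymm (Suc n) (unit_vec w) = (0 :: nat list \<Rightarrow> 'k)"
      using w ab n eq by (intro asymm_unit_repeat[of w p _ a b]) auto
    then have "proj_vec (unit_vec w) = (0 :: nat list \<Rightarrow> 'k)"
      unfolding proj_vec_def by (simp add: qop_def fun_eq_iff)
    then show "weyl_tensor r \<phi> w = 0"
      using functional_zero[OF \<phi>' sub] by (simp add: weyl_tensor_def)
  qed
  moreover have "sym_above p (Suc n) (weyl_tensor r \<phi>)"
    unfolding sym_above_def
  proof (intro allI impI)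
    fix w :: "nat list" and a b assume w: "length w = p" and ab: "Suc n \<le> a" "a < b" "b < p"
    have iff: "swp a b w \<in> words p r \<longleftrightarrow> w \<in> words p r"
      using ab by (intro swp_words_iff) auto
    have "asymm (Suc n) (unit_vec (swp a b w)) = (\<lambda>v. asymm (Suc n) (unit_vec w) (swp a b v) :: 'k)"
      using w ab by (intro asymm_unit_swp_above) auto
    then have "proj_vec (unit_vec (swp a b w)) = (proj_vec (unit_vec w) :: nat list \<Rightarrow> 'k)"
      unfolding proj_vec_def using ab n qop_swp[of n p a b] by simp
    then show "weyl_tensor r \<phi> (swp a b w) = weyl_tensor r \<phi> w"
      by (simp add: weyl_tensor_def iff)
  qed
  ultimately show ?thesis
    using weyl_tensor_coords by (simp add: tens_def)
qed

lemma kap_weyl_tensor: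
  assumes \<phi>: "\<phi> \<in> val weyl_h r" and n': "Suc n < p"
  shows "kap (Suc n) (weyl_tensor r \<phi>) = (0 :: nat list \<Rightarrow> 'k)"
proof
  fix w
  have kc: "kap (Suc n) (weyl_tensor r \<phi>) \<in> coords (words p r)"
    by (rule kap_coords[OF weyl_tensor_coords n'])
  show "kap (Suc n) (weyl_tensor r \<phi>) w = 0 w"
  proof (cases "w \<in> words p r")
    case True
    have len: "length w = p"
      by (rule length_words[OF True])
    have sw: "swp t (Suc n) w \<in> words p r" if "t < Suc n" for t
      using that n' True by (subst swp_words_iff) auto
    \<comment> \<open>Chosen so that its antisymmetrisation over \<open>n + 1\<close> positions is
      that of \<open>w\<close> over \<open>n + 2\<close> positions, which \<open>qop\<close> kills.
      Applying \<phi> to this relation yields the vanishing of \<open>kap\<close>.\<close>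
    let ?Y = "\<lambda>v. unit_vec w v - (\<Sum>t<Suc n. unit_vec (swp t (Suc n) w) v) :: 'k"
    have Y: "?Y \<in> coords (words p r)"
      unfolding coords_def
    proof (intro CollectI allI impI)
      fix v assume v: "v \<notin> words p r"
      then have "unit_vec w v = (0::'k)" "\<And>t. t < Suc n \<Longrightarrow> unit_vec (swp t (Suc n) w) v = (0::'k)"
        using True sw by (auto simp: unit_vec_def)
      then show "?Y v = 0"
        by (simp del: sum.lessThan_Suc)
    qed
    have "asymm (Suc n) ?Y v = asymm (Suc (Suc n)) (unit_vec w) v" if v: "length v = p" for v
    proof -
      have "asymm (Suc n) ?Y v = asymm (Suc n) (unit_vec w) v - (\<Sum>\<sigma> | \<sigma> permutes {..<Suc n}. \<Sum>t<Suc n.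
          of_int (sign \<sigma>) * unit_vec (swp t (Suc n) w) (permute_list \<sigma> v))"
        by (simp only: asymm_def right_diff_distrib sum_subtractf sum_distrib_left)
      also have "\<dots> = asymm (Suc n) (unit_vec w) v - (\<Sum>t<Suc n. asymm (Suc n) (unit_vec (swp t (Suc n) w)) v)"
        unfolding asymm_def by (subst sum.swap) (rule refl)
      also have "asymm (Suc n) (unit_vec w) v = (asymm (Suc n) (unit_vec v) w :: 'k)"
        using v len n by (intro asymm_unit_sym) auto
      also have "(\<Sum>t<Suc n. asymm (Suc n) (unit_vec (swp t (Suc n) w)) v) =
          (\<Sum>t<Suc n. asymm (Suc n) (unit_vec v) (swp t (Suc n) w) :: 'k)"
        using v len n by (intro sum.cong refl asymm_unit_sym) auto
      also have "asymm (Suc n) (unit_vec v) w - \<dots> = kap (Suc n) (asymm (Suc n) (unit_vec v)) w"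
        by (simp only: kap_def)
      also have "\<dots> = asymm (Suc (Suc n)) (unit_vec v) w"
        by (rule asymm_Suc[OF len n', symmetric])
      also have "\<dots> = asymm (Suc (Suc n)) (unit_vec w) v"
        using v len n' by (intro asymm_unit_sym) auto
      finally show ?thesis .
    qed
    then have "proj_vec ?Y = qop p n (asymm (Suc (Suc n)) (unit_vec w))"
      unfolding proj_vec_def by (intro qop_cong)
    also have "\<dots> = 0"
      using n' by (intro ext) (simp add: qop_alt_zero asymm_alt)
    finally have "0 = \<phi> (proj_vec ?Y)"
      using functional_zero[OF \<phi>[unfolded weyl_h_val] lin_functorD(1)[OF S]] by (simp only:)
    also have "\<dots> = (\<Sum>u\<in>words p r. ?Y u * weyl_tensor r \<phi> u)"
      by (rule weyl_expand[OF \<phi> Y])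
    also have "\<dots> = (\<Sum>u\<in>words p r. unit_vec w u * weyl_tensor r \<phi> u) -
        (\<Sum>u\<in>words p r. \<Sum>t<Suc n. unit_vec (swp t (Suc n) w) u * weyl_tensor r \<phi> u)"
      by (simp only: left_diff_distrib sum_subtractf sum_distrib_right)
    also have "(\<Sum>u\<in>words p r. \<Sum>t<Suc n. unit_vec (swp t (Suc n) w) u * weyl_tensor r \<phi> u) =
        (\<Sum>t<Suc n. \<Sum>u\<in>words p r. unit_vec (swp t (Suc n) w) u * weyl_tensor r \<phi> u)"
      by (rule sum.swap)
    also have "(\<Sum>t<Suc n. \<Sum>u\<in>words p r. unit_vec (swp t (Suc n) w) u * weyl_tensor r \<phi> u) =
        (\<Sum>t<Suc n. weyl_tensor r \<phi> (swp t (Suc n) w))"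
    proof (rule sum.cong[OF refl])
      fix t assume "t \<in> {..<Suc n}"
      then show "(\<Sum>u\<in>words p r. unit_vec (swp t (Suc n) w) u * weyl_tensor r \<phi> u) = weyl_tensor r \<phi> (swp t (Suc n) w)"
        using sw[of t] by (simp add: unit_vec_def if_distrib[of "\<lambda>c. c * _"] cong: if_cong)
    qed
    also have "(\<Sum>u\<in>words p r. unit_vec w u * weyl_tensor r \<phi> u) = weyl_tensor r \<phi> w"
      using True by (simp add: unit_vec_def if_distrib[of "\<lambda>c. c * _"] cong: if_cong)
    finally show ?thesis
      by (simp only: kap_def zero_fun_apply)
  next
    case False
    then show ?thesis
      using kc by (simp add: coords_def)
  qed
qed

section \<open>The natural map \<psi> into the Weyl functor\<close>

lemma sum_rho_fibres:
  assumes G: "\<And>w w'. length w = p \<Longrightarrow> length w' = p \<Longrightarrow> rho n w = rho n w' \<Longrightarrow> G w = G w'"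
    and a: "(a :: nat list \<Rightarrow> 'k) \<in> coords (words p r)" and q: "qop p n a = 0"
  shows "(\<Sum>w\<in>words p r. G w * a w) = 0"
proof -
  have "(\<Sum>w\<in>words p r. G w * a w) = (\<Sum>u\<in>rho n ` words p r. \<Sum>w\<in>{w\<in>words p r. rho n w = u}. G w * a w)"
    by (rule sum.image_gen) simp
  also have "\<dots> = 0"
  proof (rule sum.neutral, rule ballI)
    fix u assume "u \<in> rho n ` words p r"
    then obtain v where v: "v \<in> words p r" "u = rho n v" by blast
    have "(\<Sum>w\<in>{w\<in>words p r. rho n w = u}. G w * a w) = (\<Sum>w\<in>{w\<in>words p r. rho n w = u}. G v * a w)"
      using v by (intro sum.cong refl arg_cong2[of _ _ _ _ "(*)"] G) (auto dest: length_words)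
    also have "\<dots> = G v * qop p n a u"
      unfolding basis_map_qop[OF n a, symmetric] basis_map_def sum_distrib_left ..
    finally show "(\<Sum>w\<in>{w\<in>words p r. rho n w = u}. G w * a w) = 0"
      by (simp add: q)
  qed
  finally show ?thesis .
qed

text \<open>After the exchange the first \<open>n\<close> positions hold the letters from positions
  \<open>1, ..., n\<close>, and the others hold the first column, in which \<open>g\<close> is
  symmetric. The class under \<open>rho\<close> determines both.\<close>

lemma swp_rho_const:
  assumes g: "g \<in> tens p n n r" and w: "length w = p" "length w' = p" and e: "rho n w = rho n w'"
  shows "g (swp 0 n w) = g (swp 0 n w')"
proof (rule sym_above_mset[OF tensD(3)[OF g]])
  have m: "mset w = mset w'" "take n (tl w) = take n (tl w')"
    using rho_eq_iff[OF n w] e by auto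
  have nth: "w ! Suc i = w' ! Suc i" if "i < n" for i
  proof -
    have "take n (tl w) ! i = take n (tl w') ! i"
      using m(2) by simp
    then show ?thesis
      using that w n by (simp add: nth_tl)
  qed
  show t: "take n (swp 0 n w) = take n (swp 0 n w')"
  proof (rule nth_equalityI)
    fix i assume "i < length (take n (swp 0 n w))"
    then have i: "i < n" using w n by simp
    then have "swp 0 n w ! i = (if i = 0 then w ! n else w ! i)" "swp 0 n w' ! i = (if i = 0 then w' ! n else w' ! i)"
      using w n by (simp_all add: nth_swp)
    moreover have "w ! n = w' ! n" "i \<noteq> 0 \<Longrightarrow> w ! i = w' ! i"
      using nth[of "n - 1"] nth[of "i - 1"] i by simp_all
    ultimately show "take n (swp 0 n w) ! i = take n (swp 0 n w') ! i"
      using i by simp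
  qed (use w in simp)
  have "mset (take n (swp 0 n w)) + mset (drop n (swp 0 n w)) = mset (take n (swp 0 n w')) + mset (drop n (swp 0 n w'))"
    using m(1) w n by (simp flip: mset_append)
  then show "mset (drop n (swp 0 n w)) = mset (drop n (swp 0 n w'))"
    unfolding t by simp
qed (use w in simp_all)

text \<open>The functional defined by \<open>kap n g\<close> kills the kernel of the projection onto the Schur
  functor. Up to the invertible factor \<open>n!\<close> it is \<open>g\<close> composed with the antisymmetriser, and \<open>g\<close> is
  constant along the symmetrised positions up to an exchange of the positions \<open>0\<close> and \<open>n\<close>.\<close>

lemma kap_pairing:
  assumes char: "CHAR('k) = p" and g: "g \<in> tens p n n r" and h: "(h :: nat list \<Rightarrow> 'k) \<in> coords (words p r)"
    and z: "proj_vec h = 0"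
  shows "(\<Sum>w\<in>words p r. kap n g w * h w) = 0"
proof -
  let ?a = "asymm (Suc n) h"
  have gc: "g \<in> coords (words p r)"
    by (rule tensD(1)[OF g])
  have a: "?a \<in> coords (words p r)" "alt_below p (Suc n) ?a"
    using n by (auto intro!: asymm_coords[OF h] asymm_alt)
  have q: "qop p n ?a = 0"
    using z by (simp only: proj_vec_def)
  have "of_nat (fact n) * (\<Sum>w\<in>words p r. kap n g w * h w) = (\<Sum>w\<in>words p r. asymm (Suc n) g w * h w)"
    unfolding sum_distrib_left
  proof (rule sum.cong[OF refl])
    fix w assume "w \<in> words p r"
    then have len: "length w = p"
      by (rule length_words)
    have "asymm (Suc n) g w = kap n (asymm n g) w"
      by (rule asymm_Suc[OF len n])
    also have "\<dots> = kap n (\<lambda>v. of_nat (fact n) * g v) w"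
      using n by (intro kap_cong[OF _ len] asymm_of_alt[OF tensD(2)[OF g]]) auto
    also have "\<dots> = of_nat (fact n) * kap n g w"
      by (simp only: kap_mult)
    finally show "of_nat (fact n) * (kap n g w * h w) = asymm (Suc n) g w * h w"
      by simp
  qed
  also have "\<dots> = (\<Sum>w\<in>words p r. g w * ?a w)"
    using n by (intro asymm_adjoint[OF _ gc h]) simp
  also have "\<dots> = 0"
  proof -
    have "(\<Sum>w\<in>words p r. g (swp 0 n w) * ?a w) = 0"
      by (rule sum_rho_fibres[OF swp_rho_const[OF g] a(1) q])
    then have "(\<Sum>w\<in>words p r. g (swp 0 n (swp 0 n w)) * ?a (swp 0 n w)) = 0"
      using n by (subst sum_swp) auto
    \<comment> \<open>For \<open>n = 0\<close> the exchange is the identity, hence the sign 1 in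
      that case.\<close>
    moreover have "g (swp 0 n (swp 0 n w)) * ?a (swp 0 n w) = (if n = 0 then 1 else - 1) * (g w * ?a w)"
      if "w \<in> words p r" for w
      using length_words[OF that] altD(1)[OF a(2), of w 0 n] n by auto
    ultimately have "(if n = 0 then 1 else - 1) * (\<Sum>w\<in>words p r. g w * ?a w) = 0"
      unfolding sum_distrib_left by simp
    then show ?thesis
      by (simp split: if_splits)
  qed
  finally show ?thesis
    using of_nat_fact_neq_0[OF char n] by simp
qed

lemma weyl_lift_exists:
  assumes char: "CHAR('k) = p" and g: "(g :: nat list \<Rightarrow> 'k) \<in> tens p n n r"
  shows "\<exists>\<phi>\<in>val weyl_h r. weyl_tensor r \<phi> = kap n g"
proof -
  define L where "L h = (\<Sum>w\<in>words p r. kap n g w * h w)" for h :: "nat list \<Rightarrow> 'k"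
  \<comment> \<open>A functional on the Schur functor defined through an arbitrary preimage under
    \<open>proj_vec\<close>; by \<open>kap_pairing\<close> the choice does not affect its
    value.\<close>
  define \<phi> where "\<phi> x = (if x \<in> val schur_h r then L (SOME h. h \<in> coords (words p r) \<and> proj_vec h = x) else 0)" for x :: "nat list \<Rightarrow> 'k"
  have Ladd: "L (f + h) = L f + L h" for f h :: "nat list \<Rightarrow> 'k"
    by (simp add: L_def distrib_left sum.distrib)
  have Lscale: "L (fscale c f) = c * L f" for c and f :: "nat list \<Rightarrow> 'k"
    by (simp add: L_def fscale_apply sum_distrib_left algebra_simps)
  have Leq: "L f = L h" if f: "f \<in> coords (words p r)" and h: "h \<in> coords (words p r)" and e: "proj_vec f = proj_vec h" for f h :: "nat list \<Rightarrow> 'k"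
  proof -
    have "fscale (-1) h \<in> coords (words p r)"
      by (rule fun_vs.subspace_scale[OF coords_subspace h])
    then have c: "f + fscale (-1) h \<in> coords (words p r)"
      by (rule fun_vs.subspace_add[OF coords_subspace f])
    have "proj_vec (f + fscale (-1) h) = 0"
      unfolding proj_vec_add proj_vec_scale e by (simp add: fun_eq_iff fscale_apply)
    then have "L (f + fscale (-1) h) = 0"
      unfolding L_def by (rule kap_pairing[OF char g c])
    then show ?thesis
      unfolding Ladd Lscale by simp
  qed
  have \<phi>L: "\<phi> (proj_vec f) = L f" if f: "f \<in> coords (words p r)" for f :: "nat list \<Rightarrow> 'k"
  proof -
    have "\<exists>h. h \<in> coords (words p r) \<and> proj_vec h = proj_vec f"
      using f by blast
    from someI_ex[OF this] have "L (SOME h. h \<in> coords (words p r) \<and> proj_vec h = proj_vec f) = L f"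
      by (intro Leq f) blast+
    then show ?thesis
      unfolding \<phi>_def using proj_vec_mem[OF f] by (simp only: if_True)
  qed
  have "\<phi> \<in> val weyl_h r"
    unfolding weyl_h_val kuhn_dual_val
  proof (intro conjI ballI allI impI)
    fix x :: "nat list \<Rightarrow> 'k" assume "x \<in> val schur_h r"
    then obtain f where f: "f \<in> coords (words p r)" "x = proj_vec f"
      unfolding schur_h_val by blast
    have "\<phi> (proj_vec (fscale c f)) = L (fscale c f)" for c
      by (rule \<phi>L[OF fun_vs.subspace_scale[OF coords_subspace f(1)]])
    then show "\<phi> (fscale c x) = c * \<phi> x" for c
      unfolding f(2) proj_vec_scale Lscale \<phi>L[OF f(1)] .
    fix y :: "nat list \<Rightarrow> 'k" assume "y \<in> val schur_h r"
    then obtain h where h: "h \<in> coords (words p r)" "y = proj_vec h"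
      unfolding schur_h_val by blast
    have "\<phi> (proj_vec (f + h)) = L (f + h)"
      by (rule \<phi>L[OF fun_vs.subspace_add[OF coords_subspace f(1) h(1)]])
    then show "\<phi> (x + y) = \<phi> x + \<phi> y"
      unfolding f(2) h(2) proj_vec_add Ladd \<phi>L[OF f(1)] \<phi>L[OF h(1)] .
  qed (simp only: \<phi>_def if_False)
  moreover have "weyl_tensor r \<phi> = kap n g"
  proof
    fix w
    show "weyl_tensor r \<phi> w = kap n g w"
    proof (cases "w \<in> words p r")
      case True
      have "weyl_tensor r \<phi> w = L (unit_vec w)"
        using True \<phi>L[OF unit_vec_coords[OF True]] by (simp add: weyl_tensor_def)
      also have "\<dots> = kap n g w"
        using True by (simp add: L_def unit_vec_def if_distrib[of "\<lambda>c. _ * c"] cong: if_cong)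
      finally show ?thesis .
    next
      case False
      then show ?thesis
        using kap_coords[OF tensD(1)[OF g] n] by (simp add: weyl_tensor_def coords_def)
    qed
  qed
  ultimately show ?thesis by blast
qed

text \<open>The transformation \<psi>. By \<open>weyl_tensor_eqD\<close> the chosen functional is
  unique, and so linearity and naturality can be checked on tensors.\<close>

definition weyl_lift :: "nat \<Rightarrow> (nat list \<Rightarrow> 'k) \<Rightarrow> (nat list \<Rightarrow> 'k) \<Rightarrow> 'k"
  where "weyl_lift r g = (if g \<in> tens p n n r then SOME \<phi>. \<phi> \<in> val weyl_h r \<and> weyl_tensor r \<phi> = kap n g else 0)"

lemma weyl_lift_props:
  assumes char: "CHAR('k) = p" and g: "g \<in> tens p n n r"
  shows "weyl_lift r g \<in> val weyl_h r" "weyl_tensor r (weyl_lift r g) = kap n g"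
proof -
  have "\<exists>\<phi>. \<phi> \<in> val weyl_h r \<and> weyl_tensor r \<phi> = kap n g"
    using weyl_lift_exists[OF char g] by blast
  from someI_ex[OF this] show "weyl_lift r g \<in> val weyl_h r" "weyl_tensor r (weyl_lift r g) = kap n g"
    unfolding weyl_lift_def using g by (simp_all only: if_True)
qed

lemma weyl_lift_nat_trans:
  assumes char: "CHAR('k) = p"
  shows "weyl_lift \<in> nat_trans (ext_div p n) weyl_h"
proof -
  note pr = weyl_lift_props[OF char]
  note lW = lin_functorD[OF lin_functor_weyl]
  have "linear_map (tens p n n r) (val weyl_h r) (weyl_lift r)" for r
    unfolding linear_map_def
  proof (intro conjI ballI allI)
    fix f :: "nat list \<Rightarrow> 'k" assume f: "f \<in> tens p n n r"
    show "weyl_lift r f \<in> val weyl_h r"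
      by (rule pr(1)[OF f])
    fix c :: 'k
    have cf: "fscale c f \<in> tens p n n r"
      by (rule fun_vs.subspace_scale[OF tens_subspace f])
    show "weyl_lift r (fscale c f) = fscale c (weyl_lift r f)"
      by (rule weyl_tensor_eqD[OF pr(1)[OF cf] fun_vs.subspace_scale[OF lW(1) pr(1)[OF f]]])
        (simp only: weyl_tensor_scale pr(2)[OF cf] pr(2)[OF f] kap_scale)
  next
    fix f g :: "nat list \<Rightarrow> 'k" assume f: "f \<in> tens p n n r" and g: "g \<in> tens p n n r"
    have fg: "f + g \<in> tens p n n r"
      by (rule fun_vs.subspace_add[OF tens_subspace f g])
    show "weyl_lift r (f + g) = weyl_lift r f + weyl_lift r g"
      by (rule weyl_tensor_eqD[OF pr(1)[OF fg] fun_vs.subspace_add[OF lW(1) pr(1)[OF f] pr(1)[OF g]]])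
        (simp only: weyl_tensor_add pr(2)[OF fg] pr(2)[OF f] pr(2)[OF g] kap_add)
  qed
  moreover have "weyl_lift b (coef (tensor_power p) a b \<mu> f) = coef weyl_h a b \<mu> (weyl_lift a f)"
    if f: "f \<in> tens p n n a" for a b \<mu> f
  proof -
    have cf: "coef (tensor_power p) a b \<mu> f \<in> tens p n n b"
      using n by (intro coef_tens[OF f]) simp
    show ?thesis
      by (rule weyl_tensor_eqD[OF pr(1)[OF cf] linear_map_mem[OF lW(2) pr(1)[OF f]]])
        (simp only: weyl_tensor_coef[OF pr(1)[OF f]] pr(2)[OF cf] pr(2)[OF f] coef_kap[OF n])
  qed
  moreover have "weyl_lift r f = 0" if "f \<notin> tens p n n r" for r f
    using that by (simp only: weyl_lift_def if_False)
  ultimately show ?thesis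
    unfolding nat_trans_def ext_div_simps by blast
qed

end

end

section \<open>Tensors of the content of a generating vector\<close>

lemma alt_permute_zero_iff:
  assumes f: "alt_below p j f" and \<sigma>: "\<sigma> permutes {..<j}" and j: "j \<le> p" and w: "length w = p"
  shows "f (permute_list \<sigma> w) = 0 \<longleftrightarrow> f w = 0"
  using \<sigma> finite_lessThan w
proof (induction \<sigma> arbitrary: w rule: permutes_induct)
  case id
  show ?case by (simp add: id_def)
next
  case (swap a b q)
  have eq: "permute_list (transpose a b \<circ> q) w = permute_list q (swp a b w)"
    using permute_list_compose[of q w "transpose a b"] permutes_lessThan_mono[OF swap.hyps(4) j]
      swap.hyps(1,2) swap.prems j by (simp add: permute_list_transpose)
  have neg: "f (swp a b w) = - f w"
    using swap.hyps by (intro altD(1)[OF f swap.prems]) auto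
  have "length (swp a b w) = p"
    using swap.prems by simp
  from swap.IH[OF this] show ?case
    unfolding eq neg by simp
qed

text \<open>The contents of the alternating positions agree as well, so the two values differ by a
  sign. Only vanishing is recorded, which spares tracking that sign.\<close>

lemma alt_sym_zero_iff:
  assumes f: "alt_below p i f" "sym_above p i f" and i: "i \<le> p" and w: "length w = p" "length w' = p"
    and m: "mset w = mset w'" "mset (drop i w) = mset (drop i w')"
  shows "f w = 0 \<longleftrightarrow> f w' = 0"
proof -
  have "mset (take i w) + mset (drop i w) = mset (take i w') + mset (drop i w')"
    using m(1) by (simp flip: mset_append)
  then have "mset (take i w') = mset (take i w)"
    unfolding m(2) by simp
  then obtain \<sigma> where \<sigma>: "\<sigma> permutes {..<length (take i w)}" "permute_list \<sigma> (take i w) = take i w'"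
    by (rule mset_eq_permutation)
  have \<sigma>i: "\<sigma> permutes {..<i}"
    using \<sigma>(1) w i by simp
  have \<sigma>p: "\<sigma> permutes {..<length w}"
    using permutes_lessThan_mono[OF \<sigma>i i] w by simp
  have t: "take i (permute_list \<sigma> w) = take i w'"
  proof (rule nth_equalityI)
    fix k assume "k < length (take i (permute_list \<sigma> w))"
    then have k: "k < i" "k < p"
      using w by auto
    have "\<sigma> k < i"
      using permutes_in_image[OF \<sigma>i, of k] k by simp
    then have "permute_list \<sigma> w ! k = permute_list \<sigma> (take i w) ! k"
      using k w i permute_list_nth[OF \<sigma>p, of k] permute_list_nth[OF \<sigma>(1), of k] by simp
    then show "take i (permute_list \<sigma> w) ! k = take i w' ! k"
      unfolding \<sigma>(2) using k by simp
  qed (use w in simp)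
  have d: "drop i (permute_list \<sigma> w) = drop i w"
  proof (rule nth_equalityI)
    fix k assume "k < length (drop i (permute_list \<sigma> w))"
    then have k: "i + k < p"
      using w i by simp
    then show "drop i (permute_list \<sigma> w) ! k = drop i w ! k"
      using permute_list_nth[OF \<sigma>p, of "i + k"] permutes_not_in[OF \<sigma>i, of "i + k"] w i by simp
  qed simp
  have "f (permute_list \<sigma> w) = f w'"
    using w t m(2) by (intro sym_above_mset[OF f(2)]) (simp_all add: d)
  then show ?thesis
    using alt_permute_zero_iff[OF f(1) \<sigma>i i w(1)] by simp
qed

lemma count_base_word:
  assumes "j \<le> p"
  shows "count (mset (base_word p j)) j = p - j" "a < j \<Longrightarrow> count (mset (base_word p j)) a = 1"
    "a \<in> set (base_word p j) \<Longrightarrow> a \<le> j"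
proof -
  have "count (mset [0..<j]) a = (if a < j then 1 else 0)" for a
    by (simp add: count_mset_0_iff distinct_count_atmost_1 del: upt_Suc)
  then show "count (mset (base_word p j)) j = p - j" "a < j \<Longrightarrow> count (mset (base_word p j)) a = 1"
    "a \<in> set (base_word p j) \<Longrightarrow> a \<le> j"
    using assms by (auto simp: base_word_def)
qed

lemma image_mset_transpose:
  assumes "count M a = count M b"
  shows "image_mset (transpose a b) M = M"
proof (rule multiset_eqI)
  fix x
  have "transpose a b -` {x} = {transpose a b x}"
    by (auto simp: transpose_eq_iff)
  then have "count (image_mset (transpose a b) M) x = count M (transpose a b x)"
    by (auto simp: count_image_mset not_in_iff Int_insert_left)
  also have "\<dots> = count M x"
    using assms by (simp add: transpose_def)
  finally show "count (image_mset (transpose a b) M) x = count M x"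
    by simp
qed

context
  fixes p n j :: nat and y :: "nat list \<Rightarrow> 'k::field"
  assumes char: "CHAR('k) = p" and n: "n < p" and j: "j < p"
    and alt: "alt_below p (Suc n) y" and sym_y: "sym_above p (Suc n) y"
    and supp: "\<And>w. length w = p \<Longrightarrow> y w \<noteq> 0 \<Longrightarrow> mset w = mset (base_word p j)"
    and letters: "\<And>w a b. length w = p \<Longrightarrow> a < j \<Longrightarrow> b < j \<Longrightarrow> a \<noteq> b \<Longrightarrow> y (map (transpose a b) w) = - y w"
begin

text \<open>Two letters below \<open>j\<close> in the symmetric positions of \<open>w\<close> may be exchanged without changing \<open>y w\<close>, but
  \<open>letters\<close> makes this a change of sign; and the letter \<open>j\<close> occurs at most once in the alternating
  positions. This leaves very few contents of the symmetric positions.\<close>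

lemma tail_shape:
  assumes w: "length w = p" and nz: "y w \<noteq> 0"
  shows "mset (drop (Suc n) w) = replicate_mset (p - Suc n) j \<and> (j = n \<or> j = Suc n) \<or>
    (\<exists>a<j. mset (drop (Suc n) w) = add_mset a (replicate_mset (p - Suc (Suc n)) j) \<and>
      (j = Suc n \<or> j = Suc (Suc n)))"
proof -
  define T H where "T = mset (drop (Suc n) w)" and "H = mset (take (Suc n) w)"
  have HT: "H + T = mset (base_word p j)"
    unfolding H_def T_def supp[OF w nz, symmetric] by (simp flip: mset_append)
  have sT: "size T = p - Suc n"
    using w by (simp add: T_def)
  have B: "count H j + count T j = p - j" "\<And>a. a < j \<Longrightarrow> count H a + count T a = 1" "\<And>a. a \<in># T \<Longrightarrow> a \<le> j"
    using count_base_word[of j p] j unfolding HT[symmetric] set_mset_mset[symmetric] by auto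
  have "distinct (take (Suc n) w)"
  proof (rule ccontr)
    assume "\<not> distinct (take (Suc n) w)"
    then obtain a b where "a < Suc n" "b < Suc n" "a \<noteq> b" "w ! a = w ! b"
      by (auto simp: distinct_conv_nth)
    then show False
      using altD(2)[OF alt w] nz by blast
  qed
  then have H1: "count H j \<le> 1"
    unfolding H_def by (simp add: distinct_count_atmost_1)
  have uniq: "a = b" if a: "a \<in># T" "a \<noteq> j" and b: "b \<in># T" "b \<noteq> j" for a b
  proof (rule ccontr)
    assume ab: "a \<noteq> b"
    have lt: "a < j" "b < j"
      using B(3)[OF a(1)] B(3)[OF b(1)] a b by auto
    have cT: "count T a = 1" "count T b = 1" "count H a = 0" "count H b = 0"
      using B(2)[OF lt(1)] B(2)[OF lt(2)] a(1) b(1) by (auto simp: not_less_eq_eq simp flip: count_greater_zero_iff)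
    have "map (transpose a b) (take (Suc n) w) = take (Suc n) w"
    proof (rule map_idI)
      fix x assume "x \<in> set (take (Suc n) w)"
      then have "x \<in># H" by (simp add: H_def)
      then have "x \<noteq> a" "x \<noteq> b"
        using cT(3,4) by (auto simp: count_eq_zero_iff)
      then show "transpose a b x = x" by simp
    qed
    moreover have "image_mset (transpose a b) T = T"
      by (rule image_mset_transpose) (simp add: cT)
    ultimately have "y (map (transpose a b) w) = y w"
      using w by (intro sym_above_mset[OF sym_y]) (simp_all add: take_map drop_map T_def)
    then have "y w = - y w"
      using letters[OF w lt ab] by simp
    then have "of_nat 2 * y w = 0"
      by (simp add: algebra_simps eq_neg_iff_add_eq_0)
    \<comment> \<open>Two distinct letters in the \<open>p - n - 1\<close> symmetric positions force
      \<open>p > 2\<close>, so 2 is invertible.\<close>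
    moreover have "2 < p"
    proof -
      have "{#a, b#} \<subseteq># T"
        using a(1) b(1) ab by (simp add: insert_subset_eq_iff in_diff_count)
      from size_mset_mono[OF this] show ?thesis
        using sT by simp
    qed
    then have "of_nat 2 \<noteq> (0 :: 'k)"
      by (intro of_nat_eq_0_char(2)[OF char]) auto
    ultimately show False
      using nz by (simp del: of_nat_numeral)
  qed
  show ?thesis
  proof (cases "set_mset T \<subseteq> {j}")
    case True
    then have T: "T = replicate_mset (p - Suc n) j"
      using set_mset_subset_singletonD sT by metis
    then have "count T j = p - Suc n" by simp
    \<comment> \<open>Subtracting from the total multiplicity \<open>p - j\<close> shows that
      \<open>j\<close> occurs \<open>n + 1 - j\<close> times in the alternating positions; this must
      be 0 or 1.\<close>
    then have "j = n \<or> j = Suc n"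
      using B(1) H1 n j by linarith
    then show ?thesis
      using T unfolding T_def by blast
  next
    case False
    then obtain a where a: "a \<in># T" "a \<noteq> j" by blast
    have lt: "a < j" using B(3)[OF a(1)] a(2) by simp
    have ca: "count T a = 1"
      using B(2)[OF lt] a(1) by (auto simp flip: count_greater_zero_iff)
    have "x = j" if x: "x \<in># T - {#a#}" for x
    proof (rule ccontr)
      assume "x \<noteq> j"
      then have "x = a"
        using uniq[OF in_diffD[OF x] _ a] by blast
      then show False
        using x ca by (simp add: in_diff_count)
    qed
    then have "T - {#a#} = replicate_mset (size (T - {#a#})) j"
      by (intro set_mset_subset_singletonD) auto
    also have "size (T - {#a#}) = p - Suc (Suc n)"
      using a(1) sT by (simp add: size_Diff_singleton)
    finally have d: "T - {#a#} = replicate_mset (p - Suc (Suc n)) j" .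
    have T: "T = add_mset a (replicate_mset (p - Suc (Suc n)) j)"
      unfolding d[symmetric] using a(1) by simp
    have "size T > 0"
      using a(1) by (metis size_eq_0_iff_empty empty_iff set_mset_empty not_gr0)
    then have "Suc n < p"
      using sT by simp
    moreover have "count T j = p - Suc (Suc n)"
      using a(2) T by simp
    \<comment> \<open>Now the letter \<open>j\<close> occurs \<open>n + 2 - j\<close> times in the
      alternating positions, again 0 or 1.\<close>
    ultimately have "j = Suc n \<or> j = Suc (Suc n)"
      using B(1) H1 n j by linarith
    then show ?thesis
      using T lt unfolding T_def by blast
  qed
qed

lemma zero_of_tail:
  assumes w: "length w = p" "length w' = p" "mset w' = mset (base_word p j)"
    and t: "mset (drop (Suc n) w) = mset (drop (Suc n) w')" and z: "y w' = 0"
  shows "y w = 0"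
proof (rule ccontr)
  assume nz: "y w \<noteq> 0"
  from supp[OF w(1) nz] have "mset w = mset w'"
    using w(3) by simp
  then show False
    using alt_sym_zero_iff[OF alt sym_y _ w(1,2) _ t] n z nz by simp
qed

text \<open>Renaming \<open>a\<close> to \<open>b\<close> by \<open>letters\<close> gives
  \<open>w\<close> the tail content of \<open>w'\<close> and changes \<open>y\<close> by a sign
  only.\<close>

lemma zero_of_tail_letter:
  assumes w: "length w = p" "length w' = p" "mset w' = mset (base_word p j)"
    and t: "mset (drop (Suc n) w) = add_mset a (replicate_mset (p - Suc (Suc n)) j)"
      "mset (drop (Suc n) w') = add_mset b (replicate_mset (p - Suc (Suc n)) j)"
    and ab: "a < j" "b < j" and z: "y w' = 0"
  shows "y w = 0"
proof (cases "a = b")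
  case True
  then show ?thesis
    using t by (intro zero_of_tail[OF w _ z]) simp
next
  case False
  have "y (map (transpose a b) w) = 0"
    using ab w t False by (intro zero_of_tail[OF _ w(2,3) _ z]) (simp_all add: drop_map)
  then show ?thesis
    using letters[OF w(1) ab False] by simp
qed

text \<open>For \<open>j = n\<close> only the tail consisting of letters \<open>j\<close> is
  possible, and the base word has this tail.\<close>

lemma zero_of_base:
  assumes jn: "j = n" and z: "y (base_word p j) = 0" and w: "length w = p"
  shows "y w = 0"
proof (rule ccontr)
  assume nz: "y w \<noteq> 0"
  have "mset (drop (Suc n) (base_word p j)) = replicate_mset (p - Suc n) j"
    by (simp add: base_word_def jn del: upt_Suc)
  then show False
    using tail_shape[OF w nz] jn j w nz z by (auto intro: zero_of_tail[of w "base_word p j"])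
qed

text \<open>For \<open>j = n + 1\<close> two kinds of tail are possible. The swapped base word
  decides those with one letter below \<open>j\<close>; the relation \<open>kap\<close>, evaluated
  at the base word, expresses the other kind through them.\<close>

lemma zero_of_swapped_base:
  assumes jn: "j = Suc n" and z: "y (swp n (Suc n) (base_word p j)) = 0"
    and kap: "\<And>w. length w = p \<Longrightarrow> kap (Suc n) y w = 0" and w: "length w = p"
  shows "y w = 0"
proof -
  let ?B = "base_word p j" and ?w' = "swp n (Suc n) (base_word p j)"
  have lB: "length ?B = p" using j by simp
  have tail: "drop (Suc n) (swp t (Suc n) ?B) = t # replicate (p - Suc (Suc n)) j" if "t < Suc n" for t
    using that j jn by (intro nth_equalityI) (auto simp: nth_swp base_word_nth nth_Cons' )
  have case2: "y v = 0" if v: "length v = p" and t: "mset (drop (Suc n) v) = add_mset a (replicate_mset (p - Suc (Suc n)) j)" "a < j" for v a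
    using j jn tail[of n] by (intro zero_of_tail_letter[OF v _ _ t(1) _ t(2) _ z, of n]) simp_all
  have "y (swp t (Suc n) ?B) = 0" if "t < Suc n" for t
    using that jn lB tail[OF that] by (intro case2[of _ t]) simp_all
  then have B: "y ?B = 0"
    using kap[OF lB] by (simp add: kap_def del: sum.lessThan_Suc)
  show ?thesis
  proof (rule ccontr)
    assume nz: "y w \<noteq> 0"
    have "mset (drop (Suc n) ?B) = replicate_mset (p - Suc n) j"
      using j by (simp add: base_word_def jn del: upt_Suc)
    then have "mset (drop (Suc n) w) \<noteq> replicate_mset (p - Suc n) j"
      using zero_of_tail[OF w lB refl _ B] nz by metis
    then show False
      using tail_shape[OF w nz] case2[OF w] nz by blast
  qed
qed

text \<open>Only \<open>j = n + 2\<close> remains. At the base word every exchange in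
  \<open>kap\<close> is a renaming of two letters below \<open>j\<close>, so \<open>kap\<close>
  multiplies the value by \<open>n + 2 = j < p\<close>, which is invertible.\<close>

lemma zero_of_index:
  assumes jn: "j \<noteq> n" "j \<noteq> Suc n"
    and kap: "\<And>w. Suc n < p \<Longrightarrow> length w = p \<Longrightarrow> kap (Suc n) y w = 0" and w: "length w = p"
  shows "y w = 0"
proof (rule ccontr)
  assume nz: "y w \<noteq> 0"
  let ?B = "base_word p j"
  from tail_shape[OF w nz] jn obtain a where a: "a < j"
      "mset (drop (Suc n) w) = add_mset a (replicate_mset (p - Suc (Suc n)) j)" and jn2: "j = Suc (Suc n)"
    by blast
  have lB: "length ?B = p" using j by simp
  have "drop (Suc n) ?B = Suc n # replicate (p - Suc (Suc n)) j"
    using j jn2 by (intro nth_equalityI) (auto simp: base_word_nth nth_Cons')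
  then have tB: "mset (drop (Suc n) ?B) = add_mset (Suc n) (replicate_mset (p - Suc (Suc n)) j)"
    by simp
  have sw: "y (swp t (Suc n) ?B) = - y ?B" if t: "t < Suc n" for t
  proof -
    have "swp t (Suc n) ?B = map (transpose t (Suc n)) ?B"
      using j jn2 t by (intro nth_equalityI) (auto simp: nth_swp base_word_nth transpose_def)
    then show ?thesis
      using letters[OF lB, of t "Suc n"] t jn2 by simp
  qed
  have "0 = kap (Suc n) y ?B"
    using kap[OF _ lB] j jn2 by simp
  also have "\<dots> = of_nat (Suc (Suc n)) * y ?B"
    using sw by (simp add: kap_def algebra_simps del: sum.lessThan_Suc)
  finally have "y ?B = 0"
    using of_nat_eq_0_char(2)[OF char, of "Suc (Suc n)"] j jn2 by (simp del: of_nat_Suc)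
  then show False
    using zero_of_tail_letter[OF w lB refl a(2) tB a(1)] jn2 nz by simp
qed

end

section \<open>Values and symmetries of the generating vector\<close>

lemma gen_vec_base:
  assumes j: "j \<le> p"
  shows "gen_vec p j (base_word p j) = 1"
proof -
  let ?B = "base_word p j"
  have "permute_list \<sigma> ?B = ?B \<longleftrightarrow> \<sigma> = id" if \<sigma>: "\<sigma> permutes {..<j}" for \<sigma>
  proof
    assume e: "permute_list \<sigma> ?B = ?B"
    show "\<sigma> = id"
    proof
      fix i
      show "\<sigma> i = id i"
      proof (cases "i < j")
        case True
        have "\<sigma> i < j"
          using permutes_in_image[OF \<sigma>, of i] True by simp
        moreover have "?B ! \<sigma> i = ?B ! i"
          using permute_list_nth[of \<sigma> ?B i] permutes_lessThan_mono[OF \<sigma> j] e True j by simp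
        ultimately show ?thesis
          using True j by (simp add: base_word_nth)
      qed (use permutes_not_in[OF \<sigma>] in simp)
    qed
  qed simp
  then have "gen_vec p j ?B = (\<Sum>\<sigma> | \<sigma> permutes {..<j}. if \<sigma> = id then 1 else 0)"
    unfolding gen_vec_def asymm_def by (intro sum.cong refl) (simp add: unit_vec_def)
  also have "\<dots> = 1"
    by (simp add: finite_permutations permutes_id)
  finally show ?thesis .
qed

lemma gen_vec_support:
  assumes j: "j \<le> p" and nz: "gen_vec p j w \<noteq> 0"
  shows "length w = p" "mset w = mset (base_word p j)" "i < j \<Longrightarrow> w ! i < j" "j \<le> i \<Longrightarrow> i < p \<Longrightarrow> w ! i = j"
proof -
  obtain \<sigma> where \<sigma>: "\<sigma> permutes {..<j}" "permute_list \<sigma> w = base_word p j"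
    using nz unfolding gen_vec_def asymm_def unit_vec_def
    by (elim sum.not_neutral_contains_not_neutral) (auto split: if_splits)
  show l: "length w = p"
    using arg_cong[OF \<sigma>(2), of length] j by simp
  have \<sigma>p: "\<sigma> permutes {..<length w}"
    using permutes_lessThan_mono[OF \<sigma>(1) j] l by simp
  show "mset w = mset (base_word p j)"
    using mset_permute_list[OF \<sigma>p] \<sigma>(2) by simp
  have nth: "w ! \<sigma> k = base_word p j ! k" if "k < p" for k
    using permute_list_nth[OF \<sigma>p, of k] that l \<sigma>(2) by simp
  show "w ! i < j" if i: "i < j"
  proof -
    obtain k where k: "i = \<sigma> k"
      using permutes_surj[OF \<sigma>(1)] by (metis surj_def)
    have "k < j"
      using permutes_in_image[OF \<sigma>(1), of k] i k by simp
    then show ?thesis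
      using nth[of k] j k by (simp add: base_word_nth)
  qed
  show "w ! i = j" if i: "j \<le> i" "i < p"
    using nth[of i] permutes_not_in[OF \<sigma>(1), of i] i j by (simp add: base_word_nth)
qed

text \<open>In the base word letter \<open>i < j\<close> stands in position \<open>i\<close>, so
  exchanging two such letters is exchanging two alternating positions.\<close>

lemma gen_vec_letters:
  assumes j: "j \<le> p" and ab: "a < j" "b < j" "a \<noteq> b" and w: "length w = p"
  shows "gen_vec p j (map (transpose a b) w) = (- gen_vec p j w :: 'k::field)"
proof -
  let ?B = "base_word p j" and ?\<tau> = "transpose a b"
  have lB: "length ?B = p" using j by simp
  have sB: "swp a b ?B = map ?\<tau> ?B"
    using ab j by (intro nth_equalityI) (auto simp: nth_swp base_word_nth transpose_def)
  have "unit_vec ?B (permute_list \<sigma> (map ?\<tau> w)) = (unit_vec (swp a b ?B) (permute_list \<sigma> w) :: 'k)"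
    if "\<sigma> permutes {..<j}" for \<sigma>
  proof -
    have "permute_list \<sigma> (map ?\<tau> w) = map ?\<tau> (permute_list \<sigma> w)"
      using permutes_lessThan_mono[OF that j] w by (intro permute_list_map) simp
    moreover have "map ?\<tau> v = ?B \<longleftrightarrow> v = map ?\<tau> ?B" for v
      by (metis (no_types, lifting) list.map_comp list.map_id transpose_comp_involutory)
    ultimately show ?thesis
      by (simp add: unit_vec_def sB)
  qed
  then have "gen_vec p j (map ?\<tau> w) = (asymm j (unit_vec (swp a b ?B)) w :: 'k)"
    unfolding gen_vec_def asymm_def by (intro sum.cong refl arg_cong2[of _ _ _ _ "(*)"]) simp
  also have "\<dots> = - gen_vec p j w"
    unfolding gen_vec_def asymm_unit_swp[OF lB j ab] by simp
  finally show ?thesis .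
qed

lemma kap_gen_vec_base:
  assumes n: "n < p"
  shows "kap n (gen_vec p n) (base_word p n) = (1 :: 'k::field)"
proof -
  have "gen_vec p n (swp t n (base_word p n)) = (0 :: 'k)" if t: "t < n" for t
  proof (rule ccontr)
    assume "gen_vec p n (swp t n (base_word p n)) \<noteq> (0 :: 'k)"
    from gen_vec_support(4)[OF _ this, of n] show False
      using t n by (simp add: nth_swp base_word_nth)
  qed
  then show ?thesis
    using n by (simp add: kap_def gen_vec_base)
qed

text \<open>Only the exchange of \<open>n\<close> and \<open>n + 1\<close> restores the base word;
  every other term puts the letter \<open>n + 1\<close> into an alternating position or a smaller
  letter into a symmetric one. This normalises \<psi>\<delta> at the word used by
  \<open>hom_coord\<close>.\<close>

lemma kap_del_gen_vec:
  assumes n: "Suc n < p"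
  shows "kap n (del p n (gen_vec p (Suc n))) (swp n (Suc n) (base_word p (Suc n))) = (1 :: 'k::field)"
proof -
  let ?B = "base_word p (Suc n)" and ?g = "gen_vec p (Suc n) :: nat list \<Rightarrow> 'k"
  let ?w = "swp n (Suc n) ?B"
  have lw: "length ?w = p" using n by simp
  have z: "?g (swp n s ?w) = 0" if s: "s \<in> {n..<p} - {Suc n}" for s
  proof (rule ccontr)
    assume "?g (swp n s ?w) \<noteq> 0"
    from gen_vec_support(4)[OF _ this, of "Suc n"] show False
      using s n by (auto simp: nth_swp base_word_nth split: if_splits)
  qed
  have "del p n ?g ?w = ?g (swp n (Suc n) ?w) + (\<Sum>s\<in>{n..<p} - {Suc n}. ?g (swp n s ?w))"
    unfolding del_def using n by (intro sum.remove) auto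
  also have "\<dots> = 1"
    using z n by (simp add: gen_vec_base)
  finally have 1: "del p n ?g ?w = 1" .
  have "?g (swp n s (swp t n ?w)) = 0" if t: "t < n" and s: "s \<in> {n..<p}" for s t
  proof (rule ccontr)
    assume "?g (swp n s (swp t n ?w)) \<noteq> 0"
    from gen_vec_support(3)[OF _ this, of t] show False
      using s t n by (simp add: nth_swp base_word_nth)
  qed
  then have "del p n ?g (swp t n ?w) = 0" if "t < n" for t
    using that unfolding del_def by (intro sum.neutral) auto
  then show ?thesis
    by (simp add: kap_def 1)
qed

text \<open>With \<tau> the identity this component projects to the tensors with the content of the
  base word; a transposition \<tau> renames letters as well. Components of the formal action do this
  over any field, including finite ones.\<close>

lemma coef_letter_map:
  assumes j: "j \<le> p" and \<tau>: "\<And>x. \<tau> (\<tau> x) = x" and B: "mset (map \<tau> (base_word p j)) = mset (base_word p j)"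
  shows "coef (tensor_power p) (Suc j) (Suc j) (mset (zip (map \<tau> (base_word p j)) (base_word p j))) f w =
    (if mset w = mset (base_word p j) then f (map \<tau> w) else 0)"
proof -
  let ?B = "base_word p j"
  have wB: "u \<in> words p (Suc j)" if "mset u = mset ?B" for u
    using that base_word_words[OF j] unfolding words_def by (metis (mono_tags, lifting) mem_Collect_eq mset_eq_length mset_eq_setD)
  have "mset (zip (map \<tau> ?B) ?B) = image_mset (\<lambda>x. (\<tau> x, x)) (mset ?B)"
    by (simp add: zip_map1 zip_same_conv_map comp_def flip: mset_map)
  also have "\<dots> = image_mset (\<lambda>x. (x, \<tau> x)) (mset (map \<tau> ?B))"
    by (simp add: \<tau> multiset.map_comp comp_def)
  finally have mon: "mset (zip (map \<tau> ?B) ?B) = image_mset (\<lambda>x. (x, \<tau> x)) (mset ?B)"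
    unfolding B .
  have fib: "mset (zip w v) = mset (zip (map \<tau> ?B) ?B) \<longleftrightarrow> mset w = mset ?B \<and> v = map \<tau> w"
    if len: "length w = p" "length v = p" for v
  proof
    assume e: "mset (zip w v) = mset (zip (map \<tau> ?B) ?B)"
    have "image_mset fst (mset (zip w v)) = mset ?B"
      unfolding e mon by (simp add: multiset.map_comp comp_def)
    then have 1: "mset w = mset ?B"
      using len by (simp flip: mset_map)
    have "v ! i = \<tau> (w ! i)" if i: "i < p" for i
    proof -
      have "(w ! i, v ! i) \<in> set (zip w v)"
        using i len by (auto simp: set_zip)
      then have "(w ! i, v ! i) \<in># image_mset (\<lambda>x. (x, \<tau> x)) (mset ?B)"
        unfolding mon[symmetric] e[symmetric] by simp
      then show ?thesis by auto
    qed
    then show "mset w = mset ?B \<and> v = map \<tau> w"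
      using 1 len by (auto intro: nth_equalityI)
  next
    assume a: "mset w = mset ?B \<and> v = map \<tau> w"
    have "mset (zip w (map \<tau> w)) = image_mset (\<lambda>x. (x, \<tau> x)) (mset w)"
      by (simp add: zip_map2 zip_same_conv_map comp_def flip: mset_map)
    then show "mset (zip w v) = mset (zip (map \<tau> ?B) ?B)"
      using a mon by simp
  qed
  show ?thesis
  proof (cases "w \<in> words p (Suc j)")
    case True
    then have lw: "length w = p" by (rule length_words)
    have set_eq: "{v \<in> words p (Suc j). mset (zip w v) = mset (zip (map \<tau> ?B) ?B)} = (if mset w = mset ?B then {map \<tau> w} else {})"
    proof -
      have "map \<tau> w \<in> words p (Suc j)" if "mset w = mset ?B"
        using that B by (intro wB) simp
      then show ?thesis
        using fib[OF lw] by (auto dest: length_words)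
    qed
    show ?thesis
      using True unfolding tensor_power_coef set_eq by simp
  next
    case False
    then show ?thesis
      using wB[of w] by (auto simp: tensor_power_coef)
  qed
qed

section \<open>Homomorphisms into the Weyl functor\<close>

context
  fixes p n :: nat
  assumes n: "n < p" and char: "CHAR('k::field) = p"
begin

abbreviation (input) weyl_n :: "(nat list \<Rightarrow> 'k, 'k) spf"
  where "weyl_n \<equiv> weyl_functor (hook p n)"

abbreviation hom_gr :: "nat \<Rightarrow> (nat \<Rightarrow> (nat list \<Rightarrow> 'k) \<Rightarrow> (nat list \<Rightarrow> 'k) \<Rightarrow> 'k) set"
  where "hom_gr a \<equiv> nat_trans (hres p a) weyl_n"

lemmas lin_schur_h = is_spf_lin_functor[OF is_spf_schur_hook[OF char n]]

lemmas lin_weyl = lin_functor_weyl[OF n lin_schur_h]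

definition hom_tensor :: "nat \<Rightarrow> (nat \<Rightarrow> (nat list \<Rightarrow> 'k) \<Rightarrow> (nat list \<Rightarrow> 'k) \<Rightarrow> 'k) \<Rightarrow> nat list \<Rightarrow> 'k"
  where "hom_tensor j \<gamma> = weyl_tensor p n (Suc j) (\<gamma> (Suc j) (gen_vec p j))"

text \<open>The generator is an eigenvector of the components in \<open>coef_letter_map\<close>,
  with eigenvalue 1 for the identity and -1 for a transposition of letters below \<open>j\<close>.
  Naturality hands these relations on to its image; the other properties hold for every tensor
  coming from the Weyl functor.\<close>

lemma hom_tensor_facts:
  assumes j: "j < p" and \<gamma>: "\<gamma> \<in> nat_trans (ext_div p j) weyl_n"
  shows "alt_below p (Suc n) (hom_tensor j \<gamma>)" "sym_above p (Suc n) (hom_tensor j \<gamma>)"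
    and "hom_tensor j \<gamma> w \<noteq> 0 \<Longrightarrow> mset w = mset (base_word p j)"
    and "a < j \<Longrightarrow> b < j \<Longrightarrow> a \<noteq> b \<Longrightarrow> length w = p \<Longrightarrow>
      hom_tensor j \<gamma> (map (transpose a b) w) = - hom_tensor j \<gamma> w"
    and "Suc n < p \<Longrightarrow> kap (Suc n) (hom_tensor j \<gamma>) w = 0"
proof -
  let ?B = "base_word p j" and ?g = "gen_vec p j :: nat list \<Rightarrow> 'k" and ?y = "hom_tensor j \<gamma>"
  have jp: "j \<le> p" using j by simp
  have g: "?g \<in> val (ext_div p j) (Suc j)"
    using gen_vec_tens[OF jp] by simp
  have mem: "\<gamma> (Suc j) ?g \<in> val weyl_n (Suc j)"
    by (rule nat_transD(4)[OF \<gamma> g])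
  note t = weyl_tensor_tens[OF n lin_schur_h mem, folded hom_tensor_def]
  show "alt_below p (Suc n) ?y" "sym_above p (Suc n) ?y"
    by (rule tensD(2)[OF t], rule tensD(3)[OF t])
  show "kap (Suc n) ?y w = 0" if "Suc n < p" for w
    using kap_weyl_tensor[OF n lin_schur_h mem that] unfolding hom_tensor_def by (simp only: zero_fun_apply)
  have key: "coef (tensor_power p) (Suc j) (Suc j) \<mu> ?y = fscale c ?y"
    if \<mu>: "coef (tensor_power p) (Suc j) (Suc j) \<mu> ?g = fscale c ?g" for \<mu> c
  proof -
    have "coef (tensor_power p) (Suc j) (Suc j) \<mu> ?y = weyl_tensor p n (Suc j) (coef weyl_n (Suc j) (Suc j) \<mu> (\<gamma> (Suc j) ?g))"
      unfolding hom_tensor_def by (rule weyl_tensor_coef[OF n lin_schur_h mem, symmetric])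
    also have "\<dots> = weyl_tensor p n (Suc j) (\<gamma> (Suc j) (fscale c ?g))"
      unfolding nat_transD(3)[OF \<gamma> g, symmetric] ext_div_simps \<mu> ..
    also have "\<dots> = fscale c ?y"
      unfolding linear_map_scale[OF nat_transD(1)[OF \<gamma>] g] weyl_tensor_scale[OF n lin_schur_h] hom_tensor_def ..
    finally show ?thesis .
  qed
  have "coef (tensor_power p) (Suc j) (Suc j) (mset (zip (map id ?B) ?B)) ?g = fscale 1 ?g"
  proof
    fix w
    show "coef (tensor_power p) (Suc j) (Suc j) (mset (zip (map id ?B) ?B)) ?g w = fscale 1 ?g w"
      using gen_vec_support(2)[OF jp, of w, where 'a = 'k] by (subst coef_letter_map[OF jp]) (auto simp: fscale_apply)
  qed
  from fun_cong[OF key[OF this]] have supp: "mset w = mset ?B" if "?y w \<noteq> 0" for w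
    using that coef_letter_map[OF jp, of id ?y w] by (auto simp: fscale_apply split: if_splits)
  then show "?y w \<noteq> 0 \<Longrightarrow> mset w = mset ?B" for w .
  assume ab: "a < j" "b < j" "a \<noteq> b" and w: "length w = p"
  let ?\<tau> = "transpose a b"
  have B: "mset (map ?\<tau> ?B) = mset ?B"
    unfolding mset_map using ab jp by (intro image_mset_transpose) (simp add: count_base_word)
  note clm = coef_letter_map[OF jp transpose_involutory B]
  have "coef (tensor_power p) (Suc j) (Suc j) (mset (zip (map ?\<tau> ?B) ?B)) ?g = fscale (-1) ?g"
  proof
    fix w
    have "?g (map ?\<tau> w) = - ?g w" if "mset w = mset ?B"
      using ab jp mset_eq_length[OF that] by (intro gen_vec_letters) auto
    moreover have "?g w = 0" if "mset w \<noteq> mset ?B"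
      using gen_vec_support(2)[OF jp, of w, where 'a = 'k] that by blast
    ultimately show "coef (tensor_power p) (Suc j) (Suc j) (mset (zip (map ?\<tau> ?B) ?B)) ?g w = fscale (-1) ?g w"
      unfolding clm by (simp add: fscale_apply)
  qed
  from fun_cong[OF key[OF this], of w] have e: "(if mset w = mset ?B then ?y (map ?\<tau> w) else 0) = - ?y w"
    unfolding clm by (simp add: fscale_apply)
  show "?y (map ?\<tau> w) = - ?y w"
  proof (cases "mset w = mset ?B")
    case True
    then show ?thesis using e by simp
  next
    case False
    have "mset (map ?\<tau> w) \<noteq> mset ?B"
    proof
      assume a: "mset (map ?\<tau> w) = mset ?B"
      have "mset w = image_mset ?\<tau> (mset (map ?\<tau> w))"
        by (simp add: multiset.map_comp comp_def)
      also have "\<dots> = mset ?B"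
        unfolding a using B by simp
      finally show False using False by simp
    qed
    then have "?y (map ?\<tau> w) = 0" "?y w = 0"
      using supp[of w] supp[of "map ?\<tau> w"] False by blast+
    then show ?thesis by simp
  qed
qed

lemma hom_tensor_zero:
  assumes j: "j < p" and \<gamma>: "\<gamma> \<in> nat_trans (ext_div p j) weyl_n" and z: "\<And>w. length w = p \<Longrightarrow> hom_tensor j \<gamma> w = 0"
  shows "\<gamma> = 0"
proof (rule nat_trans_eq_gen_vec[OF char j \<gamma> nat_trans_zero[OF lin_weyl]])
  have g: "gen_vec p j \<in> val (ext_div p j :: 'k pfun) (Suc j)"
    using gen_vec_tens[of j p] j by simp
  have "hom_tensor j \<gamma> = 0"
    unfolding hom_tensor_def
    by (rule coords_eqI[OF weyl_tensor_coords[OF n lin_schur_h] fun_vs.subspace_0[OF coords_subspace]])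
      (simp only: z[unfolded hom_tensor_def] zero_fun_apply)
  then have "\<gamma> (Suc j) (gen_vec p j) = 0"
    unfolding hom_tensor_def by (rule weyl_tensor_inject[OF n lin_schur_h nat_transD(4)[OF \<gamma> g]])
  then show "\<gamma> (Suc j) (gen_vec p j) = 0 (Suc j) (gen_vec p j)"
    by (simp only: zero_fun_apply)
qed

text \<open>The evaluation points are words at which \<open>hom_gen\<close>, defined next, takes the value 1.\<close>

definition hom_coord :: "nat \<Rightarrow> (nat \<Rightarrow> (nat list \<Rightarrow> 'k) \<Rightarrow> (nat list \<Rightarrow> 'k) \<Rightarrow> 'k) \<Rightarrow> 'k"
  where "hom_coord j \<gamma> = hom_tensor j \<gamma> (if j = n then base_word p j else swp n (Suc n) (base_word p j))"

definition hom_gen :: "nat \<Rightarrow> nat \<Rightarrow> (nat list \<Rightarrow> 'k) \<Rightarrow> (nat list \<Rightarrow> 'k) \<Rightarrow> 'k"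
  where "hom_gen j = (if j = n then weyl_lift p n else weyl_lift p n \<circ>\<^sub>N nt_of (ext_div p (Suc n)) (del p n))"

lemma hom_index_zero:
  assumes j: "j < p" "j \<noteq> n" "j \<noteq> Suc n" and \<gamma>: "\<gamma> \<in> nat_trans (ext_div p j) weyl_n"
  shows "\<gamma> = 0"
proof (rule hom_tensor_zero[OF j(1) \<gamma>])
  note f = hom_tensor_facts[OF j(1) \<gamma>]
  show "hom_tensor j \<gamma> w = 0" if "length w = p" for w
    by (rule zero_of_index[OF char n j(1) f(1,2) f(3) f(4) j(2,3) f(5) that])
qed

lemma hom_coord_zero:
  assumes j: "j < p" "j = n \<or> j = Suc n" and \<gamma>: "\<gamma> \<in> nat_trans (ext_div p j) weyl_n" and z: "hom_coord j \<gamma> = 0"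
  shows "\<gamma> = 0"
proof (rule hom_tensor_zero[OF j(1) \<gamma>])
  note f = hom_tensor_facts[OF j(1) \<gamma>]
  fix w :: "nat list" assume w: "length w = p"
  show "hom_tensor j \<gamma> w = 0"
    using j(2)
  proof
    assume jn: "j = n"
    have "hom_tensor j \<gamma> (base_word p j) = 0"
      using z jn by (simp add: hom_coord_def)
    from zero_of_base[OF char n j(1) f(1,2) f(3) f(4) jn this w] show ?thesis .
  next
    assume jn: "j = Suc n"
    have z': "hom_tensor j \<gamma> (swp n (Suc n) (base_word p j)) = 0"
      using z jn by (simp add: hom_coord_def)
    have k: "kap (Suc n) (hom_tensor j \<gamma>) v = 0" for v
      using f(5) j(1) unfolding jn .
    show ?thesis
      by (rule zero_of_swapped_base[OF char n j(1) f(1,2) f(3) f(4) jn z' k w])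
  qed
qed

lemma hom_coord_add: "hom_coord j (\<alpha> + \<beta>) = hom_coord j \<alpha> + hom_coord j \<beta>"
  unfolding hom_coord_def hom_tensor_def plus_fun_apply[of \<alpha> \<beta>] plus_fun_apply[of "\<alpha> (Suc j)" "\<beta> (Suc j)"]
    weyl_tensor_add[OF n lin_schur_h] by (rule plus_fun_apply)

lemma hom_coord_scale: "hom_coord j (nt_scale c \<alpha>) = c * hom_coord j \<alpha>"
  unfolding hom_coord_def hom_tensor_def nt_scale_def weyl_tensor_scale[OF n lin_schur_h] by (rule fscale_apply)

lemma weyl_lift_zero:
  assumes u: "u \<in> tens p n n r" and z: "\<And>w. length w = p \<Longrightarrow> kap n u w = (0 :: 'k)"
  shows "weyl_lift p n r u = 0"
proof (rule weyl_tensor_inject[OF n lin_schur_h weyl_lift_props(1)[OF n lin_schur_h char u]])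
  have "kap n u = 0"
    by (rule coords_eqI[OF kap_coords[OF tensD(1)[OF u] n] fun_vs.subspace_0[OF coords_subspace]])
      (simp only: z zero_fun_apply)
  then show "weyl_tensor p n r (weyl_lift p n r u) = 0"
    by (simp only: weyl_lift_props(2)[OF n lin_schur_h char u])
qed

lemmas weyl_lift_hom = weyl_lift_nat_trans[OF n lin_schur_h char]

lemma hom_gen_hom:
  assumes j: "j < p" "j = n \<or> j = Suc n"
  shows "hom_gen j \<in> nat_trans (ext_div p j) weyl_n"
proof (cases "j = n")
  case True
  show ?thesis
    unfolding True hom_gen_def using weyl_lift_hom by (simp only: if_True refl)
next
  case False
  then have jn: "j = Suc n" using j by simp
  show ?thesis
    unfolding jn hom_gen_def using nat_trans_comp[OF del_nat_trans[OF n] weyl_lift_hom] by simp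
qed

lemma hom_gen_coord:
  assumes j: "j < p" "j = n \<or> j = Suc n"
  shows "hom_coord j (hom_gen j) = 1"
proof (cases "j = n")
  case True
  have g: "gen_vec p n \<in> (tens p n n (Suc n) :: (nat list \<Rightarrow> 'k) set)"
    using n by (intro gen_vec_tens) simp
  show ?thesis
    unfolding True hom_coord_def hom_tensor_def hom_gen_def
    by (simp only: weyl_lift_props(2)[OF n lin_schur_h char g] kap_gen_vec_base[OF n] if_True refl)
next
  case False
  then have jn: "j = Suc n" "Suc n < p" using j by auto
  have g: "gen_vec p (Suc n) \<in> (tens p (Suc n) (Suc n) (Suc (Suc n)) :: (nat list \<Rightarrow> 'k) set)"
    using jn by (intro gen_vec_tens) simp
  note d = del_tens'[OF g n]
  have "hom_gen j (Suc j) (gen_vec p j) = weyl_lift p n (Suc (Suc n)) (del p n (gen_vec p (Suc n)))"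
    using g jn by (simp add: hom_gen_def nt_of_def)
  then show ?thesis
    using False jn unfolding hom_coord_def hom_tensor_def
    by (simp only: weyl_lift_props(2)[OF n lin_schur_h char d] kap_del_gen_vec[OF jn(2)] if_False jn(1))
qed

lemma hom_eq_gen:
  assumes j: "j < p" "j = n \<or> j = Suc n" and \<gamma>: "\<gamma> \<in> nat_trans (ext_div p j) weyl_n"
  shows "\<gamma> = nt_scale (hom_coord j \<gamma>) (hom_gen j)"
proof -
  let ?c = "hom_coord j \<gamma>"
  have "\<gamma> + nt_scale (- ?c) (hom_gen j) = 0"
  proof (rule hom_coord_zero[OF j])
    show "\<gamma> + nt_scale (- ?c) (hom_gen j) \<in> nat_trans (ext_div p j) weyl_n"
      by (rule nat_trans_add[OF lin_weyl \<gamma> nat_trans_scale[OF lin_weyl hom_gen_hom[OF j]]])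
    show "hom_coord j (\<gamma> + nt_scale (- ?c) (hom_gen j)) = 0"
      unfolding hom_coord_add hom_coord_scale hom_gen_coord[OF j] by simp
  qed
  then have e: "(\<gamma> + nt_scale (- ?c) (hom_gen j)) r v x = 0" for r v x
    by (simp only: zero_fun_apply)
  show ?thesis
  proof (intro ext)
    fix r v x
    show "\<gamma> r v x = nt_scale ?c (hom_gen j) r v x"
      using e[of r v x] by (simp add: nt_scale_def fscale_apply)
  qed
qed

section \<open>Positions of the resolution with non-zero homomorphisms\<close>

definition hidx :: "nat \<Rightarrow> nat"
  where "hidx a = (if a < p then a else 2 * p - 1 - a)"

text \<open>\<open>P_n\<close> and \<open>P_(n+1)\<close> each stand in two places, one in either
  half; the condition \<open>Suc n < p\<close> leaves out \<open>P_p\<close>, which is not a term of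
  the resolution.\<close>

definition nz_degree :: "nat \<Rightarrow> bool"
  where "nz_degree a \<longleftrightarrow> a = n \<or> a = 2 * p - 1 - n \<or> Suc n < p \<and> (a = Suc n \<or> a = 2 * p - 2 - n)"

lemma nz_degreeD:
  assumes "nz_degree a"
  shows "hidx a < p" "hidx a = n \<or> hidx a = Suc n" "hres p a = ext_div p (hidx a)"
  using assms n by (auto simp: nz_degree_def hidx_def hres_def)

lemma hom_gr_zero:
  assumes \<alpha>: "\<alpha> \<in> hom_gr a" and nz: "\<not> nz_degree a"
  shows "\<alpha> = 0"
proof (cases "a < 2 * p")
  case True
  then have i: "hres p a = (ext_div p (hidx a) :: 'k pfun)" "hidx a < p" "hidx a \<noteq> n" "hidx a \<noteq> Suc n"
    using nz n by (auto simp: nz_degree_def hidx_def hres_def)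
  show ?thesis
    by (rule hom_index_zero[OF i(2-4) \<alpha>[unfolded i(1)]])
next
  case False
  have "\<alpha> r v = 0" for r v
  proof (cases "v \<in> val (hres p a) r")
    case True
    then have "v = 0"
      using False by (simp add: hres_val_zero)
    then show ?thesis
      by (simp only: nat_trans_zero_vec'[OF \<alpha>])
  qed (rule nat_transD(2)[OF \<alpha>])
  then show ?thesis
    by (intro ext) (simp only: zero_fun_apply)
qed

lemma hdiff_n: "Suc n < p \<Longrightarrow> hdiff p n = (nt_of (ext_div p (Suc n)) (del p n) :: nat \<Rightarrow> (nat list \<Rightarrow> 'k) \<Rightarrow> _)"
  by (simp add: hdiff_def hres_def hop_def fun_eq_iff)

lemma hom_comp_hdiff: "\<alpha> \<in> hom_gr a \<Longrightarrow> \<alpha> \<circ>\<^sub>N hdiff p a \<in> hom_gr (Suc a)"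
  using n by (intro nat_trans_comp[OF hdiff_nat_trans]) simp_all

text \<open>Since \<open>p\<close> is 0 in \<open>k\<close>, the two composites of
  \<open>kap\<close> and \<open>del\<close> are negatives of each other, which reduces the claim to
  \<open>kap_kap\<close>. For \<open>n = 0\<close> there is no lower term, but
  \<open>del p 0\<close> multiplies a symmetric tensor by \<open>p\<close>.\<close>

lemma kap_del_kap_zero:
  assumes v: "(v :: nat list \<Rightarrow> 'k) \<in> tens p n n r" and w: "length w = p"
  shows "kap n (del p n (kap n v)) w = 0"
proof (cases n)
  case 0
  have "kap 0 (del p 0 (kap 0 v)) w = del p 0 v w"
    by (simp add: kap_def del_def)
  also have "\<dots> = 0"
    using v w n 0 of_nat_eq_0_char(1)[OF char] by (subst del_of_sym[OF _ w]) (auto simp: tensD(3))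
  finally show ?thesis
    using 0 by simp
next
  case (Suc i)
  have i: "Suc i < p" "i < p" using n Suc by auto
  note v' = v[unfolded Suc]
  have one: "wt (\<lambda>_ _. 1) t f = f" for t and f :: "nat list \<Rightarrow> 'k"
    by (simp add: wt_def fun_eq_iff)
  have "del p (Suc i) (kap (Suc i) v) u = -1 * kap i (del p i v) u" if u: "length u = p" for u
  proof -
    have "del p (Suc i) (kap (Suc i) v) u + kap i (del p i v) u = of_nat p * v u"
      using del_kap_homotopy'[OF tensD(2,3)[OF v'] i(1) u, of "\<lambda>_ _. 1"] unfolding one by simp
    then show ?thesis
      unfolding of_nat_eq_0_char(1)[OF char] by (simp add: eq_neg_iff_add_eq_0)
  qed
  then have "kap (Suc i) (del p (Suc i) (kap (Suc i) v)) w = kap (Suc i) (\<lambda>u. -1 * kap i (del p i v) u) w"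
    by (intro kap_cong[OF _ w])
  also have "\<dots> = -1 * kap (Suc i) (kap i (del p i v)) w"
    unfolding kap_mult ..
  also have "kap (Suc i) (kap i (del p i v)) w = 0"
    by (rule kap_kap[OF char i(1) del_tens'[OF v' i(2)] w])
  finally show ?thesis
    by (simp add: Suc)
qed

lemma hom_comp_hdiff_zero:
  assumes \<alpha>: "\<alpha> \<in> hom_gr a" and a: "\<not> (a = n \<and> Suc n < p)"
  shows "\<alpha> \<circ>\<^sub>N hdiff p a = 0"
proof (cases "nz_degree a \<and> nz_degree (Suc a)")
  case False
  show ?thesis
  proof (cases "nz_degree a")
    case True
    then show ?thesis
      using False by (intro hom_gr_zero[OF hom_comp_hdiff[OF \<alpha>]]) simp
  next
    case False
    show ?thesis
      unfolding hom_gr_zero[OF \<alpha> False] by (simp add: fun_eq_iff)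
  qed
next
  case True
  define j where "j = hidx a"
  note nz = nz_degreeD[OF conjunct1[OF True], folded j_def]
  note e = hom_eq_gen[OF nz(1,2) \<alpha>[unfolded nz(3)]]
  have mem: "v \<in> tens p (hidx (Suc a)) (hidx (Suc a)) r" if "v \<in> val (hres p (Suc a)) r" for v :: "nat list \<Rightarrow> 'k" and r
    using that unfolding nz_degreeD(3)[OF conjunct2[OF True]] by simp
  have zero: "hom_gen j r (hop p a v) = 0" if v: "v \<in> val (hres p (Suc a)) r" for r v
  proof -
    \<comment> \<open>The remaining adjacent pairs of positions with non-zero homomorphisms: the two
      copies of \<open>P_(p-1)\<close>, which concern \<open>n = p - 1\<close> and
      \<open>n = p - 2\<close>, and the pair \<open>P_(n+1)\<close>, \<open>P_n\<close> in the
      second half.\<close>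
    consider "Suc n = p" "a = n" | "Suc (Suc n) = p" "a = Suc n" | "Suc n < p" "a = 2 * p - 2 - n"
      using True a n unfolding nz_degree_def by linarith
    then show ?thesis
    proof cases
      case 1
      have op: "hop p a = (kap n :: (nat list \<Rightarrow> 'k) \<Rightarrow> _)" and j: "j = n" "hidx (Suc a) = n"
        using 1 by (auto simp: hop_def j_def hidx_def)
      note v' = mem[OF v, unfolded j]
      have k: "kap n v \<in> tens p n n r"
        using tens_p_mono[of "kap n v" p r] kap_tens'[OF v' n] 1 by auto
      \<comment> \<open>The inner value alternates in all \<open>p\<close> positions, so the outer
        \<open>kap\<close> multiplies it by \<open>p\<close>.\<close>
      have "kap n (kap n v) w = 0" if w: "length w = p" for w
        using kap_of_alt[OF tensD(2)[OF kap_tens'[OF v' n]] w] 1 of_nat_eq_0_char(1)[OF char] by simp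
      from weyl_lift_zero[OF k this] show ?thesis
        unfolding op j hom_gen_def by simp
    next
      case 2
      have op: "hop p a = (kap (Suc n) :: (nat list \<Rightarrow> 'k) \<Rightarrow> _)" and j: "j = Suc n" "hidx (Suc a) = Suc n" and sn: "Suc n < p"
        using 2 by (auto simp: hop_def j_def hidx_def)
      note v' = mem[OF v, unfolded j]
      note kv = kap_tens'[OF v' sn]
      have k: "kap (Suc n) v \<in> tens p (Suc n) (Suc n) r"
        using tens_p_mono[of "kap (Suc n) v" p r] kv 2 by auto
      \<comment> \<open>With \<open>p = n + 2\<close> the operator \<open>del p n\<close> has two
        summands, and they cancel on a tensor that alternates in all positions.\<close>
      have "{n..<p} = {n, Suc n}"
        using 2 by auto
      then have "del p n (kap (Suc n) v) w = 0" if w: "length w = p" for w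
        using altD(1)[OF tensD(2)[OF kv] w, of n "Suc n"] by (simp add: del_def)
      then have "kap n (del p n (kap (Suc n) v)) w = kap n (\<lambda>_. 0) w" if "length w = p" for w
        using that by (intro kap_cong)
      then have "kap n (del p n (kap (Suc n) v)) w = 0" if "length w = p" for w
        using that by (simp add: kap_def)
      from weyl_lift_zero[OF del_tens'[OF k n] this] show ?thesis
        using k unfolding op j hom_gen_def by (simp add: nt_of_def)
    next
      case 3
      have "\<not> Suc a < p" "2 * p - 2 - a = n"
        using 3 by linarith+
      then have op: "hop p a = (kap n :: (nat list \<Rightarrow> 'k) \<Rightarrow> _)"
        by (simp add: hop_def)
      have j: "j = Suc n" "hidx (Suc a) = n"
        using 3 by (auto simp: j_def hidx_def)
      note v' = mem[OF v, unfolded j]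
      note k = kap_tens'[OF v' n]
      from weyl_lift_zero[OF del_tens'[OF k n] kap_del_kap_zero[OF v']] show ?thesis
        using k unfolding op j hom_gen_def by (simp add: nt_of_def)
    qed
  qed
  have lin0: "\<alpha> r 0 = 0" for r
    by (rule nat_trans_zero_vec'[OF \<alpha>])
  have "\<alpha> r (hdiff p a r v) = 0" for r v
  proof (cases "v \<in> val (hres p (Suc a)) r")
    case True
    then have h: "hdiff p a r v = hop p a v"
      by (simp add: hdiff_def nt_of_def)
    have "\<alpha> r (hop p a v) = fscale (hom_coord j \<alpha>) (hom_gen j r (hop p a v))"
      using fun_cong[OF fun_cong[OF e, of r], of "hop p a v"] unfolding nt_scale_def .
    also have "\<dots> = 0"
      unfolding zero[OF True] by (rule fun_vs.scale_zero_right)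
    finally show ?thesis
      unfolding h .
  next
    case False
    then have "hdiff p a r v = 0"
      by (simp add: hdiff_def nt_of_def)
    then show ?thesis
      by (simp only: lin0)
  qed
  then show ?thesis
    by (intro ext) (simp only: nt_comp_apply zero_fun_apply)
qed

lemma hom_gr_coord_zero:
  assumes "nz_degree a" "\<alpha> \<in> hom_gr a"
  shows "hom_coord (hidx a) \<alpha> = 0 \<longleftrightarrow> \<alpha> = 0"
proof
  note nz = nz_degreeD[OF assms(1)]
  show "hom_coord (hidx a) \<alpha> = 0 \<Longrightarrow> \<alpha> = 0"
    by (rule hom_coord_zero[OF nz(1,2) assms(2)[unfolded nz(3)]])
  show "hom_coord (hidx a) \<alpha> = 0" if "\<alpha> = 0"
    using hom_coord_scale[of "hidx a" 0 0] unfolding that by (simp add: nt_scale_def fscale_def zero_fun_def)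
qed

lemma hom_gr_coord_surj:
  assumes "nz_degree a"
  shows "hom_coord (hidx a) ` hom_gr a = UNIV"
proof -
  note nz = nz_degreeD[OF assms]
  have "c \<in> hom_coord (hidx a) ` hom_gr a" for c
  proof (rule image_eqI)
    show "nt_scale c (hom_gen (hidx a)) \<in> hom_gr a"
      unfolding nz(3) by (rule nat_trans_scale[OF lin_weyl hom_gen_hom[OF nz(1,2)]])
    show "c = hom_coord (hidx a) (nt_scale c (hom_gen (hidx a)))"
      unfolding hom_coord_scale hom_gen_coord[OF nz(1,2)] by simp
  qed
  then show ?thesis by blast
qed

section \<open>The cohomology of the complex of homomorphisms\<close>

context
  fixes m q :: nat
begin

abbreviation res_P :: "nat \<Rightarrow> 'k pfun"
  where "res_P \<equiv> \<lambda>i. hres p (Suc m + i)"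

abbreviation res_d :: "nat \<Rightarrow> nat \<Rightarrow> (nat list \<Rightarrow> 'k) \<Rightarrow> nat list \<Rightarrow> 'k"
  where "res_d \<equiv> \<lambda>i. hdiff p (Suc m + i)"

lemma res_cocycles: "cocycles res_P res_d weyl_n q = {\<alpha> \<in> hom_gr (Suc m + q). \<alpha> \<circ>\<^sub>N hdiff p (Suc m + q) = 0}"
  by (simp only: cocycles_def)

lemma res_coboundaries:
  "coboundaries res_P res_d weyl_n q = (if q = 0 then {0} else (\<lambda>\<beta>. \<beta> \<circ>\<^sub>N hdiff p (m + q)) ` hom_gr (m + q))"
  by (cases q) simp_all

text \<open>The only differential that can be non-zero starts at position \<open>n\<close> when
  \<open>n + 1 < p\<close>. The assumptions keep it from leaving or entering this position, so the
  cohomology is the whole one-dimensional space of homomorphisms.\<close>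

lemma coordinate_true:
  assumes nz: "nz_degree (Suc m + q)" and a: "\<not> (Suc m + q = n \<and> Suc n < p)"
    and b: "q = 0 \<or> \<not> (m + q = n \<and> Suc n < p)"
  shows "cohomology_coordinate res_P res_d weyl_n q True (hom_coord (hidx (Suc m + q)))"
proof -
  have Z: "cocycles res_P res_d weyl_n q = hom_gr (Suc m + q)"
    unfolding res_cocycles using hom_comp_hdiff_zero[OF _ a] by blast
  have B: "coboundaries res_P res_d weyl_n q = {0}"
  proof (cases "q = 0")
    case False
    then have "\<beta> \<circ>\<^sub>N hdiff p (m + q) = 0" if "\<beta> \<in> hom_gr (m + q)" for \<beta>
      using hom_comp_hdiff_zero[OF that] b by blast
    then show ?thesis
      unfolding res_coboundaries using False nat_trans_zero[OF lin_weyl] by (auto simp: image_iff)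
  qed simp
  show ?thesis
    unfolding cohomology_coordinate_def Z B
    using hom_coord_add hom_coord_scale hom_gr_coord_zero[OF nz] hom_gr_coord_surj[OF nz] by simp
qed

lemma coordinate_false:
  assumes "\<And>\<alpha>. \<alpha> \<in> cocycles res_P res_d weyl_n q \<Longrightarrow> \<alpha> \<in> coboundaries res_P res_d weyl_n q"
  shows "cohomology_coordinate res_P res_d weyl_n q False (\<lambda>_. 0)"
proof -
  have "0 \<in> cocycles res_P res_d weyl_n q"
    unfolding res_cocycles using nat_trans_zero[OF lin_weyl] by (simp add: fun_eq_iff)
  then have "(\<lambda>_. 0 :: 'k) ` cocycles res_P res_d weyl_n q = {0}"
    by blast
  then show ?thesis
    unfolding cohomology_coordinate_def using assms by simp
qed

text \<open>Outside the listed degrees non-zero homomorphisms exist only at the positions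
  \<open>n\<close> and \<open>n + 1\<close> of the first half. There a multiple of \<psi> is a
  cocycle only if it is 0, and \<psi>\<delta> is the coboundary of \<psi>.\<close>

lemma cocycle_coboundary:
  assumes c: "\<not> (m = n \<and> q = 0 \<or> Suc m + q = 2 * p - 2 - n \<or> Suc m + q = 2 * p - 1 - n)"
    and \<alpha>: "\<alpha> \<in> cocycles res_P res_d weyl_n q"
  shows "\<alpha> \<in> coboundaries res_P res_d weyl_n q"
proof -
  let ?a = "Suc m + q"
  have h: "\<alpha> \<in> hom_gr ?a" and z: "\<alpha> \<circ>\<^sub>N hdiff p ?a = 0"
    using \<alpha> unfolding res_cocycles by blast+
  note zero = coboundaries_zero[OF lin_weyl, of res_P res_d q]
  show ?thesis
  proof (cases "nz_degree ?a")
    case False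
    show ?thesis
      unfolding hom_gr_zero[OF h False] by (rule zero)
  next
    case True
    then consider "?a = n" "Suc n < p" | "?a = Suc n" "Suc n < p" | "?a = n" "Suc n = p"
      using c n unfolding nz_degree_def by linarith
    then show ?thesis
    proof cases
      case 1
      let ?g = "nt_of (ext_div p (Suc n)) (del p n) :: nat \<Rightarrow> (nat list \<Rightarrow> 'k) \<Rightarrow> _"
      have hn: "hres p ?a = (ext_div p n :: 'k pfun)"
        using 1 by (simp add: hres_def)
      have e: "\<alpha> = nt_scale (hom_coord n \<alpha>) (weyl_lift p n)"
        using hom_eq_gen[OF n _ h[unfolded hn]] unfolding hom_gen_def by simp
      have "nt_scale (hom_coord n \<alpha>) (hom_gen (Suc n)) = \<alpha> \<circ>\<^sub>N hdiff p ?a"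
        unfolding 1(1) hdiff_n[OF 1(2)] hom_gen_def
        by (subst (2) e) (simp add: nt_comp_scale_left)
      also note z
      finally have "hom_coord (Suc n) (nt_scale (hom_coord n \<alpha>) (hom_gen (Suc n))) = hom_coord (Suc n) (0 :: nat \<Rightarrow> (nat list \<Rightarrow> 'k) \<Rightarrow> (nat list \<Rightarrow> 'k) \<Rightarrow> 'k)"
        by (rule arg_cong)
      also have "\<dots> = 0"
        using hom_coord_scale[of "Suc n" 0 0] by (simp add: nt_scale_def fscale_def zero_fun_def)
      finally have "hom_coord n \<alpha> = 0"
        using hom_gen_coord[OF 1(2)] unfolding hom_coord_scale by simp
      then have "\<alpha> = 0"
        by (intro hom_coord_zero[OF n _ h[unfolded hn]]) simp
      then show ?thesis
        using zero by (simp only:)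
    next
      case 2
      \<comment> \<open>Position \<open>n + 1\<close> with \<open>q = 0\<close> would mean
        \<open>m = n\<close>, which is excluded; hence position \<open>n\<close> also belongs to the
        resolution.\<close>
      have q: "q \<noteq> 0" "m + q = n"
        using 2 c by auto
      have hn: "hres p ?a = (ext_div p (Suc n) :: 'k pfun)" "hres p n = (ext_div p n :: 'k pfun)"
        using 2 n by (auto simp: hres_def)
      have e: "\<alpha> = nt_scale (hom_coord (Suc n) \<alpha>) (hom_gen (Suc n))"
        by (rule hom_eq_gen[OF 2(2) _ h[unfolded hn]]) simp
      also have "\<dots> = nt_scale (hom_coord (Suc n) \<alpha>) (weyl_lift p n) \<circ>\<^sub>N hdiff p n"
        unfolding hdiff_n[OF 2(2)] hom_gen_def by (simp add: nt_comp_scale_left)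
      finally have "\<alpha> = nt_scale (hom_coord (Suc n) \<alpha>) (weyl_lift p n) \<circ>\<^sub>N hdiff p n" .
      moreover have "nt_scale (hom_coord (Suc n) \<alpha>) (weyl_lift p n) \<in> hom_gr n"
        unfolding hn by (rule nat_trans_scale[OF lin_weyl weyl_lift_hom])
      ultimately show ?thesis
        unfolding res_coboundaries q(2) using q(1) by (simp only: if_False) (rule image_eqI)
    next
      case 3
      then show ?thesis using c by simp
    qed
  qed
qed

lemma Ext_schur_weyl:
  assumes m: "m < p"
  shows "Ext p q (schur_functor (hook p m) :: 'k pfun) weyl_n \<cong>\<^sub>k
    (if m = n \<and> q = 0 \<or> Suc m + q = 2 * p - 2 - n \<or> Suc m + q = 2 * p - 1 - n then base_field else zero_space)"
    (is "_ \<cong>\<^sub>k (if ?c then _ else _)")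
proof -
  have R: "proj_resolution p (schur_functor (hook p m) :: 'k pfun) res_P res_d (nt_of (hres p (Suc m)) (heps p m))"
    by (rule hres_proj_resolution[OF char m]) (rule projective_ext_div[OF char])
  have "\<exists>lam. cohomology_coordinate res_P res_d weyl_n q ?c lam"
  proof (cases ?c)
    case True
    have "nz_degree (Suc m + q)" "\<not> (Suc m + q = n \<and> Suc n < p)" "q = 0 \<or> \<not> (m + q = n \<and> Suc n < p)"
      using True n m unfolding nz_degree_def by (linarith | presburger)+
    from coordinate_true[OF this] show ?thesis
      using True by (simp only:) blast
  next
    case False
    from coordinate_false[OF cocycle_coboundary[OF False]] show ?thesis
      using False by (simp only:) blast
  qed
  then obtain lam where "cohomology_coordinate res_P res_d weyl_n q ?c lam" by blast
  then show ?thesis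
    by (rule Ext_iso[OF R lin_weyl])
qed

end

end

theorem proposition2p10:
  fixes p m n q :: nat
  assumes "CHAR('k::field) = p" and "p > 0"
    and "m \<le> p - 1" and "n \<le> p - 1"
  shows "Ext p q (schur_functor (hook p m) :: (nat list, 'k) spf) (weyl_functor (hook p n)) \<cong>\<^sub>k
    (if (m = n \<and> q = 0)
        \<or> int q = 2 * int p - int m - int n - 3
        \<or> int q = 2 * int p - int m - int n - 2
     then base_field else zero_space)"
proof -
  have mn: "m < p" "n < p"
    using assms(2-4) by auto
  \<comment> \<open>Conversion from degrees to positions. For \<open>m = n = p - 1\<close> the first
    of the two integers is -1, which no degree attains.\<close>
  have "(int q = 2 * int p - int m - int n - 3) = (Suc m + q = 2 * p - 2 - n)"
    "(int q = 2 * int p - int m - int n - 2) = (Suc m + q = 2 * p - 1 - n)"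
    using mn by linarith+
  then show ?thesis
    using Ext_schur_weyl[OF mn(2) assms(1) mn(1)] by (simp only:)
qed

end
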